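(* Let $\mathcal{C}\subseteq\mathcal{R}$ be an admissible set of relations, let $T(L)$ be a tableau satisfying $\mathcal{C}$, and consider the $U_q$-module $V=V_{\mathcal{C}}(T(L))$ with action given by the Gelfand-Tsetlin formulas. For a maximal ideal $\mathsf{m}$ of the Gelfand-Tsetlin subalgebra $\Gamma_q$ put $V(\mathsf{m})=\{v\in V: \mathsf{m}^kv=0\text{ for some }k\ge0\}$. Then for every maximal ideal $\mathsf{m}$ of $\Gamma_q$ in the Gelfand-Tsetlin support of $V$ (i.e. with $V(\mathsf{m})\ne0$), the Gelfand-Tsetlin multiplicity of $\mathsf{m}$ is one, i.e. $\dim_{\mathbb{C}}V(\mathsf{m})=1$.
   Context: **Conventions.** Fix an integer $n\ge 2$ and $q\in\mathbb{C}\setminus\{0\}$ not a root of unity; fix a value of $\log q$ and put $q^x=e^{x\log q}$ for $x\in\mathbb{C}$. The ground field is $\mathbb{C}$. Put $[x]_q=\frac{q^x-q^{-x}}{q-q^{-1}}$, $1(q)=\{x\in\mathbb{C}: q^x=1\}$, $\frac{1(q)}{2}=\{x/2: x\in 1(q)\}$. **The algebra $U_q=U_q(\mathfrak{gl}_n)$.** Let $\epsilon_1,\dots,\epsilon_n$ be the standard basis of $\mathbb{Z}^n$, with $\langle\epsilon_k,\epsilon_l\rangle=\delta_{kl}$, and $\alpha_i=\epsilon_i-\epsilon_{i+1}$. $U_q$ is the unital associative algebra generated by $e_i,f_i$ ($1\le i\le n-1$) and $q^h$ ($h\in\mathbb{Z}^n$) with relations $q^0=1$, $q^hq^{h'}=q^{h+h'}$,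 $q^he_iq^{-h}=q^{\langle h,\alpha_i\rangle}e_i$, $q^hf_iq^{-h}=q^{-\langle h,\alpha_i\rangle}f_i$, $e_if_j-f_je_i=\delta_{ij}\frac{q^{\alpha_i}-q^{-\alpha_i}}{q-q^{-1}}$, $e_i^2e_j-(q+q^{-1})e_ie_je_i+e_je_i^2=0$ and $f_i^2f_j-(q+q^{-1})f_if_jf_i+f_jf_i^2=0$ for $|i-j|=1$, $e_ie_j=e_je_i$ and $f_if_j=f_jf_i$ for $|i-j|>1$. **Gelfand-Tsetlin subalgebra.** For $1\le m\le n$ let $(U_m)_q=U_q(\mathfrak{gl}_m)$, regarded as the subalgebra of $U_q$ generated by $e_i,f_i$ ($1\le i\le m-1$) and $q^{\pm\epsilon_i}$ ($1\le i\le m$), and let $Z_m$ be its center. $\Gamma_q$ is the (commutative) subalgebra of $U_q$ generated by $Z_1,\dots,Z_n$. **Tableaux.** For $L=(l_{ij})_{1\le j\le i\le n}\in\mathbb{C}^{n(n+1)/2}$, $T(L)$ denotes the triangular array (Gelfand-Tsetlin tableau of height $n$) with entries $l_{ij}$; row $i$ is $l_{i1},\dots,l_{ii}$ and row $n$ is the top row. For $1\le j\le i\le n-1$, $\delta^{ij}$ is the vector with $1$ in position $(i,j)$ and $0$ elsewhere. **Relations.** Let $\mathfrak{V}=\{(i,j): 1\le j\le i\le n\}$ and $\mathcal{R}=\mathcal{R}^{\ge}\cup\mathcal{R}^{>}\cup\mathcal{R}^0$, sets of formal relations, where $\mathcal{R}^{\ge}=\{(i,j)\ge(i-1,j'): 1\le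 j\le i\le n,\ 1\le j'\le i-1\}$, $\mathcal{R}^{>}=\{(i-1,j')>(i,j): 1\le j\le i\le n,\ 1\le j'\le i-1\}$, $\mathcal{R}^0=\{(n,i)\ge(n,j): 1\le i\ne j\le n\}$. For $\mathcal{C}\subseteq\mathcal{R}$, $\mathfrak{V}(\mathcal{C})$ is the set of elements of $\mathfrak{V}$ occurring (on either side) in some relation of $\mathcal{C}$. Two subsets $\mathcal{C}_1,\mathcal{C}_2$ are disconnected if $\mathfrak{V}(\mathcal{C}_1)\cap\mathfrak{V}(\mathcal{C}_2)=\emptyset$. $\mathcal{C}$ is decomposable if it is the union of two nonempty disconnected subsets, and indecomposable otherwise. Every $\mathcal{C}$ is uniquely a union of pairwise disconnected indecomposable sets, called its indecomposable components. Write $(i,j)\succeq_{\mathcal{C}}(r,s)$ if there is a chain $(i,j)=(i_0,j_0),(i_1,j_1),\dots,(i_{m+1},j_{m+1})=(r,s)$, $m\ge 0$, such that for each consecutive pair the relation $(i_a,j_a)\ge(i_{a+1},j_{a+1})$ or $(i_a,j_a)>(i_{a+1},j_{a+1})$ belongs to $\mathcal{C}$; write $(i,j)\succ_{\mathcal{C}}(r,s)$ if there is such a chain in which at least one of the relations is $>$. **Admissible sets.** A cross in $\mathcal{C}$ is a subset of $\mathcal{C}$ of the form $\{(k,i)\ge(k-1,t),\ (k-1,s)>(k,j)\}$ with $i<j$ and $s<t$. An indecomposable set $\mathcal{C}$ is admissible if: (i) for any $1\le k\le n$, $(k,i)\succ_{\mathcal{C}}(k,j)$ only if $i<j$; (ii)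 $(n,i)\succeq_{\mathcal{C}}(n,j)$ only if $i<j$; (iii) there is no cross in $\mathcal{C}$; (iv) for every $(k,i),(k,j)\in\mathfrak{V}(\mathcal{C})$ with $1\le k\le n-1$ and $i<j$, either there exist $s,t$ with $\{(k,i)>(k+1,s),\ (k+1,s)\ge(k,j),\ (k,i)\ge(k-1,t),\ (k-1,t)>(k,j)\}\subseteq\mathcal{C}$, or there exist $s<t$ with $\{(k,i)>(k+1,s),\ (k+1,t)\ge(k,j)\}\subseteq\mathcal{C}$. An arbitrary $\mathcal{C}\subseteq\mathcal{R}$ is admissible if all of its indecomposable components are admissible. **Realizations.** $T(L)$ satisfies the relation $(i,j)\ge(r,s)$ (resp. $(i,j)>(r,s)$) if $l_{ij}-l_{rs}\in\mathbb{Z}_{\ge0}+\frac{1(q)}{2}$ (resp. $\in\mathbb{Z}_{>0}+\frac{1(q)}{2}$). $T(L)$ satisfies $\mathcal{C}$ if it satisfies all relations in $\mathcal{C}$ and, for $i\neq j$, $l_{ki}-l_{kj}\in\mathbb{Z}+\frac{1(q)}{2}$ only if $(k,i),(k,j)$ belong to $\mathfrak{V}(\mathcal{C}')$ for one and the same indecomposable component $\mathcal{C}'$ of $\mathcal{C}$. In this case $\mathcal{B}_{\mathcal{C}}(T(L))$ is the set of all tableaux $T(L+z)$ satisfying $\mathcal{C}$, where $z\in\mathbb{Z}^{n(n-1)/2}$ (integer shifts of rows $1,\dots,n-1$, the top row being unchanged), and $V_{\mathcal{C}}(T(L))$ is the complex vector space with basis $\mathcal{B}_{\mathcal{C}}(T(L))$.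 **Gelfand-Tsetlin formulas.** For admissible $\mathcal{C}$ and $T(L)$ satisfying $\mathcal{C}$, $V_{\mathcal{C}}(T(L))$ is a $U_q$-module with the following action. For $T(R)\in\mathcal{B}_{\mathcal{C}}(T(L))$, $R=(r_{ij})$: $$q^{\epsilon_k}T(R)=q^{a_k}T(R),\quad a_k=\sum_{i=1}^k r_{ki}-\sum_{i=1}^{k-1}r_{k-1,i}+k\quad(1\le k\le n),$$ $$e_kT(R)=-\sum_{j=1}^k\frac{\prod_{i=1}^{k+1}[r_{k+1,i}-r_{kj}]_q}{\prod_{i\ne j}[r_{ki}-r_{kj}]_q}T(R+\delta^{kj}),\qquad f_kT(R)=\sum_{j=1}^k\frac{\prod_{i=1}^{k-1}[r_{k-1,i}-r_{kj}]_q}{\prod_{i\ne j}[r_{ki}-r_{kj}]_q}T(R-\delta^{kj})\quad(1\le k\le n-1),$$ where any tableau on the right-hand side not belonging to $\mathcal{B}_{\mathcal{C}}(T(L))$ is interpreted as zero.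
   Formalization: The formal statement assumes explicitly that all denominators [r_ki − r_kj]_q (i≠j, k≤n−1) in the Gelfand-Tsetlin formulas are nonzero on the basis; admissibility as literally defined does not guarantee this, and without it the module V is undefined. *)

theory Defs
  imports
    Complex_Main
    "HOL-Library.Poly_Mapping"
    "HOL-Algebra.Ideal_Product"
    "HOL-Algebra.QuotRing"
    "HOL-Algebra.Generated_Rings"
begin

section \<open>Quantum integers\<close>

text \<open>The parameter \<open>lq\<close> is the chosen value of \<open>log q\<close>; every use has \<open>exp lq = q\<close>.\<close>

definition qpow :: "complex \<Rightarrow> complex \<Rightarrow> complex" where
  "qpow lq x = exp (x * lq)"

definition qnum :: "complex \<Rightarrow> complex \<Rightarrow> complex \<Rightarrow> complex" where
  "qnum q lq x = (qpow lq x - qpow lq (- x)) / (q - inverse q)"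

definition one_set :: "complex \<Rightarrow> complex set" where
  "one_set lq = {x. qpow lq x = 1}"

definition half_one_set :: "complex \<Rightarrow> complex set" where
  "half_one_set lq = {x / 2 | x. x \<in> one_set lq}"

section \<open>Free associative algebras\<close>

text \<open>Words are wrapped in a type of their own so that they form a \<open>monoid_add\<close> under
  concatenation; finitely supported functions on words then carry the convolution product.\<close>

datatype 'g word = Word (letters: "'g list")

instantiation word :: (type) monoid_add
begin

definition zero_word :: "'a word" where
  "zero_word = Word []"

definition plus_word :: "'a word \<Rightarrow> 'a word \<Rightarrow> 'a word" where
  "plus_word u v = Word (letters u @ letters v)"

instance
  by standard (simp_all add: zero_word_def plus_word_def)

end

definition gen :: "'g \<Rightarrow> 'g word \<Rightarrow>\<^sub>0 complex" where
  "gen g = Poly_Mapping.single (Word [g]) 1"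

definition const :: "complex \<Rightarrow> 'g word \<Rightarrow>\<^sub>0 complex" where
  "const c = Poly_Mapping.single 0 c"

definition free_algebra :: "'g set \<Rightarrow> ('g word \<Rightarrow>\<^sub>0 complex) ring" where
  "free_algebra X = \<lparr>
     carrier = {p. \<forall>w \<in> Poly_Mapping.keys p. set (letters w) \<subseteq> X},
     mult = (*), one = 1, zero = 0, add = (+) \<rparr>"

lemma free_algebra_ring: "ring (free_algebra X)"
proof (rule ringI)
  show "abelian_group (free_algebra X)"
  proof (rule abelian_groupI)
    fix p assume p: "p \<in> carrier (free_algebra X)"
    show "\<exists>q \<in> carrier (free_algebra X). q \<oplus>\<^bsub>free_algebra X\<^esub> p = \<zero>\<^bsub>free_algebra X\<^esub>"
      using p by (intro bexI[of _ "- p"]) (simp_all add: free_algebra_def)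
  qed (use Poly_Mapping.keys_add in \<open>fastforce simp: free_algebra_def algebra_simps\<close>)+
  show "Group.monoid (free_algebra X)"
  proof (rule monoidI)
    fix p q assume "p \<in> carrier (free_algebra X)" "q \<in> carrier (free_algebra X)"
    then show "p \<otimes>\<^bsub>free_algebra X\<^esub> q \<in> carrier (free_algebra X)"
      using keys_mult[of p q] by (fastforce simp: free_algebra_def plus_word_def)
  qed (auto simp: free_algebra_def zero_word_def mult.assoc)
qed (simp_all add: free_algebra_def algebra_simps)

section \<open>The algebra \<open>U_q(gl_n)\<close>\<close>

text \<open>\<open>Q h\<close> stands for \<open>q^h\<close>; an element of \<open>\<int>^n\<close> is a function vanishing outside \<open>{1..n}\<close>.\<close>

datatype uq_gen = E nat | F nat | Q "nat \<Rightarrow> int"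

definition lattice :: "nat \<Rightarrow> (nat \<Rightarrow> int) set" where
  "lattice n = {h. \<forall>k. k \<notin> {1..n} \<longrightarrow> h k = 0}"

definition eps :: "nat \<Rightarrow> nat \<Rightarrow> int" where
  "eps i = (\<lambda>k. if k = i then 1 else 0)"

definition alpha :: "nat \<Rightarrow> nat \<Rightarrow> int" where
  "alpha i = (\<lambda>k. eps i k - eps (i + 1) k)"

definition pairing :: "nat \<Rightarrow> (nat \<Rightarrow> int) \<Rightarrow> (nat \<Rightarrow> int) \<Rightarrow> int" where
  "pairing n h h' = (\<Sum>k = 1..n. h k * h' k)"

definition uq_gens :: "nat \<Rightarrow> uq_gen set" where
  "uq_gens n = E ` {1..n - 1} \<union> F ` {1..n - 1} \<union> Q ` lattice n"

abbreviation uq_free :: "nat \<Rightarrow> (uq_gen word \<Rightarrow>\<^sub>0 complex) ring" where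
  "uq_free n \<equiv> free_algebra (uq_gens n)"

text \<open>Each relation \<open>a = b\<close> is recorded as the element \<open>a - b\<close> of the free algebra.\<close>

definition uq_rels :: "nat \<Rightarrow> complex \<Rightarrow> (uq_gen word \<Rightarrow>\<^sub>0 complex) set" where
  "uq_rels n q =
     {gen (Q (\<lambda>_. 0)) - 1}
   \<union> {gen (Q h) * gen (Q h') - gen (Q (\<lambda>k. h k + h' k)) | h h'.
        h \<in> lattice n \<and> h' \<in> lattice n}
   \<union> {gen (Q h) * gen (E i) * gen (Q (\<lambda>k. - h k))
        - const (q powi (pairing n h (alpha i))) * gen (E i) | h i.
        h \<in> lattice n \<and> i \<in> {1..n - 1}}
   \<union> {gen (Q h) * gen (F i) * gen (Q (\<lambda>k. - h k))
        - const (q powi (- pairing n h (alpha i))) * gen (F i) | h i.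
        h \<in> lattice n \<and> i \<in> {1..n - 1}}
   \<union> {gen (E i) * gen (F j) - gen (F j) * gen (E i)
        - (if i = j then const (1 / (q - inverse q))
                           * (gen (Q (alpha i)) - gen (Q (\<lambda>k. - alpha i k))) else 0) | i j.
        i \<in> {1..n - 1} \<and> j \<in> {1..n - 1}}
   \<union> {gen (g i) * gen (g i) * gen (g j)
        - const (q + inverse q) * (gen (g i) * gen (g j) * gen (g i))
        + gen (g j) * gen (g i) * gen (g i) | g i j.
        g \<in> {E, F} \<and> i \<in> {1..n - 1} \<and> j \<in> {1..n - 1} \<and> \<bar>int i - int j\<bar> = 1}
   \<union> {gen (g i) * gen (g j) - gen (g j) * gen (g i) | g i j.
        g \<in> {E, F} \<and> i \<in> {1..n - 1} \<and> j \<in> {1..n - 1} \<and> \<bar>int i - int j\<bar> > 1}"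

definition uq_ideal :: "nat \<Rightarrow> complex \<Rightarrow> (uq_gen word \<Rightarrow>\<^sub>0 complex) set" where
  "uq_ideal n q = Idl\<^bsub>uq_free n\<^esub> (uq_rels n q)"

definition Uq :: "nat \<Rightarrow> complex \<Rightarrow> (uq_gen word \<Rightarrow>\<^sub>0 complex) set ring" where
  "Uq n q = uq_free n Quot uq_ideal n q"

definition uq_class ::
    "nat \<Rightarrow> complex \<Rightarrow> (uq_gen word \<Rightarrow>\<^sub>0 complex) \<Rightarrow> (uq_gen word \<Rightarrow>\<^sub>0 complex) set" where
  "uq_class n q p = uq_ideal n q +>\<^bsub>uq_free n\<^esub> p"

definition uq_scalar :: "nat \<Rightarrow> complex \<Rightarrow> complex \<Rightarrow> (uq_gen word \<Rightarrow>\<^sub>0 complex) set" where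
  "uq_scalar n q c = uq_class n q (const c)"

section \<open>The Gelfand-Tsetlin subalgebra\<close>

text \<open>The unital complex subalgebra generated by \<open>S\<close> is the subring generated by \<open>S\<close>
  together with the scalars.\<close>

definition uq_subalgebra ::
    "nat \<Rightarrow> complex \<Rightarrow> (uq_gen word \<Rightarrow>\<^sub>0 complex) set set \<Rightarrow> (uq_gen word \<Rightarrow>\<^sub>0 complex) set set"
  where "uq_subalgebra n q S = generate_ring (Uq n q) (range (uq_scalar n q) \<union> S)"

definition Um :: "nat \<Rightarrow> complex \<Rightarrow> nat \<Rightarrow> (uq_gen word \<Rightarrow>\<^sub>0 complex) set set" where
  "Um n q m = uq_subalgebra n q
     (uq_class n q ` gen `
       (E ` {1..m - 1} \<union> F ` {1..m - 1} \<union> {Q (eps i) | i. i \<in> {1..m}}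
        \<union> {Q (\<lambda>k. - eps i k) | i. i \<in> {1..m}}))"

definition Zm :: "nat \<Rightarrow> complex \<Rightarrow> nat \<Rightarrow> (uq_gen word \<Rightarrow>\<^sub>0 complex) set set" where
  "Zm n q m = {z \<in> Um n q m. \<forall>u \<in> Um n q m. z \<otimes>\<^bsub>Uq n q\<^esub> u = u \<otimes>\<^bsub>Uq n q\<^esub> z}"

definition Gamma :: "nat \<Rightarrow> complex \<Rightarrow> (uq_gen word \<Rightarrow>\<^sub>0 complex) set ring" where
  "Gamma n q = (Uq n q) \<lparr> carrier := uq_subalgebra n q (\<Union>m \<in> {1..n}. Zm n q m) \<rparr>"

section \<open>Relations on the positions of a tableau\<close>

type_synonym pos = "nat \<times> nat"

text \<open>\<open>Geq a b\<close> and \<open>Gtr a b\<close> are the formal relations \<open>a \<ge> b\<close> and \<open>a > b\<close>.\<close>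

datatype relation = Geq pos pos | Gtr pos pos

definition positions :: "nat \<Rightarrow> pos set" where
  "positions n = {(i, j). 1 \<le> j \<and> j \<le> i \<and> i \<le> n}"

definition relations :: "nat \<Rightarrow> relation set" where
  "relations n =
     {Geq (i, j) (i - 1, j') | i j j'. 1 \<le> j \<and> j \<le> i \<and> i \<le> n \<and> 1 \<le> j' \<and> j' \<le> i - 1}
   \<union> {Gtr (i - 1, j') (i, j) | i j j'. 1 \<le> j \<and> j \<le> i \<and> i \<le> n \<and> 1 \<le> j' \<and> j' \<le> i - 1}
   \<union> {Geq (n, i) (n, j) | i j. 1 \<le> i \<and> i \<le> n \<and> 1 \<le> j \<and> j \<le> n \<and> i \<noteq> j}"

fun rel_positions :: "relation \<Rightarrow> pos set" where
  "rel_positions (Geq a b) = {a, b}"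
| "rel_positions (Gtr a b) = {a, b}"

definition vertices :: "relation set \<Rightarrow> pos set" where
  "vertices C = (\<Union>r \<in> C. rel_positions r)"

definition disconnected :: "relation set \<Rightarrow> relation set \<Rightarrow> bool" where
  "disconnected C1 C2 \<longleftrightarrow> vertices C1 \<inter> vertices C2 = {}"

definition decomposable :: "relation set \<Rightarrow> bool" where
  "decomposable C \<longleftrightarrow>
     (\<exists>C1 C2. C = C1 \<union> C2 \<and> C1 \<noteq> {} \<and> C2 \<noteq> {} \<and> disconnected C1 C2)"

definition indecomposable_decomposition :: "relation set \<Rightarrow> relation set set \<Rightarrow> bool" where
  "indecomposable_decomposition C P \<longleftrightarrow>
     \<Union>P = C \<and> {} \<notin> P \<and> (\<forall>D \<in> P. \<not> decomposable D)
     \<and> (\<forall>D \<in> P. \<forall>D' \<in> P. D \<noteq> D' \<longrightarrow> disconnected D D')"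

definition indecomposable_component :: "relation set \<Rightarrow> relation set \<Rightarrow> bool" where
  "indecomposable_component C D \<longleftrightarrow> (\<exists>P. indecomposable_decomposition C P \<and> D \<in> P)"

definition strict_edges :: "relation set \<Rightarrow> (pos \<times> pos) set" where
  "strict_edges C = {(a, b). Gtr a b \<in> C}"

definition edges :: "relation set \<Rightarrow> (pos \<times> pos) set" where
  "edges C = {(a, b). Geq a b \<in> C \<or> Gtr a b \<in> C}"

text \<open>Chains consist of at least one relation, so \<open>succeq\<close> is not reflexive in general.\<close>

definition succeq :: "relation set \<Rightarrow> pos \<Rightarrow> pos \<Rightarrow> bool" where
  "succeq C a b \<longleftrightarrow> (a, b) \<in> (edges C)\<^sup>+"

definition succ :: "relation set \<Rightarrow> pos \<Rightarrow> pos \<Rightarrow> bool" where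
  "succ C a b \<longleftrightarrow> (a, b) \<in> (edges C)\<^sup>* O strict_edges C O (edges C)\<^sup>*"

definition has_cross :: "relation set \<Rightarrow> bool" where
  "has_cross C \<longleftrightarrow>
     (\<exists>k i j s t. i < j \<and> s < t \<and> {Geq (k, i) (k - 1, t), Gtr (k - 1, s) (k, j)} \<subseteq> C)"

definition admissible_indecomposable :: "nat \<Rightarrow> relation set \<Rightarrow> bool" where
  "admissible_indecomposable n C \<longleftrightarrow>
     (\<forall>k i j. 1 \<le> k \<and> k \<le> n \<and> succ C (k, i) (k, j) \<longrightarrow> i < j)
   \<and> (\<forall>i j. succeq C (n, i) (n, j) \<longrightarrow> i < j)
   \<and> \<not> has_cross C
   \<and> (\<forall>k i j. 1 \<le> k \<and> k \<le> n - 1 \<and> i < j \<and> (k, i) \<in> vertices C \<and> (k, j) \<in> vertices C \<longrightarrow>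
        (\<exists>s t. {Gtr (k, i) (k + 1, s), Geq (k + 1, s) (k, j),
                Geq (k, i) (k - 1, t), Gtr (k - 1, t) (k, j)} \<subseteq> C)
      \<or> (\<exists>s t. s < t \<and> {Gtr (k, i) (k + 1, s), Geq (k + 1, t) (k, j)} \<subseteq> C))"

definition admissible :: "nat \<Rightarrow> relation set \<Rightarrow> bool" where
  "admissible n C \<longleftrightarrow> (\<forall>D. indecomposable_component C D \<longrightarrow> admissible_indecomposable n D)"

section \<open>Tableaux and realizations\<close>

type_synonym tableau = "pos \<Rightarrow> complex"

definition tableaux :: "nat \<Rightarrow> tableau set" where
  "tableaux n = {L. \<forall>p. p \<notin> positions n \<longrightarrow> L p = 0}"

fun satisfies_rel :: "complex \<Rightarrow> tableau \<Rightarrow> relation \<Rightarrow> bool" where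
  "satisfies_rel lq L (Geq a b) \<longleftrightarrow>
     (\<exists>k :: int. \<exists>x \<in> half_one_set lq. k \<ge> 0 \<and> L a - L b = of_int k + x)"
| "satisfies_rel lq L (Gtr a b) \<longleftrightarrow>
     (\<exists>k :: int. \<exists>x \<in> half_one_set lq. k > 0 \<and> L a - L b = of_int k + x)"

definition satisfies :: "nat \<Rightarrow> complex \<Rightarrow> relation set \<Rightarrow> tableau \<Rightarrow> bool" where
  "satisfies n lq C L \<longleftrightarrow>
     (\<forall>r \<in> C. satisfies_rel lq L r)
   \<and> (\<forall>k i j. (k, i) \<in> positions n \<and> (k, j) \<in> positions n \<and> i \<noteq> j
        \<and> (\<exists>d :: int. \<exists>x \<in> half_one_set lq. L (k, i) - L (k, j) = of_int d + x) \<longrightarrow>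
        (\<exists>D. indecomposable_component C D \<and> (k, i) \<in> vertices D \<and> (k, j) \<in> vertices D))"

definition shifts :: "nat \<Rightarrow> (pos \<Rightarrow> int) set" where
  "shifts n = {z. \<forall>p. p \<notin> positions (n - 1) \<longrightarrow> z p = 0}"

definition basis :: "nat \<Rightarrow> complex \<Rightarrow> relation set \<Rightarrow> tableau \<Rightarrow> tableau set" where
  "basis n lq C L =
     {R. (\<exists>z \<in> shifts n. R = (\<lambda>p. L p + of_int (z p))) \<and> satisfies n lq C R}"

section \<open>The tableau module\<close>

definition scl :: "complex \<Rightarrow> (tableau \<Rightarrow>\<^sub>0 complex) \<Rightarrow> (tableau \<Rightarrow>\<^sub>0 complex)" where
  "scl c v = Poly_Mapping.map ((*) c) v"

lemma lookup_scl [simp]: "Poly_Mapping.lookup (scl c v) R = c * Poly_Mapping.lookup v R"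
  by (simp add: scl_def Poly_Mapping.map.rep_eq when_def)

global_interpretation tab: vector_space scl
  by standard (auto intro!: poly_mapping_eqI simp: lookup_add algebra_simps)

definition V_space :: "nat \<Rightarrow> complex \<Rightarrow> relation set \<Rightarrow> tableau \<Rightarrow> (tableau \<Rightarrow>\<^sub>0 complex) set" where
  "V_space n lq C L = {v. Poly_Mapping.keys v \<subseteq> basis n lq C L}"

text \<open>The basis vector of a tableau, read as zero if the tableau lies outside \<open>B\<close>.\<close>

definition tvec :: "tableau set \<Rightarrow> tableau \<Rightarrow> (tableau \<Rightarrow>\<^sub>0 complex)" where
  "tvec B R = (if R \<in> B then Poly_Mapping.single R 1 else 0)"

text \<open>Unital left module structures of \<open>U_q\<close> on \<open>V\<close>, compatible with the complex scalars.\<close>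

definition uq_module ::
    "nat \<Rightarrow> complex \<Rightarrow> (tableau \<Rightarrow>\<^sub>0 complex) set
      \<Rightarrow> ((uq_gen word \<Rightarrow>\<^sub>0 complex) set \<Rightarrow> (tableau \<Rightarrow>\<^sub>0 complex) \<Rightarrow> (tableau \<Rightarrow>\<^sub>0 complex)) \<Rightarrow> bool"
  where "uq_module n q V act \<longleftrightarrow>
     (\<forall>u \<in> carrier (Uq n q). \<forall>v \<in> V. act u v \<in> V)
   \<and> (\<forall>u \<in> carrier (Uq n q). \<forall>v \<in> V. \<forall>w \<in> V. act u (v + w) = act u v + act u w)
   \<and> (\<forall>u \<in> carrier (Uq n q). \<forall>u' \<in> carrier (Uq n q). \<forall>v \<in> V.
        act (u \<oplus>\<^bsub>Uq n q\<^esub> u') v = act u v + act u' v)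
   \<and> (\<forall>u \<in> carrier (Uq n q). \<forall>u' \<in> carrier (Uq n q). \<forall>v \<in> V.
        act (u \<otimes>\<^bsub>Uq n q\<^esub> u') v = act u (act u' v))
   \<and> (\<forall>c. \<forall>v \<in> V. act (uq_scalar n q c) v = scl c v)"

definition gt_weight :: "tableau \<Rightarrow> nat \<Rightarrow> complex" where
  "gt_weight R k = (\<Sum>i = 1..k. R (k, i)) - (\<Sum>i = 1..k - 1. R (k - 1, i)) + of_nat k"

definition gt_e_coeff :: "complex \<Rightarrow> complex \<Rightarrow> tableau \<Rightarrow> nat \<Rightarrow> nat \<Rightarrow> complex" where
  "gt_e_coeff q lq R k j =
     (\<Prod>i = 1..k + 1. qnum q lq (R (k + 1, i) - R (k, j)))
       / (\<Prod>i \<in> {1..k} - {j}. qnum q lq (R (k, i) - R (k, j)))"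

definition gt_f_coeff :: "complex \<Rightarrow> complex \<Rightarrow> tableau \<Rightarrow> nat \<Rightarrow> nat \<Rightarrow> complex" where
  "gt_f_coeff q lq R k j =
     (\<Prod>i = 1..k - 1. qnum q lq (R (k - 1, i) - R (k, j)))
       / (\<Prod>i \<in> {1..k} - {j}. qnum q lq (R (k, i) - R (k, j)))"

text \<open>The first clause says that the fractions in the formulas make sense; it has to be explicit
  because of the convention \<open>x / 0 = 0\<close>.\<close>

definition gt_formulas ::
    "nat \<Rightarrow> complex \<Rightarrow> complex \<Rightarrow> tableau set
      \<Rightarrow> ((uq_gen word \<Rightarrow>\<^sub>0 complex) set \<Rightarrow> (tableau \<Rightarrow>\<^sub>0 complex) \<Rightarrow> (tableau \<Rightarrow>\<^sub>0 complex)) \<Rightarrow> bool"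
  where "gt_formulas n q lq B act \<longleftrightarrow>
     (\<forall>R \<in> B. \<forall>k \<in> {1..n - 1}. \<forall>i \<in> {1..k}. \<forall>j \<in> {1..k}. i \<noteq> j \<longrightarrow>
        qnum q lq (R (k, i) - R (k, j)) \<noteq> 0)
   \<and> (\<forall>R \<in> B. \<forall>k \<in> {1..n}.
        act (uq_class n q (gen (Q (eps k)))) (tvec B R) = scl (qpow lq (gt_weight R k)) (tvec B R))
   \<and> (\<forall>R \<in> B. \<forall>k \<in> {1..n - 1}.
        act (uq_class n q (gen (E k))) (tvec B R) =
          - (\<Sum>j = 1..k. scl (gt_e_coeff q lq R k j) (tvec B (R((k, j) := R (k, j) + 1)))))
   \<and> (\<forall>R \<in> B. \<forall>k \<in> {1..n - 1}.
        act (uq_class n q (gen (F k))) (tvec B R) =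
          (\<Sum>j = 1..k. scl (gt_f_coeff q lq R k j) (tvec B (R((k, j) := R (k, j) - 1)))))"

text \<open>\<open>V(m)\<close>; in \<open>ideals_set\<close> the zeroth power of an ideal is the whole ring.\<close>

definition gt_component ::
    "nat \<Rightarrow> complex \<Rightarrow> (tableau \<Rightarrow>\<^sub>0 complex) set
      \<Rightarrow> ((uq_gen word \<Rightarrow>\<^sub>0 complex) set \<Rightarrow> (tableau \<Rightarrow>\<^sub>0 complex) \<Rightarrow> (tableau \<Rightarrow>\<^sub>0 complex))
      \<Rightarrow> (uq_gen word \<Rightarrow>\<^sub>0 complex) set set \<Rightarrow> (tableau \<Rightarrow>\<^sub>0 complex) set"
  where "gt_component n q V act \<mm> =
     {v \<in> V. \<exists>k :: nat. \<forall>u \<in> \<mm> [^]\<^bsub>ideals_set (Gamma n q)\<^esub> k. act u v = 0}"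

end

theory Submission
  imports Defs "HOL-Computational_Algebra.Formal_Power_Series" "HOL-Computational_Algebra.Polynomial_FPS"
begin

text \<open>Let \<open>N\<close> be the product of the two triangular matrices formed by the root vectors of \<open>U_q\<close>. The Schur
  complements \<open>X_m(z)\<close> of \<open>1 - z N\<close> satisfy exchange relations with \<open>e_m\<close> and \<open>f_m\<close> which make the coefficients of
  \<open>X_m(z) X_(m-1)(q^2 z) X_(m-2)(q^4 z) \<dots>\<close> central in \<open>(U_m)_q\<close>, and which express \<open>X_(m+1)\<close> through \<open>X_m\<close>, \<open>e_m\<close> and \<open>f_m\<close>.

  On tableaux, induction on \<open>m\<close> shows that \<open>X_m(z)\<close> is diagonal for \<open>m < n\<close> and that its eigenvalue is multiplied by
  \<open>(1 - q^-2 b z) / (1 - b z)\<close>, \<open>b = q^(-2(l + 1))\<close>, when an entry \<open>l\<close> of row \<open>m\<close> is raised by one, whereas changes of the rows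
  above do not affect it. The basis is connected by such unit steps, so equal eigenvalues force equal rows up to a
  permutation and half periods; since no two entries of a row can cross along the steps, they force equal tableaux.

  Hence the Gelfand-Tsetlin subalgebra, which commutes with these central elements, acts diagonally with pairwise
  different characters on the tableaux, and every generalised weight space is a line.\<close>

section \<open>Quantum scalars and root vectors\<close>

text \<open>Neither a description of the centres nor closed eigenvalue formulas are used: a family
  of central elements large enough to separate tableaux suffices, and of its eigenvalues only the
  ratio across a unit step is computed. The matrix \<open>Q\<close> intertwines two coproducts of
  e_k and f_k with the vector representation in one factor, and \<open>P\<close> leads back; hence
  \<open>N\<close> and its resolvent obey exchange relations with few correction terms. The shift by
  q^2 comes from the resolvent identity: for z' = q^2 z the difference z' - z is q z (q - q^-1), and
  q - q^-1 is the factor produced when a column of operators moves across \<open>N\<close>. The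
  ratio across a step in row k+1 is forced without summing products of quantum integers. The
  recursion writes \<open>xz (Suc k)\<close> over \<open>xz k\<close> as a partial fraction; the sum
  of its coefficients is read off from the diagonal of e_k f_k - f_k e_k, and each coefficient has a
  single factor containing the raised entry. The obstacle is the boundary of the basis, where a
  neighbour may exist on one side of the step only; there that factor vanishes because the
  obstructing relation is tight.\<close>

locale qscalars =
  fixes cq ci cl :: "'r::ring_1"
  assumes cq_central: "\<And>x. cq * x = x * cq" and ci_central: "\<And>x. ci * x = x * ci"
    and cl_central: "\<And>x. cl * x = x * cl"
    and cq_ci: "cq * ci = 1" and cl_inv: "(cq - ci) * cl = 1"
    and cq_plus_ci: "\<And>x. (cq + ci) * x = 0 \<Longrightarrow> x = 0"
begin

text \<open>The scalars q, q^-1 and 1/(q - q^-1) are mere central ring elements, because the same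
  calculus is used in the opposite ring and in the ring of power series. That \<open>cq + ci\<close>
  can be cancelled is what remains of q^2 being different from -1.\<close>

definition qs :: "'r \<Rightarrow> 'r" where "qs x = cq * x"
definition qi :: "'r \<Rightarrow> 'r" where "qi x = ci * x"
definition ql :: "'r \<Rightarrow> 'r" where "ql x = cl * x"

lemma ci_cq: "ci * cq = 1"
  using cq_ci cq_central by metis

lemma qs_add [simp]: "qs (x + y) = qs x + qs y" and qi_add [simp]: "qi (x + y) = qi x + qi y"
  and ql_add [simp]: "ql (x + y) = ql x + ql y"
  and qs_diff [simp]: "qs (x - y) = qs x - qs y" and qi_diff [simp]: "qi (x - y) = qi x - qi y"
  and ql_diff [simp]: "ql (x - y) = ql x - ql y"
  and qs_minus [simp]: "qs (- x) = - qs x" and qi_minus [simp]: "qi (- x) = - qi x"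
  and ql_minus [simp]: "ql (- x) = - ql x"
  and qs_zero [simp]: "qs 0 = 0" and qi_zero [simp]: "qi 0 = 0" and ql_zero [simp]: "ql 0 = 0"
  and qs_multl [simp]: "qs x * y = qs (x * y)" and qi_multl [simp]: "qi x * y = qi (x * y)"
  and ql_multl [simp]: "ql x * y = ql (x * y)"
  by (simp_all add: qs_def qi_def ql_def algebra_simps)

lemma qs_multr [simp]: "x * qs y = qs (x * y)" and qi_multr [simp]: "x * qi y = qi (x * y)"
  and ql_multr [simp]: "x * ql y = ql (x * y)"
  unfolding qs_def qi_def ql_def by (metis cq_central ci_central cl_central mult.assoc)+

lemma qs_qi [simp]: "qs (qi x) = x" and qi_qs [simp]: "qi (qs x) = x"
  unfolding qs_def qi_def by (simp_all add: mult.assoc [symmetric] cq_ci ci_cq)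

text \<open>The identity (q - q^-1) l = 1, oriented as q l = 1 + q^-1 l. As rewrite rules these
  equations bring words in the three scalars to a normal form in which \<open>ql\<close> never meets
  \<open>qs\<close>.\<close>

lemma ql_qi [simp]: "ql (qi x) = qi (ql x)" and ql_qs [simp]: "ql (qs x) = x + qi (ql x)"
  and qs_ql [simp]: "qs (ql x) = x + qi (ql x)"
proof -
  show "ql (qi x) = qi (ql x)"
    unfolding ql_def qi_def by (metis cl_central mult.assoc)
  have "qs (ql x) - qi (ql x) = (cq - ci) * cl * x"
    by (simp only: qs_def qi_def ql_def left_diff_distrib mult.assoc)
  then show A: "qs (ql x) = x + qi (ql x)" by (simp only: cl_inv mult_1_left diff_eq_eq)
  have "ql (qs x) = qs (ql x)"
    unfolding ql_def qs_def by (metis cl_central mult.assoc)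
  with A show "ql (qs x) = x + qi (ql x)" by simp
qed

lemma qs_sum: "qs (sum g A) = (\<Sum>a\<in>A. qs (g a))" and qi_sum: "qi (sum g A) = (\<Sum>a\<in>A. qi (g a))"
  and ql_sum: "ql (sum g A) = (\<Sum>a\<in>A. ql (g a))"
  by (simp_all add: qs_def qi_def ql_def sum_distrib_left)

lemma qs_inj [simp]: "qs x = qs y \<longleftrightarrow> x = y" and qi_inj [simp]: "qi x = qi y \<longleftrightarrow> x = y"
  by (metis qs_qi qi_qs)+

lemma qs_plus_qi_0: "qs x + qi x = 0 \<Longrightarrow> x = 0"
  using cq_plus_ci[of x] by (simp add: qs_def qi_def algebra_simps)

text \<open>Multiplication by q to the power <eps_a, alpha_k>, and its inverse
  \<open>kapi\<close>.\<close>

definition kap :: "nat \<Rightarrow> nat \<Rightarrow> 'r \<Rightarrow> 'r" where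
  "kap k a x = (if a = k then qs x else if a = Suc k then qi x else x)"
definition kapi :: "nat \<Rightarrow> nat \<Rightarrow> 'r \<Rightarrow> 'r" where
  "kapi k a x = (if a = k then qi x else if a = Suc k then qs x else x)"

text \<open>Multiplication by q to the power <eps_i, eps_b - eps_a>.\<close>

definition wx :: "nat \<Rightarrow> nat \<Rightarrow> nat \<Rightarrow> 'r \<Rightarrow> 'r" where
  "wx i a b x = (if a = b then x else if i = b then qs x else if i = a then qi x else x)"

text \<open>As \<open>y\<close> commutes with \<open>e\<close>, regrouping shows that
  \<open>w\<close> equals y u - q u y for u = e' e - q e e'. The Serre relation is equivalent to e u
  = q u e, and this passes to \<open>w\<close>.\<close>

lemma serre_quommute:
  assumes "y * e = e * y"
    and serre: "e * e * e' - (qs (e * e' * e) + qi (e * e' * e)) + e' * e * e = 0"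
  defines "w \<equiv> (y * e' - qs (e' * y)) * e - qs (e * (y * e' - qs (e' * y)))"
  shows "e * w = qs (w * e)"
proof -
  have c: "y * (e * x) = e * (y * x)" for x using assms(1) by (metis mult.assoc)
  have s: "e' * (e * e) = qs (e * (e' * e)) + qi (e * (e' * e)) - e * (e * e')"
    using serre by (simp add: algebra_simps)
  have s': "e' * (e * (e * x)) = qs (e * (e' * (e * x))) + qi (e * (e' * (e * x))) - e * (e * (e' * x))" for x
    using arg_cong[OF s, of "\<lambda>u. u * x"] by (simp add: algebra_simps)
  show ?thesis unfolding w_def
    by (simp add: algebra_simps assms(1) c s s')
qed

text \<open>The hypothesis on \<open>e * w\<close> is itself a Serre relation, for \<open>e\<close>
  and \<open>v\<close>. Together with the one for \<open>e\<close> and \<open>g\<close> it only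
  yields that q + q^-1 times the commutator vanishes, so the last step is a division.\<close>

lemma serre_commute:
  assumes "v * g = g * v"
    and serre: "e * e * g - (qs (e * g * e) + qi (e * g * e)) + g * e * e = 0"
  defines "w \<equiv> v * e - qs (e * v)"
  assumes ew: "e * w = qs (w * e)"
  shows "e * (w * g - qs (g * w)) = (w * g - qs (g * w)) * e"
proof -
  have c: "g * (v * x) = v * (g * x)" for x using assms(1) by (metis mult.assoc)
  have s: "g * (e * e) = qs (e * (g * e)) + qi (e * (g * e)) - e * (e * g)"
    using serre by (simp add: algebra_simps)
  have s': "g * (e * (e * x)) = qs (e * (g * (e * x))) + qi (e * (g * (e * x))) - e * (e * (g * x))" for x
    using arg_cong[OF s, of "\<lambda>u. u * x"] by (simp add: algebra_simps)
  have "qi (e * w) = qi (qs (w * e))" by (subst ew) simp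
  then have t: "qs (e * (v * e)) = v * (e * e) + e * (e * v) - qi (e * (v * e))"
    unfolding w_def by (simp add: algebra_simps)
  have t': "qs (e * (v * (e * x))) = v * (e * (e * x)) + e * (e * (v * x)) - qi (e * (v * (e * x)))" for x
    using arg_cong[OF t, of "\<lambda>u. u * x"] by (simp add: algebra_simps)
  have t'': "qs (g * (e * (v * e))) = g * (v * (e * e)) + g * (e * (e * v)) - qi (g * (e * (v * e)))"
    using arg_cong[OF t, of "\<lambda>u. g * u"] by (simp add: algebra_simps)
  define d where "d = e * (w * g - qs (g * w)) - (w * g - qs (g * w)) * e"
  have "qs d + qi d = 0" unfolding d_def w_def
    by (simp add: algebra_simps c s s' t t' t'' assms(1)[symmetric])
  then have "d = 0" by (rule qs_plus_qi_0)
  then show ?thesis by (simp add: d_def)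
qed

end

section \<open>Weights with respect to the torus\<close>

locale torus_alg = qscalars cq ci cl for cq ci cl :: "'r::ring_1" +
  fixes n :: nat and e f t ti :: "nat \<Rightarrow> 'r"
  assumes t_ti: "i \<in> {1..n} \<Longrightarrow> t i * ti i = 1" and ti_t: "i \<in> {1..n} \<Longrightarrow> ti i * t i = 1"
    and t_t: "i \<in> {1..n} \<Longrightarrow> j \<in> {1..n} \<Longrightarrow> t i * t j = t j * t i"
    and t_e: "i \<in> {1..n} \<Longrightarrow> 1 \<le> j \<Longrightarrow> j < n \<Longrightarrow> t i * e j = kap j i (e j * t i)"
    and t_f: "i \<in> {1..n} \<Longrightarrow> 1 \<le> j \<Longrightarrow> j < n \<Longrightarrow> t i * f j = kapi j i (f j * t i)"
begin

definition K where "K i = t i * ti (Suc i)"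
definition Ki where "Ki i = ti i * t (Suc i)"

lemma t_ti_comm: "i \<in> {1..n} \<Longrightarrow> j \<in> {1..n} \<Longrightarrow> t i * ti j = ti j * t i"
  by (metis mult.assoc mult.right_neutral mult.left_neutral t_t t_ti ti_t)
lemma ti_ti_comm: "i \<in> {1..n} \<Longrightarrow> j \<in> {1..n} \<Longrightarrow> ti i * ti j = ti j * ti i"
  by (metis mult.assoc mult.right_neutral mult.left_neutral t_ti_comm t_ti ti_t)

lemma K_Ki: "1 \<le> i \<Longrightarrow> i < n \<Longrightarrow> K i * Ki i = 1" and Ki_K: "1 \<le> i \<Longrightarrow> i < n \<Longrightarrow> Ki i * K i = 1"
  unfolding K_def Ki_def
  by (smt (verit, ccfv_threshold) Suc_leI atLeastAtMost_iff le_Suc_eq less_imp_le mult.assoc mult.right_neutral t_ti t_ti_comm ti_t nat_le_linear le_trans One_nat_def)+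

text \<open>\<open>x\<close> has weight eps_b - eps_a. The index pair is that of a matrix entry in
  position (a, b), so that weights of products follow the pattern of matrix multiplication.\<close>

definition wt :: "nat \<Rightarrow> nat \<Rightarrow> 'r \<Rightarrow> bool" where
  "wt a b x \<longleftrightarrow> (\<forall>i\<in>{1..n}. t i * x = wx i a b (x * t i))"

lemma wt_ti:
  assumes "wt a b x" "i \<in> {1..n}" shows "x * ti i = wx i a b (ti i * x)"
proof -
  have "ti i * (t i * x) * ti i = ti i * wx i a b (x * t i) * ti i"
    using assms by (simp add: wt_def)
  moreover have "x * t i * ti i = x" using t_ti[OF assms(2)] by (simp add: mult.assoc)
  moreover have "ti i * (t i * x) = x" using ti_t[OF assms(2)] by (simp add: mult.assoc[symmetric])
  ultimately show ?thesis by (simp add: wx_def mult.assoc split: if_splits)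
qed

lemma wt_t:
  assumes "wt a b x" "i \<in> {1..n}" shows "t i * x = wx i a b (x * t i)"
  using assms by (simp add: wt_def)

lemma wt_ti': 
  assumes "wt a b x" "i \<in> {1..n}" shows "ti i * x = wx i b a (x * ti i)"
  using wt_ti[OF assms] by (auto simp: wx_def)

lemma wt_mult:
  assumes "wt a c x" "wt c b y" shows "wt a b (x * y)" "wt a b (y * x)"
proof -
  { fix i assume i: "i \<in> {1..n}"
    have x: "t i * (x * z) = wx i a c (x * (t i * z))" for z
      using wt_t[OF assms(1) i] by (auto simp: wx_def mult.assoc[symmetric])
    have y: "t i * (y * z) = wx i c b (y * (t i * z))" for z
      using wt_t[OF assms(2) i] by (auto simp: wx_def mult.assoc[symmetric])
    note h = wt_t[OF assms(1) i] wt_t[OF assms(2) i] x y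
    have "t i * (x * y) = wx i a b (x * y * t i)" "t i * (y * x) = wx i a b (y * x * t i)"
      by (auto simp: h mult.assoc) (auto simp: wx_def mult.assoc) }
  then show "wt a b (x * y)" "wt a b (y * x)" by (simp_all add: wt_def)
qed

lemma wt_add: "wt a b x \<Longrightarrow> wt a b y \<Longrightarrow> wt a b (x + y)" 
  and wt_diff: "wt a b x \<Longrightarrow> wt a b y \<Longrightarrow> wt a b (x - y)"
  and wt_qs: "wt a b x \<Longrightarrow> wt a b (qs x)" and wt_qi: "wt a b x \<Longrightarrow> wt a b (qi x)"
  and wt_0: "wt a b 0"
  by (auto simp: wt_def wx_def algebra_simps)

lemma wt_sum: "(\<And>i. i \<in> A \<Longrightarrow> wt a b (g i)) \<Longrightarrow> wt a b (sum g A)"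
  by (induction A rule: infinite_finite_induct) (auto intro: wt_0 wt_add)

lemma wt_e: "1 \<le> k \<Longrightarrow> k < n \<Longrightarrow> wt (Suc k) k (e k)"
  by (auto simp: wt_def wx_def t_e kap_def)
lemma wt_f: "1 \<le> k \<Longrightarrow> k < n \<Longrightarrow> wt k (Suc k) (f k)"
  by (auto simp: wt_def wx_def t_f kapi_def)
lemma wt_tt: "i \<in> {1..n} \<Longrightarrow> wt a a (t i)" "i \<in> {1..n} \<Longrightarrow> wt a a (ti i)"
  by (auto simp: wt_def wx_def t_t t_ti_comm)
lemma wt_K: "1 \<le> k \<Longrightarrow> k < n \<Longrightarrow> wt a a (K k)" "1 \<le> k \<Longrightarrow> k < n \<Longrightarrow> wt a a (Ki k)"
  unfolding K_def Ki_def by (auto intro!: wt_mult wt_tt)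

lemma K_wt:
  assumes "wt a b x" "1 \<le> k" "k < n"
  shows "K k * x = kap k b (kapi k a (x * K k))" "Ki k * x = kapi k b (kap k a (x * Ki k))"
proof -
  have k: "k \<in> {1..n}" "Suc k \<in> {1..n}" using assms by auto
  have 1: "t i * (x * z) = wx i a b (x * (t i * z))" if "i \<in> {1..n}" for z i
      using wt_t[OF assms(1) that] by (auto simp: wx_def mult.assoc[symmetric])
  show "K k * x = kap k b (kapi k a (x * K k))" "Ki k * x = kapi k b (kap k a (x * Ki k))"
    unfolding K_def Ki_def using wt_ti'[OF assms(1) k(1)] wt_ti'[OF assms(1) k(2)] 1[OF k(1)] 1[OF k(2)]
       wt_t[OF assms(1) k(2)]
     apply (auto simp: mult.assoc) 
    apply (auto simp: wx_def kap_def kapi_def mult.assoc[symmetric])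
    done
qed


lemma ti_e: "i \<in> {1..n} \<Longrightarrow> 1 \<le> j \<Longrightarrow> j < n \<Longrightarrow> ti i * e j = kapi j i (e j * ti i)"
  using wt_ti'[OF wt_e, of j i] by (auto simp: wx_def kapi_def)
lemma ti_f: "i \<in> {1..n} \<Longrightarrow> 1 \<le> j \<Longrightarrow> j < n \<Longrightarrow> ti i * f j = kap j i (f j * ti i)"
  using wt_ti'[OF wt_f, of j i] by (auto simp: wx_def kap_def)

lemma K_e: "1 \<le> k \<Longrightarrow> k < n \<Longrightarrow> 1 \<le> j \<Longrightarrow> j < n \<Longrightarrow>
     K k * e j = kap k j (kapi k (Suc j) (e j * K k))"
   "1 \<le> k \<Longrightarrow> k < n \<Longrightarrow> 1 \<le> j \<Longrightarrow> j < n \<Longrightarrow>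
     Ki k * e j = kapi k j (kap k (Suc j) (e j * Ki k))"
  using K_wt[OF wt_e] by auto

end

locale uq_alg = torus_alg cq ci cl n e f t ti
  for cq ci cl :: "'r::ring_1" and n :: nat and e f t ti :: "nat \<Rightarrow> 'r" +
  assumes e_f: "1 \<le> i \<Longrightarrow> i < n \<Longrightarrow>
        e i * f i - f i * e i = ql (t i * ti (Suc i) - t (Suc i) * ti i)"
    and e_f_comm: "1 \<le> i \<Longrightarrow> i < n \<Longrightarrow> 1 \<le> j \<Longrightarrow> j < n \<Longrightarrow> i \<noteq> j \<Longrightarrow> e i * f j = f j * e i"
    and e_e_comm: "1 \<le> i \<Longrightarrow> Suc i < j \<Longrightarrow> j < n \<Longrightarrow> e i * e j = e j * e i"
    and f_f_comm: "1 \<le> i \<Longrightarrow> Suc i < j \<Longrightarrow> j < n \<Longrightarrow> f i * f j = f j * f i"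
    and e_serre: "1 \<le> i \<Longrightarrow> i < n \<Longrightarrow> 1 \<le> j \<Longrightarrow> j < n \<Longrightarrow> i = Suc j \<or> j = Suc i \<Longrightarrow>
        e i * e i * e j - (qs (e i * e j * e i) + qi (e i * e j * e i)) + e j * e i * e i = 0"
    and f_serre: "1 \<le> i \<Longrightarrow> i < n \<Longrightarrow> 1 \<le> j \<Longrightarrow> j < n \<Longrightarrow> i = Suc j \<or> j = Suc i \<Longrightarrow>
        f i * f i * f j - (qs (f i * f j * f i) + qi (f i * f j * f i)) + f j * f i * f i = 0"
begin

text \<open>The reversal of eps_1, ..., eps_n sends alpha_i to -alpha_(n-i), so it becomes a
  symmetry when \<open>e\<close> and \<open>f\<close> are swapped as well. It will supply every
  relation for \<open>Pm\<close> from one for \<open>Qm\<close>.\<close>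

lemma reflect: "uq_alg cq ci cl n (\<lambda>i. f (n - i)) (\<lambda>i. e (n - i)) (\<lambda>i. t (Suc n - i)) (\<lambda>i. ti (Suc n - i))"
proof (unfold_locales, goal_cases)
  case (4 i j)
  then have "Suc n - i = n - j \<longleftrightarrow> i = Suc j" "Suc n - i = Suc (n - j) \<longleftrightarrow> i = j" by auto
  moreover have "Suc n - i \<in> {1..n}" "1 \<le> n - j" "n - j < n" using 4 by auto
  ultimately show ?case using t_f[of "Suc n - i" "n - j"] by (auto simp: kap_def kapi_def)
next
  case (5 i j)
  then have "Suc n - i = n - j \<longleftrightarrow> i = Suc j" "Suc n - i = Suc (n - j) \<longleftrightarrow> i = j" by auto
  moreover have "Suc n - i \<in> {1..n}" "1 \<le> n - j" "n - j < n" using 5 by auto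
  ultimately show ?case using t_e[of "Suc n - i" "n - j"] by (auto simp: kap_def kapi_def)
next
  case (6 i)
  then have "Suc n - i = Suc (n - i)" by simp
  with 6 show ?case using e_f[of "n - i"] t_ti ti_t t_t
    by (simp add: algebra_simps)
next
  case (7 i j) then show ?case using e_f_comm[of "n - j" "n - i"] by auto
next
  case (8 i j) then show ?case using f_f_comm[of "n - j" "n - i"] by auto
next
  case (9 i j) then show ?case using e_e_comm[of "n - j" "n - i"] by auto
next
  case (10 i j) then show ?case by (intro f_serre) auto
next
  case (11 i j) then show ?case by (intro e_serre) auto
qed (auto intro!: t_ti ti_t t_t)

text \<open>Below the diagonal the entries are root vectors, iterated \<open>q\<close>-commutators of the \<open>e i\<close>.\<close>

fun Qm :: "nat \<Rightarrow> nat \<Rightarrow> 'r" where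
  "Qm 0 b = 0"
| "Qm (Suc a) b = (if b = Suc a then ti b else if b \<le> a then Qm a b * e a - qs (e a * Qm a b) else 0)"

lemma Qm_diag: "1 \<le> b \<Longrightarrow> Qm b b = ti b"
  by (cases b) auto
lemma Qm_lt: "a < b \<Longrightarrow> Qm a b = 0"
  by (cases a) auto
lemma Qm_step: "b \<le> a \<Longrightarrow> Qm (Suc a) b = Qm a b * e a - qs (e a * Qm a b)"
  by simp

declare Qm.simps [simp del]

lemma Qm_induct [consumes 2, case_names diag step]:
  assumes "1 \<le> b" "b \<le> a" "1 \<le> b \<Longrightarrow> P b" "\<And>a. 1 \<le> b \<Longrightarrow> b \<le> a \<Longrightarrow> P a \<Longrightarrow> P (Suc a)"
  shows "P a"
  using assms(2) by (induction rule: dec_induct) (use assms in auto)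

section \<open>Relations between the generators and the root vectors\<close>

lemma Qm_commute:
  assumes "1 \<le> b" "b \<le> a" "y * ti b = ti b * y" "\<And>j. b \<le> j \<Longrightarrow> j < a \<Longrightarrow> y * e j = e j * y"
  shows "y * Qm a b = Qm a b * y"
  using assms
proof (induction rule: Qm_induct)
  case diag then show ?case by (simp add: Qm_diag)
next
  case (step a)
  then have 1: "y * Qm a b = Qm a b * y" "y * e a = e a * y" by auto
  then have "y * (Qm a b * x) = Qm a b * (y * x)" "y * (e a * x) = e a * (y * x)" for x
    by (metis mult.assoc)+
  with 1 show ?case by (simp add: Qm_step[OF step(2)] algebra_simps)
qed

lemma wt_Qm: "1 \<le> b \<Longrightarrow> b \<le> a \<Longrightarrow> a \<le> n \<Longrightarrow> wt a b (Qm a b)"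
proof (induction rule: Qm_induct)
  case diag then show ?case by (auto simp: Qm_diag intro!: wt_tt)
next
  case (step a)
  then have "wt a b (Qm a b)" "wt (Suc a) a (e a)" by (auto intro!: wt_e)
  then show ?case using step wt_mult[of "Suc a" a "e a" b "Qm a b"] by (auto simp: Qm_step intro!: wt_diff wt_qs)
qed

lemma e_e_comm': "1 \<le> i \<Longrightarrow> 1 \<le> j \<Longrightarrow> i < n \<Longrightarrow> j < n \<Longrightarrow> Suc i < j \<or> Suc j < i \<Longrightarrow> e i * e j = e j * e i"
  using e_e_comm by (metis)

lemma e_Qm_far: "1 \<le> b \<Longrightarrow> b \<le> a \<Longrightarrow> a \<le> n \<Longrightarrow> 1 \<le> k \<Longrightarrow> k < n \<Longrightarrow> a < k \<or> Suc k < b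
    \<Longrightarrow> e k * Qm a b = Qm a b * e k"
  by (rule Qm_commute) (auto simp: ti_e kapi_def intro!: e_e_comm')

lemma f_Qm_far: "1 \<le> b \<Longrightarrow> b \<le> a \<Longrightarrow> a \<le> n \<Longrightarrow> 1 \<le> k \<Longrightarrow> k < n \<Longrightarrow> (a \<le> k \<and> b < k) \<or> Suc k < b
    \<Longrightarrow> f k * Qm a b = Qm a b * f k"
  by (rule Qm_commute) (auto simp: ti_f kap_def e_f_comm)

text \<open>For b < k the root vector ending in the letters e_(k-1), e_k is the double q-commutator
  of \<open>serre_quommute\<close>, with \<open>y\<close> the root vector cut off before them. For b
  = k only the torus is involved.\<close>

lemma e_Qm_top:
  assumes "1 \<le> b" "b \<le> k" "k < n"
  shows "e k * Qm (Suc k) b = qs (Qm (Suc k) b * e k)"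
proof (cases "b = k")
  case True
  have 1: "ti k * e k = qi (e k * ti k)" using assms True by (simp add: ti_e kapi_def)
  then have 2: "ti k * (e k * x) = qi (e k * (ti k * x))" for x by (metis mult.assoc qi_multl)
  show ?thesis using True assms by (simp add: Qm_step Qm_diag algebra_simps 1 2)
next
  case False
  then obtain j where j: "k = Suc j" "b \<le> j" using assms by (cases k) auto
  show ?thesis unfolding Qm_step[OF assms(2)] unfolding j Qm_step[OF j(2)]
  proof (rule serre_quommute)
    show "Qm j b * e (Suc j) = e (Suc j) * Qm j b"
      using e_Qm_far[of b j "Suc j"] j assms by auto
    show "e (Suc j) * e (Suc j) * e j - (qs (e (Suc j) * e j * e (Suc j)) + qi (e (Suc j) * e j * e (Suc j)))
       + e j * e (Suc j) * e (Suc j) = 0"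
      using j assms by (intro e_serre) auto
  qed
qed

text \<open>For a = k+2 this is \<open>serre_commute\<close>, with v = \<open>Qm k b\<close> and the
  neighbouring letter e_(k+1) as \<open>g\<close>. All further letters commute with e_k.\<close>

lemma e_Qm_mid:
  assumes "1 \<le> b" "b \<le> k" "Suc (Suc k) \<le> a" "a \<le> n"
  shows "e k * Qm a b = Qm a b * e k"
  using assms(3,4)
proof (induction rule: dec_induct)
  case base
  then have k: "1 \<le> k" "Suc k < n" using assms by auto
  have s: "b \<le> Suc k" using assms by simp
  show ?case unfolding Qm_step[OF s] unfolding Qm_step[OF assms(2)]
  proof (rule serre_commute)
    show "Qm k b * e (Suc k) = e (Suc k) * Qm k b" using e_Qm_far[of b k "Suc k"] assms k by auto
    show "e k * e k * e (Suc k) - (qs (e k * e (Suc k) * e k) + qi (e k * e (Suc k) * e k)) + e (Suc k) * e k * e k = 0"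
      using k by (intro e_serre) auto
    show "e k * (Qm k b * e k - qs (e k * Qm k b)) = qs ((Qm k b * e k - qs (e k * Qm k b)) * e k)"
      using e_Qm_top[of b k] assms k by (simp add: Qm_step)
  qed
next
  case (step m)
  have b: "b \<le> m" using step assms by simp
  have 1: "e k * Qm m b = Qm m b * e k" "e k * e m = e m * e k" using step assms by (auto intro!: e_e_comm')
  then have "e k * (Qm m b * x) = Qm m b * (e k * x)" "e k * (e m * x) = e m * (e k * x)" for x
    by (metis mult.assoc)+
  with 1 show ?case by (simp add: Qm_step[OF b] algebra_simps)
qed

text \<open>Commuting with e_k lengthens the root vector at its lower end by one letter. The step
  with m = k+1 stands apart because the appended letter e_(k+1) does not commute with e_k; there
  both sides are expanded down to generators.\<close>

lemma e_Qm_low: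
  assumes "1 \<le> k" "Suc k \<le> a" "a \<le> n"
  shows "kap k a (e k * Qm a (Suc k)) = Qm a (Suc k) * e k + Qm a k * K k"
  using assms(2,3)
proof (induction rule: dec_induct)
  case base
  have i: "k \<in> {1..n}" "Suc k \<in> {1..n}" using assms by auto
  have 1: "ti k * e k = qi (e k * ti k)" "ti (Suc k) * e k = qs (e k * ti (Suc k))"
    using assms i by (simp_all add: ti_e kapi_def)
  have 2: "ti k * (e k * x) = qi (e k * (ti k * x))" for x by (metis 1(1) mult.assoc qi_multl)
  have 3: "ti k * (t k * x) = x" for x using ti_t[OF i(1)] by (metis mult.assoc mult_1_left)
  show ?case using assms
    by (simp add: Qm_step Qm_diag K_def algebra_simps 1 2 3 kap_def)
next
  case (step m)
  define r where "r = Qm m (Suc k)"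
  have km: "k \<le> m" "Suc k \<le> m" using step by auto
  show ?case
  proof (cases "m = Suc k")
    case True
    have kn: "1 \<le> Suc k" "Suc k < n" "k < n" using step True by auto
    have i: "k \<in> {1..n}" "Suc k \<in> {1..n}" using kn assms by auto
    have 1: "ti (Suc k) * e k = qs (e k * ti (Suc k))" "ti (Suc k) * e (Suc k) = qi (e (Suc k) * ti (Suc k))"
      using kn i assms by (simp_all add: ti_e kapi_def)
    have 2: "ti (Suc k) * (e k * x) = qs (e k * (ti (Suc k) * x))"
            "ti (Suc k) * (e (Suc k) * x) = qi (e (Suc k) * (ti (Suc k) * x))" for x
      by (metis 1 mult.assoc qi_multl qs_multl)+
    have 3: "Qm (Suc k) k * K k = qi (e k * ti (Suc k)) - qs (e k * ti (Suc k))"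
      using step.IH step.prems kn by (simp add: True kap_def Qm_diag 1 algebra_simps)
    have 4: "e (Suc k) * K k = qs (K k * e (Suc k))"
      using K_e(1)[of k "Suc k"] kn assms by (simp add: kap_def kapi_def)
    have 5: "Qm (Suc (Suc k)) k * K k = qs (Qm (Suc k) k * K k * e (Suc k)) - qs (e (Suc k) * (Qm (Suc k) k * K k))"
      by (simp add: Qm_step algebra_simps 4)
    show ?thesis unfolding True 5 3 using kn
      by (simp add: Qm_step Qm_diag kap_def algebra_simps 1 2)
  next
    case False
    have 1: "e k * Qm m (Suc k) = Qm m (Suc k) * e k + Qm m k * K k"
      using step False by (simp add: kap_def)
    have 2: "e k * e m = e m * e k" using step False assms by (auto intro!: e_e_comm')
    have 3: "K k * e m = e m * K k" using K_e(1)[of k m] step False assms by (simp add: kap_def kapi_def)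
    have 4: "e k * (Qm m (Suc k) * x) = Qm m (Suc k) * (e k * x) + Qm m k * (K k * x)" for x
      using arg_cong[OF 1, of "\<lambda>u. u * x"] by (simp add: algebra_simps)
    have 5: "e k * (e m * x) = e m * (e k * x)" for x by (metis 2 mult.assoc)
    show ?thesis using step False
      by (simp add: Qm_step[OF km(1)] Qm_step[OF km(2)] kap_def algebra_simps 1 2 3 4 5)
  qed
qed

text \<open>In matrix form, \<open>Qm\<close> intertwines diag(\<open>kap\<close>) e_k + E_(k,k+1)
  with e_k + E_(k,k+1) K_k, two coproducts of e_k with the vector representation in one factor. The
  cases are the positions of k relative to the interval from c to a.\<close>

lemma Qm_E:
  assumes "1 \<le> k" "k < n" "a \<in> {1..n}" "c \<in> {1..n}"
  shows "kap k a (e k * Qm a c) + (if a = k then Qm (Suc k) c else 0) =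
         Qm a c * e k + (if c = Suc k then Qm a k * K k else 0)"
proof -
  consider "a < c" | "c = Suc k" "c \<le> a" | "c \<noteq> Suc k" "c \<le> a" "a < k \<or> Suc k < c" | "c \<le> k" "a = k"
    | "c \<le> k" "a = Suc k" | "c \<le> k" "Suc (Suc k) \<le> a" using assms by force
  then show ?thesis
  proof cases
    case 1
    show ?thesis
    proof (cases "a = k \<and> c = Suc k")
      case True
      have "ti k * (t k * x) = x" for x using ti_t[of k] assms by (simp add: mult.assoc[symmetric])
      then show ?thesis using 1 True assms by (auto simp: Qm_lt Qm_diag K_def kap_def)
    next
      case False
      then show ?thesis using 1 assms by (auto simp: Qm_lt kap_def)
    qed
  next
    case 2 then show ?thesis using e_Qm_low[of k a] assms by auto
  next
    case 3 then show ?thesis using e_Qm_far[of c a k] assms by (auto simp: kap_def)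
  next
    case 4 then show ?thesis using assms by (auto simp: kap_def Qm_step)
  next
    case 5 then show ?thesis using e_Qm_top[of c k] assms by (auto simp: kap_def)
  next
    case 6 then show ?thesis using e_Qm_mid[of c k a] assms by (auto simp: kap_def)
  qed
qed

lemma f_e_swap: "1 \<le> k \<Longrightarrow> k < n \<Longrightarrow> f k * e k = e k * f k - ql (K k - Ki k)"
  using e_f[of k] t_ti_comm[of "Suc k" k] by (simp add: K_def Ki_def algebra_simps)

text \<open>Only the commutator of f_k with the last letter e_k contributes. Its K_k half cancels
  inside the q-commutator with \<open>r\<close>, and in the other half the weight of
  \<open>r\<close> produces q^2 - 1, which removes the denominator.\<close>

lemma f_Qm_top:
  assumes "1 \<le> b" "b < k" "k < n"
  shows "f k * Qm (Suc k) b = Qm (Suc k) b * f k - Ki k * Qm k b"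
proof -
  define r where "r = Qm k b"
  have 1: "f k * r = r * f k" using f_Qm_far[of b k k] assms by (auto simp: r_def)
  have 2: "f k * (r * x) = r * (f k * x)" for x by (metis 1 mult.assoc)
  have 3: "f k * e k = e k * f k - ql (K k - Ki k)" using f_e_swap assms by simp
  have 4: "f k * (e k * x) = e k * (f k * x) - ql (K k - Ki k) * x" for x
    using arg_cong[OF 3, of "\<lambda>u. u * x"] by (simp add: algebra_simps)
  have w: "wt k b r" using wt_Qm[of b k] assms by (simp add: r_def)
  have 5: "K k * r = qi (r * K k)" "Ki k * r = qs (r * Ki k)"
    using K_wt[OF w] assms by (auto simp: kap_def kapi_def)
  have s: "b \<le> k" using assms by simp
  show ?thesis unfolding Qm_step[OF s] r_def[symmetric]
    by (simp add: algebra_simps 1 2 3 4 5)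
qed

text \<open>The correction from \<open>f_Qm_top\<close> satisfies x e_(k+1) = q e_(k+1) x, so the
  next q-commutator annihilates it.\<close>

lemma f_Qm_mid:
  assumes "1 \<le> b" "b < k" "Suc (Suc k) \<le> a" "a \<le> n"
  shows "f k * Qm a b = Qm a b * f k"
  using assms(3,4)
proof (induction rule: dec_induct)
  case base
  define r where "r = Qm (Suc k) b"
  define v where "v = Qm k b"
  have s: "b \<le> Suc k" using assms by simp
  have 1: "f k * r = r * f k - Ki k * v" using f_Qm_top[of b k] assms base by (auto simp: r_def v_def)
  have 2: "f k * (r * x) = r * (f k * x) - Ki k * (v * x)" for x
    using arg_cong[OF 1, of "\<lambda>u. u * x"] by (simp add: algebra_simps)
  have 3: "f k * e (Suc k) = e (Suc k) * f k" using e_f_comm[of "Suc k" k] assms base by auto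
  have 4: "f k * (e (Suc k) * x) = e (Suc k) * (f k * x)" for x by (metis 3 mult.assoc)
  have 5: "v * e (Suc k) = e (Suc k) * v" using e_Qm_far[of b k "Suc k"] assms base by (auto simp: v_def)
  have 6: "Ki k * e (Suc k) = qs (e (Suc k) * Ki k)" using K_e(2)[of k "Suc k"] assms base by (simp add: kap_def kapi_def)
  have 7: "Ki k * (e (Suc k) * x) = qs (e (Suc k) * (Ki k * x))" for x by (metis 6 mult.assoc qs_multl)
  show ?case unfolding Qm_step[OF s] r_def[symmetric]
    by (simp add: algebra_simps 1 2 3 4 5 6 7)
next
  case (step m)
  have b: "b \<le> m" using step assms by simp
  have 1: "f k * Qm m b = Qm m b * f k" "f k * e m = e m * f k"
    using step assms e_f_comm[of m k] by auto
  then have "f k * (Qm m b * x) = Qm m b * (f k * x)" "f k * (e m * x) = e m * (f k * x)" for x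
    by (metis mult.assoc)+
  with 1 show ?case by (simp add: Qm_step[OF b] algebra_simps)
qed

lemma f_Qm_below:
  assumes "1 \<le> k" "Suc k \<le> a" "a \<le> n"
  shows "f k * Qm a (Suc k) = qs (Qm a (Suc k) * f k)"
  using assms(2,3)
proof (induction rule: dec_induct)
  case base
  then show ?case using assms by (simp add: Qm_diag ti_f kap_def)
next
  case (step m)
  have b: "Suc k \<le> m" using step by simp
  have 1: "f k * Qm m (Suc k) = qs (Qm m (Suc k) * f k)" "f k * e m = e m * f k"
    using step assms e_f_comm[of m k] by auto
  then have "f k * (Qm m (Suc k) * x) = qs (Qm m (Suc k) * (f k * x))" "f k * (e m * x) = e m * (f k * x)" for x
    by (metis mult.assoc qs_multl)+
  with 1 show ?case by (simp add: Qm_step[OF b] algebra_simps)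
qed

text \<open>Here f_b strips the lowest letter off the root vector. The additional torus term occurs
  only for a single letter, where both halves of the commutator of e_b and f_b survive.\<close>

lemma f_Qm_low:
  assumes "1 \<le> b" "Suc b \<le> a" "a \<le> n"
  shows "f b * Qm a b + (if a = Suc b then Ki b * ti b else 0) = qi (Qm a b * f b) + Qm a (Suc b)"
  using assms(2,3)
proof (induction rule: dec_induct)
  case base
  then have b: "b < n" by simp
  have i: "b \<in> {1..n}" "Suc b \<in> {1..n}" using assms b by auto
  have 1: "ti b * f b = qs (f b * ti b)" "ti b * e b = qi (e b * ti b)"
    using assms b i by (simp_all add: ti_f ti_e kap_def kapi_def)
  have 2: "ti b * (f b * x) = qs (f b * (ti b * x))" "ti b * (e b * x) = qi (e b * (ti b * x))" for x
    by (metis 1 mult.assoc qs_multl qi_multl)+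
  have 3: "f b * e b = e b * f b - ql (K b - Ki b)" using f_e_swap assms b by simp
  have 4: "f b * (e b * x) = e b * (f b * x) - ql (K b - Ki b) * x" for x
    using arg_cong[OF 3, of "\<lambda>u. u * x"] by (simp add: algebra_simps)
  have 5: "K b * ti b = ti (Suc b)"
    unfolding K_def using t_ti[OF i(1)] ti_ti_comm[OF i] by (metis mult.assoc mult_1_left)
  show ?case using assms
    by (simp add: Qm_step Qm_diag algebra_simps 1 2 3 4 5)
next
  case (step m)
  have b: "b \<le> m" "Suc b \<le> m" using step by auto
  have 1: "f b * e m = e m * f b" using step assms e_f_comm[of m b] by auto
  have 2: "f b * (e m * x) = e m * (f b * x)" for x by (metis 1 mult.assoc)
  have 3: "f b * Qm m b = qi (Qm m b * f b) + Qm m (Suc b) - (if m = Suc b then Ki b * ti b else 0)"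
    using step by (simp add: algebra_simps)
  have 4: "f b * (Qm m b * x) = qi (Qm m b * (f b * x)) + Qm m (Suc b) * x - (if m = Suc b then Ki b * (ti b * x) else 0)" for x
    using arg_cong[OF 3, of "\<lambda>u. u * x"] by (cases "m = Suc b") (simp_all add: algebra_simps)
  have 5: "Ki b * (ti b * e (Suc b)) = qs (e (Suc b) * (Ki b * ti b))" if "m = Suc b"
  proof -
    have "ti b * e m = e m * ti b" using that step assms by (simp add: ti_e kapi_def)
    moreover have "Ki b * e m = qs (e m * Ki b)" using K_e(2)[of b m] that step assms by (simp add: kap_def kapi_def)
    ultimately show ?thesis using that by (metis mult.assoc qs_multl)
  qed
  show ?case using step
    by (simp add: Qm_step[OF b(1)] Qm_step[OF b(2)] algebra_simps 1 2 3 4 5)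
qed

lemma Qm_F:
  assumes "1 \<le> k" "k < n" "a \<in> {1..n}" "c \<in> {1..n}"
  shows "f k * Qm a c + (if a = Suc k then Ki k * Qm k c else 0) =
         kapi k c (Qm a c * f k) + (if c = k then Qm a (Suc k) else 0)"
proof -
  consider "a < c" | "c = k" "a = k" | "c = k" "Suc k \<le> a" | "c = Suc k" "c \<le> a"
    | "c \<noteq> k" "c \<noteq> Suc k" "c \<le> a" "a \<le> k \<and> c < k \<or> Suc k < c"
    | "c < k" "a = Suc k" | "c < k" "Suc (Suc k) \<le> a" using assms by force
  then show ?thesis
  proof cases
    case 1 then show ?thesis using assms by (auto simp: Qm_lt kapi_def)
  next
    case 2 then show ?thesis using assms by (auto simp: Qm_lt Qm_diag ti_f kap_def kapi_def)
  next
    case 3 then show ?thesis using f_Qm_low[of k a] assms by (auto simp: Qm_diag kapi_def)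
  next
    case 4 then show ?thesis using f_Qm_below[of k a] assms by (auto simp: Qm_lt kapi_def)
  next
    case 5 then show ?thesis using f_Qm_far[of c a k] assms by (auto simp: kapi_def)
  next
    case 6 then show ?thesis using f_Qm_top[of c k] assms by (auto simp: kapi_def)
  next
    case 7 then show ?thesis using f_Qm_mid[of c k a] assms by (auto simp: kapi_def)
  qed
qed

end

section \<open>Exchange relations\<close>

context uq_alg
begin

interpretation rfl: uq_alg cq ci cl n "\<lambda>i. f (n - i)" "\<lambda>i. e (n - i)" "\<lambda>i. t (Suc n - i)" "\<lambda>i. ti (Suc n - i)"
  by (rule reflect)

text \<open>The counterpart built from the \<open>f i\<close> is \<open>Qm\<close> for the reversed Dynkin diagram.\<close>

definition Pm where "Pm a b = rfl.Qm (Suc n - a) (Suc n - b)"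

lemma Pm_diag: "b \<in> {1..n} \<Longrightarrow> Pm b b = ti b"
  by (auto simp: Pm_def rfl.Qm_diag)
lemma Pm_gt: "a \<in> {1..n} \<Longrightarrow> b < a \<Longrightarrow> Pm a b = 0"
  by (auto simp: Pm_def rfl.Qm_lt)

lemma wt_Pm: "a \<in> {1..n} \<Longrightarrow> b \<in> {1..n} \<Longrightarrow> a \<le> b \<Longrightarrow> wt a b (Pm a b)"
proof -
  assume a: "a \<in> {1..n}" "b \<in> {1..n}" "a \<le> b"
  have w: "rfl.wt (Suc n - a) (Suc n - b) (Pm a b)"
    unfolding Pm_def by (rule rfl.wt_Qm) (use a in auto)
  show ?thesis unfolding wt_def
  proof
    fix i assume i: "i \<in> {1..n}"
    then have "Suc n - (Suc n - i) = i" "Suc n - i \<in> {1..n}" by auto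
    then have 1: "t i * Pm a b = wx (Suc n - i) (Suc n - a) (Suc n - b) (Pm a b * t i)"
      using w unfolding rfl.wt_def by (metis (no_types, lifting))
    have "Suc n - i = Suc n - b \<longleftrightarrow> i = b" "Suc n - i = Suc n - a \<longleftrightarrow> i = a" "Suc n - a = Suc n - b \<longleftrightarrow> a = b"
      using a i by auto
    then show "t i * Pm a b = wx i a b (Pm a b * t i)"
      unfolding 1 by (simp add: wx_def)
  qed
qed

lemma Pm_EF:
  assumes "1 \<le> k" "k < n" "a \<in> {1..n}" "c \<in> {1..n}"
  shows "kapi k a (f k * Pm a c) + (if a = Suc k then Pm k c else 0) =
         Pm a c * f k + (if c = k then Pm a (Suc k) * Ki k else 0)"
    and "e k * Pm a c + (if a = k then K k * Pm (Suc k) c else 0) =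
         kap k c (Pm a c * e k) + (if c = Suc k then Pm a k else 0)"
proof -
  have k: "1 \<le> n - k" "n - k < n" "n - (n - k) = k" "Suc n - (n - k) = Suc k" "Suc n - Suc (n - k) = k"
    "Suc n - a \<in> {1..n}" "Suc n - c \<in> {1..n}" "Suc (n - k) = Suc n - k" "n - k = Suc n - Suc k" using assms by auto
  have i: "k \<in> {1..n}" "Suc k \<in> {1..n}" using assms by auto
  have e: "Suc n - a = n - k \<longleftrightarrow> a = Suc k" "Suc n - a = Suc (n - k) \<longleftrightarrow> a = k"
     "Suc n - c = n - k \<longleftrightarrow> c = Suc k" "Suc n - c = Suc (n - k) \<longleftrightarrow> c = k"
    using assms by auto
  have K: "rfl.K (n - k) = Ki k" "rfl.Ki (n - k) = K k"
    using assms t_ti_comm[OF i(2) i(1)] t_ti_comm[OF i(1) i(2)]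
    by (simp_all add: rfl.K_def rfl.Ki_def K_def Ki_def k(3,4))
  have kk: "kap (n - k) (Suc n - a) x = kapi k a x" "kapi (n - k) (Suc n - c) x = kap k c x" for x
    unfolding kap_def kapi_def e by auto
  show "kapi k a (f k * Pm a c) + (if a = Suc k then Pm k c else 0) =
         Pm a c * f k + (if c = k then Pm a (Suc k) * Ki k else 0)"
    using rfl.Qm_E[OF k(1,2,6,7)] unfolding e kk K k(3) unfolding k(8) unfolding k(9) unfolding Pm_def .
  show "e k * Pm a c + (if a = k then K k * Pm (Suc k) c else 0) =
         kap k c (Pm a c * e k) + (if c = Suc k then Pm a k else 0)"
    using rfl.Qm_F[OF k(1,2,6,7)] unfolding e kk K k(3) unfolding k(8) unfolding k(9) unfolding Pm_def .
qed

end

text \<open>Only the following intertwining relations of the two triangular matrices are needed later; they are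
  stable under passage to the opposite ring.\<close>

locale rlm = torus_alg cq ci cl n e f t ti
  for cq ci cl :: "'r::ring_1" and n :: nat and e f t ti :: "nat \<Rightarrow> 'r" +
  fixes Q P :: "nat \<Rightarrow> nat \<Rightarrow> 'r"
  assumes Q_lt: "a \<in> {1..n} \<Longrightarrow> b \<in> {1..n} \<Longrightarrow> a < b \<Longrightarrow> Q a b = 0"
    and P_gt: "a \<in> {1..n} \<Longrightarrow> b \<in> {1..n} \<Longrightarrow> b < a \<Longrightarrow> P a b = 0"
    and Q_diag: "b \<in> {1..n} \<Longrightarrow> Q b b = ti b" and P_diag: "b \<in> {1..n} \<Longrightarrow> P b b = ti b"
    and Q_wt: "a \<in> {1..n} \<Longrightarrow> b \<in> {1..n} \<Longrightarrow> b \<le> a \<Longrightarrow> i \<in> {1..n} \<Longrightarrow> t i * Q a b = wx i a b (Q a b * t i)"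
    and P_wt: "a \<in> {1..n} \<Longrightarrow> b \<in> {1..n} \<Longrightarrow> a \<le> b \<Longrightarrow> i \<in> {1..n} \<Longrightarrow> t i * P a b = wx i a b (P a b * t i)"
    and Q_E: "1 \<le> k \<Longrightarrow> k < n \<Longrightarrow> a \<in> {1..n} \<Longrightarrow> c \<in> {1..n} \<Longrightarrow>
        kap k a (e k * Q a c) + (if a = k then Q (Suc k) c else 0) =
         Q a c * e k + (if c = Suc k then Q a k * (t k * ti (Suc k)) else 0)"
    and Q_F: "1 \<le> k \<Longrightarrow> k < n \<Longrightarrow> a \<in> {1..n} \<Longrightarrow> c \<in> {1..n} \<Longrightarrow>
         f k * Q a c + (if a = Suc k then ti k * t (Suc k) * Q k c else 0) =
         kapi k c (Q a c * f k) + (if c = k then Q a (Suc k) else 0)"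
    and P_E: "1 \<le> k \<Longrightarrow> k < n \<Longrightarrow> a \<in> {1..n} \<Longrightarrow> c \<in> {1..n} \<Longrightarrow>
         e k * P a c + (if a = k then t k * ti (Suc k) * P (Suc k) c else 0) =
         kap k c (P a c * e k) + (if c = Suc k then P a k else 0)"
    and P_F: "1 \<le> k \<Longrightarrow> k < n \<Longrightarrow> a \<in> {1..n} \<Longrightarrow> c \<in> {1..n} \<Longrightarrow>
        kapi k a (f k * P a c) + (if a = Suc k then P k c else 0) =
         P a c * f k + (if c = k then P a (Suc k) * (ti k * t (Suc k)) else 0)"
begin

text \<open>\<open>N\<close> transforms like a matrix under the quantum adjoint action; its upper left blocks yield the
  central elements of the subalgebras of lower rank.\<close>

definition N where "N a b = (\<Sum>c = 1..n. Q a c * P c b)"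

lemma kap_simps [simp]: "kap k a (x + y) = kap k a x + kap k a y" "kap k a (x - y) = kap k a x - kap k a y"
  "kap k a 0 = 0" "kap k a x * y = kap k a (x * y)" "x * kap k a y = kap k a (x * y)"
  "kap k a (kapi k a x) = x" "kapi k a (kap k a x) = x"
  "kapi k a (x + y) = kapi k a x + kapi k a y" "kapi k a (x - y) = kapi k a x - kapi k a y"
  "kapi k a 0 = 0" "kapi k a x * y = kapi k a (x * y)" "x * kapi k a y = kapi k a (x * y)"
  by (auto simp: kap_def kapi_def)

lemma kap_sum: "kap k a (sum g A) = (\<Sum>i\<in>A. kap k a (g i))"
  by (auto simp: kap_def qs_sum qi_sum)

lemma wt_Q: "a \<in> {1..n} \<Longrightarrow> b \<in> {1..n} \<Longrightarrow> wt a b (Q a b)"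
  by (cases "b \<le> a") (auto simp: wt_def Q_wt Q_lt wx_def)
lemma wt_P: "a \<in> {1..n} \<Longrightarrow> b \<in> {1..n} \<Longrightarrow> wt a b (P a b)"
  by (cases "a \<le> b") (auto simp: wt_def P_wt P_gt wx_def)
lemma wt_N: "a \<in> {1..n} \<Longrightarrow> b \<in> {1..n} \<Longrightarrow> wt a b (N a b)"
  unfolding N_def by (intro wt_sum wt_mult(1)[OF wt_Q wt_P]) auto

text \<open>\<open>Q\<close> passes from one coproduct of e_k to the other and \<open>P\<close>
  passes back, so the product commutes with a single one. In the sum over c, the term with K_k left
  by \<open>Q_E\<close> at c = k+1 cancels the one left by \<open>P_E\<close> at c = k.\<close>

lemma N_E:
  assumes k: "1 \<le> k" "k < n" and ab: "a \<in> {1..n}" "b \<in> {1..n}"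
  shows "kap k a (e k * N a b) + (if a = k then N (Suc k) b else 0) =
         kap k b (N a b * e k) + (if b = Suc k then N a k else 0)"
proof -
  have 1: "kap k a (e k * Q a c * P c b) + (if a = k then Q (Suc k) c * P c b else 0)
      + (if c = k then Q a k * (K k * P (Suc k) b) else 0)
    = Q a c * kap k b (P c b * e k) + (if b = Suc k then Q a c * P c k else 0)
      + (if c = Suc k then Q a k * (K k * P (Suc k) b) else 0)" if c: "c \<in> {1..n}" for c
  proof -
    have "kap k a (e k * Q a c * P c b) + (if a = k then Q (Suc k) c * P c b else 0)
      = (kap k a (e k * Q a c) + (if a = k then Q (Suc k) c else 0)) * P c b"
      by (auto simp: algebra_simps)
    also have "\<dots> = Q a c * (e k * P c b) + (if c = Suc k then Q a k * (K k * P (Suc k) b) else 0)"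
      by (subst Q_E[OF k ab(1) c]) (auto simp: algebra_simps K_def)
    also have "e k * P c b = kap k b (P c b * e k) + (if b = Suc k then P c k else 0)
          - (if c = k then t k * ti (Suc k) * P (Suc k) b else 0)"
      using P_E[OF k c ab(2)] by (simp add: algebra_simps)
    finally show ?thesis by (auto simp: algebra_simps K_def)
  qed
  have "(\<Sum>c=1..n. kap k a (e k * Q a c * P c b) + (if a = k then Q (Suc k) c * P c b else 0)
      + (if c = k then Q a k * (K k * P (Suc k) b) else 0))
    = (\<Sum>c=1..n. Q a c * kap k b (P c b * e k) + (if b = Suc k then Q a c * P c k else 0)
      + (if c = Suc k then Q a k * (K k * P (Suc k) b) else 0))"
    by (rule sum.cong) (use 1 in auto)
  then show ?thesis using k
    by (auto simp: N_def sum.distrib kap_sum sum_distrib_left sum_distrib_right mult.assoc)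
qed

lemma N_F:
  assumes k: "1 \<le> k" "k < n" and ab: "a \<in> {1..n}" "b \<in> {1..n}"
  shows "f k * N a b + (if a = Suc k then Ki k * N k b else 0) =
         N a b * f k + (if b = k then N a (Suc k) * Ki k else 0)"
proof -
  have 1: "f k * Q a c * P c b + (if a = Suc k then Ki k * (Q k c * P c b) else 0)
      + (if c = Suc k then Q a (Suc k) * P k b else 0)
    = Q a c * P c b * f k + (if b = k then Q a c * P c (Suc k) * Ki k else 0)
      + (if c = k then Q a (Suc k) * P k b else 0)" if c: "c \<in> {1..n}" for c
  proof -
    have "f k * Q a c * P c b + (if a = Suc k then Ki k * (Q k c * P c b) else 0)
      = (f k * Q a c + (if a = Suc k then ti k * t (Suc k) * Q k c else 0)) * P c b"
      by (auto simp: algebra_simps Ki_def)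
    also have "\<dots> = Q a c * kapi k c (f k * P c b) + (if c = k then Q a (Suc k) * P k b else 0)"
      by (subst Q_F[OF k ab(1) c]) (auto simp: algebra_simps)
    also have "kapi k c (f k * P c b) = P c b * f k + (if b = k then P c (Suc k) * (ti k * t (Suc k)) else 0)
          - (if c = Suc k then P k b else 0)"
      using P_F[OF k c ab(2)] by (simp add: algebra_simps)
    finally show ?thesis by (auto simp: algebra_simps Ki_def)
  qed
  have "(\<Sum>c=1..n. f k * Q a c * P c b + (if a = Suc k then Ki k * (Q k c * P c b) else 0)
      + (if c = Suc k then Q a (Suc k) * P k b else 0))
    = (\<Sum>c=1..n. Q a c * P c b * f k + (if b = k then Q a c * P c (Suc k) * Ki k else 0)
      + (if c = k then Q a (Suc k) * P k b else 0))"
    by (rule sum.cong) (use 1 in auto)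
  then show ?thesis using k
    by (auto simp: N_def sum.distrib kap_sum sum_distrib_left sum_distrib_right mult.assoc)
qed

lemma Q_step: "1 \<le> b \<Longrightarrow> b \<le> a \<Longrightarrow> a < n \<Longrightarrow> Q (Suc a) b = Q a b * e a - qs (e a * Q a b)"
  using Q_E[of a a b] by (auto simp: kap_def algebra_simps)
lemma P_step: "1 \<le> a \<Longrightarrow> a < b \<Longrightarrow> b \<le> n \<Longrightarrow> P a b = P (Suc a) b * f a - qs (f a * P (Suc a) b)"
  using P_F[of a "Suc a" b] by (auto simp: kapi_def algebra_simps)

text \<open>Columns of operators transforming under the subalgebra of rank \<open>k\<close> like the columns of \<open>N\<close>.\<close>

definition colop :: "nat \<Rightarrow> (nat \<Rightarrow> 'r) \<Rightarrow> bool" where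
  "colop k \<psi> \<longleftrightarrow>
     (\<forall>i a. 1 \<le> i \<and> i < k \<and> a \<in> {1..k} \<longrightarrow>
        kap i a (e i * \<psi> a) + (if a = i then \<psi> (Suc i) else 0) = \<psi> a * e i
      \<and> f i * \<psi> a + (if a = Suc i then Ki i * \<psi> i else 0) = \<psi> a * f i)
   \<and> (\<forall>i\<in>{1..k}. \<forall>a\<in>{1..k}. \<psi> a * t i = (if i = a then qs (t i * \<psi> a) else t i * \<psi> a))"

lemma colop_e: "colop k \<psi> \<Longrightarrow> 1 \<le> i \<Longrightarrow> i < k \<Longrightarrow> a \<in> {1..k} \<Longrightarrow>
    \<psi> a * e i = kap i a (e i * \<psi> a) + (if a = i then \<psi> (Suc i) else 0)"
  and colop_f: "colop k \<psi> \<Longrightarrow> 1 \<le> i \<Longrightarrow> i < k \<Longrightarrow> a \<in> {1..k} \<Longrightarrow>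
    \<psi> a * f i = f i * \<psi> a + (if a = Suc i then Ki i * \<psi> i else 0)"
  unfolding colop_def by metis+

lemma colop_N: "k < n \<Longrightarrow> colop k (\<lambda>a. N a (Suc k))"
  unfolding colop_def
proof (intro conjI allI impI ballI)
  fix i a assume "k < n" and i: "1 \<le> i \<and> i < k \<and> a \<in> {1..k}"
  then show "kap i a (e i * N a (Suc k)) + (if a = i then N (Suc i) (Suc k) else 0) = N a (Suc k) * e i"
    using N_E[of i a "Suc k"] by (auto simp: kap_def split: if_splits)
  show "f i * N a (Suc k) + (if a = Suc i then Ki i * N i (Suc k) else 0) = N a (Suc k) * f i"
    using N_F[of i a "Suc k"] i \<open>k < n\<close> by auto
next
  fix i a assume "k < n" "i \<in> {1..k}" "a \<in> {1..k}"
  then show "N a (Suc k) * t i = (if i = a then qs (t i * N a (Suc k)) else t i * N a (Suc k))"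
    using wt_t[OF wt_N[of a "Suc k"], of i] by (auto simp: wx_def)
qed

lemma colop_ti:
  assumes "colop k \<psi>" "k \<le> n" "i \<in> {1..k}" "a \<in> {1..k}"
  shows "\<psi> a * ti i = (if i = a then qi (ti i * \<psi> a) else ti i * \<psi> a)"
proof -
  have i: "i \<in> {1..n}" using assms by auto
  have "\<psi> a * t i = (if i = a then qs (t i * \<psi> a) else t i * \<psi> a)" using assms by (auto simp: colop_def)
  then have "ti i * (\<psi> a * t i) * ti i = ti i * (if i = a then qs (t i * \<psi> a) else t i * \<psi> a) * ti i" by simp
  moreover have "\<psi> a * t i * ti i = \<psi> a" by (simp add: mult.assoc t_ti[OF i])
  moreover have "ti i * (t i * x) = x" for x by (simp add: mult.assoc[symmetric] ti_t[OF i])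
  ultimately have "ti i * \<psi> a = (if i = a then qs (\<psi> a * ti i) else \<psi> a * ti i)"
    by (auto simp: mult.assoc split: if_splits)
  then show ?thesis by auto
qed

text \<open>The element is moved across the root vector letter by letter. Among the letters e_b,
  ..., e_(a-1) only e_(k-1) is affected by the index k, and it costs one factor q^-1.\<close>

lemma colop_Q:
  assumes "colop k \<psi>" "k \<le> n" "1 \<le> b" "b \<le> a" "a \<le> k"
  shows "\<psi> k * Q a b = (if a = k then qi (Q a b * \<psi> k) else Q a b * \<psi> k)"
  using assms(4,5)
proof (induction rule: dec_induct)
  case base then show ?case using colop_ti[OF assms(1,2), of b k] assms by (auto simp: Q_diag)
next
  case (step a)
  have 1: "\<psi> k * Q a b = Q a b * \<psi> k" using step by auto
  have 2: "\<psi> k * (Q a b * x) = Q a b * (\<psi> k * x)" for x by (metis 1 mult.assoc)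
  have s: "Q (Suc a) b = Q a b * e a - qs (e a * Q a b)" using step assms by (intro Q_step) auto
  have 3: "\<psi> k * e a = (if Suc a = k then qi (e a * \<psi> k) else e a * \<psi> k)"
    using colop_e[OF assms(1), of a k] step assms by (auto simp: kap_def)
  have 4: "\<psi> k * (e a * x) = (if Suc a = k then qi (e a * (\<psi> k * x)) else e a * (\<psi> k * x))" for x
    using arg_cong[OF 3, of "\<lambda>u. u * x"] by (auto simp: algebra_simps)
  show ?case unfolding s by (simp add: 1 2 3 4 algebra_simps)
qed

lemma colop_P_lt:
  assumes "colop k \<psi>" "k \<le> n" "1 \<le> a" "a \<le> b" "b < k"
  shows "\<psi> k * P a b = P a b * \<psi> k"
  using assms(4,3)
proof (induction rule: inc_induct)
  case base then show ?case using colop_ti[OF assms(1,2), of b k] assms by (auto simp: P_diag)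
next
  case (step a)
  have 1: "\<psi> k * P (Suc a) b = P (Suc a) b * \<psi> k" using step by auto
  have 2: "\<psi> k * (P (Suc a) b * x) = P (Suc a) b * (\<psi> k * x)" for x by (metis 1 mult.assoc)
  have s: "P a b = P (Suc a) b * f a - qs (f a * P (Suc a) b)" using step assms by (intro P_step) auto
  have 3: "\<psi> k * f a = f a * \<psi> k"
    using colop_f[OF assms(1), of a k] step assms by auto
  have 4: "\<psi> k * (f a * x) = f a * (\<psi> k * x)" for x by (metis 3 mult.assoc)
  show ?case unfolding s by (simp add: 1 2 3 4 algebra_simps)
qed

definition lam where "lam x = qs x - qi x"

lemma lam_simps [simp]: "lam (x + y) = lam x + lam y" "lam (x - y) = lam x - lam y" "lam 0 = 0"
  "lam x * y = lam (x * y)" "x * lam y = lam (x * y)" "qs (lam x) = lam (qs x)" "qi (lam x) = lam (qi x)"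
  by (simp_all add: lam_def algebra_simps)

lemma lam_sum: "lam (sum g A) = (\<Sum>i\<in>A. lam (g i))"
  by (simp add: lam_def qs_sum qi_sum sum_subtractf)

text \<open>In contrast to the e-letters, f_(k-1) turns part of the entry of index k into the one of
  index k-1, the letter f_(k-2) then reaches k-2, and so on. The sum collects these contributions,
  each with the factor q - q^-1.\<close>

lemma colop_P_eq:
  assumes "colop k \<psi>" "k \<le> n" "1 \<le> a" "a \<le> k"
  shows "\<psi> k * P a k = qi (P a k * \<psi> k) - lam (\<Sum>c=a..<k. P a c * \<psi> c)"
  using assms(4,3)
proof (induction rule: inc_induct)
  case base then show ?case using colop_ti[OF assms(1,2), of k k] assms by (auto simp: P_diag)
next
  case (step a)
  have i: "a \<in> {1..n}" "Suc a \<in> {1..n}" using step assms by auto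
  have s: "P a k = P (Suc a) k * f a - qs (f a * P (Suc a) k)" using step assms by (intro P_step) auto
  have IH: "\<psi> k * P (Suc a) k = qi (P (Suc a) k * \<psi> k) - lam (\<Sum>c=Suc a..<k. P (Suc a) c * \<psi> c)"
    using step by auto
  have IH': "\<psi> k * (P (Suc a) k * x) = qi (P (Suc a) k * (\<psi> k * x)) - lam ((\<Sum>c=Suc a..<k. P (Suc a) c * \<psi> c) * x)" for x
    using arg_cong[OF IH, of "\<lambda>u. u * x"] by (simp add: algebra_simps)
  have col: "\<psi> c * f a = f a * \<psi> c + (if c = Suc a then Ki a * \<psi> a else 0)" if "c \<in> {1..k}" for c
    using colop_f[OF assms(1), of a c] step that by auto
  have KiP: "P (Suc a) (Suc a) * (Ki a * x) = P a a * x" for x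
  proof -
    have "ti (Suc a) * Ki a = ti a"
      by (simp add: Ki_def t_ti_comm[OF i(2) i(1), symmetric] mult.assoc[symmetric] ti_t[OF i(2)])
    then show ?thesis using i by (simp add: P_diag mult.assoc[symmetric])
  qed
  show ?case
  proof (cases "Suc a = k")
    case True
    have 1: "\<psi> k * f a = f a * \<psi> k + Ki a * \<psi> a" using col[of k] step True by auto
    have 2: "\<psi> k * (f a * x) = f a * (\<psi> k * x) + Ki a * (\<psi> a * x)" for x
      using arg_cong[OF 1, of "\<lambda>u. u * x"] by (simp add: algebra_simps)
    have 3: "\<psi> a * P k k = P k k * \<psi> a" "\<psi> k * P k k = qi (P k k * \<psi> k)"
      using colop_ti[OF assms(1,2), of k a] colop_ti[OF assms(1,2), of k k] step assms i True by (auto simp: P_diag)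
    have 4: "\<psi> k * (P k k * x) = qi (P k k * (\<psi> k * x))" for x by (metis 3(2) mult.assoc qi_multl)
    have 5: "P k k * (Ki a * x) = P a a * x" "Ki a * (P k k * x) = P a a * x" for x
    proof -
      show A: "P k k * (Ki a * x) = P a a * x" for x using KiP[of x] True by simp
      have "Ki a * ti k = ti k * Ki a" using wt_ti[OF wt_K(2)[of a k], of k] step assms i True
        by (auto simp: wx_def)
      then have "P k k * Ki a = Ki a * P k k" using i True by (simp add: P_diag)
      then show "Ki a * (P k k * x) = P a a * x" using A by (metis mult.assoc)
    qed
    have s1: "{a..<k} = {a}" using True by auto
    show ?thesis unfolding s s1 using True
      by (simp add: 1 2 3 4 5 algebra_simps lam_def)
  next
    case False
    then have 1: "\<psi> k * f a = f a * \<psi> k" using col[of k] step assms by auto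
    have 2: "\<psi> k * (f a * x) = f a * (\<psi> k * x)" for x by (metis 1 mult.assoc)
    have ak: "Suc a < k" using False step by auto
    have P': "P (Suc a) c * f a - qs (f a * P (Suc a) c) = P a c" if "c \<in> {Suc a..<k}" for c
      using P_step[of a c] that step assms by auto
    have S: "(\<Sum>c=Suc a..<k. P (Suc a) c * \<psi> c) * f a - qs (f a * (\<Sum>c=Suc a..<k. P (Suc a) c * \<psi> c))
        = (\<Sum>c=a..<k. P a c * \<psi> c)"
    proof -
      have "(\<Sum>c=Suc a..<k. P (Suc a) c * \<psi> c) * f a - qs (f a * (\<Sum>c=Suc a..<k. P (Suc a) c * \<psi> c))
        = (\<Sum>c=Suc a..<k. P (Suc a) c * (\<psi> c * f a) - qs (f a * P (Suc a) c * \<psi> c))"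
        by (simp add: sum_distrib_left sum_distrib_right qs_sum sum_subtractf mult.assoc)
      also have "\<dots> = (\<Sum>c=Suc a..<k. P a c * \<psi> c + (if c = Suc a then P a a * \<psi> a else 0))"
      proof (rule sum.cong)
        fix c assume c: "c \<in> {Suc a..<k}"
        then have c': "c \<in> {1..k}" by auto
        show "P (Suc a) c * (\<psi> c * f a) - qs (f a * P (Suc a) c * \<psi> c) = P a c * \<psi> c + (if c = Suc a then P a a * \<psi> a else 0)"
          unfolding P'[OF c, symmetric] col[OF c'] by (auto simp: algebra_simps KiP)
      qed auto
      also have "\<dots> = (\<Sum>c=Suc a..<k. P a c * \<psi> c) + P a a * \<psi> a"
        using ak by (simp add: sum.distrib)
      also have "\<dots> = (\<Sum>c=a..<k. P a c * \<psi> c)"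
        using step by (simp add: sum.atLeast_Suc_lessThan)
      finally show ?thesis .
    qed
    have "\<psi> k * P a k = qi (P a k * \<psi> k) - lam ((\<Sum>c=Suc a..<k. P (Suc a) c * \<psi> c) * f a - qs (f a * (\<Sum>c=Suc a..<k. P (Suc a) c * \<psi> c)))"
      unfolding s by (simp add: 1 2 IH IH' algebra_simps)
    then show ?thesis unfolding S .
  qed
qed

lemma colop_N_lt:
  assumes c: "colop k \<psi>" "k \<le> n" and ab: "a \<in> {1..k}" "b \<in> {1..<k}"
  shows "\<psi> k * N a b = (if a = k then qi (N a b * \<psi> k) else N a b * \<psi> k)"
proof -
  have "\<psi> k * (Q a d * P d b) = (if a = k then qi (Q a d * P d b * \<psi> k) else Q a d * P d b * \<psi> k)" if d: "d \<in> {1..n}" for d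
  proof (cases "d \<le> a \<and> d \<le> b")
    case True
    have 1: "\<psi> k * Q a d = (if a = k then qi (Q a d * \<psi> k) else Q a d * \<psi> k)" 
      by (rule colop_Q[OF c]) (use True d ab in auto)
    have 2: "\<psi> k * P d b = P d b * \<psi> k"
      by (rule colop_P_lt[OF c]) (use True d ab in auto)
    have "\<psi> k * (Q a d * P d b) = (\<psi> k * Q a d) * P d b" by (simp add: mult.assoc)
    then show ?thesis unfolding 1 by (simp add: mult.assoc 2)
  next
    case False
    then show ?thesis using d ab c Q_lt[of a d] P_gt[of d b] by auto
  qed
  then show ?thesis by (auto simp: N_def sum_distrib_left sum_distrib_right qi_sum intro!: sum.cong)
qed

lemma colop_N_eq:
  assumes c: "colop k \<psi>" "k \<le> n" and a: "a \<in> {1..k}"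
  defines "u \<equiv> qi (N a k * \<psi> k) - lam (\<Sum>c=1..<k. N a c * \<psi> c)"
  shows "\<psi> k * N a k = (if a = k then qi u else u)"
proof -
  have "\<psi> k * (Q a d * P d k) = (if a = k then qi else id) (qi (Q a d * P d k * \<psi> k) - lam (\<Sum>c=1..<k. Q a d * P d c * \<psi> c))"
    if d: "d \<in> {1..n}" for d
  proof (cases "d \<le> a")
    case True
    have 1: "\<psi> k * Q a d = (if a = k then qi (Q a d * \<psi> k) else Q a d * \<psi> k)" 
      by (rule colop_Q[OF c]) (use True d a in auto)
    have 2: "\<psi> k * P d k = qi (P d k * \<psi> k) - lam (\<Sum>c=d..<k. P d c * \<psi> c)"
      by (rule colop_P_eq[OF c]) (use True d a in auto)
    \<comment> \<open>Triangularity of \<open>P\<close> frees the inner range from d, so that the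
      sums over c and d can be exchanged.\<close>
    have 3: "(\<Sum>c=d..<k. P d c * \<psi> c) = (\<Sum>c=1..<k. P d c * \<psi> c)"
      by (rule sum.mono_neutral_left) (use d c in \<open>auto simp: P_gt\<close>)
    have "\<psi> k * (Q a d * P d k) = (\<psi> k * Q a d) * P d k" by (simp add: mult.assoc)
    then show ?thesis unfolding 1
      by (simp add: mult.assoc 2 3 algebra_simps sum_distrib_left lam_sum qi_sum)
  next
    case False
    then show ?thesis using d a c Q_lt[of a d] by auto
  qed
  then have "\<psi> k * N a k = (\<Sum>d=1..n. (if a = k then qi else id) (qi (Q a d * P d k * \<psi> k) - lam (\<Sum>c=1..<k. Q a d * P d c * \<psi> c)))"
    by (auto simp: N_def sum_distrib_left intro!: sum.cong)
  also have "\<dots> = (if a = k then qi else id) (qi (\<Sum>d=1..n. Q a d * P d k * \<psi> k) - lam (\<Sum>d=1..n. \<Sum>c=1..<k. Q a d * P d c * \<psi> c))"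
    by (auto simp: qi_sum lam_sum sum_subtractf)
  also have "\<dots> = (if a = k then qi u else u)"
    unfolding u_def N_def sum_distrib_right by (subst sum.swap) auto
  finally show ?thesis .
qed


text \<open>Stated for an arbitrary closed set \<open>S\<close>, because it will serve both for
  commutants and for the copy of U_q(gl_m) inside the algebra.\<close>

lemma closed_N:
  assumes "k \<le> n" "0 \<in> S" "\<And>x y. x \<in> S \<Longrightarrow> y \<in> S \<Longrightarrow> x + y \<in> S" "\<And>x y. x \<in> S \<Longrightarrow> y \<in> S \<Longrightarrow> x - y \<in> S"
    "\<And>x y. x \<in> S \<Longrightarrow> y \<in> S \<Longrightarrow> x * y \<in> S" "\<And>x. x \<in> S \<Longrightarrow> qs x \<in> S"
    "\<And>i. 1 \<le> i \<Longrightarrow> i < k \<Longrightarrow> e i \<in> S" "\<And>i. 1 \<le> i \<Longrightarrow> i < k \<Longrightarrow> f i \<in> S" "\<And>i. i \<in> {1..k} \<Longrightarrow> ti i \<in> S"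
    and ab: "a \<in> {1..k}" "b \<in> {1..k}"
  shows "N a b \<in> S"
proof -
  have Q: "Q a c \<in> S" if "1 \<le> c" "c \<le> a" "a \<le> k" for a c
    using that(2,3)
  proof (induction rule: dec_induct)
    case base then show ?case using that assms by (simp add: Q_diag)
  next
    case (step a) then show ?case using that assms by (simp add: Q_step)
  qed
  have P: "P c b \<in> S" if "1 \<le> c" "c \<le> b" "b \<le> k" for b c
    using that(2,1)
  proof (induction rule: inc_induct)
    case base then show ?case using that assms by (simp add: P_diag)
  next
    case (step c) then show ?case using that assms by (simp add: P_step)
  qed
  have QP: "Q a c * P c b \<in> S" if "c \<in> {1..n}" for c
  proof (cases "c \<le> a \<and> c \<le> b")
    case True then show ?thesis using Q[of c a] P[of c b] that ab assms(5) by auto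
  next
    case False
    then have "Q a c * P c b = 0" using Q_lt[of a c] P_gt[of c b] that ab assms(1) by auto
    then show ?thesis using assms by simp
  qed
  have "(\<Sum>c\<in>C. Q a c * P c b) \<in> S" if "C \<subseteq> {1..n}" for C
  proof -
    have "finite C" using that finite_subset by blast
    then show ?thesis using that
      by (induction C rule: finite_induct) (use assms QP in auto)
  qed
  then show ?thesis by (auto simp: N_def)
qed

end

context uq_alg
begin

lemma rlm_QP: "rlm cq ci cl n e f t ti Qm Pm"
proof
  fix a b i assume "a \<in> {1..n}" "b \<in> {1..n}" "i \<in> {1..n}"
  then show "b \<le> a \<Longrightarrow> t i * Qm a b = wx i a b (Qm a b * t i)" "a \<le> b \<Longrightarrow> t i * Pm a b = wx i a b (Pm a b * t i)"
    using wt_t wt_Qm wt_Pm by auto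
qed (fact Qm_E[unfolded K_def] Qm_F[unfolded Ki_def] Pm_EF[unfolded K_def Ki_def] |
  (use Qm_lt Pm_gt Qm_diag Pm_diag in force))+

end

section \<open>Schur complements of the resolvent\<close>

lemma resolvent_commute:
  fixes M G D :: "nat \<Rightarrow> nat \<Rightarrow> 'r::ring_1"
  assumes fin: "finite I"
    and MG: "\<And>a b. a \<in> I \<Longrightarrow> b \<in> I \<Longrightarrow> (\<Sum>c\<in>I. M a c * G c b) = (if a = b then 1 else 0)"
    and GM: "\<And>a b. a \<in> I \<Longrightarrow> b \<in> I \<Longrightarrow> (\<Sum>c\<in>I. G a c * M c b) = (if a = b then 1 else 0)"
    and DM: "\<And>a b. a \<in> I \<Longrightarrow> b \<in> I \<Longrightarrow> (\<Sum>c\<in>I. D a c * M c b) = (\<Sum>c\<in>I. M a c * D c b)"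
    and ab: "a \<in> I" "b \<in> I"
  shows "(\<Sum>c\<in>I. D a c * G c b) = (\<Sum>c\<in>I. G a c * D c b)"
proof -
  have assoc: "(\<Sum>c\<in>I. (\<Sum>d\<in>I. A a d * B d c) * C c b) = (\<Sum>d\<in>I. A a d * (\<Sum>c\<in>I. B d c * C c b))"
    for A B C :: "nat \<Rightarrow> nat \<Rightarrow> 'r" and a b
    unfolding sum_distrib_left sum_distrib_right mult.assoc by (rule sum.swap)
  have "(\<Sum>c\<in>I. D a c * G c b) = (\<Sum>d\<in>I. (\<Sum>c\<in>I. G a c * M c d) * (\<Sum>c\<in>I. D d c * G c b))"
    using fin ab by (simp add: GM if_distrib[of "\<lambda>x. x * _"] cong: if_cong)
  also have "\<dots> = (\<Sum>c\<in>I. G a c * (\<Sum>d\<in>I. M c d * (\<Sum>c\<in>I. D d c * G c b)))"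
    by (rule assoc[where C = "\<lambda>d b. \<Sum>c\<in>I. D d c * G c b"])
  also have "\<dots> = (\<Sum>c\<in>I. G a c * (\<Sum>d\<in>I. D c d * (\<Sum>e\<in>I. M d e * G e b)))"
    by (rule sum.cong) (simp_all add: assoc[symmetric] DM)
  also have "\<dots> = (\<Sum>c\<in>I. G a c * D c b)"
    using fin ab by (intro sum.cong) (simp_all add: MG if_distrib[of "\<lambda>x. _ * x"] cong: if_cong)
  finally show ?thesis .
qed

text \<open>\<open>G k\<close> is the inverse of 1 - z N on the upper left block of size k. Both
  one-sided equations are required since the ring is not commutative. \<open>z\<close> is any
  central element, so that two different parameters and the opposite ring become instances.\<close>

locale resolvent = rlm cq ci cl n e f t ti Q P
  for cq ci cl :: "'r::ring_1" and n :: nat and e f t ti :: "nat \<Rightarrow> 'r" and Q P :: "nat \<Rightarrow> nat \<Rightarrow> 'r" +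
  fixes z :: 'r and G :: "nat \<Rightarrow> nat \<Rightarrow> nat \<Rightarrow> 'r"
  assumes z_central: "z * x = x * z"
    and G_left: "k \<le> n \<Longrightarrow> a \<in> {1..k} \<Longrightarrow> b \<in> {1..k} \<Longrightarrow>
       G k a b = (if a = b then 1 else 0) + z * (\<Sum>c=1..k. N a c * G k c b)"
    and G_right: "k \<le> n \<Longrightarrow> a \<in> {1..k} \<Longrightarrow> b \<in> {1..k} \<Longrightarrow>
       G k a b = (if a = b then 1 else 0) + z * (\<Sum>c=1..k. G k a c * N c b)"
begin

definition zs where "zs x = z * x"

lemma zs_add [simp]: "zs (x + y) = zs x + zs y" and zs_diff [simp]: "zs (x - y) = zs x - zs y"
  and zs_0 [simp]: "zs 0 = 0" and zs_minus [simp]: "zs (- x) = - zs x"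
  and zs_multl [simp]: "zs x * y = zs (x * y)"
  by (simp_all add: zs_def algebra_simps)

lemma zs_multr [simp]: "x * zs y = zs (x * y)"
  and qs_zs [simp]: "qs (zs x) = zs (qs x)" and qi_zs [simp]: "qi (zs x) = zs (qi x)"
  unfolding zs_def qs_def qi_def by (metis z_central mult.assoc)+

lemma lam_zs [simp]: "lam (zs x) = zs (lam x)"
  by (simp add: lam_def)

lemma zs_sum: "zs (sum g A) = (\<Sum>i\<in>A. zs (g i))"
  by (simp add: zs_def sum_distrib_left)

lemma kap_zs [simp]: "kapi k a (zs x) = zs (kapi k a x)"
  by (simp_all add: kap_def kapi_def)

lemma wt_zs: "wt a b x \<Longrightarrow> wt a b (zs x)"
  by (simp add: wt_def wx_def)

lemma G_l: "k \<le> n \<Longrightarrow> a \<in> {1..k} \<Longrightarrow> b \<in> {1..k} \<Longrightarrow>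
       G k a b = (if a = b then 1 else 0) + zs (\<Sum>c=1..k. N a c * G k c b)"
  and G_r: "k \<le> n \<Longrightarrow> a \<in> {1..k} \<Longrightarrow> b \<in> {1..k} \<Longrightarrow>
       G k a b = (if a = b then 1 else 0) + zs (\<Sum>c=1..k. G k a c * N c b)"
  unfolding zs_def by (fact G_left G_right)+

lemma G_commute:
  assumes k: "k \<le> n" and DN: "\<And>a b. a \<in> {1..k} \<Longrightarrow> b \<in> {1..k} \<Longrightarrow>
       (\<Sum>c=1..k. D a c * N c b) = (\<Sum>c=1..k. N a c * D c b)"
    and ab: "a \<in> {1..k}" "b \<in> {1..k}"
  shows "(\<Sum>c=1..k. D a c * G k c b) = (\<Sum>c=1..k. G k a c * D c b)"
proof -
  define M where "M a b = (if a = b then 1 else 0) - zs (N a b)" for a b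
  have sl: "(\<Sum>c=1..k. (if a = c then 1 else 0) * h c) = h a" if "a \<in> {1..k}" for a and h :: "nat \<Rightarrow> 'r"
    using that by (simp add: if_distrib[of "\<lambda>x. x * _"] cong: if_cong)
  have sr: "(\<Sum>c=1..k. h c * (if c = b then 1 else 0)) = h b" if "b \<in> {1..k}" for b and h :: "nat \<Rightarrow> 'r"
    using that by (simp add: if_distrib[of "\<lambda>x. _ * x"] cong: if_cong)
  show ?thesis
  proof (rule resolvent_commute[where M = M])
    fix a b assume ab: "a \<in> {1..k}" "b \<in> {1..k}"
    show "(\<Sum>c=1..k. M a c * G k c b) = (if a = b then 1 else 0)"
      unfolding M_def left_diff_distrib sum_subtractf sl[OF ab(1)]
      using G_l[OF k ab] by (simp add: zs_sum)
    show "(\<Sum>c=1..k. G k a c * M c b) = (if a = b then 1 else 0)"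
      unfolding M_def right_diff_distrib sum_subtractf sr[OF ab(2)]
      using G_r[OF k ab] by (simp add: zs_sum)
    show "(\<Sum>c=1..k. D a c * M c b) = (\<Sum>c=1..k. M a c * D c b)"
      unfolding M_def right_diff_distrib left_diff_distrib sum_subtractf sl[OF ab(1)] sr[OF ab(2)]
      using DN[OF ab] by (simp add: zs_sum[symmetric])
  qed (use ab in auto)
qed

lemma G_commute1:
  assumes "k \<le> n" "\<And>a b. a \<in> {1..k} \<Longrightarrow> b \<in> {1..k} \<Longrightarrow> y * N a b = N a b * y"
    "a \<in> {1..k}" "b \<in> {1..k}"
  shows "y * G k a b = G k a b * y"
  using G_commute[OF assms(1), where D = "\<lambda>a b. if a = b then y else 0"] assms
  by (simp add: if_distrib[of "\<lambda>x. x * _"] if_distrib[of "\<lambda>x. _ * x"] cong: if_cong)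

text \<open>\<open>N_E\<close> says that \<open>N\<close> commutes with a matrix of operators, the
  coproduct of e_i restricted to the block; therefore the resolvent commutes with it too.
  \<open>G_F\<close> and \<open>wt_G\<close> follow the same pattern.\<close>

lemma G_E:
  assumes k: "k \<le> n" "1 \<le> i" "i < k" and ab: "a \<in> {1..k}" "b \<in> {1..k}"
  shows "kap i a (e i * G k a b) + (if a = i then G k (Suc i) b else 0) =
         kap i b (G k a b * e i) + (if b = Suc i then G k a i else 0)"
proof -
  define D where "D a b = (if a = b then kap i a (e i) else 0) + (if a = i \<and> b = Suc i then 1 else 0)" for a b
  have l: "(\<Sum>c=1..k. D a c * h c) = kap i a (e i * h a) + (if a = i then h (Suc i) else 0)"
    if "a \<in> {1..k}" for a and h :: "nat \<Rightarrow> 'r"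
    using that k unfolding D_def
    by (auto simp: distrib_right sum.distrib if_distrib[of "\<lambda>x. x * _"] cong: if_cong)
  have r: "(\<Sum>c=1..k. h c * D c b) = kap i b (h b * e i) + (if b = Suc i then h i else 0)"
    if "b \<in> {1..k}" for b and h :: "nat \<Rightarrow> 'r"
    using that k unfolding D_def
    by (auto simp: distrib_left sum.distrib if_distrib[of "\<lambda>x. _ * x"] cong: if_cong)
  have "(\<Sum>c=1..k. D a c * G k c b) = (\<Sum>c=1..k. G k a c * D c b)"
  proof (rule G_commute[OF k(1) _ ab])
    fix a b assume "a \<in> {1..k}" "b \<in> {1..k}"
    then show "(\<Sum>c=1..k. D a c * N c b) = (\<Sum>c=1..k. N a c * D c b)"
      using k by (simp only: l r) (rule N_E, auto)
  qed
  then show ?thesis unfolding l[OF ab(1)] r[OF ab(2)] .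
qed

lemma G_F:
  assumes k: "k \<le> n" "1 \<le> i" "i < k" and ab: "a \<in> {1..k}" "b \<in> {1..k}"
  shows "f i * G k a b + (if a = Suc i then Ki i * G k i b else 0) =
         G k a b * f i + (if b = i then G k a (Suc i) * Ki i else 0)"
proof -
  define D where "D a b = (if a = b then f i else 0) + (if a = Suc i \<and> b = i then Ki i else 0)" for a b
  have l: "(\<Sum>c=1..k. D a c * h c) = f i * h a + (if a = Suc i then Ki i * h i else 0)"
    if "a \<in> {1..k}" for a and h :: "nat \<Rightarrow> 'r"
    using that k unfolding D_def
    by (auto simp: distrib_right sum.distrib if_distrib[of "\<lambda>x. x * _"] cong: if_cong)
  have r: "(\<Sum>c=1..k. h c * D c b) = h b * f i + (if b = i then h (Suc i) * Ki i else 0)"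
    if "b \<in> {1..k}" for b and h :: "nat \<Rightarrow> 'r"
    using that k unfolding D_def
    by (auto simp: distrib_left sum.distrib if_distrib[of "\<lambda>x. _ * x"] cong: if_cong)
  have "(\<Sum>c=1..k. D a c * G k c b) = (\<Sum>c=1..k. G k a c * D c b)"
  proof (rule G_commute[OF k(1) _ ab])
    fix a b assume "a \<in> {1..k}" "b \<in> {1..k}"
    then show "(\<Sum>c=1..k. D a c * N c b) = (\<Sum>c=1..k. N a c * D c b)"
      using k by (simp only: l r) (rule N_F, auto)
  qed
  then show ?thesis unfolding l[OF ab(1)] r[OF ab(2)] .
qed

lemma wt_G:
  assumes k: "k \<le> n" and ab: "a \<in> {1..k}" "b \<in> {1..k}"
  shows "wt a b (G k a b)"
  unfolding wt_def
proof
  fix i assume i: "i \<in> {1..n}"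
  define D where "D a b = (if a = b then (if a = i then qs (t i) else t i) else 0)" for a b
  have l: "(\<Sum>c=1..k. D a c * h c) = (if a = i then qs (t i * h a) else t i * h a)"
    if "a \<in> {1..k}" for a and h :: "nat \<Rightarrow> 'r"
    using that k unfolding D_def
    by (auto simp: if_distrib[of "\<lambda>x. x * _"] cong: if_cong)
  have r: "(\<Sum>c=1..k. h c * D c b) = (if b = i then qs (h b * t i) else h b * t i)"
    if "b \<in> {1..k}" for b and h :: "nat \<Rightarrow> 'r"
    using that k unfolding D_def
    by (auto simp: if_distrib[of "\<lambda>x. _ * x"] cong: if_cong)
  have "(\<Sum>c=1..k. D a c * G k c b) = (\<Sum>c=1..k. G k a c * D c b)"
  proof (rule G_commute[OF k(1) _ ab])
    fix a b assume ab: "a \<in> {1..k}" "b \<in> {1..k}"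
    then have "t i * N a b = wx i a b (N a b * t i)" using wt_t[OF wt_N i] k by auto
    then show "(\<Sum>c=1..k. D a c * N c b) = (\<Sum>c=1..k. N a c * D c b)"
      unfolding l[OF ab(1)] r[OF ab(2)] by (auto simp: wx_def)
  qed
  then have "(if a = i then qs (t i * G k a b) else t i * G k a b) = (if b = i then qs (G k a b * t i) else G k a b * t i)"
    unfolding l[OF ab(1)] r[OF ab(2)] .
  then show "t i * G k a b = wx i a b (G k a b * t i)"
    by (auto simp: wx_def split: if_splits) (metis qi_qs)
qed

text \<open>Uniqueness for a fixed point equation. The block formulas and the resolvent identity are
  proved by verifying such an equation instead of manipulating inverse matrices.\<close>

lemma solve_left:
  assumes k: "k \<le> n" and v: "\<And>a. a \<in> {1..k} \<Longrightarrow> v a = w a + zs (\<Sum>c=1..k. N a c * v c)" and a: "a \<in> {1..k}"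
  shows "v a = (\<Sum>b=1..k. G k a b * w b)"
proof -
  have "(\<Sum>b=1..k. G k a b * w b) = (\<Sum>b=1..k. G k a b * v b) - (\<Sum>b=1..k. zs (G k a b * (\<Sum>c=1..k. N b c * v c)))"
    unfolding sum_subtractf[symmetric]
  proof (rule sum.cong)
    fix b assume "b \<in> {1..k}"
    then have "w b = v b - zs (\<Sum>c=1..k. N b c * v c)" using v[of b] by simp
    then show "G k a b * w b = G k a b * v b - zs (G k a b * (\<Sum>c=1..k. N b c * v c))"
      by (simp add: right_diff_distrib)
  qed simp
  also have "(\<Sum>b=1..k. zs (G k a b * (\<Sum>c=1..k. N b c * v c))) = (\<Sum>c=1..k. zs (\<Sum>b=1..k. G k a b * N b c) * v c)"
    unfolding zs_sum sum_distrib_left sum_distrib_right by (subst sum.swap) (simp add: mult.assoc)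
  also have "\<dots> = (\<Sum>c=1..k. G k a c * v c - (if a = c then v c else 0))"
    using G_r[OF k a] by (intro sum.cong) (auto simp: algebra_simps)
  also have "\<dots> = (\<Sum>c=1..k. G k a c * v c) - v a" using a by (simp add: sum_subtractf)
  finally show ?thesis by simp
qed

lemma solve_right:
  assumes k: "k \<le> n" and v: "\<And>a. a \<in> {1..k} \<Longrightarrow> v a = w a + zs (\<Sum>c=1..k. v c * N c a)" and a: "a \<in> {1..k}"
  shows "v a = (\<Sum>b=1..k. w b * G k b a)"
proof -
  have "(\<Sum>b=1..k. w b * G k b a) = (\<Sum>b=1..k. v b * G k b a) - (\<Sum>b=1..k. zs ((\<Sum>c=1..k. v c * N c b) * G k b a))"
    unfolding sum_subtractf[symmetric]
  proof (rule sum.cong)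
    fix b assume "b \<in> {1..k}"
    then have "w b = v b - zs (\<Sum>c=1..k. v c * N c b)" using v[of b] by simp
    then show "w b * G k b a = v b * G k b a - zs ((\<Sum>c=1..k. v c * N c b) * G k b a)"
      by (simp add: left_diff_distrib)
  qed simp
  also have "(\<Sum>b=1..k. zs ((\<Sum>c=1..k. v c * N c b) * G k b a)) = (\<Sum>c=1..k. v c * zs (\<Sum>b=1..k. N c b * G k b a))"
    unfolding zs_sum sum_distrib_left sum_distrib_right by (subst sum.swap) (simp add: mult.assoc)
  also have "\<dots> = (\<Sum>c=1..k. v c * G k c a - (if c = a then v c else 0))"
    using G_l[OF k _ a] by (intro sum.cong) (auto simp: algebra_simps)
  also have "\<dots> = (\<Sum>c=1..k. v c * G k c a) - v a" using a by (simp add: sum_subtractf)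
  finally show ?thesis by simp
qed

text \<open>The off-diagonal column and row of the next larger block, multiplied by the resolvent of
  size k: the data of block elimination.\<close>

definition phi where "phi k a = (\<Sum>b=1..k. G k a b * N b (Suc k))"
definition rho where "rho k b = (\<Sum>a=1..k. N (Suc k) a * G k a b)"
text \<open>\<open>X m\<close> is a Schur complement of \<open>1 - z N\<close> and inverts the corner entry \<open>G m m m\<close> of the resolvent.\<close>

definition X where "X m = 1 - zs (N m m) - zs (zs (\<Sum>a=1..m-1. N m a * phi (m - 1) a))"

lemma X_rho: "X (Suc k) = 1 - zs (N (Suc k) (Suc k)) - zs (zs (\<Sum>b=1..k. rho k b * N b (Suc k)))"
  unfolding X_def phi_def rho_def by (simp add: sum_distrib_left sum_distrib_right mult.assoc) (subst sum.swap, rule refl)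

section \<open>Block inversion of the resolvent\<close>

context
  fixes k m :: nat
  assumes m: "m = Suc k" and mn: "m \<le> n"
begin

lemma G_lS: "a \<in> {1..m} \<Longrightarrow> b \<in> {1..m} \<Longrightarrow>
    G m a b = (if a = b then 1 else 0) + zs (\<Sum>c=1..k. N a c * G m c b) + zs (N a m * G m m b)"
  and G_rS: "a \<in> {1..m} \<Longrightarrow> b \<in> {1..m} \<Longrightarrow>
    G m a b = (if a = b then 1 else 0) + zs (\<Sum>c=1..k. G m a c * N c b) + zs (G m a m * N m b)"
  using G_l[of m a b] G_r[of m a b] m mn by (simp_all add: add.assoc)

lemma G_col: "a \<in> {1..k} \<Longrightarrow> G m a m = zs (phi k a * G m m m)"
proof -
  assume a: "a \<in> {1..k}"
  have "G m a m = (\<Sum>b=1..k. G k a b * zs (N b m * G m m m))"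
  proof (rule solve_left[where v = "\<lambda>a. G m a m", OF _ _ a])
    fix a assume "a \<in> {1..k}"
    then show "G m a m = zs (N a m * G m m m) + zs (\<Sum>c=1..k. N a c * G m c m)"
      by (subst G_lS) (use m in auto)
  qed (use m mn in auto)
  then show ?thesis by (simp add: phi_def m zs_sum sum_distrib_right mult.assoc)
qed

lemma G_row: "b \<in> {1..k} \<Longrightarrow> G m m b = zs (G m m m * rho k b)"
proof -
  assume b: "b \<in> {1..k}"
  have "G m m b = (\<Sum>a=1..k. zs (G m m m * N m a) * G k a b)"
  proof (rule solve_right[where v = "\<lambda>b. G m m b", OF _ _ b])
    fix b assume "b \<in> {1..k}"
    then show "G m m b = zs (G m m m * N m b) + zs (\<Sum>c=1..k. G m m c * N c b)"
      by (subst G_rS) (use m in auto)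
  qed (use m mn in auto)
  then show ?thesis by (simp add: rho_def m zs_sum sum_distrib_left mult.assoc)
qed

lemma G_block: "a \<in> {1..k} \<Longrightarrow> b \<in> {1..k} \<Longrightarrow> G m a b = G k a b + zs (phi k a * G m m b)"
proof -
  assume a: "a \<in> {1..k}" and b: "b \<in> {1..k}"
  have "G m a b = (\<Sum>c=1..k. G k a c * ((if c = b then 1 else 0) + zs (N c m * G m m b)))"
  proof (rule solve_left[where v = "\<lambda>a. G m a b", OF _ _ a])
    fix a assume "a \<in> {1..k}"
    then show "G m a b = (if a = b then 1 else 0) + zs (N a m * G m m b) + zs (\<Sum>c=1..k. N a c * G m c b)"
      by (subst G_lS) (use b m in auto)
  qed (use m mn in auto)
  also have "\<dots> = G k a b + (\<Sum>c=1..k. zs (G k a c * N c m * G m m b))"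
    using b by (simp add: distrib_left sum.distrib if_distrib[of "\<lambda>x. _ * x"] mult.assoc cong: if_cong)
  finally show ?thesis by (simp add: phi_def m zs_sum sum_distrib_right mult.assoc)
qed

lemma X_G: "X m * G m m m = 1"
proof -
  have "G m m m = 1 + zs (N m m * G m m m) + zs (\<Sum>c=1..k. N m c * G m c m)"
    using G_l[of m m m] mn m by (simp add: algebra_simps)
  also have "(\<Sum>c=1..k. N m c * G m c m) = zs (\<Sum>c=1..k. N m c * phi k c) * G m m m"
    by (simp add: G_col zs_sum sum_distrib_right mult.assoc)
  finally show ?thesis unfolding X_def m by (simp add: algebra_simps)
qed

lemma G_X: "G m m m * X m = 1"
proof -
  have "G m m m = 1 + zs (G m m m * N m m) + zs (\<Sum>c=1..k. G m m c * N c m)"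
    using G_r[of m m m] mn m by (simp add: algebra_simps)
  also have "(\<Sum>c=1..k. G m m c * N c m) = G m m m * zs (\<Sum>c=1..k. rho k c * N c m)"
    by (simp add: G_row zs_sum sum_distrib_left mult.assoc)
  finally show ?thesis unfolding X_rho m by (simp add: algebra_simps)
qed

end

lemma inverse_commute: "y * g = g * y \<Longrightarrow> x * g = 1 \<Longrightarrow> g * x = 1 \<Longrightarrow> y * x = x * y" for x y g :: 'r
  by (metis mult.assoc mult_1_left mult_1_right)

lemma X_G_inv: "m \<in> {1..n} \<Longrightarrow> X m * G m m m = 1" "m \<in> {1..n} \<Longrightarrow> G m m m * X m = 1"
  using X_G[of m "m - 1"] G_X[of m "m - 1"] by auto

lemma wt_phi: "k < n \<Longrightarrow> a \<in> {1..k} \<Longrightarrow> wt a (Suc k) (phi k a)"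
  unfolding phi_def by (intro wt_sum wt_mult(1)[OF wt_G wt_N]) auto

lemma wt_one: "wt a a 1" by (simp add: wt_def wx_def)

lemma wt_X: "m \<in> {1..n} \<Longrightarrow> wt m m (X m)"
  unfolding X_def
proof (intro wt_diff wt_one wt_zs wt_N wt_sum)
  fix a assume "m \<in> {1..n}" "a \<in> {1..m - 1}"
  then show "wt m m (N m a * phi (m - 1) a)"
    using wt_mult(1)[OF wt_N[of m a] wt_phi[of "m - 1" a]] by auto
qed auto

lemma X_t: "m \<in> {1..n} \<Longrightarrow> i \<in> {1..n} \<Longrightarrow> t i * X m = X m * t i"
  and X_ti: "m \<in> {1..n} \<Longrightarrow> i \<in> {1..n} \<Longrightarrow> ti i * X m = X m * ti i"
  using wt_t[OF wt_X] wt_ti'[OF wt_X] by (auto simp: wx_def)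

lemma X_K: "m \<in> {1..n} \<Longrightarrow> 1 \<le> i \<Longrightarrow> i < n \<Longrightarrow> K i * X m = X m * K i"
  using K_wt(1)[OF wt_X] by (auto simp: kap_def kapi_def)

lemma X_commute1:
  assumes m: "m \<in> {1..n}" and y: "\<And>a b. a \<in> {1..m} \<Longrightarrow> b \<in> {1..m} \<Longrightarrow> y * N a b = N a b * y"
  shows "y * X m = X m * y"
proof -
  define j where "j = m - 1"
  have XD: "X m = 1 - zs (N m m) - zs (zs (\<Sum>a=1..j. N m a * phi j a))"
    unfolding X_def j_def ..
  have jm: "j < m" using m by (auto simp: j_def)
  have G: "y * G j a b = G j a b * y" if "a \<in> {1..j}" "b \<in> {1..j}" for a b
    by (rule G_commute1) (use that m y jm in auto)
  have N: "y * (N a b * x) = N a b * (y * x)" if "a \<in> {1..m}" "b \<in> {1..m}" for a b x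
    using y[OF that] by (metis mult.assoc)
  have G': "y * (G j a b * x) = G j a b * (y * x)" if "a \<in> {1..j}" "b \<in> {1..j}" for a b x
    using G[OF that] by (metis mult.assoc)
  have "y * (N m a * phi j a) = N m a * phi j a * y" if "a \<in> {1..j}" for a
    using that m jm unfolding phi_def
    by (auto simp: sum_distrib_left sum_distrib_right mult.assoc N G' y intro!: sum.cong)
  then have "y * (\<Sum>a=1..j. N m a * phi j a) = (\<Sum>a=1..j. N m a * phi j a) * y"
    by (auto simp: sum_distrib_left sum_distrib_right intro!: sum.cong)
  then show ?thesis using y[of m m] m by (simp add: XD algebra_simps)
qed

text \<open>For i+1 < m the corrections in \<open>G_E\<close> do not touch the corner (m, m), and
  \<open>X m\<close> is the inverse of that corner entry. For i > m there is a different reason: e_i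
  commutes with every entry of the block.\<close>

lemma X_e_low: "m \<in> {1..n} \<Longrightarrow> 1 \<le> i \<Longrightarrow> Suc i < m \<Longrightarrow> e i * X m = X m * e i"
  by (rule inverse_commute[OF _ X_G_inv]) (use G_E[of m i m m] in \<open>auto simp: kap_def\<close>)
lemma X_f_low: "m \<in> {1..n} \<Longrightarrow> 1 \<le> i \<Longrightarrow> Suc i < m \<Longrightarrow> f i * X m = X m * f i"
  by (rule inverse_commute[OF _ X_G_inv]) (use G_F[of m i m m] in auto)
lemma X_e_high: "m \<in> {1..n} \<Longrightarrow> m < i \<Longrightarrow> i < n \<Longrightarrow> e i * X m = X m * e i"
proof (rule X_commute1)
  fix a b assume "m < i" "i < n" "a \<in> {1..m}" "b \<in> {1..m}"
  then show "e i * N a b = N a b * e i" using N_E[of i a b] by (auto simp: kap_def)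
qed
lemma X_f_high: "m \<in> {1..n} \<Longrightarrow> m < i \<Longrightarrow> i < n \<Longrightarrow> f i * X m = X m * f i"
proof (rule X_commute1)
  fix a b assume "m < i" "i < n" "a \<in> {1..m}" "b \<in> {1..m}"
  then show "f i * N a b = N a b * f i" using N_F[of i a b] by auto
qed

text \<open>The bottom row of the resolvent has its corner entry as a common left factor, see
  \<open>G_row\<close>, and \<open>X k\<close> cancels it.\<close>

lemma X_phi:
  assumes k: "1 \<le> k" and \<psi>: "k \<le> n"
  shows "X k * (\<Sum>b=1..k. G k k b * \<psi> b) = \<psi> k + zs (\<Sum>b=1..k-1. rho (k - 1) b * \<psi> b)"
proof -
  obtain j where j: "k = Suc j" using k by (cases k) auto
  have "(\<Sum>b=1..k. G k k b * \<psi> b) = G k k k * (\<psi> k + zs (\<Sum>b=1..j. rho j b * \<psi> b))"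
    using G_row[OF j \<psi>] by (simp add: j algebra_simps sum_distrib_left zs_sum)
  then show ?thesis using X_G[OF j \<psi>] by (simp add: j mult.assoc[symmetric])
qed

section \<open>Exchange relations of two consecutive Schur complements with e_k and f_k\<close>

context
  fixes k :: nat
  assumes k: "1 \<le> k" "k < n"
begin

text \<open>The factor K_k absorbs the inverse torus element in the column correction of
  \<open>N_F\<close>.\<close>

abbreviation F where "F \<equiv> f k * K k"

lemma kn: "k \<in> {1..n}" "Suc k \<in> {1..n}" using k by auto

lemma F_N_lt: "a \<in> {1..<k} \<Longrightarrow> b \<in> {1..<k} \<Longrightarrow> F * N a b = N a b * F"
proof -
  assume a: "a \<in> {1..<k}" and b: "b \<in> {1..<k}"
  then have "f k * N a b = N a b * f k" "K k * N a b = N a b * K k"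
    using N_F[of k a b] K_wt(1)[OF wt_N[of a b], of k] k by (auto simp: kap_def kapi_def)
  then show ?thesis by (metis mult.assoc)
qed

lemma F_N_row: "b \<in> {1..<k} \<Longrightarrow> F * N k b = qi (N k b * F)"
proof -
  assume b: "b \<in> {1..<k}"
  then have "f k * N k b = N k b * f k" "K k * N k b = qi (N k b * K k)"
    using N_F[of k k b] K_wt(1)[OF wt_N[of k b], of k] k by (auto simp: kap_def kapi_def)
  then show ?thesis by (metis mult.assoc qi_multr)
qed

lemma F_N_col: "a \<in> {1..<k} \<Longrightarrow> F * N a k = qs (N a k * F) + qs (N a (Suc k))"
proof -
  assume a: "a \<in> {1..<k}"
  then have 1: "f k * N a k = N a k * f k + N a (Suc k) * Ki k" "K k * N a k = qs (N a k * K k)"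
    using N_F[of k a k] K_wt(1)[OF wt_N[of a k], of k] k by (auto simp: kap_def kapi_def)
  have "F * N a k = qs (f k * N a k * K k)" by (simp add: mult.assoc 1(2))
  then show ?thesis unfolding 1(1) using Ki_K[OF k] by (simp add: algebra_simps)
qed

lemma F_N_diag: "F * N k k = N k k * F + N k (Suc k)"
proof -
  have 1: "f k * N k k = N k k * f k + N k (Suc k) * Ki k" "K k * N k k = N k k * K k"
    using N_F[of k k k] K_wt(1)[OF wt_N[of k k], of k] k by (auto simp: kap_def kapi_def)
  have "F * N k k = f k * N k k * K k" by (simp add: mult.assoc 1(2))
  then show ?thesis unfolding 1(1) using Ki_K[OF k] by (simp add: algebra_simps)
qed

text \<open>\<open>F\<close> rescales row k of \<open>N\<close> by q^-1 and column k by q, apart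
  from adding q times column k+1. The factors cancel in the Schur complement, and what remains is
  the same expression with the last column replaced by column k+1, which \<open>X_phi\<close>
  identifies.\<close>

lemma X_F: "X k * F - F * X k = zs (X k * phi k k)"
proof -
  define j where "j = k - 1"
  have XD: "X k = 1 - zs (N k k) - zs (zs (\<Sum>a=1..j. N k a * phi j a))"
    unfolding X_def j_def ..
  define g where "g = F"
  have gN: "b \<in> {1..<k} \<Longrightarrow> g * N k b = qi (N k b * g)" "b \<in> {1..<k} \<Longrightarrow> g * N b k = qs (N b k * g) + qs (N b (Suc k))"
     "g * N k k = N k k * g + N k (Suc k)" "a \<in> {1..<k} \<Longrightarrow> b \<in> {1..<k} \<Longrightarrow> g * N a b = N a b * g" for a b
    using F_N_row F_N_col F_N_diag F_N_lt by (simp_all only: g_def)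
  have Sj: "Suc j = k" using k by (auto simp: j_def)
  have phiD: "phi j a = (\<Sum>b=1..j. G j a b * N b k)" and rhoD: "rho j a = (\<Sum>b=1..j. N k b * G j b a)" for a
    by (simp_all add: phi_def rho_def Sj)
  have jk: "j < k" using k by (auto simp: j_def)
  have G: "g * G j a b = G j a b * g" if "a \<in> {1..j}" "b \<in> {1..j}" for a b
    by (rule G_commute1) (use that k gN(4) jk in auto)
  have G': "g * (G j a b * x) = G j a b * (g * x)" if "a \<in> {1..j}" "b \<in> {1..j}" for a b x
    using G[OF that] by (metis mult.assoc)
  have R: "g * (N k a * x) = qi (N k a * (g * x))" if "a \<in> {1..j}" for a x
    using gN(1)[of a] that jk by (auto simp flip: mult.assoc)
  have "g * (\<Sum>a=1..j. N k a * phi j a) = (\<Sum>a=1..j. N k a * phi j a) * g + (\<Sum>a=1..j. \<Sum>b=1..j. N k a * G j a b * N b (Suc k))"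
  proof -
    have "g * (N k a * (G j a b * N b k)) = N k a * (G j a b * N b k) * g + N k a * G j a b * N b (Suc k)"
      if "a \<in> {1..j}" "b \<in> {1..j}" for a b
      using that gN(2)[of b] jk by (simp add: R G' algebra_simps)
    then show ?thesis using k jk unfolding phiD
      by (simp add: sum_distrib_left sum_distrib_right sum.distrib flip: mult.assoc)
  qed
  also have "(\<Sum>a=1..j. \<Sum>b=1..j. N k a * G j a b * N b (Suc k)) = (\<Sum>b=1..j. rho j b * N b (Suc k))"
    unfolding rhoD using k jk by (subst sum.swap) (simp add: sum_distrib_right)
  finally have "X k * g - g * X k = zs (N k (Suc k) + zs (\<Sum>b=1..j. rho j b * N b (Suc k)))"
    unfolding XD using gN(3) by (simp add: algebra_simps)
  also have "\<dots> = zs (X k * phi k k)"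
    unfolding phi_def using X_phi[of k "\<lambda>b. N b (Suc k)"] k j_def by simp
  finally show ?thesis unfolding g_def .
qed

text \<open>\<open>G_F\<close> at the corner of the block of size k+1 has a single correction, the
  entry above the corner, and \<open>G_col\<close> factors it through the corner. Multiplying by the
  inverse of the corner on both sides gives the claim.\<close>

lemma F_X_Suc: "F * X (Suc k) = X (Suc k) * (F + qs (qs (zs (phi k k))))"
proof -
  define g where "g = G (Suc k) (Suc k) (Suc k)"
  define y where "y = X (Suc k)"
  have yg: "y * g = 1" "g * y = 1" using X_G_inv[OF kn(2)] by (auto simp: y_def g_def)
  have "f k * g + Ki k * zs (phi k k * g) = g * f k"
    using G_F[of "Suc k" k "Suc k" "Suc k"] G_col[of "Suc k" k k] k by (simp add: g_def)
  then have "y * (f k * g + Ki k * zs (phi k k * g)) * y = y * (g * f k) * y" by simp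
  then have 1: "f k * y = y * f k + y * zs (Ki k * phi k k)"
    by (simp add: algebra_simps yg) (simp add: yg flip: mult.assoc)
  have 2: "y * K k = K k * y" using X_K[OF kn(2) k] by (simp add: y_def)
  have "K k * phi k k = qi (qi (phi k k * K k))"
    using K_wt(1)[OF wt_phi[of k k], of k] k by (simp add: kap_def kapi_def)
  then have "phi k k * K k = qs (qs (K k * phi k k))" by simp
  then have 3: "Ki k * phi k k * K k = qs (qs (phi k k))"
    using Ki_K[OF k] by (simp add: mult.assoc) (simp flip: mult.assoc)
  have "F * y = f k * y * K k" by (simp add: mult.assoc 2)
  also have "\<dots> = y * F + zs (y * (Ki k * phi k k * K k))"
    unfolding 1 by (simp add: algebra_simps)
  finally show ?thesis unfolding 3 y_def[symmetric] by (simp add: algebra_simps)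
qed

text \<open>\<open>G_E\<close> in position (k, k+1) of the block of size k+1 compares the corner
  \<open>g\<close> of that block with the corner \<open>w\<close> of the block of size k. Expressing
  the remaining entries through \<open>p\<close> and \<open>g\<close> gives w = (1 - q^-1 p e + q e
  p) g.\<close>

lemma X_Suc: "X (Suc k) = X k * (1 - qi (zs (phi k k * e k)) + qs (e k * zs (phi k k)))"
proof -
  define g where "g = G (Suc k) (Suc k) (Suc k)"
  define w where "w = G k k k"
  define p where "p = zs (phi k k)"
  have yg: "X (Suc k) * g = 1" "g * X (Suc k) = 1" using X_G_inv[OF kn(2)] by (auto simp: g_def)
  have xw: "X k * w = 1" using X_G_inv[OF kn(1)] by (auto simp: w_def)
  have 1: "G (Suc k) k (Suc k) = p * g" using G_col[of "Suc k" k k] k by (simp add: g_def p_def)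
  have 2: "G (Suc k) k k = w + p * G (Suc k) (Suc k) k" using G_block[of "Suc k" k k k] k by (simp add: p_def w_def)
  have 3: "G (Suc k) (Suc k) k = qi (e k * g) - qi (g * e k)"
    using G_E[of "Suc k" k "Suc k" "Suc k"] k by (simp add: g_def kap_def algebra_simps)
  have "qs (e k * (p * g)) + g = qi (p * g * e k) + (w + p * (qi (e k * g) - qi (g * e k)))"
    using G_E[of "Suc k" k k "Suc k"] k unfolding 1 2 3 by (simp add: g_def kap_def)
  then have "w = (1 - qi (p * e k) + qs (e k * p)) * g"
    by (simp add: algebra_simps)
  then have "w * X (Suc k) = 1 - qi (p * e k) + qs (e k * p)"
    using yg by (simp add: mult.assoc)
  then have "X k * w * X (Suc k) = X k * (1 - qi (p * e k) + qs (e k * p))" by (simp add: mult.assoc)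
  then show ?thesis by (simp add: xw p_def)
qed

end

text \<open>The Schur complement is expanded in entries of \<open>N\<close>, and the k-th entry of
  the column is pushed through each of them. The terms with q - q^-1, which arise in the last column
  of \<open>N\<close> only, reassemble by means of rho = N + z rho N into the expression of
  \<open>X_phi\<close>.\<close>

lemma colop_X:
  assumes c: "colop k \<psi>" and k: "1 \<le> k" "k \<le> n"
  shows "lam (X k * (\<Sum>b=1..k. G k k b * \<psi> b)) = qs (\<psi> k * X k) - qi (X k * \<psi> k)"
proof -
  define j where "j = k - 1"
  have XD: "X k = 1 - zs (N k k) - zs (zs (\<Sum>a=1..j. N k a * phi j a))"
    unfolding X_def j_def ..
  have Sj: "Suc j = k" using k by (auto simp: j_def)
  have phiD: "phi j a = (\<Sum>b=1..j. G j a b * N b k)" and rhoD: "rho j a = (\<Sum>b=1..j. N k b * G j b a)" for a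
    by (simp_all add: phi_def rho_def Sj)
  have jk: "j < k" using k by (auto simp: j_def)
  have jn: "j \<le> n" using k jk by simp
  have X_phi': "X k * (\<Sum>b=1..k. G k k b * \<psi> b) = \<psi> k + zs (\<Sum>b=1..j. rho j b * \<psi> b)"
    unfolding j_def by (rule X_phi[OF k])
  let ?p = "\<psi> k"
  have G: "?p * G j a b = G j a b * ?p" if "a \<in> {1..j}" "b \<in> {1..j}" for a b
    by (rule G_commute1) (use that k jk colop_N_lt[OF c] in auto)
  have G': "?p * (G j a b * x) = G j a b * (?p * x)" if "a \<in> {1..j}" "b \<in> {1..j}" for a b x
    using G[OF that] by (metis mult.assoc)
  have R: "?p * (N k a * x) = qi (N k a * (?p * x))" if "a \<in> {1..j}" for a x
    using colop_N_lt[OF c, of k a] that k jk by (auto simp flip: mult.assoc)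
  have iv: "{1..<k} = {1..j}" using k j_def by auto
  have C: "?p * N b k = qi (N b k * ?p) - lam (\<Sum>c=1..j. N b c * \<psi> c)" if "b \<in> {1..j}" for b
    using colop_N_eq[OF c, of b] that k jk unfolding iv by auto
  have D: "?p * N k k = qi (qi (N k k * ?p)) - lam (qi (\<Sum>c=1..j. N k c * \<psi> c))"
    using colop_N_eq[OF c, of k] k unfolding iv by auto
  have S: "rho j b = N k b + zs (\<Sum>c=1..j. rho j c * N c b)" if "b \<in> {1..j}" for b
  proof -
    have "rho j b = (\<Sum>a=1..j. N k a * ((if a = b then 1 else 0) + zs (\<Sum>c=1..j. G j a c * N c b)))"
      unfolding rhoD using k that by (intro sum.cong) (simp_all add: G_r[OF jn _ that])
    also have "\<dots> = N k b + zs (\<Sum>a=1..j. \<Sum>c=1..j. N k a * G j a c * N c b)"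
      using that by (simp add: distrib_left sum.distrib if_distrib[of "\<lambda>x. _ * x"] zs_sum sum_distrib_left mult.assoc cong: if_cong)
    also have "(\<Sum>a=1..j. \<Sum>c=1..j. N k a * G j a c * N c b) = (\<Sum>c=1..j. rho j c * N c b)"
      unfolding rhoD using k jk by (subst sum.swap) (simp add: sum_distrib_right)
    finally show ?thesis .
  qed
  define T where "T = (\<Sum>a=1..j. N k a * phi j a)"
  define U where "U = (\<Sum>c=1..j. N k c * \<psi> c)"
  define W where "W = (\<Sum>b=1..j. rho j b * (\<Sum>c=1..j. N b c * \<psi> c))"
  have RU: "(\<Sum>b=1..j. rho j b * \<psi> b) = U + zs W"
  proof -
    have "(\<Sum>b=1..j. rho j b * \<psi> b) = U + (\<Sum>b=1..j. zs (\<Sum>c=1..j. rho j c * N c b) * \<psi> b)"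
      unfolding U_def sum.distrib[symmetric] by (rule sum.cong) (simp_all add: S distrib_right[symmetric] del: zs_multl)
    also have "(\<Sum>b=1..j. zs (\<Sum>c=1..j. rho j c * N c b) * \<psi> b) = zs W"
      unfolding W_def by (simp add: zs_sum sum_distrib_left sum_distrib_right mult.assoc) (rule sum.swap)
    finally show ?thesis .
  qed
  have TT: "T = (\<Sum>a=1..j. \<Sum>b=1..j. N k a * (G j a b * N b k))"
    unfolding T_def phiD using k jk by (simp add: sum_distrib_left)
  have WW: "W = (\<Sum>a=1..j. \<Sum>b=1..j. N k a * (G j a b * (\<Sum>c=1..j. N b c * \<psi> c)))"
    unfolding W_def rhoD using k jk
    by (simp add: sum_distrib_right mult.assoc) (rule sum.swap)
  have pT: "?p * T = qi (qi (T * ?p)) - lam (qi W)"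
  proof -
    have "?p * (N k a * (G j a b * N b k)) = qi (qi (N k a * (G j a b * N b k) * ?p)) 
        - lam (qi (N k a * (G j a b * (\<Sum>c=1..j. N b c * \<psi> c))))" if "a \<in> {1..j}" "b \<in> {1..j}" for a b
      using that by (simp add: R G' C algebra_simps)
    then show ?thesis unfolding TT WW
      by (simp add: sum_distrib_left sum_distrib_right qi_sum lam_sum sum_subtractf)
  qed
  have "qs (?p * X k) - qi (X k * ?p) = lam (?p + zs (U + zs W))"
    unfolding XD T_def[symmetric] by (simp add: D[folded U_def] pT lam_def algebra_simps)
  then show ?thesis unfolding X_phi' RU by simp
qed

text \<open>The resolvent commutes with the coproducts, so it maps such columns to such columns.
  This makes \<open>colop_X\<close> applicable to \<open>phi\<close>, which is itself a resolvent
  applied to a column of \<open>N\<close>.\<close>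

lemma colop_G:
  assumes c: "colop k \<psi>" and k: "k \<le> n"
  shows "colop k (\<lambda>a. \<Sum>b=1..k. G k a b * \<psi> b)"
proof -
  { fix i a assume i: "1 \<le> i" "i < k" and a: "a \<in> {1..k}"
    have 1: "kap i a (e i * (G k a b * \<psi> b)) + (if a = i then G k (Suc i) b * \<psi> b else 0) + (if b = i then G k a i * \<psi> (Suc i) else 0) =
        G k a b * \<psi> b * e i + (if b = Suc i then G k a i * \<psi> (Suc i) else 0)" if b: "b \<in> {1..k}" for b
    proof -
      have "kap i a (e i * (G k a b * \<psi> b)) + (if a = i then G k (Suc i) b * \<psi> b else 0) =
        (kap i a (e i * G k a b) + (if a = i then G k (Suc i) b else 0)) * \<psi> b"
        by (auto simp: algebra_simps)
      also have "\<dots> = G k a b * kap i b (e i * \<psi> b) + (if b = Suc i then G k a i * \<psi> (Suc i) else 0)"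
        unfolding G_E[OF k i a b] by (auto simp: algebra_simps)
      also have "kap i b (e i * \<psi> b) = \<psi> b * e i - (if b = i then \<psi> (Suc i) else 0)"
        using colop_e[OF c i b] by simp
      finally show ?thesis by (auto simp: algebra_simps)
    qed
    have "kap i a (e i * (\<Sum>b=1..k. G k a b * \<psi> b)) + (if a = i then (\<Sum>b=1..k. G k (Suc i) b * \<psi> b) else 0)
       = (\<Sum>b=1..k. G k a b * \<psi> b) * e i"
      using sum.cong[OF refl 1, of "{1..k}" "\<lambda>x. x"] i
      by (auto simp: sum.distrib kap_sum sum_distrib_left sum_distrib_right)
  } note E = this
  { fix i a assume i: "1 \<le> i" "i < k" and a: "a \<in> {1..k}"
    have 1: "f i * (G k a b * \<psi> b) + (if a = Suc i then Ki i * (G k i b * \<psi> b) else 0) + (if b = Suc i then G k a (Suc i) * (Ki i * \<psi> i) else 0) =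
        G k a b * \<psi> b * f i + (if b = i then G k a (Suc i) * (Ki i * \<psi> i) else 0)" if b: "b \<in> {1..k}" for b
    proof -
      have "f i * (G k a b * \<psi> b) + (if a = Suc i then Ki i * (G k i b * \<psi> b) else 0) =
        (f i * G k a b + (if a = Suc i then Ki i * G k i b else 0)) * \<psi> b"
        by (auto simp: algebra_simps)
      also have "\<dots> = G k a b * (f i * \<psi> b) + (if b = i then G k a (Suc i) * (Ki i * \<psi> i) else 0)"
        unfolding G_F[OF k i a b] by (auto simp: algebra_simps)
      also have "f i * \<psi> b = \<psi> b * f i - (if b = Suc i then Ki i * \<psi> i else 0)"
        using colop_f[OF c i b] by simp
      finally show ?thesis by (auto simp: algebra_simps)
    qed
    have "f i * (\<Sum>b=1..k. G k a b * \<psi> b) + (if a = Suc i then Ki i * (\<Sum>b=1..k. G k i b * \<psi> b) else 0)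
       = (\<Sum>b=1..k. G k a b * \<psi> b) * f i"
      using sum.cong[OF refl 1, of "{1..k}" "\<lambda>x. x"] i
      by (auto simp: sum.distrib sum_distrib_left sum_distrib_right)
  } note Fm = this
  { fix i a assume i: "i \<in> {1..k}" and a: "a \<in> {1..k}"
    have 1: "G k a b * \<psi> b * t i = (if i = a then qs (t i * (G k a b * \<psi> b)) else t i * (G k a b * \<psi> b))" if b: "b \<in> {1..k}" for b
    proof -
      have "G k a b * \<psi> b * t i = (if i = b then qs (G k a b * t i * \<psi> b) else G k a b * t i * \<psi> b)"
        using c i b by (auto simp: colop_def mult.assoc)
      moreover have "t i * (G k a b * \<psi> b) = wx i a b (G k a b * t i * \<psi> b)"
        using wt_t[OF wt_G[OF k a b], of i] i k by (auto simp: wx_def simp flip: mult.assoc)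
      ultimately show ?thesis by (auto simp: wx_def)
    qed
    have "(\<Sum>b=1..k. G k a b * \<psi> b) * t i = (if i = a then qs (t i * (\<Sum>b=1..k. G k a b * \<psi> b)) else t i * (\<Sum>b=1..k. G k a b * \<psi> b))"
      using 1 by (auto simp: sum_distrib_left sum_distrib_right qs_sum)
  } note T = this
  show ?thesis unfolding colop_def using E Fm T by auto
qed

end

section \<open>Two parameters differing by the factor q^2\<close>

locale resolvent2 =
  r: resolvent cq ci cl n e f t ti Q P z G + r': resolvent cq ci cl n e f t ti Q P z' G'
  for cq ci cl :: "'r::ring_1" and n :: nat and e f t ti :: "nat \<Rightarrow> 'r" and Q P :: "nat \<Rightarrow> nat \<Rightarrow> 'r"
    and z z' :: 'r and G G' :: "nat \<Rightarrow> nat \<Rightarrow> nat \<Rightarrow> 'r" +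
  assumes z': "z' = cq * (cq * z)"
begin

lemma zs'_eq: "r'.zs x = r.qs (r.qs (r.zs x))"
  unfolding r.zs_def r'.zs_def r.qs_def unfolding z' by (simp add: mult.assoc)

text \<open>The identity z' G' - z G = (z' - z) G' G applied to column k+1 of \<open>N\<close>. The
  right side is shown to solve the equation that characterises the left side.\<close>

lemma resolvent_identity:
  assumes k: "k < n" and a: "a \<in> {1..k}"
  shows "r'.zs (r'.phi k a) = r.zs (r.phi k a) + (r'.zs (\<Sum>b=1..k. G' k a b * r.phi k b) - r.zs (\<Sum>b=1..k. G' k a b * r.phi k b))"
proof -
  define v where "v a = (\<Sum>b=1..k. G' k a b * r.phi k b)" for a
  define u where "u a = r.zs (r.phi k a) + (r'.zs (v a) - r.zs (v a))" for a
  have kn: "k \<le> n" using k by simp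
  have ph: "r.phi k a = r.N a (Suc k) + r.zs (\<Sum>c=1..k. r.N a c * r.phi k c)" if a: "a \<in> {1..k}" for a
  proof -
    have "r.phi k a = (\<Sum>b=1..k. ((if a = b then 1 else 0) + r.zs (\<Sum>c=1..k. r.N a c * G k c b)) * r.N b (Suc k))"
      unfolding r.phi_def using a kn by (intro sum.cong) (simp_all add: r.G_l[of k a])
    also have "\<dots> = r.N a (Suc k) + r.zs (\<Sum>b=1..k. \<Sum>c=1..k. r.N a c * G k c b * r.N b (Suc k))"
      using a by (simp add: distrib_right sum.distrib if_distrib[of "\<lambda>x. x * _"] r.zs_sum sum_distrib_right mult.assoc cong: if_cong)
    also have "(\<Sum>b=1..k. \<Sum>c=1..k. r.N a c * G k c b * r.N b (Suc k)) = (\<Sum>c=1..k. r.N a c * r.phi k c)"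
      unfolding r.phi_def by (subst sum.swap) (simp add: sum_distrib_left mult.assoc)
    finally show ?thesis .
  qed
  have vv: "v a = r.phi k a + r'.zs (\<Sum>c=1..k. r.N a c * v c)" if a: "a \<in> {1..k}" for a
  proof -
    have "v a = (\<Sum>b=1..k. ((if a = b then 1 else 0) + r'.zs (\<Sum>c=1..k. r.N a c * G' k c b)) * r.phi k b)"
      unfolding v_def using a kn by (intro sum.cong) (simp_all add: r'.G_l[of k a])
    also have "\<dots> = r.phi k a + r'.zs (\<Sum>b=1..k. \<Sum>c=1..k. r.N a c * G' k c b * r.phi k b)"
      using a by (simp add: distrib_right sum.distrib if_distrib[of "\<lambda>x. x * _"] r'.zs_sum sum_distrib_right mult.assoc cong: if_cong)
    also have "(\<Sum>b=1..k. \<Sum>c=1..k. r.N a c * G' k c b * r.phi k b) = (\<Sum>c=1..k. r.N a c * v c)"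
      unfolding v_def by (subst sum.swap) (simp add: sum_distrib_left mult.assoc)
    finally show ?thesis .
  qed
  have "u a = (\<Sum>b=1..k. G' k a b * r'.zs (r.N b (Suc k)))"
  proof (rule r'.solve_left[OF kn _ a])
    fix a assume a: "a \<in> {1..k}"
    define s where "s = (\<Sum>c=1..k. r.N a c * r.phi k c)"
    define s' where "s' = (\<Sum>c=1..k. r.N a c * v c)"
    have Nu: "(\<Sum>c=1..k. r.N a c * u c) = r.zs s + (r'.zs s' - r.zs s')"
      unfolding s_def s'_def u_def by (simp add: distrib_left right_diff_distrib sum.distrib sum_subtractf r.zs_sum r'.zs_sum)
    have Na: "r.N a (Suc k) = r.phi k a - r.zs s" using ph[OF a] by (simp add: s_def)
    have va: "v a = r.phi k a + r'.zs s'" using vv[OF a] by (simp add: s'_def)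
    show "u a = r'.zs (r.N a (Suc k)) + r'.zs (\<Sum>c=1..k. r.N a c * u c)"
      unfolding Nu unfolding Na u_def va zs'_eq by (simp add: algebra_simps)
  qed
  also have "\<dots> = r'.zs (r'.phi k a)" unfolding r'.phi_def by (simp add: r'.zs_sum)
  finally show ?thesis by (simp add: u_def v_def)
qed

text \<open>Since z' - z = q z (q - q^-1), the extra term of the resolvent identity is exactly the
  left side of \<open>colop_X\<close> for the column \<open>phi\<close>; here the ratio q^2 is
  decisive. The outcome contains the same factor as \<open>F_X_Suc\<close>, but on the other
  side.\<close>

lemma X'_F:
  assumes k: "1 \<le> k" "k < n"
  shows "r'.X k * (f k * r.K k) = (f k * r.K k + r.qs (r.qs (r.zs (r.phi k k)))) * r'.X k"
proof -
  define v where "v = (\<Sum>b=1..k. G' k k b * r.phi k b)"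
  have "r.colop k (r.phi k)"
    unfolding r.phi_def by (rule r.colop_G[OF r.colop_N]) (use k in auto)
  then have 1: "r.lam (r'.X k * v) = r.qs (r.phi k k * r'.X k) - r.qi (r'.X k * r.phi k k)"
    unfolding v_def by (rule r'.colop_X) (use k in auto)
  have "r'.X k * (f k * r.K k) - f k * r.K k * r'.X k = r'.X k * r'.zs (r'.phi k k)"
    using r'.X_F[OF k] by simp
  also have "\<dots> = r'.X k * (r.zs (r.phi k k) + (r'.zs v - r.zs v))"
    unfolding v_def by (subst resolvent_identity) (use k in auto)
  also have "r'.zs v - r.zs v = r.qs (r.zs (r.lam v))"
    by (simp add: zs'_eq r.lam_def)
  also have "r'.X k * (r.zs (r.phi k k) + r.qs (r.zs (r.lam v))) = r.zs (r'.X k * r.phi k k) + r.qs (r.zs (r.lam (r'.X k * v)))"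
    by (simp add: algebra_simps)
  also have "\<dots> = r.qs (r.qs (r.zs (r.phi k k))) * r'.X k"
    unfolding 1 by (simp add: algebra_simps)
  finally show ?thesis by (simp add: algebra_simps)
qed

text \<open>\<open>F_X_Suc\<close> creates the correction between the two factors and
  \<open>X'_F\<close> removes it; the torus factor of \<open>F\<close> commutes with both Schur
  complements and is cancelled.\<close>

lemma XX'_f:
  assumes k: "1 \<le> k" "k < n"
  shows "f k * (r.X (Suc k) * r'.X k) = r.X (Suc k) * r'.X k * f k"
proof -
  let ?y = "r.X (Suc k) * r'.X k"
  have "f k * r.K k * ?y = r.X (Suc k) * (f k * r.K k + r.qs (r.qs (r.zs (r.phi k k)))) * r'.X k"
    using r.F_X_Suc[OF k] by (simp flip: mult.assoc)
  also have "\<dots> = ?y * (f k * r.K k)"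
    using X'_F[OF k] by (simp add: mult.assoc)
  finally have 1: "f k * r.K k * ?y = ?y * (f k * r.K k)" .
  have "r.K k * ?y = ?y * r.K k"
    using r.X_K[of "Suc k" k] r'.X_K[of k k] k by simp (metis mult.assoc)
  then have "f k * ?y * r.K k = ?y * f k * r.K k" using 1 by (simp add: mult.assoc)
  then have "f k * ?y * r.K k * r.Ki k = ?y * f k * r.K k * r.Ki k" by simp
  then show ?thesis using r.K_Ki[OF k] by (simp add: mult.assoc)
qed

end

section \<open>The opposite ring\<close>

text \<open>The opposite ring exchanges \<open>e\<close> and \<open>f\<close>, so that commutation with \<open>e k\<close> becomes a copy of commutation
  with \<open>f k\<close>.\<close>

typedef 'a opp = "UNIV :: 'a set" morphisms unop Op ..

lemma unop_Op [simp]: "unop (Op x) = x" by (simp add: Op_inverse)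
lemma opp_eq_iff: "x = y \<longleftrightarrow> unop x = unop y" by (simp add: unop_inject)

instantiation opp :: (ring_1) ring_1
begin
definition "0 = Op 0"
definition "1 = Op 1"
definition "x + y = Op (unop x + unop y)"
definition "x - y = Op (unop x - unop y)"
definition "- x = Op (- unop x)"
definition "x * y = Op (unop y * unop x)"
instance
  by standard (auto simp: zero_opp_def one_opp_def plus_opp_def minus_opp_def uminus_opp_def times_opp_def
     opp_eq_iff algebra_simps)
end

lemma unop_simps [simp]: "unop 0 = 0" "unop 1 = 1" "unop (x + y) = unop x + unop y" "unop (x - y) = unop x - unop y"
  "unop (- x) = - unop x" "unop (x * y) = unop y * unop x" for x y :: "'a::ring_1 opp"
  by (auto simp: zero_opp_def one_opp_def plus_opp_def minus_opp_def uminus_opp_def times_opp_def)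

lemma unop_sum [simp]: "unop (sum g A) = (\<Sum>i\<in>A. unop (g i))" for g :: "'b \<Rightarrow> 'a::ring_1 opp"
  by (induction A rule: infinite_finite_induct) auto

lemma unop_if: "unop (if c then x else y) = (if c then unop x else unop y)" by simp

lemma (in qscalars) opposite_scalars: "qscalars (Op cq) (Op ci) (Op cl)"
proof
  fix x :: "'r opp"
  show "Op cq * x = x * Op cq" "Op ci * x = x * Op ci" "Op cl * x = x * Op cl"
    by (simp_all add: opp_eq_iff cq_central ci_central cl_central flip: cq_central ci_central cl_central)
  show "Op cq * Op ci = 1" by (simp add: opp_eq_iff ci_cq)
  show "(Op cq - Op ci) * Op cl = 1" using cl_inv cl_central by (simp add: opp_eq_iff)
  show "(Op cq + Op ci) * x = 0 \<Longrightarrow> x = 0"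
    using cq_plus_ci[of "unop x"] cq_central ci_central by (simp add: opp_eq_iff algebra_simps)
qed

context rlm
begin

interpretation o: qscalars "Op cq" "Op ci" "Op cl" by (rule opposite_scalars)

lemma unop_scalars [simp]: "unop (o.qs x) = qs (unop x)" "unop (o.qi x) = qi (unop x)"
  "unop (o.kap k a x) = kap k a (unop x)" "unop (o.kapi k a x) = kapi k a (unop x)"
  "unop (o.wx i a b x) = wx i a b (unop x)"
proof -
  show "unop (o.qs x) = qs (unop x)" "unop (o.qi x) = qi (unop x)" for x
    by (simp_all add: o.qs_def o.qi_def qs_def qi_def cq_central ci_central)
  then show "unop (o.kap k a x) = kap k a (unop x)" "unop (o.kapi k a x) = kapi k a (unop x)"
     "unop (o.wx i a b x) = wx i a b (unop x)"
    by (auto simp: o.kap_def o.kapi_def o.wx_def kap_def kapi_def wx_def)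
qed

lemma kap_kap: "kap k a (kap k b x) = kap k b (kap k a x)" "kap k a (kapi k b x) = kapi k b (kap k a x)"
   "kapi k a (kapi k b x) = kapi k b (kapi k a x)" "kap k a (qi x) = qi (kap k a x)" "kap k a (qs x) = qs (kap k a x)"
   "kapi k a (qi x) = qi (kapi k a x)" "kapi k a (qs x) = qs (kapi k a x)"
   "kapi k c (kapi k a (kap k c x)) = kapi k a x" "kapi k c (kap k a (kap k c x)) = kap k a x"
   "kap k c (kap k a (kapi k c x)) = kap k a x" "kap k c (kapi k a (kapi k c x)) = kapi k a x"
  by (auto simp: kap_def kapi_def)

lemma kap_same: "kap k k x = qs x" "kapi k k x = qi x"
  by (simp_all add: kap_def kapi_def)

text \<open>Reversing products negates weights, so \<open>f\<close> takes the place of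
  \<open>e\<close>, and \<open>Q\<close> and \<open>P\<close> are exchanged and transposed. The
  torus twists move K_k from one correction term to the other, and the powers of q compensate for
  commuting it past entries of index k.\<close>

lemma opposite_rlm: "rlm (Op cq) (Op ci) (Op cl) n (\<lambda>i. Op (qi (f i * K i))) (\<lambda>i. Op (qs (Ki i * e i)))
    (\<lambda>i. Op (t i)) (\<lambda>i. Op (ti i)) (\<lambda>a b. Op (P b a)) (\<lambda>a b. Op (Q b a))"
proof (unfold_locales, goal_cases)
  case (4 i j)
  then have tK: "t i * K j = K j * t i" using wt_t[OF wt_K(1)[of j 1], of i] by (simp add: wx_def)
  have "t i * (f j * K j) = kapi j i (f j * t i) * K j" using t_f[of i j] 4 by (simp flip: mult.assoc)
  then have "t i * (f j * K j) = kapi j i (f j * K j * t i)" by (simp add: mult.assoc tK)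
  then show ?case by (simp add: opp_eq_iff kap_kap)
next
  case (5 i j)
  have "t i * (Ki j * e j) = Ki j * (t i * e j)"
    using wt_t[OF wt_K(2)[of j 1], of i] 5 by (simp add: wx_def flip: mult.assoc)
  then have "t i * (Ki j * e j) = kap j i (Ki j * e j * t i)"
    using t_e[of i j] 5 by (simp add: mult.assoc)
  then show ?case by (simp add: opp_eq_iff kap_kap)
next
  case (10 a b i)
  then show ?case using P_wt[of b a i] by (auto simp: opp_eq_iff wx_def)
next
  case (11 a b i)
  then show ?case using Q_wt[of b a i] by (auto simp: opp_eq_iff wx_def)
next
  case (12 k a c)
  have KP: "K k * P k a = kap k a (qi (P k a * K k))" "P c a * K k = kap k c (kapi k a (K k * P c a))"
    using K_wt(1)[OF wt_P[of k a], of k] K_wt(1)[OF wt_P[of c a], of k] 12 by (simp_all add: kap_kap kap_same)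
  have tt: "ti (Suc k) * t k = K k" using t_ti_comm[of k "Suc k"] 12 by (simp add: K_def)
  have "(kapi k c (f k * P c a) + (if c = Suc k then P k a else 0)) * K k =
         P c a * (f k * K k) + (if a = k then P c (Suc k) else 0)"
    using P_F[of k c a, folded Ki_def] 12 Ki_K[of k] by (simp add: distrib_right mult.assoc)
  then have H: "kapi k a (f k * (K k * P c a)) + (if c = Suc k then P k a * K k else 0) =
         P c a * (f k * K k) + (if a = k then P c (Suc k) else 0)"
    by (auto simp: distrib_right mult.assoc KP(2) kap_kap)
  have "qi (f k * (K k * P c a)) + (if c = Suc k then K k * P k a else 0) =
      kap k a (qi (kapi k a (f k * (K k * P c a)) + (if c = Suc k then P k a * K k else 0)))"
    by (cases "c = Suc k") (simp_all add: kap_kap KP(1))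
  also have "\<dots> = kap k a (qi (P c a * (f k * K k))) + (if a = k then P c (Suc k) else 0)"
    unfolding H by (cases "a = k") (simp_all add: kap_same)
  finally have "qi (f k * (K k * P c a)) + (if c = Suc k then K k * P k a else 0) =
      kap k a (qi (P c a * (f k * K k))) + (if a = k then P c (Suc k) else 0)" .
  then show ?case by (auto simp: opp_eq_iff unop_if tt mult.assoc)
next
  case (13 k a c)
  have KP: "Ki k * P c a = kap k c (kapi k a (P c a * Ki k))" "Ki k * P c k = kap k c (qi (P c k * Ki k))"
    using K_wt(2)[OF wt_P[of c a], of k] K_wt(2)[OF wt_P[of c k], of k] 13 by (simp_all add: kap_kap kap_same)
  have KPx: "Ki k * (P c a * x) = kap k c (kapi k a (P c a * (Ki k * x)))" for x
    using arg_cong[OF KP(1), of "\<lambda>u. u * x"] by (simp add: mult.assoc)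
  have tt: "t (Suc k) * ti k = Ki k" using t_ti_comm[of "Suc k" k] 13 by (simp add: Ki_def)
  have KK: "Ki k * (K k * x) = x" for x using Ki_K[of k] 13 by (simp flip: mult.assoc)
  have "Ki k * (e k * P c a + (if c = k then K k * P (Suc k) a else 0)) =
        Ki k * (kap k a (P c a * e k) + (if a = Suc k then P c k else 0))"
    by (simp only: P_E[OF 13(1,2,4,3), folded K_def])
  then have H: "Ki k * (e k * P c a) + (if c = k then P (Suc k) a else 0) =
      kap k c (P c a * (Ki k * e k)) + (if a = Suc k then Ki k * P c k else 0)"
    by (auto simp: distrib_left KPx KK kap_kap)
  have "kapi k c (qs (Ki k * (e k * P c a))) + (if c = k then P (Suc k) a else 0) =
      kapi k c (qs (Ki k * (e k * P c a) + (if c = k then P (Suc k) a else 0)))"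
    by (cases "c = k") (simp_all add: kap_same)
  also have "\<dots> = qs (P c a * (Ki k * e k)) + (if a = Suc k then P c k * Ki k else 0)"
    unfolding H by (cases "a = Suc k") (simp_all add: kap_kap KP(2))
  finally have "kapi k c (qs (Ki k * (e k * P c a))) + (if c = k then P (Suc k) a else 0) =
      qs (P c a * (Ki k * e k)) + (if a = Suc k then P c k * Ki k else 0)" .
  then show ?case by (auto simp: opp_eq_iff unop_if tt mult.assoc)
next
  case (14 k a c)
  have KQ: "Q c a * K k = kap k c (kapi k a (K k * Q c a))" "K k * Q k a = kap k a (qi (Q k a * K k))"
    using K_wt(1)[OF wt_Q[of c a], of k] K_wt(1)[OF wt_Q[of k a], of k] 14 by (simp_all add: kap_kap kap_same)
  have KQ': "Q k a = kap k a (qi (Ki k * (Q k a * K k)))"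
    using arg_cong[OF KQ(2), of "\<lambda>x. Ki k * x"] Ki_K[of k] 14 by (simp flip: mult.assoc)
  have tt: "ti (Suc k) * t k = K k" using t_ti_comm[of k "Suc k"] 14 by (simp add: K_def)
  have "(f k * Q c a + (if c = Suc k then Ki k * Q k a else 0)) * K k =
        (kapi k a (Q c a * f k) + (if a = k then Q c (Suc k) else 0)) * K k"
    by (simp only: Q_F[OF 14(1,2,4,3), folded Ki_def])
  then have H: "kap k c (kapi k a (f k * (K k * Q c a))) + (if c = Suc k then Ki k * (Q k a * K k) else 0) =
      kapi k a (Q c a * (f k * K k)) + (if a = k then Q c (Suc k) * K k else 0)"
    by (auto simp: distrib_right mult.assoc KQ(1) kap_kap)
  have "kap k c (qi (f k * (K k * Q c a))) + (if c = Suc k then Q k a else 0) =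
      kap k a (qi (kap k c (kapi k a (f k * (K k * Q c a))) + (if c = Suc k then Ki k * (Q k a * K k) else 0)))"
    using KQ' by (cases "c = Suc k") (simp_all add: kap_kap)
  also have "\<dots> = qi (Q c a * (f k * K k)) + (if a = k then Q c (Suc k) * K k else 0)"
    unfolding H by (cases "a = k") (simp_all add: kap_kap kap_same)
  finally have "kap k c (qi (f k * (K k * Q c a))) + (if c = Suc k then Q k a else 0) =
      qi (Q c a * (f k * K k)) + (if a = k then Q c (Suc k) * K k else 0)" .
  then show ?case by (auto simp: opp_eq_iff unop_if tt mult.assoc)
next
  case (15 k a c)
  have KQ: "Ki k * Q c a = kap k c (kapi k a (Q c a * Ki k))" "Ki k * Q c k = kap k c (qi (Q c k * Ki k))"
    using K_wt(2)[OF wt_Q[of c a], of k] K_wt(2)[OF wt_Q[of c k], of k] 15 by (simp_all add: kap_kap kap_same)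
  have KQx: "Ki k * (Q c a * x) = kap k c (kapi k a (Q c a * (Ki k * x)))" for x
    using arg_cong[OF KQ(1), of "\<lambda>u. u * x"] by (simp add: mult.assoc)
  have KQ': "Ki k * (Q c k * K k) = kap k c (qi (Q c k))"
    using arg_cong[OF KQ(2), of "\<lambda>x. x * K k"] Ki_K[of k] 15 by (simp add: mult.assoc)
  have tt: "t (Suc k) * ti k = Ki k" using t_ti_comm[of "Suc k" k] 15 by (simp add: Ki_def)
  have "Ki k * (kap k c (e k * Q c a) + (if c = k then Q (Suc k) a else 0)) =
        Ki k * (Q c a * e k + (if a = Suc k then Q c k * K k else 0))"
    by (simp only: Q_E[OF 15(1,2,4,3), folded K_def])
  moreover have "Ki k * (kap k c (e k * Q c a) + (if c = k then Q (Suc k) a else 0)) =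
      kap k c (Ki k * (e k * Q c a)) + (if c = k then Ki k * Q (Suc k) a else 0)"
    by (simp add: distrib_left)
  moreover have "Ki k * (Q c a * e k + (if a = Suc k then Q c k * K k else 0)) =
      kap k c (kapi k a (Q c a * (Ki k * e k))) + (if a = Suc k then kap k c (qi (Q c k)) else 0)"
    by (simp add: distrib_left KQx KQ' kap_kap)
  ultimately have H: "kap k c (Ki k * (e k * Q c a)) + (if c = k then Ki k * Q (Suc k) a else 0) =
      kap k c (kapi k a (Q c a * (Ki k * e k))) + (if a = Suc k then kap k c (qi (Q c k)) else 0)"
    by (simp only:)
  have "qs (Ki k * (e k * Q c a)) + (if c = k then Ki k * Q (Suc k) a else 0) =
      kapi k c (qs (kap k c (Ki k * (e k * Q c a)) + (if c = k then Ki k * Q (Suc k) a else 0)))"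
    by (cases "c = k") (simp_all add: kap_kap kap_same)
  also have "\<dots> = kapi k a (qs (Q c a * (Ki k * e k))) + (if a = Suc k then Q c k else 0)"
    unfolding H by (cases "a = Suc k") (simp_all add: kap_kap kap_same)
  finally have "qs (Ki k * (e k * Q c a)) + (if c = k then Ki k * Q (Suc k) a else 0) =
      kapi k a (qs (Q c a * (Ki k * e k))) + (if a = Suc k then Q c k else 0)" .
  then show ?case by (auto simp: opp_eq_iff unop_if tt mult.assoc)
qed (auto simp: opp_eq_iff t_ti ti_t t_t Q_lt P_gt Q_diag P_diag)


end

context resolvent2
begin

interpretation o: rlm "Op cq" "Op ci" "Op cl" n "\<lambda>i. Op (r.qi (f i * r.K i))" "\<lambda>i. Op (r.qs (r.Ki i * e i))"
    "\<lambda>i. Op (t i)" "\<lambda>i. Op (ti i)" "\<lambda>a b. Op (P b a)" "\<lambda>a b. Op (Q b a)"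
  by (rule r.opposite_rlm)

lemma opposite_N: "o.N a b = Op (r.N b a)"
  by (simp add: o.N_def r.N_def opp_eq_iff)

interpretation o: resolvent2 "Op cq" "Op ci" "Op cl" n "\<lambda>i. Op (r.qi (f i * r.K i))" "\<lambda>i. Op (r.qs (r.Ki i * e i))"
    "\<lambda>i. Op (t i)" "\<lambda>i. Op (ti i)" "\<lambda>a b. Op (P b a)" "\<lambda>a b. Op (Q b a)" "Op z" "Op z'"
    "\<lambda>k a b. Op (G k b a)" "\<lambda>k a b. Op (G' k b a)"
proof (unfold_locales, goal_cases)
  case (1 x)
  show ?case using r.z_central[of "unop x"] by (simp add: opp_eq_iff)
next
  case (2 k a b)
  then show ?case using r.G_right[of k b a] r.z_central[of "\<Sum>c=1..k. G k b c * r.N c a"]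
    by (simp add: opp_eq_iff opposite_N unop_if)
next
  case (3 k a b)
  then show ?case using r.G_left[of k b a] r.z_central[of "\<Sum>c=1..k. r.N b c * G k c a"]
    by (simp add: opp_eq_iff opposite_N unop_if)
next
  case (4 x)
  show ?case using r'.z_central[of "unop x"] by (simp add: opp_eq_iff)
next
  case (5 k a b)
  then show ?case using r'.G_right[of k b a] r'.z_central[of "\<Sum>c=1..k. G' k b c * r.N c a"]
    by (simp add: opp_eq_iff opposite_N unop_if)
next
  case (6 k a b)
  then show ?case using r'.G_left[of k b a] r'.z_central[of "\<Sum>c=1..k. r.N b c * G' k c a"]
    by (simp add: opp_eq_iff opposite_N unop_if)
next
  case 7 show ?case using r.cq_central[of z] r.cq_central[of "z * cq"] by (simp add: opp_eq_iff z' mult.assoc)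
qed

lemma opp_zs: "unop (o.r.zs x) = r.zs (unop x)" "unop (o.r'.zs x) = r'.zs (unop x)"
  by (simp_all add: o.r.zs_def r.zs_def r.z_central o.r'.zs_def r'.zs_def r'.z_central)

text \<open>Reversal turns \<open>phi\<close> into \<open>rho\<close>; the second form
  \<open>X_rho\<close> of the Schur complement is what matches.\<close>

lemma opposite_X: "1 \<le> k \<Longrightarrow> o.r.X k = Op (r.X k)" "1 \<le> k \<Longrightarrow> o.r'.X k = Op (r'.X k)"
proof -
  assume "1 \<le> k"
  then obtain j where k: "k = Suc j" by (cases k) auto
  show "o.r.X k = Op (r.X k)"
    unfolding k r.X_rho unfolding o.r.X_def o.r.phi_def r.rho_def
    by (simp add: opp_eq_iff opposite_N opp_zs)
  show "o.r'.X k = Op (r'.X k)"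
    unfolding k r'.X_rho unfolding o.r'.X_def o.r'.phi_def r'.rho_def
    by (simp add: opp_eq_iff opposite_N opp_zs)
qed

lemma XX'_e:
  assumes k: "1 \<le> k" "k < n"
  shows "e k * (r'.X k * r.X (Suc k)) = r'.X k * r.X (Suc k) * e k"
proof -
  let ?y = "r'.X k * r.X (Suc k)"
  have "unop (Op (r.qs (r.Ki k * e k)) * (o.r.X (Suc k) * o.r'.X k)) = unop (o.r.X (Suc k) * o.r'.X k * Op (r.qs (r.Ki k * e k)))"
    using o.XX'_f[OF k] by simp
  then have "r.qs (?y * (r.Ki k * e k)) = r.qs (r.Ki k * e k * ?y)"
    using k by (simp add: opposite_X)
  then have 1: "?y * (r.Ki k * e k) = r.Ki k * e k * ?y" by simp
  have "r.K k * ?y = ?y * r.K k"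
    using r.X_K[of "Suc k" k] r'.X_K[of k k] k by simp (metis mult.assoc)
  then have "r.K k * (r.Ki k * e k * ?y) = ?y * (r.K k * (r.Ki k * e k))"
    unfolding 1[symmetric] by (metis mult.assoc)
  then show ?thesis using r.K_Ki[OF k] by (simp flip: mult.assoc)
qed

end

section \<open>Central generating functions\<close>

lemma commute_mult: "y * a = a * y \<Longrightarrow> y * b = b * y \<Longrightarrow> y * (a * b) = a * b * y" for y a b :: "'a::ring_1"
  by (metis mult.assoc)

lemma fps_commuteI:
  fixes Y H :: "'a::ring_1 fps"
  assumes "\<And>i j. fps_nth Y i * fps_nth H j = fps_nth H j * fps_nth Y i"
  shows "Y * H = H * Y"
proof (rule fps_ext)
  fix i
  have "fps_nth (Y * H) i = (\<Sum>j=0..i. fps_nth H (i - j) * fps_nth Y j)"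
    by (simp add: fps_mult_nth assms)
  also have "\<dots> = fps_nth (H * Y) i"
    unfolding fps_mult_nth by (rule sum.reindex_bij_witness[of _ "\<lambda>j. i - j" "\<lambda>j. i - j"]) auto
  finally show "fps_nth (Y * H) i = fps_nth (H * Y) i" .
qed

definition fps_scale :: "'a::ring_1 \<Rightarrow> 'a fps \<Rightarrow> 'a fps" where
  "fps_scale c Y = Abs_fps (\<lambda>i. c ^ i * fps_nth Y i)"

lemma fps_scale_nth [simp]: "fps_nth (fps_scale c Y) i = c ^ i * fps_nth Y i"
  by (simp add: fps_scale_def)

lemma fps_scale_simps:
  "fps_scale c 1 = 1" "fps_scale c 0 = 0" "fps_scale c (Y + H) = fps_scale c Y + fps_scale c H"
  "fps_scale c (Y - H) = fps_scale c Y - fps_scale c H" "fps_scale c (fps_const a) = fps_const a"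
  "fps_scale c fps_X = fps_const c * fps_X" for Y H :: "'a::ring_1 fps"
  by (auto simp: fps_eq_iff algebra_simps fps_one_nth fps_X_def fps_mult_left_const_nth)

lemma fps_scale_sum: "fps_scale c (sum g A) = (\<Sum>i\<in>A. fps_scale c (g i))"
  by (induction A rule: infinite_finite_induct) (auto simp: fps_scale_simps)

text \<open>Multiplying the variable by c is a ring endomorphism because c is central.\<close>

lemma fps_scale_mult:
  assumes "\<And>x. c * x = x * c" shows "fps_scale c (Y * H) = fps_scale c Y * fps_scale c (H :: 'a::ring_1 fps)"
proof (rule fps_ext)
  fix i
  have p: "c ^ i * x = x * c ^ i" for i x using power_commuting_commutes[of c x i] assms by simp
  have "c ^ i * (fps_nth Y j * fps_nth H (i - j)) = c ^ j * fps_nth Y j * (c ^ (i - j) * fps_nth H (i - j))" if "j \<in> {0..i}" for j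
  proof -
    have "c ^ i = c ^ j * c ^ (i - j)" using that by (simp flip: power_add)
    then have "c ^ i * (fps_nth Y j * fps_nth H (i - j)) = c ^ j * ((c ^ (i - j) * fps_nth Y j) * fps_nth H (i - j))"
      by (simp only: mult.assoc)
    also have "c ^ (i - j) * fps_nth Y j = fps_nth Y j * c ^ (i - j)" by (rule p)
    finally show ?thesis by (simp only: mult.assoc)
  qed
  then show "fps_nth (fps_scale c (Y * H)) i = fps_nth (fps_scale c Y * fps_scale c H) i"
    by (simp add: fps_mult_nth sum_distrib_left)
qed

lemma fps_const_sum: "fps_const (sum g A) = (\<Sum>i\<in>A. fps_const (g i :: 'a::ring_1))"
  by (induction A rule: infinite_finite_induct) (auto simp flip: fps_const_add)

lemma fps_commute_const_iff:
  "fps_const y * Y = Y * fps_const y \<longleftrightarrow> (\<forall>i. y * fps_nth Y i = fps_nth Y i * y)" for Y :: "'a::ring_1 fps"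
  by (simp add: fps_eq_iff fps_mult_left_const_nth fps_mult_right_const_nth)

lemma (in qscalars) qscalars_fps: "qscalars (fps_const cq) (fps_const ci) (fps_const cl)"
proof
  fix x :: "'r fps"
  show "fps_const cq * x = x * fps_const cq" "fps_const ci * x = x * fps_const ci" "fps_const cl * x = x * fps_const cl"
    by (simp_all add: fps_commute_const_iff cq_central ci_central cl_central)
  show "fps_const cq * fps_const ci = 1" "(fps_const cq - fps_const ci) * fps_const cl = 1"
    by (simp_all add: cq_ci cl_inv)
  show "(fps_const cq + fps_const ci) * x = 0 \<Longrightarrow> x = 0"
    using cq_plus_ci by (auto simp: fps_eq_iff fps_mult_left_const_nth fps_const_add simp del: fps_const_add [symmetric])
qed

section \<open>The resolvent as a power series in a formal parameter\<close>

context rlm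
begin

interpretation fp: qscalars "fps_const cq" "fps_const ci" "fps_const cl" by (rule qscalars_fps)

lemma fps_const_scalars:
  "fp.qs (fps_const x) = fps_const (qs x)" "fp.qi (fps_const x) = fps_const (qi x)"
  "fp.kap k a (fps_const x) = fps_const (kap k a x)" "fp.kapi k a (fps_const x) = fps_const (kapi k a x)"
  "fp.wx i a b (fps_const x) = fps_const (wx i a b x)"
  by (auto simp: fp.qs_def fp.qi_def qs_def qi_def fp.kap_def fp.kapi_def fp.wx_def kap_def kapi_def wx_def)

lemma fps_if_const: "(if c then fps_const x else fps_const y) = fps_const (if c then x else y)"
  "(if c then fps_const x else 0) = fps_const (if c then x else 0)" by auto

lemma rlm_fps: "rlm (fps_const cq) (fps_const ci) (fps_const cl) n (\<lambda>i. fps_const (e i)) (\<lambda>i. fps_const (f i))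
   (\<lambda>i. fps_const (t i)) (\<lambda>i. fps_const (ti i)) (\<lambda>a b. fps_const (Q a b)) (\<lambda>a b. fps_const (P a b))"
  by unfold_locales
    (simp_all only: fps_const_mult fps_const_add fps_const_scalars fps_if_const fps_const_0_eq_0 fps_const_1_eq_1
      t_ti ti_t t_t t_e t_f Q_lt P_gt Q_diag P_diag Q_wt P_wt Q_E Q_F P_E P_F)

text \<open>Powers of the block matrix. They are the coefficients of the Neumann series, which
  provides the inverse of 1 - z N without any invertibility assumption.\<close>

fun mpow :: "nat \<Rightarrow> nat \<Rightarrow> nat \<Rightarrow> nat \<Rightarrow> 'r" where
  "mpow k 0 a b = (if a = b then 1 else 0)"
| "mpow k (Suc i) a b = (\<Sum>c=1..k. N a c * mpow k i c b)"

lemma mpow_Suc_right: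
  "a \<in> {1..k} \<Longrightarrow> b \<in> {1..k} \<Longrightarrow> mpow k (Suc i) a b = (\<Sum>c=1..k. mpow k i a c * N c b)"
proof (induction i arbitrary: a)
  case 0
  then show ?case by (simp add: if_distrib[of "\<lambda>x. x * _"] if_distrib[of "\<lambda>x. _ * x"] cong: if_cong)
next
  case (Suc i)
  have "mpow k (Suc (Suc i)) a b = (\<Sum>c=1..k. N a c * (\<Sum>d=1..k. mpow k i c d * N d b))"
    unfolding mpow.simps(2)[of k "Suc i"] using Suc by (intro sum.cong) (auto simp del: mpow.simps)
  also have "\<dots> = (\<Sum>d=1..k. mpow k (Suc i) a d * N d b)"
    by (simp add: sum_distrib_left sum_distrib_right mult.assoc) (rule sum.swap)
  finally show ?case .
qed

definition Gz where "Gz k a b = Abs_fps (\<lambda>i. mpow k i a b)"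

interpretation fp: rlm "fps_const cq" "fps_const ci" "fps_const cl" n "\<lambda>i. fps_const (e i)" "\<lambda>i. fps_const (f i)"
   "\<lambda>i. fps_const (t i)" "\<lambda>i. fps_const (ti i)" "\<lambda>a b. fps_const (Q a b)" "\<lambda>a b. fps_const (P a b)"
  by (rule rlm_fps)

lemma fp_N: "fp.N a b = fps_const (N a b)"
  by (simp add: fp.N_def N_def fps_const_sum)

lemma resolvent_Gz: "resolvent (fps_const cq) (fps_const ci) (fps_const cl) n (\<lambda>i. fps_const (e i)) (\<lambda>i. fps_const (f i))
   (\<lambda>i. fps_const (t i)) (\<lambda>i. fps_const (ti i)) (\<lambda>a b. fps_const (Q a b)) (\<lambda>a b. fps_const (P a b)) fps_X Gz"
proof
  fix x :: "'r fps" show "fps_X * x = x * fps_X" by (rule fps_mult_fps_X_commute)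
next
  fix k a b assume ab: "k \<le> n" "a \<in> {1..k}" "b \<in> {1..k}"
  show "Gz k a b = (if a = b then 1 else 0) + fps_X * (\<Sum>c=1..k. fp.N a c * Gz k c b)"
  proof (rule fps_ext)
    fix i show "fps_nth (Gz k a b) i = fps_nth ((if a = b then 1 else 0) + fps_X * (\<Sum>c=1..k. fp.N a c * Gz k c b)) i"
      by (cases i) (simp_all add: Gz_def fp_N fps_sum_nth)
  qed
  show "Gz k a b = (if a = b then 1 else 0) + fps_X * (\<Sum>c=1..k. Gz k a c * fp.N c b)"
  proof (rule fps_ext)
    fix i show "fps_nth (Gz k a b) i = fps_nth ((if a = b then 1 else 0) + fps_X * (\<Sum>c=1..k. Gz k a c * fp.N c b)) i"
      using ab by (cases i) (simp_all add: Gz_def fp_N fps_sum_nth mpow_Suc_right del: mpow.simps(2))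
  qed
qed

lemma cq2_central: "cq * cq * x = x * (cq * cq)" by (metis cq_central mult.assoc)

lemma resolvent2_Gz: "resolvent2 (fps_const cq) (fps_const ci) (fps_const cl) n (\<lambda>i. fps_const (e i)) (\<lambda>i. fps_const (f i))
   (\<lambda>i. fps_const (t i)) (\<lambda>i. fps_const (ti i)) (\<lambda>a b. fps_const (Q a b)) (\<lambda>a b. fps_const (P a b)) fps_X
   (fps_const (cq * cq) * fps_X) Gz (\<lambda>k a b. fps_scale (cq * cq) (Gz k a b))"
proof -
  interpret r: resolvent "fps_const cq" "fps_const ci" "fps_const cl" n "\<lambda>i. fps_const (e i)" "\<lambda>i. fps_const (f i)"
   "\<lambda>i. fps_const (t i)" "\<lambda>i. fps_const (ti i)" "\<lambda>a b. fps_const (Q a b)" "\<lambda>a b. fps_const (P a b)" fps_X Gz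
    by (rule resolvent_Gz)
  note sc = fps_scale_mult[of "cq * cq", OF cq2_central] fps_scale_sum fps_scale_simps
  show ?thesis
  proof
    fix x :: "'r fps"
    have "fps_const (cq * cq) * x = x * fps_const (cq * cq)" unfolding fps_commute_const_iff by (intro allI cq2_central)
    then show "fps_const (cq * cq) * fps_X * x = x * (fps_const (cq * cq) * fps_X)"
      by (intro commute_mult[symmetric]) (simp_all only: fps_mult_fps_X_commute)
  next
    fix k a b assume ab: "k \<le> n" "a \<in> {1..k}" "b \<in> {1..k}"
    show "fps_scale (cq * cq) (Gz k a b) = (if a = b then 1 else 0) +
        fps_const (cq * cq) * fps_X * (\<Sum>c=1..k. fp.N a c * fps_scale (cq * cq) (Gz k c b))"
      by (subst r.G_left[OF ab]) (auto simp: sc fp_N)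
    show "fps_scale (cq * cq) (Gz k a b) = (if a = b then 1 else 0) +
        fps_const (cq * cq) * fps_X * (\<Sum>c=1..k. fps_scale (cq * cq) (Gz k a c) * fp.N c b)"
      by (subst r.G_right[OF ab]) (auto simp: sc fp_N)
  qed (simp add: mult.assoc flip: fps_const_mult)
qed

interpretation r2: resolvent2 "fps_const cq" "fps_const ci" "fps_const cl" n "\<lambda>i. fps_const (e i)" "\<lambda>i. fps_const (f i)"
   "\<lambda>i. fps_const (t i)" "\<lambda>i. fps_const (ti i)" "\<lambda>a b. fps_const (Q a b)" "\<lambda>a b. fps_const (P a b)" fps_X
   "fps_const (cq * cq) * fps_X" Gz "\<lambda>k a b. fps_scale (cq * cq) (Gz k a b)"
  by (rule resolvent2_Gz)

definition Xz where "Xz = r2.r.X"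
definition Wz where "Wz k = Gz k k k"

abbreviation rescale where "rescale \<equiv> fps_scale (cq * cq)"

lemmas rescale_simps = fps_scale_mult[of "cq * cq", OF cq2_central] fps_scale_sum fps_scale_simps

lemma rescale_X: "r2.r'.X k = rescale (Xz k)"
  unfolding Xz_def r2.r'.X_def r2.r.X_def r2.r'.phi_def r2.r.phi_def r2.r'.zs_def r2.r.zs_def
  by (simp add: rescale_simps fp_N)

lemma Xz_t: "m \<in> {1..n} \<Longrightarrow> i \<in> {1..n} \<Longrightarrow> fps_const (t i) * Xz m = Xz m * fps_const (t i)"
  and Xz_ti: "m \<in> {1..n} \<Longrightarrow> i \<in> {1..n} \<Longrightarrow> fps_const (ti i) * Xz m = Xz m * fps_const (ti i)"
  and Xz_e: "m \<in> {1..n} \<Longrightarrow> 1 \<le> i \<Longrightarrow> i < n \<Longrightarrow> Suc i < m \<or> m < i \<Longrightarrow> fps_const (e i) * Xz m = Xz m * fps_const (e i)"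
  and Xz_f: "m \<in> {1..n} \<Longrightarrow> 1 \<le> i \<Longrightarrow> i < n \<Longrightarrow> Suc i < m \<or> m < i \<Longrightarrow> fps_const (f i) * Xz m = Xz m * fps_const (f i)"
  and Xz_inverse: "m \<in> {1..n} \<Longrightarrow> Xz m * Wz m = 1" "m \<in> {1..n} \<Longrightarrow> Wz m * Xz m = 1"
  unfolding Xz_def Wz_def
  using r2.r.X_t r2.r.X_ti r2.r.X_e_low r2.r.X_e_high r2.r.X_f_low r2.r.X_f_high r2.r.X_G_inv by blast+

lemma Xz_one: "1 \<le> n \<Longrightarrow> Xz 1 = 1 - fps_X * fps_const (ti 1 * ti 1)"
proof -
  assume n: "1 \<le> n"
  have "N 1 1 = (\<Sum>c=1..n. if c = 1 then ti 1 * ti 1 else 0)"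
    unfolding N_def by (rule sum.cong) (use n in \<open>auto simp: Q_lt Q_diag P_diag\<close>)
  also have "\<dots> = ti 1 * ti 1" using n by (subst sum.delta) auto
  finally show ?thesis by (simp add: Xz_def r2.r.X_def r2.r.zs_def fp_N)
qed

text \<open>\<open>X_F\<close> is solved for \<open>phi\<close>, which is thereby eliminated: the
  recursion now contains only e_k, f_k, the torus and the Schur complement of rank k, all of whose
  effects on tableaux are known in the induction.\<close>

lemma Xz_Suc:
  assumes k: "1 \<le> k" "k < n"
  defines "Y \<equiv> fps_const (f k * K k)" and "e' \<equiv> fps_const (e k)"
  shows "Xz (Suc k) = Xz k - fps_const ci * ((Xz k * Y - Y * Xz k) * e')
      + fps_const cq * (Xz k * e' * (Y - Wz k * Y * Xz k))"
proof -
  have FF: "Y = fps_const (f k) * fp.K k" by (simp add: Y_def fp.K_def K_def)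
  define p where "p = r2.r.zs (r2.r.phi k k)"
  have kn: "k \<in> {1..n}" using k by auto
  have Xp: "Xz k * Y - Y * Xz k = Xz k * p"
    using r2.r.X_F[OF k] unfolding FF Xz_def p_def by simp
  then have "Wz k * (Xz k * Y - Y * Xz k) = p" by (metis Xz_inverse(2)[OF kn] mult.assoc mult_1_left)
  then have p: "p = Y - Wz k * Y * Xz k"
    using Xz_inverse[OF kn] by (simp add: algebra_simps) (simp flip: mult.assoc)
  have "Xz (Suc k) = Xz k * (1 - fp.qi (p * e') + fp.qs (e' * p))"
    using r2.r.X_Suc[OF k] unfolding Xz_def p_def e'_def by simp
  also have "\<dots> = Xz k - fp.qi (Xz k * p * e') + fp.qs (Xz k * e' * p)"
    by (simp add: algebra_simps)
  finally show ?thesis unfolding Xp[symmetric] p[symmetric]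
    unfolding p fp.qi_def fp.qs_def Xp by (simp add: p mult.assoc)
qed

lemma Xz_X'_f: "1 \<le> k \<Longrightarrow> k < n \<Longrightarrow> fps_const (f k) * (Xz (Suc k) * rescale (Xz k)) = Xz (Suc k) * rescale (Xz k) * fps_const (f k)"
  and Xz_X'_e: "1 \<le> k \<Longrightarrow> k < n \<Longrightarrow> fps_const (e k) * (rescale (Xz k) * Xz (Suc k)) = rescale (Xz k) * Xz (Suc k) * fps_const (e k)"
  using r2.XX'_f r2.XX'_e unfolding rescale_X Xz_def by auto

lemma closed_Xz:
  assumes "m \<in> {1..n}" "1 \<in> S" "0 \<in> S" "\<And>x y. x \<in> S \<Longrightarrow> y \<in> S \<Longrightarrow> x + y \<in> S" "\<And>x y. x \<in> S \<Longrightarrow> y \<in> S \<Longrightarrow> x - y \<in> S"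
    "\<And>x y. x \<in> S \<Longrightarrow> y \<in> S \<Longrightarrow> x * y \<in> S" "\<And>x. x \<in> S \<Longrightarrow> qs x \<in> S"
    "\<And>i. 1 \<le> i \<Longrightarrow> i < m \<Longrightarrow> e i \<in> S" "\<And>i. 1 \<le> i \<Longrightarrow> i < m \<Longrightarrow> f i \<in> S" "\<And>i. i \<in> {1..m} \<Longrightarrow> ti i \<in> S"
  shows "fps_nth (Xz m) i \<in> S"
proof -
  have sums: "(\<And>c. c \<in> C \<Longrightarrow> g c \<in> S) \<Longrightarrow> sum g C \<in> S" for C :: "nat set" and g
    by (induction C rule: infinite_finite_induct) (use assms in auto)
  have N: "N a b \<in> S" if "a \<in> {1..m}" "b \<in> {1..m}" for a b
    by (rule closed_N[of m]) (use assms that in auto)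
  have M: "mpow (m - 1) i a b \<in> S" if "a \<in> {1..m-1}" "b \<in> {1..m-1}" for i a b
    using that
  proof (induction i arbitrary: a)
    case (Suc i)
    have "N a c * mpow (m - 1) i c b \<in> S" if "c \<in> {1..m-1}" for c
      by (intro assms(6) N Suc.IH) (use Suc.prems that in auto)
    then show ?case by (auto intro!: sums)
  qed (use assms in auto)
  define Sf where "Sf = {Y. \<forall>i. fps_nth Y i \<in> S}"
  have Sfm: "Y * H \<in> Sf" if "Y \<in> Sf" "H \<in> Sf" for Y H :: "'r fps"
    using that by (auto simp: Sf_def fps_mult_nth intro!: sums assms)
  have Sfs: "(\<And>c. c \<in> C \<Longrightarrow> g c \<in> Sf) \<Longrightarrow> sum g C \<in> Sf" for C :: "nat set" and g
    by (auto simp: Sf_def fps_sum_nth intro!: sums)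
  have Sfc: "fps_const x \<in> Sf" if "x \<in> S" for x using that assms by (auto simp: Sf_def)
  have Sfd: "Y - H \<in> Sf" if "Y \<in> Sf" "H \<in> Sf" for Y H :: "'r fps"
    using that assms by (auto simp: Sf_def)
  have SfX: "fps_X * Y \<in> Sf" if "Y \<in> Sf" for Y :: "'r fps"
    using that assms by (auto simp: Sf_def)
  have Sf1: "1 \<in> Sf" using Sfc[OF assms(2)] by simp
  have SfG: "Gz (m - 1) a b \<in> Sf" if "a \<in> {1..m-1}" "b \<in> {1..m-1}" for a b
    using M[OF that] by (auto simp: Sf_def Gz_def)
  have "Xz m \<in> Sf"
    unfolding Xz_def r2.r.X_def r2.r.phi_def r2.r.zs_def fp_N
    by (intro Sfd Sfm SfX Sfs Sf1 Sfc SfG N) (use assms(1) in auto)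
  then show ?thesis by (simp add: Sf_def)
qed

text \<open>The shifts by \<open>q\<^sup>2\<close> make this product of Schur complements a quantum determinant.\<close>

fun Az :: "nat \<Rightarrow> 'r fps" where
  "Az 0 = 1"
| "Az (Suc m) = Xz (Suc m) * rescale (Az m)"

lemma rescale_commute:
  "fps_const y * Y = Y * fps_const y \<Longrightarrow> fps_const y * rescale Y = rescale Y * fps_const y"
proof -
  have "(cq * cq) ^ i * x = x * (cq * cq) ^ i" for i x
    using power_commuting_commutes[of "cq * cq" x i] cq2_central by simp
  then show "fps_const y * Y = Y * fps_const y \<Longrightarrow> fps_const y * rescale Y = rescale Y * fps_const y"
    unfolding fps_commute_const_iff fps_scale_nth by (auto intro!: commute_mult)
qed

lemma Az_t: "m \<le> n \<Longrightarrow> i \<in> {1..n} \<Longrightarrow> fps_const (t i) * Az m = Az m * fps_const (t i)"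
  and Az_ti: "m \<le> n \<Longrightarrow> i \<in> {1..n} \<Longrightarrow> fps_const (ti i) * Az m = Az m * fps_const (ti i)"
  by (induction m) (auto intro!: commute_mult rescale_commute Xz_t Xz_ti)

lemma Az_high:
  "m < i \<Longrightarrow> i < n \<Longrightarrow> fps_const (e i) * Az m = Az m * fps_const (e i)"
  "m < i \<Longrightarrow> i < n \<Longrightarrow> fps_const (f i) * Az m = Az m * fps_const (f i)"
  by (induction m) (auto intro!: commute_mult rescale_commute Xz_e Xz_f)

text \<open>The Schur complement of rank k is built from the torus and from e_i, f_i with i < k, and
  every one of these commutes with the next Schur complement.\<close>

lemma Xz_coeff_commute:
  assumes k: "1 \<le> k" "k < n"
  shows "fps_nth (Xz k) i * fps_nth (Xz (Suc k)) j = fps_nth (Xz (Suc k)) j * fps_nth (Xz k) i"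
proof -
  define S where "S = {x. fps_const x * Xz (Suc k) = Xz (Suc k) * fps_const x}"
  have S: "x \<in> S \<longleftrightarrow> fps_const x * Xz (Suc k) = Xz (Suc k) * fps_const x" for x by (simp add: S_def)
  have "fps_nth (Xz k) i \<in> S"
  proof (rule closed_Xz)
    fix x y assume "x \<in> S" "y \<in> S"
    then show "x + y \<in> S" "x - y \<in> S" "x * y \<in> S"
      unfolding S by (simp_all add: algebra_simps flip: fps_const_add fps_const_sub fps_const_mult)
        (metis mult.assoc)
  next
    fix x assume "x \<in> S"
    then show "qs x \<in> S" unfolding S fps_commute_const_iff by simp
  qed (use k in \<open>auto simp: S intro!: Xz_e Xz_f Xz_ti\<close>)
  then show ?thesis unfolding S fps_commute_const_iff by blast
qed

lemma Xz_rescale_commute: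
  assumes k: "1 \<le> k" "k < n" shows "rescale (Xz k) * Xz (Suc k) = Xz (Suc k) * rescale (Xz k)"
proof (rule fps_commuteI)
  fix i j
  have p: "(cq * cq) ^ i * x = x * (cq * cq) ^ i" for i x
    using power_commuting_commutes[of "cq * cq" x i] cq2_central by simp
  show "fps_nth (rescale (Xz k)) i * fps_nth (Xz (Suc k)) j = fps_nth (Xz (Suc k)) j * fps_nth (rescale (Xz k)) i"
    unfolding fps_scale_nth by (rule commute_mult[symmetric]) (simp_all only: p Xz_coeff_commute[OF k])
qed

text \<open>Below the last index, both the new factor and, by induction, the old product commute.
  For the last index two factors X_(m+1)(z) X_m(q^2 z) are split off: they commute only as a pair,
  and the rest is of too low rank to interact.\<close>

lemma Az_central:
  "m \<le> n \<Longrightarrow> 1 \<le> i \<Longrightarrow> i < m \<Longrightarrow> fps_const (e i) * Az m = Az m * fps_const (e i)"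
  "m \<le> n \<Longrightarrow> 1 \<le> i \<Longrightarrow> i < m \<Longrightarrow> fps_const (f i) * Az m = Az m * fps_const (f i)"
proof (induction m)
  case (Suc m)
  { case 1
    show ?case
    proof (cases "i < m")
      case True
      then show ?thesis using 1 Suc by (auto intro!: commute_mult rescale_commute Xz_e)
    next
      case False
      then have i: "i = m" using 1 by simp
      then obtain j where j: "m = Suc j" using 1 by (cases m) auto
      have a: "Az (Suc m) = Xz (Suc m) * rescale (Xz m) * rescale (rescale (Az j))"
        unfolding j by (simp add: rescale_simps mult.assoc)
      show ?thesis unfolding i a
      proof (rule commute_mult)
        show "fps_const (e m) * (Xz (Suc m) * rescale (Xz m)) = Xz (Suc m) * rescale (Xz m) * fps_const (e m)"
          using Xz_X'_e[of m] Xz_rescale_commute[of m] 1 i by simp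
        show "fps_const (e m) * rescale (rescale (Az j)) = rescale (rescale (Az j)) * fps_const (e m)"
          using 1 i j by (intro rescale_commute Az_high) auto
      qed
    qed
  next
    case 2
    show ?case
    proof (cases "i < m")
      case True
      then show ?thesis using 2 Suc by (auto intro!: commute_mult rescale_commute Xz_f)
    next
      case False
      then have i: "i = m" using 2 by simp
      then obtain j where j: "m = Suc j" using 2 by (cases m) auto
      have a: "Az (Suc m) = Xz (Suc m) * rescale (Xz m) * rescale (rescale (Az j))"
        unfolding j by (simp add: rescale_simps mult.assoc)
      show ?thesis unfolding i a
      proof (rule commute_mult)
        show "fps_const (f m) * (Xz (Suc m) * rescale (Xz m)) = Xz (Suc m) * rescale (Xz m) * fps_const (f m)"
          using Xz_X'_f[of m] 2 i by simp
        show "fps_const (f m) * rescale (rescale (Az j)) = rescale (rescale (Az j)) * fps_const (f m)"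
          using 2 i j by (intro rescale_commute Az_high) auto
      qed
    qed }
qed auto

lemma closed_Az:
  assumes "m \<le> n" "1 \<in> S" "0 \<in> S" "\<And>x y. x \<in> S \<Longrightarrow> y \<in> S \<Longrightarrow> x + y \<in> S" "\<And>x y. x \<in> S \<Longrightarrow> y \<in> S \<Longrightarrow> x - y \<in> S"
    "\<And>x y. x \<in> S \<Longrightarrow> y \<in> S \<Longrightarrow> x * y \<in> S" "\<And>x. x \<in> S \<Longrightarrow> qs x \<in> S"
    "\<And>i. 1 \<le> i \<Longrightarrow> i < m \<Longrightarrow> e i \<in> S" "\<And>i. 1 \<le> i \<Longrightarrow> i < m \<Longrightarrow> f i \<in> S" "\<And>i. i \<in> {1..m} \<Longrightarrow> ti i \<in> S"
  shows "fps_nth (Az m) i \<in> S"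
  using assms(1,8-10)
proof (induction m arbitrary: i)
  case (Suc m)
  have sums: "(\<And>c. c \<in> C \<Longrightarrow> g c \<in> S) \<Longrightarrow> sum g C \<in> S" for C :: "nat set" and g
    by (induction C rule: infinite_finite_induct) (use assms in auto)
  have "fps_nth (Xz (Suc m)) j \<in> S" for j
    by (rule closed_Xz) (use assms Suc.prems in auto)
  moreover have "(cq * cq) ^ j * fps_nth (Az m) j \<in> S" for j
  proof -
    have "(cq * cq) ^ j * x \<in> S" if "x \<in> S" for x
    proof (induction j)
      case (Suc j)
      have "(cq * cq) ^ Suc j * x = qs (qs ((cq * cq) ^ j * x))" by (simp add: qs_def mult.assoc)
      with Suc show ?case using assms by auto
    qed (use that in auto)
    moreover have "fps_nth (Az m) j \<in> S" using Suc by auto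
    ultimately show ?thesis by auto
  qed
  ultimately show ?case using assms by (auto simp: fps_mult_nth intro!: sums)
qed (use assms in auto)

end

section \<open>The quantum group as a type\<close>

lemma const_mult: "const c * const d = const (c * d)"
  by (simp add: const_def mult_single)
lemma const_add: "const (c + d) = const c + const d"
  by (simp add: const_def single_add)
lemma const_diff: "const (c - d) = const c - const d"
  by (simp add: const_def single_diff)
lemma const_1: "const 1 = 1" and const_0: "const 0 = 0" by (simp_all add: const_def)

lemma const_central: "const c * p = p * const c" for p :: "'g word \<Rightarrow>\<^sub>0 complex"
proof (induction p rule: update_induct)
  case const then show ?case by simp
next
  case (update f a b)
  have "Poly_Mapping.update a b f = f + Poly_Mapping.single a b"
    using update by (intro poly_mapping_eqI) (auto simp: lookup_update lookup_add lookup_single in_keys_iff when_def)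
  with update show ?case by (simp add: algebra_simps const_def mult_single)
qed

context
  fixes X :: "'g set"
begin

lemma free_simps: "(\<oplus>\<^bsub>free_algebra X\<^esub>) = (+)" "(\<otimes>\<^bsub>free_algebra X\<^esub>) = (*)"
  "\<zero>\<^bsub>free_algebra X\<^esub> = 0" "\<one>\<^bsub>free_algebra X\<^esub> = 1"
  by (simp_all add: free_algebra_def)

interpretation fa: ring "free_algebra X" by (rule free_algebra_ring)

lemma free_a_inv: "p \<in> carrier (free_algebra X) \<Longrightarrow> \<ominus>\<^bsub>free_algebra X\<^esub> p = - p"
  using fa.l_neg[of p] by (simp add: free_simps eq_neg_iff_add_eq_0)

lemma free_carrier:
  "p \<in> carrier (free_algebra X) \<Longrightarrow> q \<in> carrier (free_algebra X) \<Longrightarrow> p + q \<in> carrier (free_algebra X)"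
  "p \<in> carrier (free_algebra X) \<Longrightarrow> q \<in> carrier (free_algebra X) \<Longrightarrow> p * q \<in> carrier (free_algebra X)"
  "p \<in> carrier (free_algebra X) \<Longrightarrow> q \<in> carrier (free_algebra X) \<Longrightarrow> p - q \<in> carrier (free_algebra X)"
  "0 \<in> carrier (free_algebra X)" "1 \<in> carrier (free_algebra X)"
  "const c \<in> carrier (free_algebra X)" "g \<in> X \<Longrightarrow> gen g \<in> carrier (free_algebra X)"
proof -
  show "p \<in> carrier (free_algebra X) \<Longrightarrow> q \<in> carrier (free_algebra X) \<Longrightarrow> p + q \<in> carrier (free_algebra X)" for p q
    using fa.a_closed[of p q] by (simp add: free_simps)
  show "p \<in> carrier (free_algebra X) \<Longrightarrow> q \<in> carrier (free_algebra X) \<Longrightarrow> p * q \<in> carrier (free_algebra X)" for p q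
    using fa.m_closed[of p q] by (simp add: free_simps)
  show "p \<in> carrier (free_algebra X) \<Longrightarrow> q \<in> carrier (free_algebra X) \<Longrightarrow> p - q \<in> carrier (free_algebra X)" for p q
    using fa.minus_closed[of p q] by (simp add: free_simps a_minus_def free_a_inv)
  show "0 \<in> carrier (free_algebra X)" "1 \<in> carrier (free_algebra X)"
    using fa.zero_closed fa.one_closed by (simp_all add: free_simps)
  show "const c \<in> carrier (free_algebra X)" "g \<in> X \<Longrightarrow> gen g \<in> carrier (free_algebra X)"
    by (auto simp: const_def gen_def free_algebra_def zero_word_def)
qed

end

lemma lattice_simps: "i \<in> {1..n} \<Longrightarrow> eps i \<in> lattice n" "i \<in> {1..n} \<Longrightarrow> (\<lambda>k. - eps i k) \<in> lattice n"
  "i \<in> {1..n-1} \<Longrightarrow> alpha i \<in> lattice n" "i \<in> {1..n-1} \<Longrightarrow> (\<lambda>k. - alpha i k) \<in> lattice n" "(\<lambda>_. 0) \<in> lattice n"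
  "h \<in> lattice n \<Longrightarrow> h' \<in> lattice n \<Longrightarrow> (\<lambda>k. h k + h' k) \<in> lattice n" "h \<in> lattice n \<Longrightarrow> (\<lambda>k. - h k) \<in> lattice n"
  by (auto simp: lattice_def eps_def alpha_def)

lemma gen_carrier: "i \<in> {1..n-1} \<Longrightarrow> gen (E i) \<in> carrier (uq_free n)" "i \<in> {1..n-1} \<Longrightarrow> gen (F i) \<in> carrier (uq_free n)"
  "h \<in> lattice n \<Longrightarrow> gen (Q h) \<in> carrier (uq_free n)"
  by (auto intro!: free_carrier simp: uq_gens_def)

lemma uq_rels_carrier: "uq_rels n q \<subseteq> carrier (uq_free n)"
  unfolding uq_rels_def
  apply (intro Un_least subsetI)
  by (auto split: if_splits intro!: free_carrier(1-6) gen_carrier lattice_simps)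

lemma uq_ideal: "ideal (uq_ideal n q) (uq_free n)"
  unfolding uq_ideal_def by (rule ring.genideal_ideal[OF free_algebra_ring uq_rels_carrier])

lemma Uq_ring: "ring (Uq n q)"
  unfolding Uq_def by (rule ideal.quotient_is_ring[OF uq_ideal])

lemma uq_class_hom: "uq_class n q \<in> ring_hom (uq_free n) (Uq n q)"
  unfolding Uq_def uq_class_def[abs_def] by (rule ideal.rcos_ring_hom[OF uq_ideal])

lemma uq_class_simps:
  assumes "p \<in> carrier (uq_free n)" "p' \<in> carrier (uq_free n)"
  shows "uq_class n q (p + p') = uq_class n q p \<oplus>\<^bsub>Uq n q\<^esub> uq_class n q p'"
    "uq_class n q (p * p') = uq_class n q p \<otimes>\<^bsub>Uq n q\<^esub> uq_class n q p'"
    "uq_class n q p \<in> carrier (Uq n q)"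
  using ring_hom_add[OF uq_class_hom assms] ring_hom_mult[OF uq_class_hom assms] ring_hom_closed[OF uq_class_hom assms(1)]
  by (simp_all add: free_simps)

lemma uq_class_carrier [simp]: "p \<in> carrier (uq_free n) \<Longrightarrow> uq_class n q p \<in> carrier (Uq n q)"
  by (rule uq_class_simps(3))

lemma uq_class_1: "uq_class n q 1 = \<one>\<^bsub>Uq n q\<^esub>"
  using ring_hom_one[OF uq_class_hom] by (simp add: free_simps)

lemma uq_class_diff:
  assumes "p \<in> carrier (uq_free n)" "p' \<in> carrier (uq_free n)"
  shows "uq_class n q (p - p') = uq_class n q p \<ominus>\<^bsub>Uq n q\<^esub> uq_class n q p'"
proof -
  interpret U: ring "Uq n q" by (rule Uq_ring)
  have "uq_class n q p = uq_class n q (p - p') \<oplus>\<^bsub>Uq n q\<^esub> uq_class n q p'"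
    using uq_class_simps(1)[OF free_carrier(3)[OF assms] assms(2), of q] by simp
  moreover have "uq_class n q p \<in> carrier (Uq n q)" "uq_class n q p' \<in> carrier (Uq n q)" "uq_class n q (p - p') \<in> carrier (Uq n q)"
    using assms by (auto intro!: uq_class_simps free_carrier)
  ultimately show ?thesis by (simp add: a_minus_def U.a_assoc U.r_neg)
qed

lemma uq_class_eq:
  assumes "p - p' \<in> uq_rels n q" "p \<in> carrier (uq_free n)" "p' \<in> carrier (uq_free n)"
  shows "uq_class n q p = uq_class n q p'"
proof -
  have "p \<ominus>\<^bsub>uq_free n\<^esub> p' = p - p'" using assms by (simp add: a_minus_def free_a_inv free_simps)
  moreover have "p - p' \<in> uq_ideal n q"
    unfolding uq_ideal_def using ring.genideal_self[OF free_algebra_ring uq_rels_carrier] assms(1) by blast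
  ultimately show ?thesis
    unfolding uq_class_def using ring.quotient_eq_iff_same_a_r_cos[OF free_algebra_ring uq_ideal assms(2,3)] by simp
qed

text \<open>Identities in a quotient algebra cannot be computed with type class automation. All \<open>Uq n q\<close>
  are therefore packed into a single ring type; the extra complex factor provides \<open>0 \<noteq> 1\<close>.\<close>

typedef uqt = "{F :: (nat \<times> complex \<Rightarrow> (uq_gen word \<Rightarrow>\<^sub>0 complex) set) \<times> complex.
    \<forall>n q. fst F (n, q) \<in> carrier (Uq n q)}"
  using ring.ring_simprules(2)[OF Uq_ring] by (intro exI[of _ "(\<lambda>(n, q). \<zero>\<^bsub>Uq n q\<^esub>, 0)"]) auto

definition ucomp :: "nat \<Rightarrow> complex \<Rightarrow> uqt \<Rightarrow> (uq_gen word \<Rightarrow>\<^sub>0 complex) set" where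
  "ucomp n q u = fst (Rep_uqt u) (n, q)"
definition uscal :: "uqt \<Rightarrow> complex" where "uscal u = snd (Rep_uqt u)"
definition umk :: "(nat \<Rightarrow> complex \<Rightarrow> (uq_gen word \<Rightarrow>\<^sub>0 complex) set) \<Rightarrow> complex \<Rightarrow> uqt" where
  "umk g c = Abs_uqt (\<lambda>(n, q). g n q, c)"

lemma ucomp_carrier [simp, intro]: "ucomp n q u \<in> carrier (Uq n q)"
  using Rep_uqt[of u] by (auto simp: ucomp_def)

lemma ucomp_umk: "(\<And>n q. g n q \<in> carrier (Uq n q)) \<Longrightarrow> ucomp n q (umk g c) = g n q"
  and uscal_umk: "(\<And>n q. g n q \<in> carrier (Uq n q)) \<Longrightarrow> uscal (umk g c) = c"
  by (simp_all add: ucomp_def uscal_def umk_def Abs_uqt_inverse)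

lemma uqt_eqI: "(\<And>n q. ucomp n q u = ucomp n q v) \<Longrightarrow> uscal u = uscal v \<Longrightarrow> u = v"
  by (auto simp: ucomp_def uscal_def Rep_uqt_inject[symmetric] prod_eq_iff)

lemmas Uq_rules = ring.ring_simprules[OF Uq_ring]

instantiation uqt :: ring_1
begin
definition "0 = umk (\<lambda>n q. \<zero>\<^bsub>Uq n q\<^esub>) 0"
definition "1 = umk (\<lambda>n q. \<one>\<^bsub>Uq n q\<^esub>) 1"
definition "u + v = umk (\<lambda>n q. ucomp n q u \<oplus>\<^bsub>Uq n q\<^esub> ucomp n q v) (uscal u + uscal v)"
definition "u * v = umk (\<lambda>n q. ucomp n q u \<otimes>\<^bsub>Uq n q\<^esub> ucomp n q v) (uscal u * uscal v)"
definition "- u = umk (\<lambda>n q. \<ominus>\<^bsub>Uq n q\<^esub> ucomp n q u) (- uscal u)"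
definition "(u :: uqt) - v = u + - v"

lemma ucomp_simps_aux:
  "ucomp n q 0 = \<zero>\<^bsub>Uq n q\<^esub>" "ucomp n q 1 = \<one>\<^bsub>Uq n q\<^esub>" "ucomp n q (u + v) = ucomp n q u \<oplus>\<^bsub>Uq n q\<^esub> ucomp n q v"
  "ucomp n q (u * v) = ucomp n q u \<otimes>\<^bsub>Uq n q\<^esub> ucomp n q v" "ucomp n q (- u) = \<ominus>\<^bsub>Uq n q\<^esub> ucomp n q u"
  "uscal 0 = 0" "uscal 1 = 1" "uscal (u + v) = uscal u + uscal v" "uscal (u * v) = uscal u * uscal v" "uscal (- u) = - uscal u"
  unfolding zero_uqt_def one_uqt_def plus_uqt_def times_uqt_def uminus_uqt_def
  by (subst ucomp_umk uscal_umk; simp add: Uq_rules(1,2,3,5,6))+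

instance
proof
  fix a b c :: uqt
  show "a + b + c = a + (b + c)" "a + b = b + a" "0 + a = a" "- a + a = 0" "a * b * c = a * (b * c)"
     "1 * a = a" "a * 1 = a" "(a + b) * c = a * c + b * c" "a * (b + c) = a * b + a * c"
    by (rule uqt_eqI; simp add: ucomp_simps_aux Uq_rules monoid.r_one[OF ring.is_monoid[OF Uq_ring]] distrib_left distrib_right)+
  show "(0::uqt) \<noteq> 1" using ucomp_simps_aux(6,7) zero_neq_one[where 'a = complex] by metis
  show "a - b = a + - b" by (rule minus_uqt_def)
qed
end

lemma ucomp_diff: "ucomp n q (u - v) = ucomp n q u \<ominus>\<^bsub>Uq n q\<^esub> ucomp n q v" and uscal_diff: "uscal (u - v) = uscal u - uscal v"
  unfolding minus_uqt_def ucomp_simps_aux a_minus_def by simp_all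

lemmas ucomp_simps = ucomp_simps_aux ucomp_diff uscal_diff

lemma uq_scalar_carrier [simp]: "uq_scalar n q c \<in> carrier (Uq n q)"
  by (simp add: uq_scalar_def uq_class_simps(3) free_carrier)

definition usc :: "complex \<Rightarrow> uqt" where "usc c = umk (\<lambda>n q. uq_scalar n q c) c"

lemma ucomp_usc: "ucomp n q (usc c) = uq_class n q (const c)" "uscal (usc c) = c"
  unfolding usc_def by (simp_all add: ucomp_umk uscal_umk) (simp add: uq_scalar_def)

lemma uq_class_fold:
  assumes "p \<in> carrier (uq_free n)" "p' \<in> carrier (uq_free n)"
  shows "uq_class n q p \<oplus>\<^bsub>Uq n q\<^esub> uq_class n q p' = uq_class n q (p + p')"
    "uq_class n q p \<otimes>\<^bsub>Uq n q\<^esub> uq_class n q p' = uq_class n q (p * p')"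
    "uq_class n q p \<ominus>\<^bsub>Uq n q\<^esub> uq_class n q p' = uq_class n q (p - p')"
  using uq_class_simps[OF assms] uq_class_diff[OF assms] by simp_all

lemma uq_class_0: "\<zero>\<^bsub>Uq n q\<^esub> = uq_class n q 0"
  using uq_class_diff[where p = 0 and p' = 0 and n = n and q = q] uq_class_carrier[of 0 n q] by (simp add: free_carrier a_minus_def Uq_rules)

lemma uq_carrier_class: "x \<in> carrier (Uq n q) \<Longrightarrow> \<exists>p\<in>carrier (uq_free n). x = uq_class n q p"
  by (auto simp: Uq_def uq_class_def FactRing_def A_RCOSETS_def' )

lemma usc_simps: "usc (c + d) = usc c + usc d" "usc (c * d) = usc c * usc d" "usc (c - d) = usc c - usc d"
   "usc 1 = 1" "usc 0 = 0"
  by (rule uqt_eqI; simp add: ucomp_usc ucomp_simps uq_class_fold free_carrier const_add const_mult const_diff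
    const_1 const_0 uq_class_1 uq_class_0)+

lemma usc_central: "usc c * u = u * usc c"
proof (rule uqt_eqI)
  fix n q
  obtain p where "p \<in> carrier (uq_free n)" "ucomp n q u = uq_class n q p" using uq_carrier_class[OF ucomp_carrier] by blast
  then show "ucomp n q (usc c * u) = ucomp n q (u * usc c)"
    by (simp add: ucomp_simps ucomp_usc uq_class_fold free_carrier const_central)
qed (simp add: ucomp_simps)

lemma usc_qscalars:
  assumes "q \<noteq> 0" "q * q \<noteq> 1" "q * q \<noteq> -1"
  shows "qscalars (usc q) (usc (1 / q)) (usc (1 / (q - 1 / q)))"
proof
  have 1: "q - 1 / q \<noteq> 0" "q + 1 / q \<noteq> 0" using assms by (auto simp: field_simps eq_neg_iff_add_eq_0)
  show "usc q * usc (1 / q) = 1" "(usc q - usc (1 / q)) * usc (1 / (q - 1 / q)) = 1"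
    using assms 1 by (simp_all flip: usc_simps)
  fix x assume "(usc q + usc (1 / q)) * x = 0"
  then have "usc (1 / (q + 1 / q)) * (usc (q + 1 / q) * x) = 0" by (simp add: usc_simps)
  then have "usc (1 / (q + 1 / q) * (q + 1 / q)) * x = 0" by (simp only: usc_simps(2) mult.assoc)
  then show "x = 0" using 1 by (simp add: usc_simps)
qed (rule usc_central)+

definition ulift :: "nat \<Rightarrow> complex \<Rightarrow> (uq_gen word \<Rightarrow>\<^sub>0 complex) \<Rightarrow> uqt \<Rightarrow> uqt" where
  "ulift n q p u = umk (\<lambda>n' q'. if n' = n \<and> q' = q \<and> p \<in> carrier (uq_free n) then uq_class n q p else ucomp n' q' u) (uscal u)"

lemma ucomp_ulift: "ucomp n' q' (ulift n q p u) = (if n' = n \<and> q' = q \<and> p \<in> carrier (uq_free n) then uq_class n q p else ucomp n' q' u)"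
  and uscal_ulift: "uscal (ulift n q p u) = uscal u"
  unfolding ulift_def by (subst ucomp_umk uscal_umk; auto intro: uq_class_simps)+

text \<open>The defaults 0 and 1 in the other components are chosen so that the relations of the
  quantum group hold there trivially.\<close>

definition ue where "ue n q i = ulift n q (gen (E i)) 0"
definition uf where "uf n q i = ulift n q (gen (F i)) 0"
definition ut where "ut n q i = ulift n q (gen (Q (eps i))) 1"
definition uti where "uti n q i = ulift n q (gen (Q (\<lambda>k. - eps i k))) 1"

lemma uqt_eqI2: "ucomp n q u = ucomp n q v \<Longrightarrow> (\<And>n' q'. \<not> (n' = n \<and> q' = q) \<Longrightarrow> ucomp n' q' u = ucomp n' q' v)
    \<Longrightarrow> uscal u = uscal v \<Longrightarrow> u = v"
  by (rule uqt_eqI) metis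

lemma uq_rels_intros:
  "gen (Q (\<lambda>_. 0)) - 1 \<in> uq_rels n q"
  "h \<in> lattice n \<Longrightarrow> h' \<in> lattice n \<Longrightarrow> gen (Q h) * gen (Q h') - gen (Q (\<lambda>k. h k + h' k)) \<in> uq_rels n q"
  "h \<in> lattice n \<Longrightarrow> i \<in> {1..n - 1} \<Longrightarrow> gen (Q h) * gen (E i) * gen (Q (\<lambda>k. - h k))
        - const (q powi (pairing n h (alpha i))) * gen (E i) \<in> uq_rels n q"
  "h \<in> lattice n \<Longrightarrow> i \<in> {1..n - 1} \<Longrightarrow> gen (Q h) * gen (F i) * gen (Q (\<lambda>k. - h k))
        - const (q powi (- pairing n h (alpha i))) * gen (F i) \<in> uq_rels n q"
  "i \<in> {1..n - 1} \<Longrightarrow> gen (E i) * gen (F i) - gen (F i) * gen (E i)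
        - const (1 / (q - inverse q)) * (gen (Q (alpha i)) - gen (Q (\<lambda>k. - alpha i k))) \<in> uq_rels n q"
  "i \<in> {1..n - 1} \<Longrightarrow> j \<in> {1..n - 1} \<Longrightarrow> i \<noteq> j \<Longrightarrow> gen (E i) * gen (F j) - gen (F j) * gen (E i) \<in> uq_rels n q"
  "i \<in> {1..n - 1} \<Longrightarrow> j \<in> {1..n - 1} \<Longrightarrow> \<bar>int i - int j\<bar> = 1 \<Longrightarrow> g \<in> {E, F} \<Longrightarrow>
     gen (g i) * gen (g i) * gen (g j) - const (q + inverse q) * (gen (g i) * gen (g j) * gen (g i))
        + gen (g j) * gen (g i) * gen (g i) \<in> uq_rels n q"
  "i \<in> {1..n - 1} \<Longrightarrow> j \<in> {1..n - 1} \<Longrightarrow> \<bar>int i - int j\<bar> > 1 \<Longrightarrow> g \<in> {E, F} \<Longrightarrow>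
     gen (g i) * gen (g j) - gen (g j) * gen (g i) \<in> uq_rels n q"
proof -
  let ?c = "\<lambda>i j. if i = j then const (1 / (q - inverse q)) * (gen (Q (alpha i)) - gen (Q (\<lambda>k. - alpha i k))) else 0"
  have ef: "gen (E i) * gen (F j) - gen (F j) * gen (E i) - ?c i j \<in> uq_rels n q" if "i \<in> {1..n - 1}" "j \<in> {1..n - 1}" for i j
    using that unfolding uq_rels_def by blast
  show "i \<in> {1..n - 1} \<Longrightarrow> gen (E i) * gen (F i) - gen (F i) * gen (E i)
        - const (1 / (q - inverse q)) * (gen (Q (alpha i)) - gen (Q (\<lambda>k. - alpha i k))) \<in> uq_rels n q"
    using ef[of i i] by simp
  show "i \<in> {1..n - 1} \<Longrightarrow> j \<in> {1..n - 1} \<Longrightarrow> i \<noteq> j \<Longrightarrow> gen (E i) * gen (F j) - gen (F j) * gen (E i) \<in> uq_rels n q"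
    using ef[of i j] by simp
qed (unfold uq_rels_def, blast+)

lemma pairing_eps: "i \<in> {1..n} \<Longrightarrow> pairing n (eps i) (alpha j) = (if i = j then 1 else if i = Suc j then -1 else 0)"
  by (auto simp: pairing_def eps_def alpha_def if_distrib[of "\<lambda>x. x * _"] cong: if_cong)

context
  fixes n :: nat and q :: complex
begin

lemma ucomp_gens:
  "1 \<le> i \<Longrightarrow> i < n \<Longrightarrow> ucomp n q (ue n q i) = uq_class n q (gen (E i))"
  "1 \<le> i \<Longrightarrow> i < n \<Longrightarrow> ucomp n q (uf n q i) = uq_class n q (gen (F i))"
  "i \<in> {1..n} \<Longrightarrow> ucomp n q (ut n q i) = uq_class n q (gen (Q (eps i)))"
  "i \<in> {1..n} \<Longrightarrow> ucomp n q (uti n q i) = uq_class n q (gen (Q (\<lambda>k. - eps i k)))"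
  by (auto simp: ue_def uf_def ut_def uti_def ucomp_ulift gen_carrier lattice_simps)

lemma ucomp_other:
  "\<not> (n' = n \<and> q' = q) \<Longrightarrow> ucomp n' q' (ue n q i) = \<zero>\<^bsub>Uq n' q'\<^esub>" "\<not> (n' = n \<and> q' = q) \<Longrightarrow> ucomp n' q' (uf n q i) = \<zero>\<^bsub>Uq n' q'\<^esub>"
  "\<not> (n' = n \<and> q' = q) \<Longrightarrow> ucomp n' q' (ut n q i) = \<one>\<^bsub>Uq n' q'\<^esub>" "\<not> (n' = n \<and> q' = q) \<Longrightarrow> ucomp n' q' (uti n q i) = \<one>\<^bsub>Uq n' q'\<^esub>"
  "uscal (ue n q i) = 0" "uscal (uf n q i) = 0" "uscal (ut n q i) = 1" "uscal (uti n q i) = 1"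
  by (auto simp: ue_def uf_def ut_def uti_def ucomp_ulift uscal_ulift ucomp_simps)

lemmas ucl = uq_class_fold free_carrier gen_carrier lattice_simps
lemmas um = ucomp_simps ucomp_gens ucomp_usc ucl uq_class_1
lemmas uo = ucomp_simps ucomp_other ucomp_usc Uq_rules free_carrier

lemma ut_uti: "i \<in> {1..n} \<Longrightarrow> ut n q i * uti n q i = 1" and uti_ut: "i \<in> {1..n} \<Longrightarrow> uti n q i * ut n q i = 1"
proof -
  assume i: "i \<in> {1..n}"
  have 0: "uq_class n q (gen (Q (\<lambda>_. 0))) = uq_class n q 1"
    by (rule uq_class_eq[OF uq_rels_intros(1)]) (auto simp: ucl)
  have "uq_class n q (gen (Q (eps i)) * gen (Q (\<lambda>k. - eps i k))) = uq_class n q (gen (Q (\<lambda>k. eps i k + - eps i k)))"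
    by (rule uq_class_eq[OF uq_rels_intros(2)]) (use i in \<open>auto simp: ucl\<close>)
  then show "ut n q i * uti n q i = 1"
    using i 0 by (intro uqt_eqI2[of n q], simp add: um, simp add: uo, simp add: uo)
  have "uq_class n q (gen (Q (\<lambda>k. - eps i k)) * gen (Q (eps i))) = uq_class n q (gen (Q (\<lambda>k. - eps i k + eps i k)))"
    by (rule uq_class_eq[OF uq_rels_intros(2)]) (use i in \<open>auto simp: ucl\<close>)
  then show "uti n q i * ut n q i = 1"
    using i 0 by (intro uqt_eqI2[of n q], simp add: um, simp add: uo, simp add: uo)
qed

lemma ut_ut: "i \<in> {1..n} \<Longrightarrow> j \<in> {1..n} \<Longrightarrow> ut n q i * ut n q j = ut n q j * ut n q i"
proof -
  assume i: "i \<in> {1..n}" "j \<in> {1..n}"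
  have "uq_class n q (gen (Q (eps i)) * gen (Q (eps j))) = uq_class n q (gen (Q (\<lambda>k. eps i k + eps j k)))"
    by (rule uq_class_eq[OF uq_rels_intros(2)]) (use i in \<open>auto simp: ucl\<close>)
  moreover have "uq_class n q (gen (Q (eps j)) * gen (Q (eps i))) = uq_class n q (gen (Q (\<lambda>k. eps j k + eps i k)))"
    by (rule uq_class_eq[OF uq_rels_intros(2)]) (use i in \<open>auto simp: ucl\<close>)
  ultimately show ?thesis
    using i by (intro uqt_eqI2[of n q], simp add: um add.commute, simp add: uo, simp add: uo)
qed

lemma ut_ue: "i \<in> {1..n} \<Longrightarrow> 1 \<le> j \<Longrightarrow> j < n \<Longrightarrow> ut n q i * ue n q j = usc (q powi (pairing n (eps i) (alpha j))) * (ue n q j * ut n q i)"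
proof -
  assume i: "i \<in> {1..n}" "1 \<le> j" "j < n"
  have "uq_class n q (gen (Q (eps i)) * gen (E j) * gen (Q (\<lambda>k. - eps i k))) =
      uq_class n q (const (q powi (pairing n (eps i) (alpha j))) * gen (E j))"
    by (rule uq_class_eq[OF uq_rels_intros(3)]) (use i in \<open>auto simp: ucl\<close>)
  then have "ut n q i * ue n q j * uti n q i = usc (q powi (pairing n (eps i) (alpha j))) * ue n q j"
    using i by (intro uqt_eqI2[of n q], simp add: um, simp add: uo, simp add: uo)
  then have "ut n q i * ue n q j * (uti n q i * ut n q i) = usc (q powi (pairing n (eps i) (alpha j))) * ue n q j * ut n q i"
    by (simp add: mult.assoc[symmetric])
  then show ?thesis using uti_ut[OF i(1)] by (simp add: mult.assoc)
qed

lemma ut_uf: "i \<in> {1..n} \<Longrightarrow> 1 \<le> j \<Longrightarrow> j < n \<Longrightarrow> ut n q i * uf n q j = usc (q powi (- pairing n (eps i) (alpha j))) * (uf n q j * ut n q i)"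
proof -
  assume i: "i \<in> {1..n}" "1 \<le> j" "j < n"
  have "uq_class n q (gen (Q (eps i)) * gen (F j) * gen (Q (\<lambda>k. - eps i k))) =
      uq_class n q (const (q powi (- pairing n (eps i) (alpha j))) * gen (F j))"
    by (rule uq_class_eq[OF uq_rels_intros(4)]) (use i in \<open>auto simp: ucl\<close>)
  then have "ut n q i * uf n q j * uti n q i = usc (q powi (- pairing n (eps i) (alpha j))) * uf n q j"
    using i by (intro uqt_eqI2[of n q], simp add: um, simp add: uo, simp add: uo)
  then have "ut n q i * uf n q j * (uti n q i * ut n q i) = usc (q powi (- pairing n (eps i) (alpha j))) * uf n q j * ut n q i"
    by (simp add: mult.assoc[symmetric])
  then show ?thesis using uti_ut[OF i(1)] by (simp add: mult.assoc)
qed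

lemma ue_uf: "1 \<le> i \<Longrightarrow> i < n \<Longrightarrow> ue n q i * uf n q i - uf n q i * ue n q i =
   usc (1 / (q - inverse q)) * (ut n q i * uti n q (Suc i) - uti n q i * ut n q (Suc i))"
proof -
  assume i: "1 \<le> i" "i < n"
  then have I: "i \<in> {1..n}" "Suc i \<in> {1..n}" "i \<in> {1..n-1}" by auto
  have a: "alpha i = (\<lambda>k. eps i k + - eps (Suc i) k)" "(\<lambda>k. - alpha i k) = (\<lambda>k. - eps i k + eps (Suc i) k)"
    by (auto simp: alpha_def)
  have al: "(\<lambda>k. eps i k - eps (Suc i) k) \<in> lattice n" "(\<lambda>k. eps (Suc i) k - eps i k) \<in> lattice n"
    using I by (auto simp: lattice_def eps_def)
  have K: "uq_class n q (gen (Q (eps i)) * gen (Q (\<lambda>k. - eps (Suc i) k))) = uq_class n q (gen (Q (alpha i)))"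
    unfolding a by (rule uq_class_eq[OF uq_rels_intros(2)]) (use I al in \<open>auto simp: ucl\<close>)
  have Ki: "uq_class n q (gen (Q (\<lambda>k. - eps i k)) * gen (Q (eps (Suc i)))) = uq_class n q (gen (Q (\<lambda>k. - alpha i k)))"
    unfolding a(2) by (rule uq_class_eq[OF uq_rels_intros(2)]) (use I al in \<open>auto simp: ucl\<close>)
  have ef: "uq_class n q (gen (E i) * gen (F i) - gen (F i) * gen (E i)) = 
      uq_class n q (const (1 / (q - inverse q)) * (gen (Q (alpha i)) - gen (Q (\<lambda>k. - alpha i k))))"
    by (rule uq_class_eq[OF uq_rels_intros(5)]) (use I in \<open>auto simp: ucl\<close>)
  have "uq_class n q (const (1 / (q - inverse q)) * (gen (Q (alpha i)) - gen (Q (\<lambda>k. - alpha i k))))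
     = uq_class n q (const (1 / (q - inverse q))) \<otimes>\<^bsub>Uq n q\<^esub> (uq_class n q (gen (Q (alpha i))) \<ominus>\<^bsub>Uq n q\<^esub> uq_class n q (gen (Q (\<lambda>k. - alpha i k))))"
    using I by (simp add: ucl)
  then show ?thesis
    using i I ef unfolding K[symmetric] Ki[symmetric]
    by (intro uqt_eqI2[of n q], simp add: um, simp add: uo, simp add: uo)
qed

lemma ue_uf_comm: "1 \<le> i \<Longrightarrow> i < n \<Longrightarrow> 1 \<le> j \<Longrightarrow> j < n \<Longrightarrow> i \<noteq> j \<Longrightarrow> ue n q i * uf n q j = uf n q j * ue n q i"
proof -
  assume i: "1 \<le> i" "i < n" "1 \<le> j" "j < n" "i \<noteq> j"
  have "uq_class n q (gen (E i) * gen (F j)) = uq_class n q (gen (F j) * gen (E i))"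
    by (rule uq_class_eq[OF uq_rels_intros(6)]) (use i in \<open>auto simp: ucl\<close>)
  then show ?thesis
    using i by (intro uqt_eqI2[of n q], simp add: um, simp add: uo, simp add: uo)
qed

lemma ue_ue_comm: "1 \<le> i \<Longrightarrow> Suc i < j \<Longrightarrow> j < n \<Longrightarrow> ue n q i * ue n q j = ue n q j * ue n q i"
  and uf_uf_comm: "1 \<le> i \<Longrightarrow> Suc i < j \<Longrightarrow> j < n \<Longrightarrow> uf n q i * uf n q j = uf n q j * uf n q i"
proof -
  assume i: "1 \<le> i" "Suc i < j" "j < n"
  have "uq_class n q (gen (E i) * gen (E j)) = uq_class n q (gen (E j) * gen (E i))"
    by (rule uq_class_eq[OF uq_rels_intros(8)]) (use i in \<open>auto simp: ucl\<close>)
  then show "ue n q i * ue n q j = ue n q j * ue n q i"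
    using i by (intro uqt_eqI2[of n q], simp add: um, simp add: uo, simp add: uo)
  have "uq_class n q (gen (F i) * gen (F j)) = uq_class n q (gen (F j) * gen (F i))"
    by (rule uq_class_eq[OF uq_rels_intros(8)]) (use i in \<open>auto simp: ucl\<close>)
  then show "uf n q i * uf n q j = uf n q j * uf n q i"
    using i by (intro uqt_eqI2[of n q], simp add: um, simp add: uo, simp add: uo)
qed

lemma u_serre:
  assumes i: "1 \<le> i" "i < n" "1 \<le> j" "j < n" "i = Suc j \<or> j = Suc i"
    and g: "g = ue n q \<and> G = E \<or> g = uf n q \<and> G = F"
  shows "g i * g i * g j - usc (q + inverse q) * (g i * g j * g i) + g j * g i * g i = 0"
proof -
  have "uq_class n q (gen (G i) * gen (G i) * gen (G j) - const (q + inverse q) * (gen (G i) * gen (G j) * gen (G i))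
        + gen (G j) * gen (G i) * gen (G i)) = uq_class n q 0"
    by (rule uq_class_eq) (use i g uq_rels_intros(7)[of i n j G q] in \<open>auto simp: ucl\<close>)
  moreover have "ucomp n q (g i) = uq_class n q (gen (G i))" "ucomp n q (g j) = uq_class n q (gen (G j))"
     "gen (G i) \<in> carrier (uq_free n)" "gen (G j) \<in> carrier (uq_free n)"
    using i g by (auto simp: ucomp_gens ucl)
  moreover have "ucomp n' q' (g i) = \<zero>\<^bsub>Uq n' q'\<^esub>" "ucomp n' q' (g j) = \<zero>\<^bsub>Uq n' q'\<^esub>" if "\<not> (n' = n \<and> q' = q)" for n' q'
    using that g by (auto simp: ucomp_other)
  moreover have "uscal (g i) = 0" "uscal (g j) = 0" using g by (auto simp: ucomp_other)
  ultimately show ?thesis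
    by (intro uqt_eqI2[of n q], simp add: um uq_class_0[of n q], simp add: uo, simp add: uo)
qed

lemma uqt_uq_alg:
  assumes q: "q \<noteq> 0" "q * q \<noteq> 1" "q * q \<noteq> -1"
  shows "uq_alg (usc q) (usc (1 / q)) (usc (1 / (q - 1 / q))) n (ue n q) (uf n q) (ut n q) (uti n q)"
proof -
  interpret qscalars "usc q" "usc (1 / q)" "usc (1 / (q - 1 / q))" by (rule usc_qscalars[OF q])
  have sc: "usc (q powi 1) * x = qs x" "usc (q powi - 1) * x = qi x" "usc (q powi 0) * x = x" for x
    by (simp_all add: qs_def qi_def usc_simps power_int_minus inverse_eq_divide)
  have two: "usc (q + inverse q) * x = qs x + qi x" for x
    by (simp add: qs_def qi_def usc_simps inverse_eq_divide distrib_right)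
  have comm: "ut n q (Suc i) * uti n q i = uti n q i * ut n q (Suc i)" if "1 \<le> i" "i < n" for i
  proof -
    have i: "i \<in> {1..n}" "Suc i \<in> {1..n}" using that by auto
    have "uti n q i * (ut n q i * ut n q (Suc i)) * uti n q i = uti n q i * (ut n q (Suc i) * ut n q i) * uti n q i"
      using ut_ut[OF i] by simp
    moreover have "uti n q i * (ut n q i * x) = x" "x * ut n q i * uti n q i = x" for x
      using ut_uti[OF i(1)] uti_ut[OF i(1)] by (simp_all add: mult.assoc) (simp flip: mult.assoc)
    ultimately show ?thesis by (simp flip: mult.assoc)
  qed
  show ?thesis
  proof (unfold_locales, goal_cases)
    case (4 i j) then show ?case by (simp only: ut_ue pairing_eps) (simp add: sc[simplified] kap_def)
  next
    case (5 i j) then show ?case by (simp only: ut_uf pairing_eps) (simp add: sc[simplified] kapi_def)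
  next
    case (6 i) then show ?case using ue_uf[of i] comm[of i] by (simp add: ql_def inverse_eq_divide)
  next
    case (10 i j) then show ?case using u_serre[of i j "ue n q" E] by (simp add: two)
  next
    case (11 i j) then show ?case using u_serre[of i j "uf n q" F] by (simp add: two)
  qed (auto simp: ut_uti uti_ut ue_uf_comm intro: ut_ut ue_ue_comm uf_uf_comm)
qed

end

section \<open>Bases of tableaux\<close>

definition upd :: "tableau \<Rightarrow> pos \<Rightarrow> int \<Rightarrow> tableau" where
  "upd R p c = R(p := R p + of_int c)"

lemma upd_simps [simp]: "upd R p c p = R p + of_int c" "p' \<noteq> p \<Longrightarrow> upd R p c p' = R p'"
  by (auto simp: upd_def)

lemma upd_upd: "upd (upd R p c) p d = upd R p (c + d)" "upd R p 0 = R"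
  by (auto simp: upd_def)

lemma upd_commute: "p \<noteq> p' \<Longrightarrow> upd (upd R p c) p' d = upd (upd R p' d) p c"
  by (auto simp: upd_def)

lemma upd_eq_iff: "upd R p c = upd R p' c' \<longleftrightarrow> (c = c' \<and> p = p') \<or> (c = 0 \<and> c' = 0)"
proof
  assume A: "upd R p c = upd R p' c'"
  show "(c = c' \<and> p = p') \<or> (c = 0 \<and> c' = 0)"
    using fun_cong[OF A, of p] fun_cong[OF A, of p'] by (cases "p = p'") auto
qed (auto simp: upd_def)

locale gt_data =
  fixes n :: nat and q lq :: complex and C :: "relation set" and L :: tableau
  assumes q0: "q \<noteq> 0" and not_root: "\<And>k::nat. k \<ge> 1 \<Longrightarrow> q ^ k \<noteq> 1" and lq: "exp lq = q"
    and C_rel: "C \<subseteq> relations n" and L_sat: "satisfies n lq C L"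
begin

abbreviation B where "B \<equiv> basis n lq C L"
abbreviation qp where "qp \<equiv> qpow lq"

lemma qp_add: "qp (x + y) = qp x * qp y"
  by (simp add: qpow_def distrib_right exp_add)
lemma qp_diff: "qp (x - y) = qp x / qp y"
  by (simp add: qpow_def left_diff_distrib exp_diff)
lemma qp_minus: "qp (- x) = inverse (qp x)"
  by (simp add: qpow_def exp_minus)
lemma qp_0 [simp]: "qp 0 = 1" and qp_1 [simp]: "qp 1 = q" and qp_nz [simp]: "qp x \<noteq> 0"
  by (simp_all add: qpow_def lq)
lemma qp_nat: "qp (of_nat k) = q ^ k"
  by (induction k) (simp_all add: qp_add)
lemma qp_int_1: "qp (of_int k) = 1 \<Longrightarrow> k = 0"
proof (rule ccontr)
  assume A: "qp (of_int k) = 1" "k \<noteq> 0"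
  have "qp (of_nat (nat \<bar>k\<bar>)) = 1"
    using A by (cases "k \<ge> 0") (simp_all add: qp_minus)
  with A not_root[of "nat \<bar>k\<bar>"] show False by (simp only: qp_nat)
qed

section \<open>Integer offsets modulo half periods\<close>

lemma half_iff: "x \<in> half_one_set lq \<longleftrightarrow> qp (2 * x) = 1"
  by (auto simp: half_one_set_def one_set_def mult.commute[of _ 2] intro!: exI[of _ "2 * x"])

lemma int_half_iff: "(\<exists>x\<in>half_one_set lq. d = of_int k + x) \<longleftrightarrow> qp (2 * d) = qp (2 * of_int k)"
proof -
  have "(\<exists>x\<in>half_one_set lq. d = of_int k + x) \<longleftrightarrow> d - of_int k \<in> half_one_set lq"
    by (metis add_diff_cancel_left' add.commute diff_add_cancel)
  also have "\<dots> \<longleftrightarrow> qp (2 * d) = qp (2 * of_int k)"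
    by (simp add: half_iff right_diff_distrib qp_diff)
  finally show ?thesis .
qed

lemma qp2_int_eq: "qp (2 * of_int k) = qp (2 * of_int l) \<Longrightarrow> k = l"
proof -
  assume "qp (2 * of_int k) = qp (2 * of_int l)"
  then have "qp (of_int (2 * k - 2 * l)) = 1" by (simp add: qp_diff)
  from qp_int_1[OF this] show "k = l" by simp
qed

text \<open>The difference of the entries is \<open>k\<close> modulo \<open>half_one_set\<close>.
  Doubling the exponent turns this into one equation, and \<open>k\<close> is unique because q is
  not a root of unity.\<close>

definition off :: "tableau \<Rightarrow> pos \<Rightarrow> pos \<Rightarrow> int \<Rightarrow> bool" where
  "off R a b k \<longleftrightarrow> qp (2 * (R a - R b)) = qp (2 * of_int k)"

lemma off_unique: "off R a b k \<Longrightarrow> off R a b l \<Longrightarrow> k = l"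
  using qp2_int_eq by (auto simp: off_def)

lemma off_refl: "off R a a 0" by (simp add: off_def)

lemma off_trans: "off R a b k \<Longrightarrow> off R b c l \<Longrightarrow> off R a c (k + l)"
proof -
  assume "off R a b k" "off R b c l"
  moreover have "2 * (R a - R c) = 2 * (R a - R b) + 2 * (R b - R c)" by simp
  moreover have "2 * of_int (k + l) = 2 * of_int k + (2 * of_int l :: complex)" by simp
  ultimately show ?thesis unfolding off_def by (simp only: qp_add)
qed

lemma off_sym: "off R a b k \<Longrightarrow> off R b a (- k)"
proof -
  assume "off R a b k"
  moreover have "2 * (R b - R a) = - (2 * (R a - R b))" "2 * of_int (- k) = - (2 * of_int k :: complex)" by simp_all
  ultimately show ?thesis unfolding off_def by (simp only: qp_minus)
qed

lemma off_shift: "off (\<lambda>p. R p + of_int (z p)) a b k \<longleftrightarrow> off R a b (k - z a + z b)"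
proof -
  have "2 * (R a + of_int (z a) - (R b + of_int (z b))) = 2 * (R a - R b) + 2 * of_int (z a - z b)" by (simp add: algebra_simps)
  moreover have "2 * of_int k = 2 * of_int (k - z a + z b) + (2 * of_int (z a - z b) :: complex)" by simp
  ultimately show ?thesis unfolding off_def by (simp only: qp_add mult_cancel_right qp_nz) simp
qed

lemma sat_iff:
  "satisfies_rel lq R (Geq a b) \<longleftrightarrow> (\<exists>k\<ge>0. off R a b k)"
  "satisfies_rel lq R (Gtr a b) \<longleftrightarrow> (\<exists>k>0. off R a b k)"
  unfolding satisfies_rel.simps off_def int_half_iff[symmetric] by blast+

lemma sat_lower:
  assumes "r = Geq a b \<or> r = Gtr a b"
  shows "satisfies_rel lq T r \<longleftrightarrow> (\<exists>k\<ge>(if r = Geq a b then 0 else 1). off T a b k)"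
  using assms
proof
  assume "r = Geq a b"
  then show ?thesis by (simp only: sat_iff refl if_True)
next
  assume r: "r = Gtr a b"
  have "(0 < k) = (1 \<le> k)" for k :: int by auto
  then show ?thesis unfolding r sat_iff by simp
qed

lemma same_row_iff: "(\<exists>d. \<exists>x\<in>half_one_set lq. R (k, i) - R (k, j) = of_int d + x) \<longleftrightarrow> (\<exists>d. off R (k, i) (k, j) d)"
  unfolding off_def int_half_iff[symmetric] ..

text \<open>The second clause of \<open>satisfies\<close> sees entries only modulo integers and half
  periods, so it is inherited from \<open>L\<close> by all integer shifts.\<close>

lemma basis_iff:
  "R \<in> B \<longleftrightarrow> (\<exists>z\<in>shifts n. R = (\<lambda>p. L p + of_int (z p))) \<and> (\<forall>r\<in>C. satisfies_rel lq R r)"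
proof -
  have "satisfies n lq C R" if "\<forall>r\<in>C. satisfies_rel lq R r" "R = (\<lambda>p. L p + of_int (z p))" for z
    unfolding satisfies_def same_row_iff
  proof (intro conjI allI impI)
    fix k i j assume A: "(k, i) \<in> positions n \<and> (k, j) \<in> positions n \<and> i \<noteq> j \<and> (\<exists>d. off R (k, i) (k, j) d)"
    then have "\<exists>d. off L (k, i) (k, j) d" using that(2) off_shift by blast
    with A show "\<exists>D. indecomposable_component C D \<and> (k, i) \<in> vertices D \<and> (k, j) \<in> vertices D"
      using L_sat unfolding satisfies_def same_row_iff by blast
  qed (use that in auto)
  then have "satisfies n lq C R \<longleftrightarrow> (\<forall>r\<in>C. satisfies_rel lq R r)" if "R = (\<lambda>p. L p + of_int (z p))" for z
    using that unfolding satisfies_def[of n lq C R] by blast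
  then show ?thesis unfolding basis_def by blast
qed

lemma basisE:
  assumes "R \<in> B"
  obtains z where "z \<in> shifts n" "R = (\<lambda>p. L p + of_int (z p))"
  using assms by (auto simp: basis_iff)

lemma B_sat: "R \<in> B \<Longrightarrow> r \<in> C \<Longrightarrow> satisfies_rel lq R r"
  by (auto simp: basis_iff)

lemma upd_basis_iff:
  assumes "R \<in> B" "p \<in> positions (n - 1)"
  shows "upd R p c \<in> B \<longleftrightarrow> (\<forall>r\<in>C. satisfies_rel lq (upd R p c) r)"
proof -
  obtain z where z: "z \<in> shifts n" "R = (\<lambda>p. L p + of_int (z p))" using assms basisE by blast
  have "z(p := z p + c) \<in> shifts n" "upd R p c = (\<lambda>p'. L p' + of_int ((z(p := z p + c)) p'))"
    using z assms(2) by (auto simp: shifts_def upd_def)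
  then show ?thesis unfolding basis_iff by (metis (no_types, lifting))
qed

lemma rel_cases:
  assumes "r \<in> C"
  obtains (geq) i j j' where "r = Geq (i, j) (i - 1, j')" "1 \<le> j" "j \<le> i" "i \<le> n" "1 \<le> j'" "j' \<le> i - 1"
  | (gtr) i j j' where "r = Gtr (i - 1, j') (i, j)" "1 \<le> j" "j \<le> i" "i \<le> n" "1 \<le> j'" "j' \<le> i - 1"
  | (top) i j where "r = Geq (n, i) (n, j)" "1 \<le> i" "i \<le> n" "1 \<le> j" "j \<le> n" "i \<noteq> j"
  using assms C_rel unfolding relations_def by blast

lemma rel_distinct: "Geq a b \<in> C \<Longrightarrow> a \<noteq> b" "Gtr a b \<in> C \<Longrightarrow> a \<noteq> b"
  by (auto elim!: rel_cases)

lemma geq_rows: "Geq a b \<in> C \<Longrightarrow> fst a = Suc (fst b) \<or> fst a = n \<and> fst b = n"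
  by (erule rel_cases) auto
lemma gtr_rows: "Gtr a b \<in> C \<Longrightarrow> fst b = Suc (fst a)"
  by (erule rel_cases) auto

lemma sat_cong: "R a = R' a \<Longrightarrow> R b = R' b \<Longrightarrow> satisfies_rel lq R (Geq a b) = satisfies_rel lq R' (Geq a b)"
  "R a = R' a \<Longrightarrow> R b = R' b \<Longrightarrow> satisfies_rel lq R (Gtr a b) = satisfies_rel lq R' (Gtr a b)"
  unfolding sat_iff off_def by simp_all

lemma off_upd: "a \<noteq> b \<Longrightarrow> off (upd R p c) a b k \<longleftrightarrow> off R a b (k - (if a = p then c else 0) + (if b = p then c else 0))"
proof -
  have "upd R p c = (\<lambda>p'. R p' + of_int (if p' = p then c else 0))" by (auto simp: upd_def)
  then show ?thesis using off_shift[of R "\<lambda>p'. if p' = p then c else 0"] by simp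
qed

text \<open>A relation sees only two positions, so membership of a double shift is decided by the relations
  containing both shifted positions.\<close>

lemma upd2_basis:
  assumes R: "R \<in> B" "upd R p c \<in> B" "upd R p' c' \<in> B" and p: "p \<in> positions (n - 1)" "p' \<in> positions (n - 1)" "p \<noteq> p'"
    and both: "\<And>r. r \<in> C \<Longrightarrow> rel_positions r = {p, p'} \<Longrightarrow> satisfies_rel lq (upd (upd R p c) p' c') r"
  shows "upd (upd R p c) p' c' \<in> B"
  unfolding upd_basis_iff[OF R(2) p(2)]
proof
  fix r assume r: "r \<in> C"
  obtain a b where ab: "r = Geq a b \<or> r = Gtr a b" by (cases r) auto
  consider "p \<notin> {a, b}" | "p' \<notin> {a, b}" | "{a, b} = {p, p'}" using p(3) by blast
  then show "satisfies_rel lq (upd (upd R p c) p' c') r"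
  proof cases
    case 1
    then have "upd (upd R p c) p' c' a = upd R p' c' a" "upd (upd R p c) p' c' b = upd R p' c' b"
      by (auto simp: upd_def)
    then show ?thesis using ab B_sat[OF R(3) r] sat_cong by blast
  next
    case 2
    then have "upd (upd R p c) p' c' a = upd R p c a" "upd (upd R p c) p' c' b = upd R p c b"
      by (auto simp: upd_def)
    then show ?thesis using ab B_sat[OF R(2) r] sat_cong by blast
  next
    case 3
    moreover have "rel_positions r = {a, b}" using ab by (elim disjE) simp_all
    ultimately show ?thesis using both[OF r] by simp
  qed
qed

text \<open>A relation is tight if raising its smaller side by one breaks it. Along a chain of tight
  relations the difference grows at each strict relation, and each weak one descends a row since the
  top row is excluded. A cycle would have difference zero, hence only weak relations, yet it would
  end in a lower row.\<close>

lemma tight_acyclic: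
  assumes "finite S" "S \<subseteq> positions (n - 1)" "S \<noteq> {}"
  obtains p where "p \<in> S" "\<And>a. a \<in> S \<Longrightarrow> Geq a p \<in> C \<Longrightarrow> \<not> off R a p 0" "\<And>a. a \<in> S \<Longrightarrow> Gtr a p \<in> C \<Longrightarrow> \<not> off R a p 1"
proof -
  define T where "T = {(a, b). a \<in> S \<and> b \<in> S \<and> (Geq a b \<in> C \<and> off R a b 0 \<or> Gtr a b \<in> C \<and> off R a b 1)}"
  have "\<exists>k\<ge>0. off R a b k \<and> (k > 0 \<or> fst b < fst a)" if "(a, b) \<in> T\<^sup>+" for a b
    using that
  proof (induction rule: trancl_induct)
    case (base b)
    then show ?case
    proof (cases "Geq a b \<in> C \<and> off R a b 0")
      case True
      moreover have "fst a \<noteq> n" using base assms(2) by (auto simp: T_def positions_def)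
      ultimately show ?thesis using geq_rows[of a b] by auto
    next
      case False
      then show ?thesis using base by (auto simp: T_def intro!: exI[of _ 1])
    qed
  next
    case (step b c)
    then obtain k where k: "k \<ge> 0" "off R a b k" "k > 0 \<or> fst b < fst a" by blast
    show ?case
    proof (cases "Geq b c \<in> C \<and> off R b c 0")
      case True
      moreover have "fst b \<noteq> n" using step(2) assms(2) by (auto simp: T_def positions_def)
      ultimately have "off R a c (k + 0)" "fst c < fst b" using geq_rows[of b c] off_trans[OF k(2), of c 0] by auto
      then show ?thesis using k by (intro exI[of _ k]) auto
    next
      case False
      then have "off R a c (k + 1)" using step(2) off_trans[OF k(2), of c 1] by (auto simp: T_def)
      then show ?thesis using k by (intro exI[of _ "k + 1"]) auto
    qed
  qed
  then have "(a, a) \<notin> T\<^sup>+" for a using off_unique[OF off_refl] by fastforce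
  then have "acyclic T" by (auto simp: acyclic_def)
  moreover have "finite T" by (rule finite_subset[of _ "S \<times> S"]) (use assms in \<open>auto simp: T_def\<close>)
  ultimately have "wf T" by (rule finite_acyclic_wf[rotated])
  then obtain p where "p \<in> S" "\<And>a. (a, p) \<in> T \<Longrightarrow> a \<notin> S" using assms(3) wf_eq_minimal[of T] by (metis all_not_in_conv)
  then show ?thesis unfolding T_def by (intro that[of p]) blast+
qed

text \<open>Raising \<open>p\<close> can only break a tight relation with \<open>p\<close> on its
  smaller side. As the target tableau satisfies that relation, its larger side must be raised at
  least as much and so lies in \<open>S\<close>; the choice of \<open>p\<close> excludes
  this.\<close>

lemma unit_step:
  assumes R: "R \<in> B" and R': "(\<lambda>p. R p + of_int (z p)) \<in> B" and z: "\<And>p. z p \<ge> 0" "z \<in> shifts n" "z p0 \<noteq> 0"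
  obtains p where "p \<in> positions (n - 1)" "z p > 0" "upd R p 1 \<in> B"
proof -
  define S where "S = {p. z p > 0}"
  have S: "S \<subseteq> positions (n - 1)" using z(2) by (force simp: S_def shifts_def)
  have "positions (n - 1) \<subseteq> {..n} \<times> {..n}" by (auto simp: positions_def)
  then have "finite S" using S by (meson finite_SigmaI finite_atMost finite_subset)
  moreover have "p0 \<in> S" using z(1)[of p0] z(3) by (auto simp: S_def)
  ultimately obtain p where p: "p \<in> S" "\<And>a. a \<in> S \<Longrightarrow> Geq a p \<in> C \<Longrightarrow> \<not> off R a p 0" "\<And>a. a \<in> S \<Longrightarrow> Gtr a p \<in> C \<Longrightarrow> \<not> off R a p 1"
    using tight_acyclic[OF _ S] by blast
  have pp: "p \<in> positions (n - 1)" "z p > 0" using p(1) S by (auto simp: S_def)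
  have "upd R p 1 \<in> B"
    unfolding upd_basis_iff[OF R pp(1)]
  proof
    fix r assume r: "r \<in> C"
    obtain a b where ab: "r = Geq a b \<or> r = Gtr a b" by (cases r) auto
    have ne: "a \<noteq> b" using ab r rel_distinct by metis
    define l :: int where "l = (if r = Geq a b then 0 else 1)"
    have sat: "satisfies_rel lq T r \<longleftrightarrow> (\<exists>k\<ge>l. off T a b k)" for T
      unfolding l_def by (rule sat_lower[OF ab])
    obtain k where k: "k \<ge> l" "off R a b k" using B_sat[OF R r] sat by blast
    obtain k' where k': "k' \<ge> l" "off R a b (k' - z a + z b)" using B_sat[OF R' r] sat off_shift by blast
    have kk: "k' = k + z a - z b" using off_unique[OF k(2) k'(2)] by simp
    show "satisfies_rel lq (upd R p 1) r"
    proof (cases "b = p")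
      case True
      have "k \<noteq> l"
      proof
        assume "k = l"
        then have "z a \<ge> z b" using kk k' by simp
        then have "a \<in> S" using True pp by (auto simp: S_def)
        then show False using p(2,3)[of a] True r ab k(2) \<open>k = l\<close> by (auto simp: l_def split: if_splits)
      qed
      then show ?thesis unfolding sat using k True ne
        by (intro exI[of _ "k - 1"]) (auto simp: off_upd)
    next
      case False
      then show ?thesis unfolding sat using k ne
        by (intro exI[of _ "if a = p then k + 1 else k"]) (auto simp: off_upd)
    qed
  qed
  with pp show ?thesis by (rule that)
qed

lemma path_induct:
  assumes R: "R \<in> B" and R': "R' \<in> B" and z: "R' = (\<lambda>p. R p + of_int (z p))" "\<And>p. z p \<ge> 0" "z \<in> shifts n"
    and refl: "\<And>R. R \<in> B \<Longrightarrow> Pr R R"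
    and step: "\<And>R p. R \<in> B \<Longrightarrow> p \<in> positions (n - 1) \<Longrightarrow> z p > 0 \<Longrightarrow> upd R p 1 \<in> B \<Longrightarrow> Pr R (upd R p 1)"
    and trans: "\<And>R R' R''. R \<in> B \<Longrightarrow> R' \<in> B \<Longrightarrow> R'' \<in> B \<Longrightarrow> Pr R R' \<Longrightarrow> Pr R' R'' \<Longrightarrow> Pr R R''"
  shows "Pr R R'"
proof -
  \<comment> \<open>The bound by \<open>z\<close> is kept in the claim so that every step made on
    the way occurs at a position where \<open>z\<close> is positive.\<close>
  have "Pr R (\<lambda>p. R p + of_int (y p))" if "R \<in> B" "(\<lambda>p. R p + of_int (y p)) \<in> B" "\<And>p. y p \<ge> 0" "\<And>p. y p \<le> z p"
      "N = (\<Sum>p\<in>positions (n - 1). nat (y p))" for y R N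
    using that
  proof (induction N arbitrary: y R rule: less_induct)
    case (less N)
    have y: "y \<in> shifts n"
      unfolding shifts_def
    proof (intro CollectI allI impI)
      fix p assume "p \<notin> positions (n - 1)"
      then have "z p = 0" using z(3) unfolding shifts_def by blast
      then show "y p = 0" using less.prems(3,4)[of p] by simp
    qed
    have fin: "finite (positions (n - 1))"
      by (rule finite_subset[of _ "{..n} \<times> {..n}"]) (auto simp: positions_def)
    show ?case
    proof (cases "\<forall>p. y p = 0")
      case True
      then have "(\<lambda>p. R p + of_int (y p)) = R" by (simp add: fun_eq_iff)
      then show ?thesis using refl[OF less.prems(1)] by simp
    next
      case False
      then obtain p0 where "y p0 \<noteq> 0" by blast
      then obtain p where p: "p \<in> positions (n - 1)" "y p > 0" "upd R p 1 \<in> B"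
        using unit_step[OF less.prems(1,2,3) y] by blast
      define y' where "y' = y(p := y p - 1)"
      have e: "(\<lambda>p. R p + of_int (y p)) = (\<lambda>p'. upd R p 1 p' + of_int (y' p'))"
        by (auto simp: y'_def upd_def)
      have lt: "(\<Sum>p\<in>positions (n - 1). nat (y' p)) < N"
        unfolding less.prems(5) by (rule sum_strict_mono_ex1[OF fin]) (use p in \<open>auto simp: y'_def\<close>)
      have "Pr (upd R p 1) (\<lambda>p'. upd R p 1 p' + of_int (y' p'))"
      proof (rule less.IH[OF lt p(3)])
        show "(\<lambda>p'. upd R p 1 p' + of_int (y' p')) \<in> B" using less.prems(2) e by simp
        show "y' p' \<ge> 0" "y' p' \<le> z p'" for p' using less.prems(3,4)[of p'] p by (auto simp: y'_def)
      qed simp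
      moreover have "Pr R (upd R p 1)"
        using less.prems(1) less.prems(4)[of p] p by (intro step) auto
      ultimately show ?thesis using trans[OF less.prems(1) p(3)] less.prems(2) unfolding e by blast
    qed
  qed
  then show ?thesis using R R' z by auto
qed

text \<open>Each relation bounds a difference of two shifts from below by a constant, and a system
  of such inequalities is closed under entrywise maxima.\<close>

lemma max_basis:
  assumes "z \<in> shifts n" "z' \<in> shifts n" "(\<lambda>p. L p + of_int (z p)) \<in> B" "(\<lambda>p. L p + of_int (z' p)) \<in> B"
  shows "(\<lambda>p. L p + of_int (max (z p) (z' p))) \<in> B"
  unfolding basis_iff
proof (intro conjI ballI bexI[of _ "\<lambda>p. max (z p) (z' p)"])
  fix r assume r: "r \<in> C"
  obtain a b where ab: "r = Geq a b \<or> r = Gtr a b" by (cases r) auto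
  define l :: int where "l = (if r = Geq a b then 0 else 1)"
  have sat: "satisfies_rel lq T r \<longleftrightarrow> (\<exists>k\<ge>l. off T a b k)" for T
    unfolding l_def by (rule sat_lower[OF ab])
  obtain k where k: "k \<ge> l" "off L a b (k - z a + z b)" using B_sat[OF assms(3) r] sat off_shift by blast
  obtain k' where k': "k' \<ge> l" "off L a b (k' - z' a + z' b)" using B_sat[OF assms(4) r] sat off_shift by blast
  have "k - z a + z b = k' - z' a + z' b" using off_unique[OF k(2) k'(2)] .
  moreover define K where "K = k - z a + z b + max (z a) (z' a) - max (z b) (z' b)"
  ultimately have "K \<ge> l" using k k' by (auto simp: max_def)
  moreover have "off L a b (K - max (z a) (z' a) + max (z b) (z' b))"
  proof -
    have "K - max (z a) (z' a) + max (z b) (z' b) = k - z a + z b" by (simp add: K_def)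
    then show ?thesis using k by (simp only:)
  qed
  ultimately show "satisfies_rel lq (\<lambda>p. L p + of_int (max (z p) (z' p))) r"
    unfolding sat off_shift by blast
qed (use assms in \<open>auto simp: shifts_def\<close>)

text \<open>The two tableaux are joined through their maximum, by \<open>path_induct\<close> applied to each of them.\<close>

lemma connect:
  assumes R: "R \<in> B" and R': "R' \<in> B" and S: "\<And>p. R p \<noteq> R' p \<Longrightarrow> S p"
    and refl: "\<And>R. R \<in> B \<Longrightarrow> Pr R R"
    and step: "\<And>R p. R \<in> B \<Longrightarrow> p \<in> positions (n - 1) \<Longrightarrow> S p \<Longrightarrow> upd R p 1 \<in> B \<Longrightarrow> Pr R (upd R p 1)"
    and sym: "\<And>R R'. R \<in> B \<Longrightarrow> R' \<in> B \<Longrightarrow> Pr R R' \<Longrightarrow> Pr R' R"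
    and trans: "\<And>R R' R''. R \<in> B \<Longrightarrow> R' \<in> B \<Longrightarrow> R'' \<in> B \<Longrightarrow> Pr R R' \<Longrightarrow> Pr R' R'' \<Longrightarrow> Pr R R''"
  shows "Pr R R'"
proof -
  obtain z where z: "z \<in> shifts n" "R = (\<lambda>p. L p + of_int (z p))" using R basisE by blast
  obtain z' where z': "z' \<in> shifts n" "R' = (\<lambda>p. L p + of_int (z' p))" using R' basisE by blast
  define M where "M = (\<lambda>p. L p + of_int (max (z p) (z' p)))"
  have M: "M \<in> B" unfolding M_def by (rule max_basis) (use R R' z z' in auto)
  have "Pr R M"
  proof (rule path_induct[OF R M, where z = "\<lambda>p. max (z p) (z' p) - z p"])
    fix R0 p assume "R0 \<in> B" "p \<in> positions (n - 1)" "0 < max (z p) (z' p) - z p" "upd R0 p 1 \<in> B"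
    moreover from this(3) have "z p \<noteq> z' p" by auto
    then have "R p \<noteq> R' p" unfolding z(2) z'(2) by simp
    ultimately show "Pr R0 (upd R0 p 1)" using step[OF _ _ S] by blast
  next
    show "(\<lambda>p. max (z p) (z' p) - z p) \<in> shifts n" using z(1) z'(1) by (simp add: shifts_def)
    show "M = (\<lambda>p. R p + of_int (max (z p) (z' p) - z p))"
      unfolding M_def z(2) by (rule ext) simp
    show "0 \<le> max (z p) (z' p) - z p" for p by simp
    show "Pr R R''" if "R \<in> B" "R' \<in> B" "R'' \<in> B" "Pr R R'" "Pr R' R''" for R R' R''
      using trans that by blast
  qed (rule refl)
  moreover have "Pr R' M"
  proof (rule path_induct[OF R' M, where z = "\<lambda>p. max (z p) (z' p) - z' p"])
    fix R0 p assume "R0 \<in> B" "p \<in> positions (n - 1)" "0 < max (z p) (z' p) - z' p" "upd R0 p 1 \<in> B"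
    moreover from this(3) have "z p \<noteq> z' p" by auto
    then have "R p \<noteq> R' p" unfolding z(2) z'(2) by simp
    ultimately show "Pr R0 (upd R0 p 1)" using step[OF _ _ S] by blast
  next
    show "(\<lambda>p. max (z p) (z' p) - z' p) \<in> shifts n" using z(1) z'(1) by (simp add: shifts_def)
    show "M = (\<lambda>p. R' p + of_int (max (z p) (z' p) - z' p))"
      unfolding M_def z'(2) by (rule ext) simp
    show "0 \<le> max (z p) (z' p) - z' p" for p by simp
    show "Pr R R''" if "R \<in> B" "R' \<in> B" "R'' \<in> B" "Pr R R'" "Pr R' R''" for R R' R''
      using trans that by blast
  qed (rule refl)
  ultimately show ?thesis using R R' M sym trans by blast
qed

end

section \<open>The order of the entries within a row\<close>

locale gt_nonsing = gt_data +
  assumes nonsing: "R \<in> basis n lq C L \<Longrightarrow> k \<in> {1..n-1} \<Longrightarrow> i \<in> {1..k} \<Longrightarrow> j \<in> {1..k} \<Longrightarrow> i \<noteq> j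
     \<Longrightarrow> \<not> off R (k, i) (k, j) 0"
begin

definition above :: "nat \<Rightarrow> tableau \<Rightarrow> nat \<Rightarrow> nat \<Rightarrow> bool" where
  "above m R i j \<longleftrightarrow> (\<exists>k>0. off R (m, i) (m, j) k)"

text \<open>A unit step changes an offset by at most one and the offset zero never occurs, so its
  sign cannot change.\<close>

lemma above_step:
  assumes "m \<in> {1..n-1}" "R \<in> B" "upd R p 1 \<in> B" "i \<in> {1..m}" "j \<in> {1..m}" "i \<noteq> j"
  shows "above m R i j \<longleftrightarrow> above m (upd R p 1) i j"
proof
  assume "above m R i j"
  then obtain k where k: "k > 0" "off R (m, i) (m, j) k" by (auto simp: above_def)
  define k' where "k' = k + (if (m, i) = p then 1 else 0) - (if (m, j) = p then 1 else 0)"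
  have k': "off (upd R p 1) (m, i) (m, j) k'"
    using k assms(6) by (subst off_upd) (auto simp: k'_def)
  moreover have "k' \<noteq> 0" using nonsing[OF assms(3,1,4-6)] k' by auto
  moreover have "k' \<ge> 0" using k by (auto simp: k'_def)
  ultimately show "above m (upd R p 1) i j" unfolding above_def by (intro exI[of _ k']) auto
next
  assume "above m (upd R p 1) i j"
  then obtain k where k: "k > 0" "off (upd R p 1) (m, i) (m, j) k" by (auto simp: above_def)
  define k' where "k' = k - (if (m, i) = p then 1 else 0) + (if (m, j) = p then 1 else 0)"
  have k': "off R (m, i) (m, j) k'"
    using k(2) assms(6) by (subst (asm) off_upd) (auto simp: k'_def)
  moreover have "k' \<noteq> 0" using nonsing[OF assms(2,1,4-6)] k' by auto
  moreover have "k' \<ge> 0" using k by (auto simp: k'_def)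
  ultimately show "above m R i j" unfolding above_def by (intro exI[of _ k']) auto
qed

lemma above_const:
  assumes "m \<in> {1..n-1}" "R \<in> B" "R' \<in> B" "i \<in> {1..m}" "j \<in> {1..m}" "i \<noteq> j"
  shows "above m R i j \<longleftrightarrow> above m R' i j"
  by (rule connect[OF assms(2,3), where S = "\<lambda>_. True"]) (use above_step assms in auto)

lemma above_irrefl: "\<not> above m R i i"
  using off_unique[OF off_refl] by (fastforce simp: above_def)

lemma above_trans: "above m R i j \<Longrightarrow> above m R j k \<Longrightarrow> above m R i k"
  unfolding above_def using off_trans by (metis add_pos_pos)

text \<open>A permutation matching two rows modulo \<open>half_one_set\<close> preserves the number of entries above a
  given one, and this number is the same for all tableaux of the basis.\<close>

lemma row_eq:
  assumes m: "m \<in> {1..n-1}" and R: "R \<in> B" "R' \<in> B" and bij: "bij_betw \<sigma> {1..m} {1..m}"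
    and eq: "\<And>i. i \<in> {1..m} \<Longrightarrow> qp (2 * (R (m, i) - R' (m, \<sigma> i))) = 1" and i: "i \<in> {1..m}"
  shows "R (m, i) = R' (m, i)"
proof -
  define rk where "rk T i = card {j \<in> {1..m}. above m T j i}" for T i
  have s: "\<sigma> j \<in> {1..m}" if "j \<in> {1..m}" for j using bij that by (auto simp: bij_betw_def)
  have ab: "above m R j i \<longleftrightarrow> above m R' (\<sigma> j) (\<sigma> i)" if "i \<in> {1..m}" "j \<in> {1..m}" for i j
  proof -
    have "2 * (R (m, j) - R (m, i)) = 2 * (R (m, j) - R' (m, \<sigma> j)) + 2 * (R' (m, \<sigma> j) - R' (m, \<sigma> i)) - 2 * (R (m, i) - R' (m, \<sigma> i))"
      by (simp add: algebra_simps)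
    then have "qp (2 * (R (m, j) - R (m, i))) = qp (2 * (R' (m, \<sigma> j) - R' (m, \<sigma> i)))"
      using eq[OF that(1)] eq[OF that(2)] by (simp only: qp_add qp_diff) simp
    then show ?thesis by (simp add: above_def off_def)
  qed
  have "rk R' (\<sigma> i) = rk R i" if i: "i \<in> {1..m}" for i
  proof -
    have "bij_betw \<sigma> {j \<in> {1..m}. above m R j i} {j \<in> {1..m}. above m R' j (\<sigma> i)}"
      unfolding bij_betw_def
    proof
      show "inj_on \<sigma> {j \<in> {1..m}. above m R j i}"
        using bij by (auto simp: bij_betw_def intro: inj_on_subset)
      show "\<sigma> ` {j \<in> {1..m}. above m R j i} = {j \<in> {1..m}. above m R' j (\<sigma> i)}"
      proof (intro equalityI subsetI)
        fix j' assume j': "j' \<in> {j \<in> {1..m}. above m R' j (\<sigma> i)}"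
        then obtain j where "j \<in> {1..m}" "j' = \<sigma> j" using bij unfolding bij_betw_def by blast
        then show "j' \<in> \<sigma> ` {j \<in> {1..m}. above m R j i}" using j' ab[OF i] by auto
      qed (use ab i s in auto)
    qed
    then show ?thesis unfolding rk_def by (simp add: bij_betw_same_card)
  qed
  moreover have "rk R' i = rk R i" if "i \<in> {1..m}" for i
  proof -
    have "{j \<in> {1..m}. above m R' j i} = {j \<in> {1..m}. above m R j i}"
      using above_const[OF m R] that above_irrefl by blast
    then show ?thesis by (simp add: rk_def)
  qed
  ultimately have rk: "rk R (\<sigma> i) = rk R i" using i s by metis
  have rk_lt: "rk R j < rk R k" if "above m R j k" "j \<in> {1..m}" for j k
    unfolding rk_def
  proof (rule psubset_card_mono)
    show "{i \<in> {1..m}. above m R i j} \<subset> {i \<in> {1..m}. above m R i k}"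
      using that above_trans above_irrefl by blast
  qed simp
  obtain z where z: "R = (\<lambda>p. L p + of_int (z p))" using R basisE by blast
  obtain z' where z': "R' = (\<lambda>p. L p + of_int (z' p))" using R basisE by blast
  have "\<sigma> i = i"
  proof (rule ccontr)
    assume ne: "\<sigma> i \<noteq> i"
    \<comment> \<open>\<open>R\<close> and \<open>R'\<close> differ by integers, so the entries i
      and \<open>\<sigma> i\<close> of \<open>R\<close> itself have an integer offset. It is
      nonzero, and either sign contradicts the equality of ranks.\<close>
    define d where "d = z' (m, \<sigma> i) - z (m, \<sigma> i)"
    have "2 * (R (m, i) - R (m, \<sigma> i)) = 2 * (R (m, i) - R' (m, \<sigma> i)) + 2 * of_int d"
      by (simp add: z z' d_def algebra_simps)
    then have o: "off R (m, i) (m, \<sigma> i) d" using eq[OF i] unfolding off_def by (simp only: qp_add) simp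
    then have "d \<noteq> 0" using nonsing[OF R(1) m i s[OF i]] ne by auto
    then have "above m R i (\<sigma> i) \<or> above m R (\<sigma> i) i"
      using o off_sym[OF o] unfolding above_def by (metis neg_0_less_iff_less linorder_neqE_linordered_idom)
    then show False using rk_lt i s[OF i] rk by (metis nat_neq_iff)
  qed
  then have "qp (2 * of_int (z (m, i) - z' (m, i))) = qp (2 * of_int 0)"
    using eq[OF i] by (simp add: z z')
  from qp2_int_eq[OF this] show ?thesis by (simp add: z z')
qed

end

section \<open>Matrix elements\<close>

locale gt_module = gt_data n q lq C L for n q lq C L +
  fixes act :: "(uq_gen word \<Rightarrow>\<^sub>0 complex) set \<Rightarrow> (tableau \<Rightarrow>\<^sub>0 complex) \<Rightarrow> (tableau \<Rightarrow>\<^sub>0 complex)"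
  assumes n2: "n \<ge> 2" and act_module: "uq_module n q (V_space n lq C L) act"
    and gt: "gt_formulas n q lq (basis n lq C L) act"
begin

abbreviation V where "V \<equiv> V_space n lq C L"

lemma q_squares: "q * q \<noteq> 1" "q * q \<noteq> -1" "q - inverse q \<noteq> 0"
proof -
  show a: "q * q \<noteq> 1" using not_root[of 2] by (simp add: power2_eq_square)
  have "q ^ 4 = (q * q) * (q * q)" by (simp add: eval_nat_numeral)
  then show "q * q \<noteq> -1" using not_root[of 4] by auto
  show "q - inverse q \<noteq> 0" using a q0 by (auto simp: field_simps)
qed

text \<open>Isolates the factor 1 - q^(-2d), which depends on d only modulo half periods and
  vanishes exactly for offset zero.\<close>

lemma qnum_eq: "qnum q lq d = qp d * (1 - inverse (qp (2 * d))) / (q - inverse q)"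
proof -
  have "qp (2 * d) = qp d * qp d" by (simp flip: qp_add)
  then have "qp d * (1 - inverse (qp (2 * d))) = qp d - qp (- d)"
    by (simp add: qp_minus right_diff_distrib)
  then show ?thesis by (simp add: qnum_def)
qed

sublocale gt_nonsing n q lq C L
proof
  fix R k i j assume "R \<in> B" "k \<in> {1..n-1}" "i \<in> {1..k}" "j \<in> {1..k}" "i \<noteq> j"
  then have "qnum q lq (R (k, i) - R (k, j)) \<noteq> 0" using gt unfolding gt_formulas_def by blast
  then show "\<not> off R (k, i) (k, j) 0" unfolding off_def by (auto simp: qnum_eq)
qed

sublocale uq: uq_alg "usc q" "usc (1 / q)" "usc (1 / (q - 1 / q))" n "ue n q" "uf n q" "ut n q" "uti n q"
  by (rule uqt_uq_alg[OF q0 q_squares(1,2)])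

sublocale r: rlm "usc q" "usc (1 / q)" "usc (1 / (q - 1 / q))" n "ue n q" "uf n q" "ut n q" "uti n q" uq.Qm uq.Pm
  by (rule uq.rlm_QP)

definition A where "A u v = act (ucomp n q u) v"
definition bv :: "tableau \<Rightarrow> tableau \<Rightarrow>\<^sub>0 complex" where "bv R = Poly_Mapping.single R 1"

lemma V_iff: "v \<in> V \<longleftrightarrow> (\<forall>R. Poly_Mapping.lookup v R \<noteq> 0 \<longrightarrow> R \<in> B)"
  by (auto simp: V_space_def in_keys_iff)

lemma V_closed: "0 \<in> V" "v \<in> V \<Longrightarrow> w \<in> V \<Longrightarrow> v + w \<in> V" "v \<in> V \<Longrightarrow> scl c v \<in> V"
  unfolding V_iff lookup_add by (simp, metis add.right_neutral, simp)

lemma V_sum: "(\<And>i. i \<in> I \<Longrightarrow> g i \<in> V) \<Longrightarrow> sum g I \<in> V"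
  by (induction I rule: infinite_finite_induct) (simp_all add: V_closed)

lemma bv_V: "R \<in> B \<Longrightarrow> bv R \<in> V"
  by (auto simp: V_iff bv_def lookup_single when_def)

lemma lookup_bv: "Poly_Mapping.lookup (bv R) R' = (if R = R' then 1 else 0)"
  by (simp add: bv_def lookup_single when_def)

lemma A_V: "v \<in> V \<Longrightarrow> A u v \<in> V"
  and A_add_right: "v \<in> V \<Longrightarrow> w \<in> V \<Longrightarrow> A u (v + w) = A u v + A u w"
  and A_add: "v \<in> V \<Longrightarrow> A (u + u') v = A u v + A u' v"
  and A_mult: "v \<in> V \<Longrightarrow> A (u * u') v = A u (A u' v)"
  and A_usc: "v \<in> V \<Longrightarrow> A (usc c) v = scl c v"
  using act_module ucomp_carrier[of n q] unfolding uq_module_def A_def ucomp_simps ucomp_usc uq_scalar_def[symmetric] by blast+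

text \<open>Homogeneity is not among the module axioms; it follows because the scalars act through
  central elements.\<close>

lemma A_scl: "v \<in> V \<Longrightarrow> A u (scl c v) = scl c (A u v)"
  using usc_central[of c u] by (metis A_V A_mult A_usc)

lemma A_one: "v \<in> V \<Longrightarrow> A 1 v = v" and A_zero: "v \<in> V \<Longrightarrow> A 0 v = 0"
  using A_usc[of v 1] A_usc[of v 0] by (simp_all add: usc_simps)

lemma A_diff: "v \<in> V \<Longrightarrow> A (u - u') v = A u v - A u' v"
  using A_add[of v "u - u'" u'] by simp

lemma A_zero_right: "A u 0 = 0"
  using A_scl[OF V_closed(1), of u 0] by simp

lemma A_sum_right: "(\<And>i. i \<in> I \<Longrightarrow> g i \<in> V) \<Longrightarrow> A u (sum g I) = (\<Sum>i\<in>I. A u (g i))"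
proof (induction I rule: infinite_finite_induct)
  case (insert x F)
  then have "sum g F \<in> V" "g x \<in> V" by (auto intro!: V_sum)
  with insert show ?case by (simp add: A_add_right)
qed (simp_all add: A_zero_right)

lemma A_sum: "v \<in> V \<Longrightarrow> A (sum g I) v = (\<Sum>i\<in>I. A (g i) v)"
  by (induction I rule: infinite_finite_induct) (simp_all add: A_zero A_add)

lemma expand: "finite S \<Longrightarrow> (\<And>R. Poly_Mapping.lookup v R \<noteq> 0 \<Longrightarrow> R \<in> S) \<Longrightarrow>
    v = (\<Sum>R\<in>S. scl (Poly_Mapping.lookup v R) (bv R))"
  by (rule poly_mapping_eqI) (auto simp: lookup_sum lookup_bv if_distrib cong: if_cong)

lemma A_expand:
  assumes "v \<in> V" "finite S" "\<And>R. Poly_Mapping.lookup v R \<noteq> 0 \<Longrightarrow> R \<in> S"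
  shows "A u v = (\<Sum>R\<in>S. scl (Poly_Mapping.lookup v R) (A u (bv R)))"
proof -
  have t: "scl (Poly_Mapping.lookup v R) (bv R) \<in> V" for R
    using assms(1) by (auto simp: V_iff lookup_bv split: if_splits)
  have s: "A u (scl (Poly_Mapping.lookup v R) (bv R)) = scl (Poly_Mapping.lookup v R) (A u (bv R))" for R
    using assms(1) A_scl[OF bv_V, of R u] by (cases "Poly_Mapping.lookup v R = 0") (auto simp: V_iff A_zero_right)
  have "A u v = A u (\<Sum>R\<in>S. scl (Poly_Mapping.lookup v R) (bv R))"
    using expand[OF assms(2,3)] by simp
  also have "\<dots> = (\<Sum>R\<in>S. A u (scl (Poly_Mapping.lookup v R) (bv R)))"
    by (rule A_sum_right) (rule t)
  finally show ?thesis by (simp only: s)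
qed

definition me where "me u R' R = Poly_Mapping.lookup (A u (bv R)) R'"

lemma me_simps:
  assumes "R \<in> B"
  shows "me (u + v) R' R = me u R' R + me v R' R" "me (u - v) R' R = me u R' R - me v R' R"
    "me 1 R' R = (if R = R' then 1 else 0)" "me 0 R' R = 0" "me (usc c * u) R' R = c * me u R' R"
    "me (sum g I) R' R = (\<Sum>i\<in>I. me (g i) R' R)"
  using assms by (simp_all add: me_def A_add A_diff A_one A_zero A_mult A_V A_usc bv_V lookup_add lookup_minus lookup_bv
     A_sum lookup_sum)

lemma me_outside: "R \<in> B \<Longrightarrow> me u R' R \<noteq> 0 \<Longrightarrow> R' \<in> B"
  using A_V[OF bv_V, of R u] by (auto simp: V_iff me_def)

text \<open>The basis may be infinite, but columns have finite support. Any finite set containing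
  the support is allowed, so that sums can be taken over the neighbours of a tableau.\<close>

lemma me_mult:
  assumes "R \<in> B" "finite S" "\<And>R''. me v R'' R \<noteq> 0 \<Longrightarrow> R'' \<in> S"
  shows "me (u * v) R' R = (\<Sum>R''\<in>S. me u R' R'' * me v R'' R)"
  unfolding me_def A_mult[OF bv_V[OF assms(1)]]
  by (subst A_expand[OF A_V[OF bv_V[OF assms(1)]] assms(2)])
    (use assms(3) in \<open>auto simp: me_def lookup_sum mult.commute\<close>)

lemma me_mult_keys:
  assumes "R \<in> B"
  shows "me (u * v) R' R = (\<Sum>R''\<in>Poly_Mapping.keys (A v (bv R)). me u R' R'' * me v R'' R)"
  by (rule me_mult[OF assms]) (auto simp: me_def in_keys_iff)

definition M :: "uqt fps \<Rightarrow> tableau \<Rightarrow> tableau \<Rightarrow> complex fps" where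
  "M U R' R = Abs_fps (\<lambda>i. me (fps_nth U i) R' R)"

lemma M_nth [simp]: "fps_nth (M U R' R) i = me (fps_nth U i) R' R" by (simp add: M_def)

lemma M_simps:
  assumes "R \<in> B"
  shows "M (U + W) R' R = M U R' R + M W R' R" "M (U - W) R' R = M U R' R - M W R' R"
    "M (fps_const u) R' R = fps_const (me u R' R)" "M 1 R' R = (if R = R' then 1 else 0)"
    "M (fps_X * U) R' R = fps_X * M U R' R" "M (fps_const (usc c) * U) R' R = fps_const c * M U R' R"
    "M (fps_scale (usc c) U) R' R = fps_scale c (M U R' R)"
proof -
  have "usc c ^ i = usc (c ^ i)" for i by (induction i) (simp_all add: usc_simps)
  then show "M (U + W) R' R = M U R' R + M W R' R" "M (U - W) R' R = M U R' R - M W R' R"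
    "M (fps_const u) R' R = fps_const (me u R' R)" "M 1 R' R = (if R = R' then 1 else 0)"
    "M (fps_X * U) R' R = fps_X * M U R' R" "M (fps_const (usc c) * U) R' R = fps_const c * M U R' R"
    "M (fps_scale (usc c) U) R' R = fps_scale c (M U R' R)"
    using assms by (auto simp: fps_eq_iff me_simps fps_one_nth)
qed

lemma M_mult:
  assumes R: "R \<in> B" and S: "finite S" "\<And>R''. M W R'' R \<noteq> 0 \<Longrightarrow> R'' \<in> S"
  shows "M (U * W) R' R = (\<Sum>R''\<in>S. M U R' R'' * M W R'' R)"
proof (rule fps_ext)
  fix i
  have "me (fps_nth U j * fps_nth W (i - j)) R' R = (\<Sum>R''\<in>S. me (fps_nth U j) R' R'' * me (fps_nth W (i - j)) R'' R)" for j
    by (rule me_mult[OF R S(1)]) (use S(2) in \<open>force simp: fps_eq_iff\<close>)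
  then show "fps_nth (M (U * W) R' R) i = fps_nth (\<Sum>R''\<in>S. M U R' R'' * M W R'' R) i"
    by (simp add: fps_mult_nth me_simps R fps_sum_nth) (rule sum.swap)
qed

lemma M_mult_diag:
  assumes "R \<in> B" "\<And>R''. R'' \<noteq> R \<Longrightarrow> M W R'' R = 0"
  shows "M (U * W) R' R = M U R' R * M W R R"
  using M_mult[OF assms(1), of "{R}" W U R'] assms(2) by auto

text \<open>The eigenvalue of K_k.\<close>

definition wgt where "wgt R k = qp (gt_weight R k - gt_weight R (Suc k))"

lemma A_t: "k \<in> {1..n} \<Longrightarrow> R \<in> B \<Longrightarrow> A (ut n q k) (bv R) = scl (qp (gt_weight R k)) (bv R)"
  using gt unfolding gt_formulas_def by (auto simp: A_def ucomp_gens tvec_def bv_def)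

lemma A_ti: "k \<in> {1..n} \<Longrightarrow> R \<in> B \<Longrightarrow> A (uti n q k) (bv R) = scl (inverse (qp (gt_weight R k))) (bv R)"
proof -
  assume k: "k \<in> {1..n}" "R \<in> B"
  have "bv R = A (uti n q k * ut n q k) (bv R)" using k by (simp add: uti_ut A_one bv_V)
  also have "\<dots> = scl (qp (gt_weight R k)) (A (uti n q k) (bv R))"
    using k by (simp add: A_mult bv_V A_t A_scl)
  finally have "scl (inverse (qp (gt_weight R k))) (bv R) = scl (inverse (qp (gt_weight R k)) * qp (gt_weight R k)) (A (uti n q k) (bv R))"
    by (metis tab.scale_scale)
  then show ?thesis by simp
qed

lemma me_ti2: "R \<in> B \<Longrightarrow> me (uti n q 1 * uti n q 1) R' R = (if R = R' then qp (- 2 * gt_weight R 1) else 0)"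
proof -
  have "qp (- 2 * w) = inverse (qp w) * inverse (qp w)" for w
    by (simp flip: qp_minus qp_add)
  then show "R \<in> B \<Longrightarrow> ?thesis" using n2
    by (simp add: me_def A_mult A_ti A_scl bv_V V_closed lookup_bv)
qed

lemma A_K:
  assumes "1 \<le> k" "k < n" "R \<in> B"
  shows "A (uq.K k) (bv R) = scl (wgt R k) (bv R)" "A (uq.Ki k) (bv R) = scl (inverse (wgt R k)) (bv R)"
  using assms unfolding uq.K_def uq.Ki_def
  by (auto simp: A_mult bv_V A_t A_ti A_scl V_closed wgt_def qp_diff field_simps)

lemma A_e: "1 \<le> k \<Longrightarrow> k < n \<Longrightarrow> R \<in> B \<Longrightarrow>
    A (ue n q k) (bv R) = - (\<Sum>j=1..k. scl (gt_e_coeff q lq R k j) (tvec B (upd R (k, j) 1)))"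
proof -
  assume k: "1 \<le> k" "k < n" "R \<in> B"
  then have "k \<in> {1..n-1}" by auto
  with k(3) show ?thesis using gt k unfolding gt_formulas_def by (simp add: A_def ucomp_gens tvec_def bv_def upd_def)
qed

lemma A_f: "1 \<le> k \<Longrightarrow> k < n \<Longrightarrow> R \<in> B \<Longrightarrow>
    A (uf n q k) (bv R) = (\<Sum>j=1..k. scl (gt_f_coeff q lq R k j) (tvec B (upd R (k, j) (-1))))"
proof -
  assume k: "1 \<le> k" "k < n" "R \<in> B"
  then have "k \<in> {1..n-1}" by auto
  with k(3) show ?thesis using gt k unfolding gt_formulas_def by (simp add: A_def ucomp_gens tvec_def bv_def upd_def)
qed

lemma lookup_tvec: "Poly_Mapping.lookup (tvec B R) R' = (if R = R' \<and> R \<in> B then 1 else 0)"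
  by (simp add: tvec_def lookup_single when_def)

lemma lookup_upd_sum:
  assumes "c \<noteq> 0"
  shows "Poly_Mapping.lookup (\<Sum>j=1..k. scl (g j) (tvec B (upd R (k, j) c))) R' \<noteq> 0 \<Longrightarrow> R' \<in> (\<lambda>j. upd R (k, j) c) ` {1..k}"
    "j \<in> {1..k} \<Longrightarrow> Poly_Mapping.lookup (\<Sum>j=1..k. scl (g j) (tvec B (upd R (k, j) c))) (upd R (k, j) c)
       = (if upd R (k, j) c \<in> B then g j else 0)"
proof -
  have l: "Poly_Mapping.lookup (\<Sum>j=1..k. scl (g j) (tvec B (upd R (k, j) c))) R' =
    (\<Sum>j=1..k. g j * (if upd R (k, j) c = R' \<and> upd R (k, j) c \<in> B then 1 else 0))" for R'
    by (simp add: lookup_sum lookup_tvec)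
  then show "Poly_Mapping.lookup (\<Sum>j=1..k. scl (g j) (tvec B (upd R (k, j) c))) R' \<noteq> 0 \<Longrightarrow> R' \<in> (\<lambda>j. upd R (k, j) c) ` {1..k}"
    by (auto elim!: sum.not_neutral_contains_not_neutral split: if_splits)
  assume j: "j \<in> {1..k}"
  have "(\<Sum>i=1..k. g i * (if upd R (k, i) c = upd R (k, j) c \<and> upd R (k, i) c \<in> B then 1 else 0)) =
     (\<Sum>i=1..k. if i = j then (if upd R (k, j) c \<in> B then g j else 0) else 0)"
    by (rule sum.cong) (auto simp: upd_eq_iff assms)
  then show "Poly_Mapping.lookup (\<Sum>j=1..k. scl (g j) (tvec B (upd R (k, j) c))) (upd R (k, j) c)
       = (if upd R (k, j) c \<in> B then g j else 0)" using j unfolding l by simp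
qed

lemma me_e:
  assumes "1 \<le> k" "k < n" "R \<in> B"
  shows "me (ue n q k) R' R \<noteq> 0 \<Longrightarrow> R' \<in> (\<lambda>j. upd R (k, j) 1) ` {1..k}"
    "j \<in> {1..k} \<Longrightarrow> me (ue n q k) (upd R (k, j) 1) R = - (if upd R (k, j) 1 \<in> B then gt_e_coeff q lq R k j else 0)"
  using lookup_upd_sum[of 1] unfolding me_def A_e[OF assms] lookup_uminus by simp_all

lemma me_F:
  assumes k: "1 \<le> k" "k < n" and R: "R \<in> B"
  shows "me (uf n q k * uq.K k) R' R = wgt R k * me (uf n q k) R' R"
  unfolding me_def A_mult[OF bv_V[OF R]] A_K(1)[OF k R] A_scl[OF bv_V[OF R]] lookup_scl ..

lemma me_f:
  assumes "1 \<le> k" "k < n" "R \<in> B"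
  shows "me (uf n q k) R' R \<noteq> 0 \<Longrightarrow> R' \<in> (\<lambda>j. upd R (k, j) (-1)) ` {1..k}"
    "j \<in> {1..k} \<Longrightarrow> me (uf n q k) (upd R (k, j) (-1)) R = (if upd R (k, j) (-1) \<in> B then gt_f_coeff q lq R k j else 0)"
  using lookup_upd_sum[of "-1"] unfolding me_def A_f[OF assms] by simp_all

end

section \<open>Eigenvalues of the Schur complements\<close>

definition lin :: "complex \<Rightarrow> complex fps" where "lin w = 1 - fps_const w * fps_X"
definition geo :: "complex \<Rightarrow> complex fps" where "geo w = fps_const w * fps_X * inverse (lin w)"

lemma lin_nth_0 [simp]: "fps_nth (lin w) 0 = 1" by (simp add: lin_def)
lemma lin_inverse: "lin w * inverse (lin w) = 1" "inverse (lin w) * lin w = 1"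
  by (simp_all add: inverse_mult_eq_1 inverse_mult_eq_1')
lemma geo_nth_0 [simp]: "fps_nth (geo w) 0 = 0"
  by (simp add: geo_def mult.assoc)
lemma lin_geo: "lin w * geo w = fps_const w * fps_X"
  using lin_inverse(1)[of w] by (simp add: geo_def mult.left_commute)
lemma lin_nz [simp]: "lin w \<noteq> 0" using lin_nth_0[of w] by (metis fps_zero_nth zero_neq_one)

text \<open>The partial fraction (1 - a z/c) / (1 - a z) = 1 + (1 - 1/c) a z / (1 - a z). With c =
  q^2 it expresses the effect of a unit step on an eigenvalue.\<close>

lemma lin_ratio:
  assumes "lin a * y = lin (a / c) * x"
  shows "y = x + fps_const (1 - 1 / c) * geo a * x"
proof -
  have "lin a * (x + fps_const (1 - 1 / c) * geo a * x) = (lin a + fps_const (1 - 1 / c) * (lin a * geo a)) * x"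
    by (simp only: distrib_left distrib_right mult_ac)
  also have "lin a + fps_const (1 - 1 / c) * (lin a * geo a) = lin (a / c)"
    unfolding lin_geo unfolding lin_def
    by (auto simp: fps_eq_iff fps_X_def algebra_simps simp flip: mult.assoc)
  finally have "lin a * (x + fps_const (1 - 1 / c) * geo a * x) = lin a * y" by (simp only: assms)
  then show ?thesis by simp
qed

text \<open>Both terms have their pole at z = 1/w. There the numerators are (1 - b/(c w)) (1 - b/w)
  in both cases, so the difference is divisible by \<open>lin w\<close> and the pole
  disappears.\<close>

lemma step_term:
  assumes w: "w \<noteq> 0"
  shows "lin (b / c) * (fps_const (\<pi> * (1 - b / w)) * geo w) - lin b * (fps_const (\<pi> * (1 - b / c / w)) * geo w)
     = - fps_const (\<pi> * (b - b / c)) * fps_X"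
proof -
  have "lin (b / c) * fps_const (1 - b / w) - lin b * fps_const (1 - b / c / w) = - fps_const ((b - b / c) / w) * lin w"
    unfolding lin_def using w
    by (auto simp: fps_eq_iff fps_X_def fps_one_nth algebra_simps diff_divide_distrib numeral_2_eq_2 split: nat.splits)
  then have "(lin (b / c) * fps_const (1 - b / w) - lin b * fps_const (1 - b / c / w)) * (fps_const \<pi> * geo w) =
      - fps_const ((b - b / c) / w) * fps_const \<pi> * (lin w * geo w)" by (simp only: mult_ac mult_minus_left)
  also have "\<dots> = - fps_const (\<pi> * (b - b / c)) * fps_X"
    unfolding lin_geo using w by (simp add: mult.commute flip: mult.assoc)
  finally have "(lin (b / c) * fps_const (1 - b / w) - lin b * fps_const (1 - b / c / w)) * (fps_const \<pi> * geo w)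
     = - fps_const (\<pi> * (b - b / c)) * fps_X" .
  moreover have "fps_const (\<pi> * x) = fps_const x * fps_const \<pi>" for x by (simp add: mult.commute)
  ultimately show ?thesis by (simp only: left_diff_distrib mult.assoc)
qed

text \<open>The hypotheses on the sums force \<open>\<Sum>\<pi> = -1\<close>, which is what makes the two rational functions
  proportional.\<close>

lemma rational_ratio:
  fixes p p' w :: "'i \<Rightarrow> complex"
  assumes "\<And>i. i \<in> J \<Longrightarrow> w i \<noteq> 0"
    and "\<And>i. i \<in> J \<Longrightarrow> \<exists>\<pi>. p i = \<pi> * (1 - b / w i) \<and> p' i = \<pi> * (1 - b / c / w i)"
    and "(\<Sum>i\<in>J. p i) = \<kappa> - 1" "(\<Sum>i\<in>J. p' i) = \<kappa> / c - 1" and c: "c \<noteq> 0" "c \<noteq> 1"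
  shows "lin b * (1 - (\<Sum>i\<in>J. fps_const (p' i) * geo (w i))) = lin (b / c) * (1 - (\<Sum>i\<in>J. fps_const (p i) * geo (w i)))"
proof -
  obtain \<pi> where \<pi>: "\<And>i. i \<in> J \<Longrightarrow> p i = \<pi> i * (1 - b / w i)" "\<And>i. i \<in> J \<Longrightarrow> p' i = \<pi> i * (1 - b / c / w i)"
    using assms(2) by metis
  have "(\<Sum>i\<in>J. p i) = (\<Sum>i\<in>J. \<pi> i) - b * (\<Sum>i\<in>J. \<pi> i / w i)"
    by (simp add: \<pi> algebra_simps sum_subtractf sum_distrib_left)
  moreover have "(\<Sum>i\<in>J. p' i) = (\<Sum>i\<in>J. \<pi> i) - b / c * (\<Sum>i\<in>J. \<pi> i / w i)"
    by (simp add: \<pi> algebra_simps sum_subtractf sum_distrib_left)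
  moreover from this have "c * (\<Sum>i\<in>J. p' i) = c * (\<Sum>i\<in>J. \<pi> i) - b * (\<Sum>i\<in>J. \<pi> i / w i)"
    using c by (simp add: right_diff_distrib)
  ultimately have "(c - 1) * (\<Sum>i\<in>J. \<pi> i) = c * (\<Sum>i\<in>J. p' i) - (\<Sum>i\<in>J. p i)" by (simp add: left_diff_distrib)
  also have "\<dots> = - (c - 1)" unfolding assms(3,4) using c by (simp add: field_simps)
  finally have s: "(\<Sum>i\<in>J. \<pi> i) = -1" using c by (metis mult_minus1_right mult_cancel_left right_minus_eq)
  have "lin (b / c) * (\<Sum>i\<in>J. fps_const (p i) * geo (w i)) - lin b * (\<Sum>i\<in>J. fps_const (p' i) * geo (w i)) =
     (\<Sum>i\<in>J. - fps_const (\<pi> i * (b - b / c)) * fps_X)"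
    unfolding sum_distrib_left sum_subtractf[symmetric]
  proof (rule sum.cong[OF refl])
    fix i assume i: "i \<in> J"
    show "lin (b / c) * (fps_const (p i) * geo (w i)) - lin b * (fps_const (p' i) * geo (w i)) = - fps_const (\<pi> i * (b - b / c)) * fps_X"
      unfolding \<pi>[OF i] by (rule step_term[OF assms(1)[OF i]])
  qed
  also have "\<dots> = - fps_const ((\<Sum>i\<in>J. \<pi> i) * (b - b / c)) * fps_X"
    by (simp only: sum_distrib_right fps_const_sum sum_negf mult_minus_left)
  also have "\<dots> = lin (b / c) - lin b"
    unfolding s lin_def by (simp add: algebra_simps flip: fps_const_sub)
  finally show ?thesis by (simp add: algebra_simps)
qed

section \<open>Loops through neighbouring tableaux, and compatible steps\<close>

context gt_module
begin

lemma M_mult_e: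
  assumes k: "1 \<le> k" "k < n" and R: "R \<in> B"
  shows "M (U * fps_const (ue n q k)) R' R =
    (\<Sum>j=1..k. M U R' (upd R (k, j) 1) * fps_const (me (ue n q k) (upd R (k, j) 1) R))"
proof -
  have "M (U * fps_const (ue n q k)) R' R = (\<Sum>R''\<in>(\<lambda>j. upd R (k, j) 1) ` {1..k}. M U R' R'' * M (fps_const (ue n q k)) R'' R)"
    by (rule M_mult[OF R]) (use me_e(1)[OF k R] in \<open>auto simp: M_simps R\<close>)
  also have "\<dots> = (\<Sum>j=1..k. M U R' (upd R (k, j) 1) * fps_const (me (ue n q k) (upd R (k, j) 1) R))"
    by (subst sum.reindex) (auto simp: inj_on_def upd_eq_iff M_simps R)
  finally show ?thesis .
qed

lemma M_mult_support_f:
  assumes R: "R \<in> B" and W: "\<And>R'. M W R' R \<noteq> 0 \<Longrightarrow> R' \<in> (\<lambda>j. upd R (k, j) (-1)) ` {1..k}"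
  shows "M (U * W) R' R = (\<Sum>j=1..k. M U R' (upd R (k, j) (-1)) * M W (upd R (k, j) (-1)) R)"
proof -
  have "M (U * W) R' R = (\<Sum>R''\<in>(\<lambda>j. upd R (k, j) (-1)) ` {1..k}. M U R' R'' * M W R'' R)"
    by (rule M_mult[OF R]) (use W in auto)
  also have "\<dots> = (\<Sum>j=1..k. M U R' (upd R (k, j) (-1)) * M W (upd R (k, j) (-1)) R)"
    by (subst sum.reindex) (auto simp: inj_on_def upd_eq_iff)
  finally show ?thesis .
qed

text \<open>Up to sign, the contributions of the loops through the neighbours of \<open>R\<close> in
  row k to the diagonals of f_k e_k (\<open>hp\<close>) and e_k f_k (\<open>hm\<close>).\<close>

definition hp where
  "hp R k j = (if upd R (k, j) 1 \<in> B then gt_e_coeff q lq R k j * gt_f_coeff q lq (upd R (k, j) 1) k j else 0)"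
definition hm where
  "hm R k j = (if upd R (k, j) (-1) \<in> B then gt_f_coeff q lq R k j * gt_e_coeff q lq (upd R (k, j) (-1)) k j else 0)"

lemma me_ef:
  assumes k: "1 \<le> k" "k < n" and R: "R \<in> B" and j: "j \<in> {1..k}"
  shows "me (ue n q k) R (upd R (k, j) (-1)) * me (uf n q k) (upd R (k, j) (-1)) R = - hm R k j"
    "me (uf n q k) R (upd R (k, j) 1) * me (ue n q k) (upd R (k, j) 1) R = - hp R k j"
  using me_e(2)[OF k R j] me_f(2)[OF k R j]
    me_e(2)[OF k, of "upd R (k, j) (-1)", OF _ j] me_f(2)[OF k, of "upd R (k, j) 1", OF _ j] R
  by (auto simp: hm_def hp_def upd_upd)

text \<open>The diagonal coefficient of the relation for e_k f_k - f_k e_k. That the formulas define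
  a module thus replaces a summation identity for products of quantum integers.\<close>

lemma sum_hp_hm:
  assumes k: "1 \<le> k" "k < n" and R: "R \<in> B"
  shows "(\<Sum>j=1..k. hp R k j) - (\<Sum>j=1..k. hm R k j) = (wgt R k - inverse (wgt R k)) / (q - 1 / q)"
proof -
  have 1: "me (ue n q k * uf n q k) R R = (\<Sum>j=1..k. - hm R k j)"
  proof -
    have "me (ue n q k * uf n q k) R R = (\<Sum>R''\<in>(\<lambda>j. upd R (k, j) (-1)) ` {1..k}. me (ue n q k) R R'' * me (uf n q k) R'' R)"
      by (rule me_mult[OF R]) (use me_f(1)[OF k R] in auto)
    also have "\<dots> = (\<Sum>j=1..k. - hm R k j)"
      by (subst sum.reindex) (auto simp: inj_on_def upd_eq_iff me_ef[OF k R] intro!: sum.cong)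
    finally show ?thesis .
  qed
  have 2: "me (uf n q k * ue n q k) R R = (\<Sum>j=1..k. - hp R k j)"
  proof -
    have "me (uf n q k * ue n q k) R R = (\<Sum>R''\<in>(\<lambda>j. upd R (k, j) 1) ` {1..k}. me (uf n q k) R R'' * me (ue n q k) R'' R)"
      by (rule me_mult[OF R]) (use me_e(1)[OF k R] in auto)
    also have "\<dots> = (\<Sum>j=1..k. - hp R k j)"
      by (subst sum.reindex) (auto simp: inj_on_def upd_eq_iff me_ef[OF k R] intro!: sum.cong)
    finally show ?thesis .
  qed
  have 3: "ue n q k * uf n q k - uf n q k * ue n q k = usc (1 / (q - 1 / q)) * (uq.K k - uq.Ki k)"
    using uq.e_f[OF k] uq.t_ti_comm[of "Suc k" k] k by (simp add: uq.ql_def uq.K_def uq.Ki_def)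
  have "me (uq.K k) R R = wgt R k" "me (uq.Ki k) R R = inverse (wgt R k)"
    unfolding me_def A_K[OF k R] by (simp_all add: lookup_bv)
  then have "me (ue n q k * uf n q k - uf n q k * ue n q k) R R = (wgt R k - inverse (wgt R k)) / (q - 1 / q)"
    unfolding 3 me_simps(5)[OF R] me_simps(2)[OF R] by simp
  then show ?thesis unfolding me_simps(2)[OF R] 1 2 by (simp add: sum_negf)
qed

lemma gt_weight_upd:
  "gt_weight (upd R (l, s) c) i = gt_weight R i + (if l = i \<and> s \<in> {1..i} then of_int c else 0)
     - (if l = i - 1 \<and> s \<in> {1..i-1} then of_int c else 0)"
proof -
  have *: "(\<Sum>j=1..k. upd R (l, s) c (i, j)) = (\<Sum>j=1..k. R (i, j)) + (if l = i \<and> s \<in> {1..k} then of_int c else 0)" for i k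
  proof -
    have "(\<Sum>j=1..k. upd R (l, s) c (i, j)) = (\<Sum>j=1..k. R (i, j) + (if j = s then (if l = i then of_int c else 0) else 0))"
      by (rule sum.cong) (auto simp: upd_def)
    also have "\<dots> = (\<Sum>j=1..k. R (i, j)) + (if l = i \<and> s \<in> {1..k} then of_int c else 0)"
      by (auto simp: sum.distrib)
    finally show ?thesis .
  qed
  show ?thesis unfolding gt_weight_def * by simp
qed

lemma wgt_upd:
  "1 \<le> k \<Longrightarrow> s \<in> {1..Suc k} \<Longrightarrow> wgt (upd R (Suc k, s) 1) k = wgt R k / q"
  "1 \<le> k \<Longrightarrow> s \<in> {1..k} \<Longrightarrow> wgt (upd R (k, s) 1) k = q * q * wgt R k"
  "1 \<le> k \<Longrightarrow> Suc k < l \<Longrightarrow> wgt (upd R (l, s) 1) k = wgt R k"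
proof -
  have e: "qp (2 + x) = q * q * qp x" "qp (x + 1 - (y - 1)) = q * q * qp (x - y)" "qp (x - (y + 1)) = qp (x - y) / q" for x y
    using qp_nat[of 2] by (simp_all add: qp_add qp_diff power2_eq_square)
  show "1 \<le> k \<Longrightarrow> s \<in> {1..Suc k} \<Longrightarrow> wgt (upd R (Suc k, s) 1) k = wgt R k / q"
    "1 \<le> k \<Longrightarrow> s \<in> {1..k} \<Longrightarrow> wgt (upd R (k, s) 1) k = q * q * wgt R k"
    "1 \<le> k \<Longrightarrow> Suc k < l \<Longrightarrow> wgt (upd R (l, s) 1) k = wgt R k"
    unfolding wgt_def gt_weight_upd by (auto simp: e)
qed

lemma wgt_nz [simp]: "wgt R k \<noteq> 0" by (simp add: wgt_def)

text \<open>The coefficient of e_k without the one factor that changes when the entry (k+1, s) is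
  moved.\<close>

definition ec where
  "ec R k j s = (\<Prod>i \<in> {1..Suc k} - {s}. qnum q lq (R (Suc k, i) - R (k, j)))
       / (\<Prod>i \<in> {1..k} - {j}. qnum q lq (R (k, i) - R (k, j)))"

lemma e_coeff_split:
  assumes "s \<in> {1..Suc k}"
  shows "gt_e_coeff q lq R k j = qnum q lq (R (Suc k, s) - R (k, j)) * ec R k j s"
  using prod.remove[of "{1..Suc k}" s "\<lambda>i. qnum q lq (R (Suc k, i) - R (k, j))"] assms
  unfolding gt_e_coeff_def ec_def Suc_eq_plus1[symmetric] by simp

lemma ec_upd: "ec (upd R (Suc k, s) c) k j s = ec R k j s"
proof -
  have "(\<Prod>i \<in> {1..Suc k} - {s}. qnum q lq (upd R (Suc k, s) c (Suc k, i) - upd R (Suc k, s) c (k, j))) =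
    (\<Prod>i \<in> {1..Suc k} - {s}. qnum q lq (R (Suc k, i) - R (k, j)))"
    by (rule prod.cong) auto
  then show ?thesis by (simp add: ec_def)
qed

lemma f_coeff_upd: "k < l \<Longrightarrow> gt_f_coeff q lq (upd R (l, s) c) k j = gt_f_coeff q lq R k j"
proof -
  assume "k < l"
  then have "k - 1 \<noteq> l" "k \<noteq> l" by auto
  then show ?thesis by (simp add: gt_f_coeff_def)
qed

lemma e_coeff_upd: "Suc k < l \<Longrightarrow> gt_e_coeff q lq (upd R (l, s) c) k j = gt_e_coeff q lq R k j"
  by (simp add: gt_e_coeff_def)

text \<open>Apart from those inside the top row, relations join adjacent rows only.\<close>

lemma upd2_far:
  assumes R: "R \<in> B" "upd R (k, j) c \<in> B" "upd R (l, s) c' \<in> B"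
    and p: "1 \<le> j" "j \<le> k" "1 \<le> s" "s \<le> l" "Suc k < l" "l < n"
  shows "upd (upd R (k, j) c) (l, s) c' \<in> B"
proof (rule upd2_basis[OF R])
  fix r assume r: "r \<in> C" "rel_positions r = {(k, j), (l, s)}"
  obtain a b where ab: "r = Geq a b \<or> r = Gtr a b" by (cases r) auto
  then have "rel_positions r = {a, b}" by (elim disjE) simp_all
  then have "{a, b} = {(k, j), (l, s)}" using r(2) by simp
  then have "a = (k, j) \<and> b = (l, s) \<or> a = (l, s) \<and> b = (k, j)" by (auto simp: doubleton_eq_iff)
  with ab r(1) have False using geq_rows[of a b] gtr_rows[of a b] p by auto
  then show "satisfies_rel lq (upd (upd R (k, j) c) (l, s) c') r" ..
qed (use p in \<open>auto simp: positions_def\<close>)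

text \<open>Only the relations (k+1, s) >= (k, j) and (k, j) > (k+1, s) can join the two positions.
  Each becomes an inequality for the integer offset \<open>d\<close>, left as a hypothesis.\<close>

lemma upd2_near:
  assumes R: "R \<in> B" "upd R (Suc k, s) c \<in> B" "upd R (k, j) c' \<in> B"
    and p: "1 \<le> j" "j \<le> k" "1 \<le> s" "s \<le> Suc k" "Suc k < n"
    and geq: "\<And>d. off R (Suc k, s) (k, j) d \<Longrightarrow> d \<ge> 0 \<Longrightarrow> d + c \<ge> 0 \<Longrightarrow> d - c' \<ge> 0 \<Longrightarrow> d + c - c' \<ge> 0"
    and gtr: "\<And>d. off R (k, j) (Suc k, s) d \<Longrightarrow> d > 0 \<Longrightarrow> d - c > 0 \<Longrightarrow> d + c' > 0 \<Longrightarrow> d - c + c' > 0"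
  shows "upd (upd R (Suc k, s) c) (k, j) c' \<in> B"
proof (rule upd2_basis[OF R])
  fix r assume r: "r \<in> C" "rel_positions r = {(Suc k, s), (k, j)}"
  obtain a b where ab: "r = Geq a b \<or> r = Gtr a b" by (cases r) auto
  then have "rel_positions r = {a, b}" by (elim disjE) simp_all
  then have "{a, b} = {(Suc k, s), (k, j)}" using r(2) by simp
  then have "a = (k, j) \<and> b = (Suc k, s) \<or> a = (Suc k, s) \<and> b = (k, j)" by (auto simp: doubleton_eq_iff)
  with ab r(1) have "r = Geq (Suc k, s) (k, j) \<or> r = Gtr (k, j) (Suc k, s)"
    using geq_rows[of a b] gtr_rows[of a b] p by auto
  then show "satisfies_rel lq (upd (upd R (Suc k, s) c) (k, j) c') r"
  proof
    assume rr: "r = Geq (Suc k, s) (k, j)"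
    have *: "satisfies_rel lq T r \<longleftrightarrow> (\<exists>d\<ge>0. off T (Suc k, s) (k, j) d)" for T unfolding rr by (rule sat_iff)
    obtain d where d: "d \<ge> 0" "off R (Suc k, s) (k, j) d" using B_sat[OF R(1) r(1)] * by blast
    obtain d1 where d1: "d1 \<ge> 0" "off R (Suc k, s) (k, j) (d1 - c)"
      using B_sat[OF R(2) r(1)] * off_upd[of "(Suc k, s)" "(k, j)"] by auto
    obtain d2 where d2: "d2 \<ge> 0" "off R (Suc k, s) (k, j) (d2 + c')"
      using B_sat[OF R(3) r(1)] * off_upd[of "(Suc k, s)" "(k, j)"] by auto
    have "d + c - c' \<ge> 0"
      using geq[OF d(2,1)] d1(1) d2(1) off_unique[OF d(2) d1(2)] off_unique[OF d(2) d2(2)] by simp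
    moreover have "off (upd (upd R (Suc k, s) c) (k, j) c') (Suc k, s) (k, j) (d + c - c')"
      using d(2) by (simp add: off_upd)
    ultimately show ?thesis unfolding * by blast
  next
    assume rr: "r = Gtr (k, j) (Suc k, s)"
    have *: "satisfies_rel lq T r \<longleftrightarrow> (\<exists>d>0. off T (k, j) (Suc k, s) d)" for T unfolding rr by (rule sat_iff)
    obtain d where d: "d > 0" "off R (k, j) (Suc k, s) d" using B_sat[OF R(1) r(1)] * by blast
    obtain d1 where d1: "d1 > 0" "off R (k, j) (Suc k, s) (d1 + c)"
      using B_sat[OF R(2) r(1)] * off_upd[of "(k, j)" "(Suc k, s)"] by auto
    obtain d2 where d2: "d2 > 0" "off R (k, j) (Suc k, s) (d2 - c')"
      using B_sat[OF R(3) r(1)] * off_upd[of "(k, j)" "(Suc k, s)"] by auto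
    have "d - c + c' > 0"
      using gtr[OF d(2,1)] d1(1) d2(1) off_unique[OF d(2) d1(2)] off_unique[OF d(2) d2(2)] by simp
    moreover have "off (upd (upd R (Suc k, s) c) (k, j) c') (k, j) (Suc k, s) (d - c + c')"
      using d(2) by (simp add: off_upd)
    ultimately show ?thesis unfolding * by blast
  qed
qed (use p in \<open>auto simp: positions_def\<close>)

text \<open>If a step in row \<open>k\<close> is possible on only one side of a step in row \<open>k + 1\<close>, the obstructing relation is
  tight there; the corresponding matrix coefficient then vanishes by itself.\<close>

lemma near_steps:
  assumes R: "R \<in> B" "upd R (Suc k, s) 1 \<in> B" and p: "1 \<le> j" "j \<le> k" "1 \<le> s" "s \<le> Suc k" "Suc k < n"
  shows "upd R (k, j) 1 \<in> B \<Longrightarrow> upd (upd R (Suc k, s) 1) (k, j) 1 \<in> B"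
    "upd (upd R (Suc k, s) 1) (k, j) 1 \<in> B \<Longrightarrow> upd R (k, j) 1 \<notin> B \<Longrightarrow> off R (Suc k, s) (k, j) 0"
    "upd (upd R (Suc k, s) 1) (k, j) (-1) \<in> B \<Longrightarrow> upd R (k, j) (-1) \<in> B"
    "upd R (k, j) (-1) \<in> B \<Longrightarrow> upd (upd R (Suc k, s) 1) (k, j) (-1) \<notin> B \<Longrightarrow> off R (k, j) (Suc k, s) 2"
proof -
  let ?R2 = "upd R (Suc k, s) 1"
  have step_back: "upd ?R2 (Suc k, s) (-1) = R" by (simp add: upd_upd)
  show "upd R (k, j) 1 \<in> B \<Longrightarrow> upd ?R2 (k, j) 1 \<in> B"
    by (rule upd2_near[OF R _ p]) auto
  show "upd ?R2 (k, j) (-1) \<in> B \<Longrightarrow> upd R (k, j) (-1) \<in> B"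
    using upd2_near[OF R(2) _ _ p, of "-1" "-1"] R(1) unfolding step_back by auto
  show "off R (Suc k, s) (k, j) 0" if "upd ?R2 (k, j) 1 \<in> B" "upd R (k, j) 1 \<notin> B"
  proof (rule ccontr)
    assume n: "\<not> off R (Suc k, s) (k, j) 0"
    have o: "off ?R2 (Suc k, s) (k, j) d = off R (Suc k, s) (k, j) (d - 1)" for d by (simp add: off_upd)
    have "upd (upd ?R2 (Suc k, s) (-1)) (k, j) 1 \<in> B"
    proof (rule upd2_near[OF R(2) _ that(1) p])
      fix d assume "off ?R2 (Suc k, s) (k, j) d" "d - 1 \<ge> 0"
      moreover from this n have "d \<noteq> 1" unfolding o by auto
      ultimately show "d + -1 - 1 \<ge> 0" by simp
    qed (use R(1) step_back in auto)
    then show False using that(2) step_back by simp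
  qed
  show "off R (k, j) (Suc k, s) 2" if "upd R (k, j) (-1) \<in> B" "upd ?R2 (k, j) (-1) \<notin> B"
  proof (rule ccontr)
    assume n: "\<not> off R (k, j) (Suc k, s) 2"
    have "upd ?R2 (k, j) (-1) \<in> B"
    proof (rule upd2_near[OF R that(1) p])
      fix d assume "off R (k, j) (Suc k, s) d" "d - 1 > 0"
      moreover from this n have "d \<noteq> 2" by auto
      ultimately show "d - 1 + -1 > 0" by simp
    qed auto
    then show False using that(2) by simp
  qed
qed

end

section \<open>Partial fraction coefficients under unit steps\<close>

context gt_module
begin

text \<open>\<open>pw\<close> and \<open>rt\<close> are the coefficients and reciprocal poles of \<open>xz (Suc k) R / xz k R\<close>, see \<open>xz_Suc\<close>; the
  Boolean distinguishes steps up and down.\<close>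

definition pw :: "tableau \<Rightarrow> nat \<Rightarrow> nat \<times> bool \<Rightarrow> complex" where
  "pw R k i = (q - 1 / q) * wgt R k * (if snd i then hp R k (fst i) else - hm R k (fst i))"
definition rt :: "tableau \<Rightarrow> nat \<Rightarrow> nat \<times> bool \<Rightarrow> complex" where
  "rt R k i = inverse (qp (2 * (R (k, fst i) + (if snd i then 1 else 0))))"
definition ix :: "nat \<Rightarrow> (nat \<times> bool) set" where "ix k = {1..k} \<times> UNIV"

lemma sum_ix: "(\<Sum>i\<in>ix k. g i) = (\<Sum>j=1..k. g (j, True) + g (j, False))"
proof -
  have "(\<Sum>i\<in>ix k. g i) = (\<Sum>j=1..k. \<Sum>c\<in>UNIV. g (j, c))"
    unfolding ix_def sum.cartesian_product by simp
  then show ?thesis by (simp add: UNIV_bool add.commute)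
qed

lemma q2_nz: "q - 1 / q \<noteq> 0" using q_squares(3) by (simp add: inverse_eq_divide)

lemma sum_pw:
  assumes k: "1 \<le> k" "k < n" and R: "R \<in> B"
  shows "(\<Sum>i\<in>ix k. pw R k i) = wgt R k * wgt R k - 1"
proof -
  have "(\<Sum>i\<in>ix k. pw R k i) = (q - 1 / q) * wgt R k * ((\<Sum>j=1..k. hp R k j) - (\<Sum>j=1..k. hm R k j))"
    unfolding sum_ix by (simp add: pw_def sum_distrib_left sum.distrib sum_negf sum_subtractf right_diff_distrib)
  also have "\<dots> = wgt R k * wgt R k - 1"
  proof -
    have "x * w * ((w - inverse w) / x) = w * w - 1" if "x \<noteq> 0" "w \<noteq> 0" for x w :: complex
      using that by (simp add: field_simps)
    then show ?thesis unfolding sum_hp_hm[OF k R] using q2_nz wgt_nz by blast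
  qed
  finally show ?thesis .
qed

lemma inverse_qp2: "inverse (qp (2 * (x + 1))) = inverse (qp (2 * x)) / (q * q)"
  using qp_nat[of 2] by (simp add: distrib_left qp_add power2_eq_square field_simps)

lemma rt_ratio: "inverse (qp (2 * (x + 1))) / inverse (qp (2 * (y + 1))) = inverse (qp (2 * (x - y)))"
  "inverse (qp (2 * (x + 1))) / inverse (qp (2 * y)) = inverse (qp (2 * (x - y + 1)))"
  by (simp_all add: right_diff_distrib distrib_left qp_add qp_diff field_simps)

text \<open>Of all factors, one quantum integer and the torus weight see the raised entry;
  separating their dependence on it leaves a common \<open>\<pi>\<close>. If the step in row k is
  possible for only one of the two tableaux, the offset found in \<open>near_steps\<close> makes the
  factor belonging to the other one vanish, so the formula still holds.\<close>

lemma pw_upd: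
  assumes R: "R \<in> B" "upd R (Suc k, s) 1 \<in> B" and p: "1 \<le> j" "j \<le> k" "1 \<le> s" "s \<le> Suc k" "Suc k < n"
  defines "b \<equiv> inverse (qp (2 * (R (Suc k, s) + 1)))"
  shows "\<exists>\<pi>. pw R k (j, c) = \<pi> * (1 - b / rt R k (j, c)) \<and>
     pw (upd R (Suc k, s) 1) k (j, c) = \<pi> * (1 - b / (q * q) / rt R k (j, c))"
proof -
  let ?R2 = "upd R (Suc k, s) 1"
  define d where "d = R (Suc k, s) - R (k, j)"
  have s: "s \<in> {1..Suc k}" and j: "j \<in> {1..k}" using p by auto
  have com: "upd ?R2 (k, j) c = upd (upd R (k, j) c) (Suc k, s) 1" for c by (rule upd_commute) auto
  have wgt: "wgt ?R2 k = wgt R k / q" by (rule wgt_upd(1)) (use p in auto)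
  have qn: "(q - 1 / q) * qnum q lq x = qp x * (1 - inverse (qp (2 * x)))"
    "(q - 1 / q) * qnum q lq (x + 1) = q * qp x * (1 - inverse (qp (2 * x)) / (q * q))" for x
    unfolding qnum_eq inverse_qp2 using q2_nz by (simp_all add: qp_add inverse_eq_divide)
  define c1 where "c1 = ec R k j s * gt_f_coeff q lq (upd R (k, j) 1) k j"
  have e1: "gt_e_coeff q lq R k j * gt_f_coeff q lq (upd R (k, j) 1) k j = qnum q lq d * c1"
    "gt_e_coeff q lq ?R2 k j * gt_f_coeff q lq (upd ?R2 (k, j) 1) k j = qnum q lq (d + 1) * c1"
    unfolding com e_coeff_split[OF s] ec_upd f_coeff_upd[OF lessI] by (simp_all add: c1_def d_def algebra_simps)
  define c2 where "c2 = gt_f_coeff q lq R k j * ec (upd R (k, j) (-1)) k j s"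
  have e2: "gt_f_coeff q lq R k j * gt_e_coeff q lq (upd R (k, j) (-1)) k j = qnum q lq (d + 1) * c2"
    "gt_f_coeff q lq ?R2 k j * gt_e_coeff q lq (upd ?R2 (k, j) (-1)) k j = qnum q lq (d + 1 + 1) * c2"
    unfolding com e_coeff_split[OF s] ec_upd f_coeff_upd[OF lessI] by (simp_all add: c2_def d_def algebra_simps)
  show ?thesis
  proof (cases c)
    case True
    have b: "b / rt R k (j, c) = inverse (qp (2 * d))"
      unfolding b_def rt_def d_def using True by (simp only: fst_conv snd_conv if_True rt_ratio(1))
    \<comment> \<open>An upward step possible for \<open>R\<close> is possible for
      \<open>?R2\<close>, so the test is made on \<open>?R2\<close>. For downward steps the
      implication is reversed, and the test below is made on \<open>R\<close>.\<close>
    define \<pi> where "\<pi> = (if upd ?R2 (k, j) 1 \<in> B then wgt R k * c1 * qp d else 0)"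
    have "pw ?R2 k (j, c) = \<pi> * (1 - b / rt R k (j, c) / (q * q))"
    proof (cases "upd ?R2 (k, j) 1 \<in> B")
      case T: True
      have "pw ?R2 k (j, c) = wgt R k / q * c1 * ((q - 1 / q) * qnum q lq (d + 1))"
        using T True by (simp add: pw_def hp_def e1 wgt)
      then show ?thesis unfolding qn(2) b using T q0 by (simp add: \<pi>_def)
    qed (use True in \<open>simp add: pw_def hp_def \<pi>_def\<close>)
    moreover have "pw R k (j, c) = \<pi> * (1 - b / rt R k (j, c))"
    proof (cases "upd R (k, j) 1 \<in> B")
      case T: True
      then have T2: "upd ?R2 (k, j) 1 \<in> B" by (rule near_steps(1)[OF R p])
      have "pw R k (j, c) = wgt R k * c1 * ((q - 1 / q) * qnum q lq d)"
        using T True by (simp add: pw_def hp_def e1)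
      then show ?thesis unfolding qn(1) b using T2 by (simp add: \<pi>_def)
    next
      case F: False
      have "\<pi> = 0 \<or> qp (2 * d) = 1"
        using near_steps(2)[OF R p _ F] by (auto simp: \<pi>_def off_def d_def)
      then show ?thesis unfolding b using F True by (auto simp: pw_def hp_def)
    qed
    ultimately show ?thesis by (auto simp: mult.commute)
  next
    case False
    have b: "b / rt R k (j, c) = inverse (qp (2 * (d + 1)))"
      unfolding b_def rt_def d_def using False by (simp only: fst_conv snd_conv if_False add_0_right rt_ratio(2))
    define \<pi> where "\<pi> = (if upd R (k, j) (-1) \<in> B then - wgt R k * c2 * qp (d + 1) else 0)"
    have "pw ?R2 k (j, c) = \<pi> * (1 - b / rt R k (j, c) / (q * q))"
    proof (cases "upd ?R2 (k, j) (-1) \<in> B")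
      case T: True
      then have T2: "upd R (k, j) (-1) \<in> B" by (rule near_steps(3)[OF R p])
      have "pw ?R2 k (j, c) = - (wgt R k / q * c2 * ((q - 1 / q) * qnum q lq (d + 1 + 1)))"
        using T False by (simp add: pw_def hm_def e2 wgt)
      then show ?thesis unfolding qn(2) b using T2 q0 by (simp add: \<pi>_def)
    next
      case F: False
      have "\<pi> = 0 \<or> inverse (qp (2 * (d + 1))) / (q * q) = 1"
      proof (cases "upd R (k, j) (-1) \<in> B")
        case True
        from off_sym[OF near_steps(4)[OF R p this F]] have "qp (2 * d) = qp (2 * of_int (-2))"
          unfolding off_def d_def .
        then have "qp (2 * d + 2 * 2) = 1" unfolding qp_add[of "2 * d"] by (simp flip: qp_add)
        moreover have "2 * d + 2 * 2 = 2 * (d + 1 + 1)" by simp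
        ultimately have "qp (2 * (d + 1 + 1)) = 1" by (simp only:)
        then show ?thesis unfolding inverse_qp2[symmetric] by (simp only: inverse_1 simp_thms)
      qed (simp add: \<pi>_def)
      then show ?thesis unfolding b using F False by (auto simp: pw_def hm_def)
    qed
    moreover have "pw R k (j, c) = \<pi> * (1 - b / rt R k (j, c))"
    proof (cases "upd R (k, j) (-1) \<in> B")
      case T: True
      have "pw R k (j, c) = - (wgt R k * c2 * ((q - 1 / q) * qnum q lq (d + 1)))"
        using T False by (simp add: pw_def hm_def e2)
      then show ?thesis unfolding qn(1) b using T by (simp add: \<pi>_def)
    qed (use False in \<open>simp add: pw_def hm_def \<pi>_def\<close>)
    ultimately show ?thesis by (auto simp: mult.commute)
  qed
qed

lemma rt_upd: "Suc k \<le> l \<Longrightarrow> rt (upd R (l, s) 1) k i = rt R k i"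
  by (simp add: rt_def)

lemma pw_far:
  assumes R: "R \<in> B" "upd R (l, s) 1 \<in> B" and p: "1 \<le> j" "j \<le> k" "1 \<le> s" "s \<le> l" "Suc k < l" "l < n"
  shows "pw (upd R (l, s) 1) k (j, c) = pw R k (j, c)"
proof -
  have ne: "(l, s) \<noteq> (k, j)" using p by auto
  have com: "upd (upd R (l, s) 1) (k, j) c = upd (upd R (k, j) c) (l, s) 1" for c by (rule upd_commute[OF ne])
  have iff: "upd (upd R (l, s) 1) (k, j) c \<in> B \<longleftrightarrow> upd R (k, j) c \<in> B" for c
  proof
    assume a: "upd (upd R (l, s) 1) (k, j) c \<in> B"
    have "upd (upd (upd R (l, s) 1) (k, j) c) (l, s) (-1) \<in> B"
      by (rule upd2_far[OF R(2) a _ p]) (use R(1) in \<open>simp add: upd_upd\<close>)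
    then show "upd R (k, j) c \<in> B" unfolding com by (simp add: upd_upd)
  next
    assume "upd R (k, j) c \<in> B"
    then show "upd (upd R (l, s) 1) (k, j) c \<in> B" unfolding com by (rule upd2_far[OF R(1) _ R(2) p])
  qed
  have "k < l" using p by simp
  have "wgt (upd R (l, s) 1) k = wgt R k" by (rule wgt_upd(3)) (use p in auto)
  then show ?thesis unfolding pw_def fst_conv snd_conv hp_def hm_def iff unfolding com f_coeff_upd[OF \<open>k < l\<close>] e_coeff_upd[OF p(5)]
    by simp
qed

definition xz where "xz m R = M (r.Xz m) R R"

text \<open>The clauses are carried through the induction together: diagonality in rank m+1 requires
  that the eigenvalues of rank m separate tableaux, which rests on the last two clauses.\<close>

definition good where
  "good m \<longleftrightarrow> (\<forall>R\<in>B. \<forall>R'. M (r.Xz m) R' R = (if R = R' then xz m R else 0))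
    \<and> (\<forall>R\<in>B. fps_nth (xz m R) 0 = 1)
    \<and> (\<forall>R\<in>B. \<forall>s\<in>{1..m}. upd R (m, s) 1 \<in> B \<longrightarrow>
         lin (inverse (qp (2 * (R (m, s) + 1)))) * xz m (upd R (m, s) 1) =
         lin (inverse (qp (2 * (R (m, s) + 1))) / (q * q)) * xz m R)
    \<and> (\<forall>R\<in>B. \<forall>l s. m < l \<longrightarrow> l < n \<longrightarrow> s \<in> {1..l} \<longrightarrow> upd R (l, s) 1 \<in> B \<longrightarrow> xz m (upd R (l, s) 1) = xz m R)"

text \<open>The weight in row 1 is l + 1, which is the origin of the constant q^(-2(l + 1)).\<close>

lemma good_one: "good 1"
proof -
  have "M (r.Xz 1) R' R = (if R = R' then lin (inverse (qp (2 * (R (1, 1) + 1)))) else 0)" if R: "R \<in> B" for R R'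
  proof -
    have w: "qp (- 2 * gt_weight R 1) = inverse (qp (2 * (R (1, 1) + 1)))"
      by (simp add: gt_weight_def flip: qp_minus)
    have n: "1 \<le> n" using n2 by simp
    show ?thesis unfolding r.Xz_one[OF n] M_simps[OF R] me_ti2[OF R] w
      by (simp add: lin_def mult.commute)
  qed
  note M1 = this
  have x: "xz 1 R = lin (inverse (qp (2 * (R (1, 1) + 1))))" if "R \<in> B" for R
    using M1[OF that, of R] unfolding xz_def by simp
  show ?thesis
    unfolding good_def
  proof (intro conjI ballI allI impI)
    fix R s assume R: "R \<in> B" "s \<in> {1..1::nat}" "upd R (1, s) 1 \<in> B"
    then have s: "s = 1" by simp
    show "lin (inverse (qp (2 * (R (1, s) + 1)))) * xz 1 (upd R (1, s) 1) =
         lin (inverse (qp (2 * (R (1, s) + 1))) / (q * q)) * xz 1 R"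
      using R(3) unfolding s by (simp only: x[OF R(1)] x upd_simps of_int_1 inverse_qp2[of "R (1, 1) + 1"] mult.commute)
  qed (use M1 x in auto)
qed

text \<open>By the step rule, \<open>xz m R\<close> divided by the product of linear factors
  \<open>D R\<close> is unchanged by steps in row m, and steps above row m affect neither. Hence it
  is constant along any path that leaves the rows below m alone; transitivity uses that the
  eigenvalue has constant term 1.\<close>

lemma good_tele:
  assumes m: "1 \<le> m" "m < n" and g: "good m" and R: "R \<in> B" "R' \<in> B" and low: "\<And>l i. l < m \<Longrightarrow> R (l, i) = R' (l, i)"
  defines "D \<equiv> \<lambda>R. \<Prod>i=1..m. lin (inverse (qp (2 * (R (m, i) + 1))))"
  shows "D R * xz m R' = D R' * xz m R"
proof (rule connect[OF R, where S = "\<lambda>p. m \<le> fst p"])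
  show "R p \<noteq> R' p \<Longrightarrow> m \<le> fst p" for p using low[of "fst p" "snd p"] by (cases "m \<le> fst p") auto
next
  fix R p assume R: "R \<in> B" "p \<in> positions (n - 1)" "m \<le> fst p" "upd R p 1 \<in> B"
  obtain l s where p: "p = (l, s)" by (cases p)
  have ls: "1 \<le> s" "s \<le> l" "l < n" "m \<le> l" using R(2,3) m by (auto simp: p positions_def)
  show "D R * xz m (upd R p 1) = D (upd R p 1) * xz m R"
  proof (cases "l = m")
    case True
    have s: "s \<in> {1..m}" using ls True by auto
    define E where "E = (\<Prod>i\<in>{1..m}-{s}. lin (inverse (qp (2 * (R (m, i) + 1)))))"
    have d1: "D R = lin (inverse (qp (2 * (R (m, s) + 1)))) * E"
      unfolding D_def E_def by (rule prod.remove) (use s in auto)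
    have d2: "D (upd R p 1) = lin (inverse (qp (2 * (R (m, s) + 1))) / (q * q)) * E"
    proof -
      have "D (upd R p 1) = lin (inverse (qp (2 * (upd R p 1 (m, s) + 1)))) * (\<Prod>i\<in>{1..m}-{s}. lin (inverse (qp (2 * (upd R p 1 (m, i) + 1)))))"
        unfolding D_def by (rule prod.remove) (use s in auto)
      also have "(\<Prod>i\<in>{1..m}-{s}. lin (inverse (qp (2 * (upd R p 1 (m, i) + 1))))) = E"
        unfolding E_def by (rule prod.cong) (auto simp: p True)
      also have "upd R p 1 (m, s) = R (m, s) + 1" by (simp add: p True)
      finally show ?thesis by (simp only: inverse_qp2)
    qed
    have d3: "lin (inverse (qp (2 * (R (m, s) + 1)))) * xz m (upd R p 1) =
         lin (inverse (qp (2 * (R (m, s) + 1))) / (q * q)) * xz m R"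
      using g R s unfolding good_def p True by blast
    have "D R * xz m (upd R p 1) = E * (lin (inverse (qp (2 * (R (m, s) + 1)))) * xz m (upd R p 1))"
      unfolding d1 by (simp only: mult_ac)
    also have "\<dots> = D (upd R p 1) * xz m R" unfolding d2 d3 by (simp only: mult_ac)
    finally show ?thesis .
  next
    case False
    then have "D (upd R p 1) = D R" "xz m (upd R p 1) = xz m R"
      using g R ls unfolding good_def p D_def by auto
    then show ?thesis by simp
  qed
next
  fix R R' R'' assume B: "R \<in> B" "R' \<in> B" "R'' \<in> B" and a: "D R * xz m R' = D R' * xz m R" "D R' * xz m R'' = D R'' * xz m R'"
  have "fps_nth (xz m R') 0 = 1" using g B(2) unfolding good_def by blast
  then have nz: "xz m R' \<noteq> 0" by auto
  have "xz m R' * (D R * xz m R'') = (D R * xz m R') * xz m R''" by (simp only: mult_ac)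
  also have "\<dots> = D R'' * xz m R' * xz m R" unfolding a(1) a(2)[symmetric] by (simp only: mult_ac)
  also have "\<dots> = xz m R' * (D R'' * xz m R)" by (simp only: mult_ac)
  finally show "D R * xz m R'' = D R'' * xz m R" using nz by simp
qed auto

text \<open>Comparison of the roots of two polynomials, hence only of the underlying sets.
  Injectivity will be supplied by the fact that entries of a row are distinct modulo half
  periods.\<close>

lemma lin_prod_eqD:
  assumes fin: "finite I" "finite J" and nz: "\<And>i. i \<in> I \<Longrightarrow> b i \<noteq> 0"
    and eq: "(\<Prod>i\<in>I. lin (b i)) = (\<Prod>j\<in>J. lin (c j))"
  shows "b ` I \<subseteq> c ` J"
proof
  fix x assume "x \<in> b ` I"
  then obtain i where i: "i \<in> I" "x = b i" by blast
  have l: "lin w = fps_of_poly [:1, - w:]" for w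
    by (simp add: lin_def fps_of_poly_pCons mult.commute)
  have "fps_of_poly (\<Prod>i\<in>I. [:1, - b i:]) = fps_of_poly (\<Prod>j\<in>J. [:1, - c j:])"
    using eq unfolding l fps_of_poly_prod .
  then have "(\<Prod>i\<in>I. [:1, - b i:]) = (\<Prod>j\<in>J. [:1, - c j:])" by simp
  from arg_cong[OF this, of "\<lambda>p. poly p (inverse x)"]
  have "(\<Prod>i\<in>I. 1 - inverse x * b i) = (\<Prod>j\<in>J. 1 - inverse x * c j)" by (simp add: poly_prod)
  moreover have "(\<Prod>i\<in>I. 1 - inverse x * b i) = 0"
    by (rule prod_zero[OF fin(1)]) (use i nz in \<open>auto intro!: bexI[of _ i]\<close>)
  ultimately obtain j where "j \<in> J" "1 - inverse x * c j = 0" using prod_zero_iff[OF fin(2)] by metis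
  then show "x \<in> c ` J" using i nz by (auto simp: field_simps)
qed

text \<open>With equal eigenvalues \<open>good_tele\<close> makes the two products of linear factors
  equal. Their roots are matched by a permutation of the row, to which \<open>row_eq\<close>
  applies.\<close>

lemma good_separates:
  assumes m: "1 \<le> m" "m < n" and g: "good m" and R: "R \<in> B" "R' \<in> B" and low: "\<And>l i. l < m \<Longrightarrow> R (l, i) = R' (l, i)"
    and eq: "xz m R = xz m R'" and i: "i \<in> {1..m}"
  shows "R (m, i) = R' (m, i)"
proof -
  define b :: "tableau \<Rightarrow> nat \<Rightarrow> complex" where "b R i = inverse (qp (2 * (R (m, i) + 1)))" for R i
  have m': "m \<in> {1..n-1}" using m by auto
  have "fps_nth (xz m R') 0 = 1" using g R(2) unfolding good_def by blast
  then have nz: "xz m R' \<noteq> 0" by auto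
  have D: "(\<Prod>i=1..m. lin (b R i)) = (\<Prod>i=1..m. lin (b R' i))"
    using good_tele[OF m g R low] nz unfolding eq b_def by simp
  have ratio: "qp (2 * (T (m, i) - T' (m, j))) = 1" if "b T i = b T' j" for T T' i j
  proof -
    have "qp (2 * (T (m, i) + 1)) = qp (2 * (T' (m, j) + 1))" using that by (simp add: b_def)
    then have "qp (2 * (T (m, i) + 1) - 2 * (T' (m, j) + 1)) = 1" by (simp only: qp_diff) simp
    then show ?thesis by (simp add: algebra_simps)
  qed
  have inj: "inj_on (b T) {1..m}" if "T \<in> B" for T
  proof (rule inj_onI, rule ccontr)
    fix i j assume a: "i \<in> {1..m}" "j \<in> {1..m}" "b T i = b T j" "i \<noteq> j"
    have "off T (m, i) (m, j) 0" using ratio[OF a(3)] by (simp add: off_def)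
    then show False using nonsing[OF that m' a(1,2,4)] by simp
  qed
  have sub: "b R ` {1..m} \<subseteq> b R' ` {1..m}"
    by (rule lin_prod_eqD[OF _ _ _ D]) (auto simp: b_def)
  then have "\<forall>i\<in>{1..m}. \<exists>j\<in>{1..m}. b R i = b R' j" by blast
  then obtain \<sigma> where \<sigma>: "\<And>i. i \<in> {1..m} \<Longrightarrow> \<sigma> i \<in> {1..m} \<and> b R i = b R' (\<sigma> i)" by metis
  have "inj_on \<sigma> {1..m}" using inj[OF R(1)] \<sigma> by (metis (mono_tags, lifting) inj_on_def)
  moreover have "\<sigma> ` {1..m} = {1..m}" by (rule endo_inj_surj) (use \<sigma> calculation in auto)
  ultimately have "bij_betw \<sigma> {1..m} {1..m}" by (simp add: bij_betw_def)
  from row_eq[OF m' R this _ i] show ?thesis using ratio \<sigma> by blast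
qed

end

section \<open>Recursion for the eigenvalues and induction on the rank\<close>

context gt_module
begin

lemma me_diag_left:
  assumes "\<And>T T'. T \<in> B \<Longrightarrow> me u T' T = (if T = T' then c T else 0)" and R: "R \<in> B"
  shows "me (u * v) R' R = c R' * me v R' R"
proof -
  let ?S = "Poly_Mapping.keys (A v (bv R))"
  have "me (u * v) R' R = (\<Sum>R''\<in>?S. me u R' R'' * me v R'' R)" by (rule me_mult_keys[OF R])
  also have "\<dots> = (\<Sum>R''\<in>?S. if R'' = R' then c R' * me v R' R else 0)"
    by (rule sum.cong) (use assms(1) me_outside[OF R] in \<open>auto simp: in_keys_iff me_def[symmetric]\<close>)
  also have "\<dots> = c R' * me v R' R" by (auto simp: in_keys_iff me_def)
  finally show ?thesis .
qed

lemma me_diag_right: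
  assumes "\<And>T T'. T \<in> B \<Longrightarrow> me u T' T = (if T = T' then c T else 0)" and R: "R \<in> B"
  shows "me (v * u) R' R = me v R' R * c R"
  by (subst me_mult[OF R, of "{R}"]) (use assms in \<open>auto split: if_splits\<close>)

lemma M_diag_left:
  assumes "\<And>T T'. T \<in> B \<Longrightarrow> M U T' T = (if T = T' then x T else 0)" and R: "R \<in> B"
  shows "M (U * W) R' R = x R' * M W R' R"
proof (rule fps_ext)
  fix i
  have u: "me (fps_nth U j) T' T = (if T = T' then fps_nth (x T) j else 0)" if "T \<in> B" for j T' T
    using assms(1)[OF that, of T'] by (metis M_nth fps_zero_nth)
  have "me (fps_nth U j * fps_nth W (i - j)) R' R = fps_nth (x R') j * me (fps_nth W (i - j)) R' R" for j
    by (rule me_diag_left[OF _ R]) (rule u)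
  then show "fps_nth (M (U * W) R' R) i = fps_nth (x R' * M W R' R) i"
    by (simp add: fps_mult_nth me_simps R)
qed

lemma goodD:
  assumes "good m"
  shows "R \<in> B \<Longrightarrow> M (r.Xz m) R' R = (if R = R' then xz m R else 0)"
    "R \<in> B \<Longrightarrow> fps_nth (xz m R) 0 = 1" "R \<in> B \<Longrightarrow> xz m R \<noteq> 0"
    "R \<in> B \<Longrightarrow> s \<in> {1..m} \<Longrightarrow> upd R (m, s) 1 \<in> B \<Longrightarrow>
         lin (inverse (qp (2 * (R (m, s) + 1)))) * xz m (upd R (m, s) 1) =
         lin (inverse (qp (2 * (R (m, s) + 1))) / (q * q)) * xz m R"
    "R \<in> B \<Longrightarrow> m < l \<Longrightarrow> l < n \<Longrightarrow> s \<in> {1..l} \<Longrightarrow> upd R (l, s) 1 \<in> B \<Longrightarrow> xz m (upd R (l, s) 1) = xz m R"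
proof -
  show 1: "R \<in> B \<Longrightarrow> fps_nth (xz m R) 0 = 1" using assms unfolding good_def by blast
  then show "R \<in> B \<Longrightarrow> xz m R \<noteq> 0" by force
qed (use assms in \<open>unfold good_def, blast+\<close>)

lemma M_Wz:
  assumes g: "good k" and k: "1 \<le> k" "k < n" and R: "R \<in> B"
  shows "M (r.Wz k) R' R = (if R = R' then inverse (xz k R) else 0)"
proof -
  have "M (r.Wz k * r.Xz k) R' R = M (r.Wz k) R' R * xz k R"
    by (subst M_mult_diag[OF R]) (use goodD(1)[OF g R] in auto)
  moreover have "r.Wz k * r.Xz k = 1" using k by (intro r.Xz_inverse) auto
  ultimately have "M (r.Wz k) R' R * xz k R = (if R = R' then 1 else 0)" by (simp add: M_simps R)
  then have "M (r.Wz k) R' R * xz k R * inverse (xz k R) = (if R = R' then inverse (xz k R) else 0)" by simp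
  then show ?thesis using goodD(2)[OF g R] by (simp add: mult.assoc inverse_mult_eq_1')
qed

lemma xz_up:
  assumes g: "good k" and "R \<in> B" "j \<in> {1..k}" "upd R (k, j) 1 \<in> B"
  shows "xz k (upd R (k, j) 1) = xz k R + fps_const (1 - 1 / (q * q)) * geo (rt R k (j, True)) * xz k R"
  using lin_ratio[OF goodD(4)[OF assms]] by (simp add: rt_def)

text \<open>\<open>R\<close> is regarded as an upward step from its lower neighbour, and
  \<open>xz_up\<close> is applied there; the pole is the one indexed by \<open>False\<close> because
  the entry of the neighbour plus one is the entry of \<open>R\<close>.\<close>

lemma xz_down:
  assumes g: "good k" and "R \<in> B" "j \<in> {1..k}" "upd R (k, j) (-1) \<in> B"
  shows "inverse (xz k (upd R (k, j) (-1))) * xz k R = 1 + fps_const (1 - 1 / (q * q)) * geo (rt R k (j, False))"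
proof -
  let ?T = "upd R (k, j) (-1)"
  have R: "upd ?T (k, j) 1 = R" by (simp add: upd_upd)
  have "rt ?T k (j, True) = rt R k (j, False)" by (simp add: rt_def)
  then have "xz k R = (1 + fps_const (1 - 1 / (q * q)) * geo (rt R k (j, False))) * xz k ?T"
    using xz_up[OF g assms(4,3)] assms(2) unfolding R by (simp add: distrib_right)
  then show ?thesis using goodD(2)[OF g assms(4)]
    by (simp add: mult.left_commute[of "inverse _"] inverse_mult_eq_1)
qed

text \<open>Both corrections in \<open>Xz_Suc\<close> pass through single steps of row \<open>k\<close>.\<close>

lemma xz_Suc:
  assumes g: "good k" and k: "1 \<le> k" "k < n" and R: "R \<in> B"
  shows "xz (Suc k) R = xz k R * (1 - (\<Sum>i\<in>ix k. fps_const (pw R k i) * geo (rt R k i)))"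
proof -
  let ?c = "1 - 1 / (q * q)"
  define F where "F = fps_const (uf n q k * uq.K k)"
  define e' where "e' = fps_const (ue n q k)"
  have MF: "M F R' T = fps_const (wgt T k * me (uf n q k) R' T)" if "T \<in> B" for R' T
    unfolding F_def M_simps(3)[OF that] me_F[OF k that] ..
  have MX: "T \<in> B \<Longrightarrow> M (r.Xz k) T' T = (if T = T' then xz k T else 0)" for T T' by (rule goodD(1)[OF g])
  have MXl: "T \<in> B \<Longrightarrow> M (r.Xz k * W) R' T = xz k R' * M W R' T" for W R' T
    by (rule M_diag_left[OF MX])
  have MXr: "T \<in> B \<Longrightarrow> M (W * r.Xz k) R' T = M W R' T * xz k T" for W R' T
    using M_mult_diag[of T "r.Xz k" W R'] MX[of T] by auto
  have MWl: "T \<in> B \<Longrightarrow> M (r.Wz k * W) R' T = inverse (xz k R') * M W R' T" for W R' T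
    by (rule M_diag_left[OF M_Wz[OF g k]])
  have t1: "M ((r.Xz k * F - F * r.Xz k) * e') R R =
     (\<Sum>j=1..k. fps_const ((q * q - 1) * wgt R k * hp R k j) * geo (rt R k (j, True)) * xz k R)"
    unfolding e'_def M_mult_e[OF k R]
  proof (rule sum.cong[OF refl])
    fix j assume j: "j \<in> {1..k}"
    let ?T = "upd R (k, j) 1"
    show "M (r.Xz k * F - F * r.Xz k) R ?T * fps_const (me (ue n q k) ?T R) =
        fps_const ((q * q - 1) * wgt R k * hp R k j) * geo (rt R k (j, True)) * xz k R"
    proof (cases "?T \<in> B")
      case True
      have "M (r.Xz k * F - F * r.Xz k) R ?T * fps_const (me (ue n q k) ?T R)
         = (xz k R - xz k ?T) * fps_const (wgt ?T k * (me (uf n q k) R ?T * me (ue n q k) ?T R))"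
        unfolding M_simps(2)[OF True] MXl[OF True] MXr[OF True] MF[OF True]
        by (simp add: algebra_simps flip: fps_const_mult)
      also have "\<dots> = - (fps_const ?c * geo (rt R k (j, True)) * xz k R) * fps_const (- (q * q * wgt R k * hp R k j))"
        unfolding me_ef(2)[OF k R j] xz_up[OF g R j True] wgt_upd(2)[OF k(1) j] by simp
      also have "\<dots> = fps_const (?c * (q * q * wgt R k * hp R k j)) * (geo (rt R k (j, True)) * xz k R)"
        by (simp add: mult_ac flip: fps_const_mult fps_const_neg)
      also have "?c * (q * q * wgt R k * hp R k j) = (q * q - 1) * wgt R k * hp R k j"
        using q0 by (simp add: field_simps)
      finally show ?thesis by (simp only: mult.assoc)
    next
      case False
      then show ?thesis using me_e(2)[OF k R j] by (simp add: hp_def)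
    qed
  qed
  have MD: "M (F - r.Wz k * F * r.Xz k) R' R = M F R' R * (1 - inverse (xz k R') * xz k R)" for R'
    unfolding M_simps(2)[OF R] MXr[OF R] MWl[OF R] by (simp add: algebra_simps)
  have t2: "M (r.Xz k * e' * (F - r.Wz k * F * r.Xz k)) R R =
     (\<Sum>j=1..k. fps_const (?c * wgt R k * hm R k j) * geo (rt R k (j, False)) * xz k R)"
  proof (subst M_mult_support_f[OF R])
    fix R' assume "M (F - r.Wz k * F * r.Xz k) R' R \<noteq> 0"
    then have "me (uf n q k) R' R \<noteq> 0" unfolding MD MF[OF R] by auto
    then show "R' \<in> (\<lambda>j. upd R (k, j) (-1)) ` {1..k}" by (rule me_f(1)[OF k R])
  next
    show "(\<Sum>j=1..k. M (r.Xz k * e') R (upd R (k, j) (-1)) * M (F - r.Wz k * F * r.Xz k) (upd R (k, j) (-1)) R) =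
      (\<Sum>j=1..k. fps_const (?c * wgt R k * hm R k j) * geo (rt R k (j, False)) * xz k R)"
    proof (rule sum.cong[OF refl])
      fix j assume j: "j \<in> {1..k}"
      let ?T = "upd R (k, j) (-1)"
      show "M (r.Xz k * e') R ?T * M (F - r.Wz k * F * r.Xz k) ?T R =
          fps_const (?c * wgt R k * hm R k j) * geo (rt R k (j, False)) * xz k R"
      proof (cases "?T \<in> B")
        case True
        have "M (r.Xz k * e') R ?T * M (F - r.Wz k * F * r.Xz k) ?T R =
           xz k R * fps_const (wgt R k * (me (ue n q k) R ?T * me (uf n q k) ?T R)) * (1 - inverse (xz k ?T) * xz k R)"
          unfolding MD MXl[OF True] MF[OF R] unfolding e'_def M_simps(3)[OF True]
          by (simp add: mult_ac flip: fps_const_mult)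
        also have "\<dots> = xz k R * fps_const (- (wgt R k * hm R k j)) * - (fps_const ?c * geo (rt R k (j, False)))"
          unfolding me_ef(1)[OF k R j] xz_down[OF g R j True] by simp
        also have "\<dots> = fps_const (?c * wgt R k * hm R k j) * geo (rt R k (j, False)) * xz k R"
          by (simp add: mult_ac flip: fps_const_mult fps_const_neg)
        finally show ?thesis .
      next
        case False
        then show ?thesis using me_f(2)[OF k R j] unfolding MD MF[OF R] by (simp add: hm_def)
      qed
    qed
  qed
  have "xz (Suc k) R = xz k R - fps_const (1 / q) * M ((r.Xz k * F - F * r.Xz k) * e') R R
      + fps_const q * M (r.Xz k * e' * (F - r.Wz k * F * r.Xz k)) R R"
    unfolding xz_def r.Xz_Suc[OF k] F_def[symmetric] e'_def[symmetric] M_simps(1,2,6)[OF R] ..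
  also have "\<dots> = xz k R - (\<Sum>i\<in>ix k. fps_const (pw R k i) * geo (rt R k i) * xz k R)"
  proof -
    have "fps_const (1 / q) * (fps_const ((q * q - 1) * wgt R k * hp R k j) * geo (rt R k (j, True)) * xz k R)
        = fps_const (pw R k (j, True)) * geo (rt R k (j, True)) * xz k R" for j
    proof -
      have "1 / q * ((q * q - 1) * wgt R k * hp R k j) = pw R k (j, True)"
        using q0 by (simp add: pw_def field_simps)
      then show ?thesis by (simp only: mult.assoc[symmetric] fps_const_mult)
    qed
    moreover have "fps_const q * (fps_const (?c * wgt R k * hm R k j) * geo (rt R k (j, False)) * xz k R)
        = - (fps_const (pw R k (j, False)) * geo (rt R k (j, False)) * xz k R)" for j
    proof -
      have "q * (?c * wgt R k * hm R k j) = - pw R k (j, False)"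
        using q0 by (simp add: pw_def field_simps)
      then show ?thesis by (simp only: mult.assoc[symmetric] fps_const_mult fps_const_neg[symmetric] mult_minus_left)
    qed
    ultimately show ?thesis unfolding t1 t2 sum_ix by (simp only: sum_distrib_left sum.distrib sum_negf) simp
  qed
  also have "\<dots> = xz k R * (1 - (\<Sum>i\<in>ix k. fps_const (pw R k i) * geo (rt R k i)))"
    by (simp add: right_diff_distrib sum_distrib_left mult_ac)
  finally show ?thesis .
qed

lemma basis_outside: "R \<in> B \<Longrightarrow> R' \<in> B \<Longrightarrow> p \<notin> positions (n - 1) \<Longrightarrow> R p = R' p"
proof -
  assume "R \<in> B" "R' \<in> B" "p \<notin> positions (n - 1)"
  moreover obtain z where "z \<in> shifts n" "R = (\<lambda>p. L p + of_int (z p))" using basisE[OF \<open>R \<in> B\<close>] .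
  moreover obtain z' where "z' \<in> shifts n" "R' = (\<lambda>p. L p + of_int (z' p))" using basisE[OF \<open>R' \<in> B\<close>] .
  ultimately have "z p = 0" "z' p = 0" "R p = L p + of_int (z p)" "R' p = L p + of_int (z' p)"
    unfolding shifts_def by blast+
  then show "R p = R' p" by simp
qed

text \<open>All ingredients of \<open>Xz_Suc\<close> change at most row k. This confines the
  off-diagonal coefficients of the next Schur complement to pairs of tableaux that agree in all
  other rows.\<close>

definition rowel :: "nat \<Rightarrow> uqt set" where
  "rowel k = {u. \<forall>R\<in>B. \<forall>R'. me u R' R \<noteq> 0 \<longrightarrow> (\<forall>p. fst p \<noteq> k \<longrightarrow> R' p = R p)}"

lemma rowelD: "u \<in> rowel k \<Longrightarrow> R \<in> B \<Longrightarrow> me u R' R \<noteq> 0 \<Longrightarrow> fst p \<noteq> k \<Longrightarrow> R' p = R p"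
  unfolding rowel_def by blast

lemma rowel_closed:
  "u \<in> rowel k \<Longrightarrow> v \<in> rowel k \<Longrightarrow> u + v \<in> rowel k" "u \<in> rowel k \<Longrightarrow> v \<in> rowel k \<Longrightarrow> u - v \<in> rowel k"
  "u \<in> rowel k \<Longrightarrow> v \<in> rowel k \<Longrightarrow> u * v \<in> rowel k" "0 \<in> rowel k" "usc c \<in> rowel k"
proof -
  assume uv: "u \<in> rowel k" "v \<in> rowel k"
  show "u + v \<in> rowel k" "u - v \<in> rowel k"
    unfolding rowel_def using rowelD[OF uv(1)] rowelD[OF uv(2)]
    by (clarsimp simp: me_simps, metis add.right_neutral add.left_neutral diff_zero diff_self)+
  show "u * v \<in> rowel k"
    unfolding rowel_def
  proof (intro CollectI ballI allI impI)
    fix R R' and p :: pos assume R: "R \<in> B" "me (u * v) R' R \<noteq> 0" and p: "fst p \<noteq> k"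
    from R(2) obtain R'' where "me u R' R'' * me v R'' R \<noteq> 0"
      unfolding me_mult_keys[OF R(1)] by (auto elim!: sum.not_neutral_contains_not_neutral)
    then show "R' p = R p"
      using rowelD[OF uv(1) _ _ p, of R'' R'] rowelD[OF uv(2) R(1) _ p, of R''] me_outside[OF R(1), of v R''] by auto
  qed
next
  show "0 \<in> rowel k" "usc c \<in> rowel k"
    using me_simps(5)[of _ c 1] by (auto simp: rowel_def me_simps)
qed

lemma rowel_sum: "(\<And>i. i \<in> I \<Longrightarrow> g i \<in> rowel k) \<Longrightarrow> sum g I \<in> rowel k"
  by (induction I rule: infinite_finite_induct) (auto intro: rowel_closed)

lemma rowel_Xz_Suc:
  assumes g: "good k" and k: "1 \<le> k" "k < n"
  shows "fps_nth (r.Xz (Suc k)) i \<in> rowel k"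
proof -
  define RR where "RR = {U :: uqt fps. \<forall>i. fps_nth U i \<in> rowel k}"
  have cl: "U + W \<in> RR" "U - W \<in> RR" "U * W \<in> RR" if "U \<in> RR" "W \<in> RR" for U W
    using that by (auto simp: RR_def fps_mult_nth intro!: rowel_closed rowel_sum)
  have c: "fps_const u \<in> RR" if "u \<in> rowel k" for u using that rowel_closed(4) by (auto simp: RR_def)
  have diag: "U \<in> RR" if "\<And>R R'. R \<in> B \<Longrightarrow> R \<noteq> R' \<Longrightarrow> M U R' R = 0" for U
  proof -
    have "me (fps_nth U i) R' R = 0" if "R \<in> B" "R \<noteq> R'" for R R' i
      using \<open>\<And>R R'. R \<in> B \<Longrightarrow> R \<noteq> R' \<Longrightarrow> M U R' R = 0\<close>[OF that] by (metis M_nth fps_zero_nth)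
    note off = this
    show ?thesis
      unfolding RR_def rowel_def
    proof (intro CollectI allI ballI impI)
      fix i R R' and p :: pos assume "R \<in> B" "me (fps_nth U i) R' R \<noteq> 0"
      then have "R = R'" using off by blast
      then show "R' p = R p" by simp
    qed
  qed
  have "ue n q k \<in> rowel k"
    unfolding rowel_def using me_e(1)[OF k] by (fastforce simp: upd_def)
  moreover have "uf n q k * uq.K k \<in> rowel k"
    unfolding rowel_def using me_f(1)[OF k] by (fastforce simp: upd_def me_F[OF k])
  moreover have "r.Xz k \<in> RR" "r.Wz k \<in> RR"
    by (rule diag; use goodD(1)[OF g] M_Wz[OF g k] in simp)+
  ultimately have "r.Xz (Suc k) \<in> RR"
    unfolding r.Xz_Suc[OF k] by (intro cl c rowel_closed(5))
  then show ?thesis by (simp add: RR_def)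
qed

text \<open>A nonzero coefficient from \<open>R\<close> to \<open>R'\<close> leaves all rows but k
  unchanged; as the Schur complements of ranks k and k+1 commute, it also preserves
  \<open>xz k\<close>, so \<open>good_separates\<close> gives R = R'. The step rule is
  \<open>rational_ratio\<close> with c = q^2 and the square of the torus weight as
  \<open>\<kappa>\<close>; higher steps change no ingredient of the recursion.\<close>

lemma good_Suc:
  assumes g: "good k" and k: "1 \<le> k" "Suc k < n"
  shows "good (Suc k)"
  unfolding good_def
proof (intro conjI ballI allI impI)
  have kn: "k < n" using k by simp
  fix R assume R: "R \<in> B"
  show "fps_nth (xz (Suc k) R) 0 = 1"
    unfolding xz_Suc[OF g k(1) kn R] by (simp add: fps_sum_nth goodD(2)[OF g R])
  fix R'
  have "M (r.Xz (Suc k)) R' R = 0" if "R \<noteq> R'"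
  proof (rule ccontr)
    assume "M (r.Xz (Suc k)) R' R \<noteq> 0"
    then obtain j where j: "me (fps_nth (r.Xz (Suc k)) j) R' R \<noteq> 0" by (auto simp: fps_eq_iff)
    then have R': "R' \<in> B" by (rule me_outside[OF R])
    have d: "T \<in> B \<Longrightarrow> me (fps_nth (r.Xz k) i) T' T = (if T = T' then fps_nth (xz k T) i else 0)" for i T T'
      using goodD(1)[OF g, of T T'] by (metis M_nth fps_zero_nth)
    have "me (fps_nth (r.Xz k) i * fps_nth (r.Xz (Suc k)) j) R' R = fps_nth (xz k R') i * me (fps_nth (r.Xz (Suc k)) j) R' R"
       "me (fps_nth (r.Xz (Suc k)) j * fps_nth (r.Xz k) i) R' R = me (fps_nth (r.Xz (Suc k)) j) R' R * fps_nth (xz k R) i" for i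
      by (rule me_diag_left[OF _ R] me_diag_right[OF _ R], rule d, assumption)+
    then have "fps_nth (xz k R) i = fps_nth (xz k R') i" for i
      using arg_cong[OF r.Xz_coeff_commute[OF k(1) kn, of i j], of "\<lambda>u. me u R' R"] j by simp
    then have x: "xz k R = xz k R'" by (simp add: fps_eq_iff)
    have off: "R p = R' p" if "fst p \<noteq> k" for p
      using rowelD[OF rowel_Xz_Suc[OF g k(1) kn] R j that] by simp
    have "R = R'"
    proof
      fix p :: pos
      obtain l i where p: "p = (l, i)" by (cases p)
      show "R p = R' p"
      proof (cases "l = k \<and> i \<in> {1..k}")
        case True
        then show ?thesis using good_separates[OF k(1) kn g R R' _ x, of i] off p by simp
      next
        case False
        then have "l \<noteq> k \<or> p \<notin> positions (n - 1)" using p by (auto simp: positions_def)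
        then show ?thesis using off[of p] basis_outside[OF R R', of p] p by auto
      qed
    qed
    with that show False by simp
  qed
  then show "M (r.Xz (Suc k)) R' R = (if R = R' then xz (Suc k) R else 0)" by (simp add: xz_def)
next
  have kn: "k < n" using k by simp
  fix R s assume R: "R \<in> B" and s: "s \<in> {1..Suc k}" and R2: "upd R (Suc k, s) 1 \<in> B"
  let ?R2 = "upd R (Suc k, s) 1" and ?b = "inverse (qp (2 * (R (Suc k, s) + 1)))"
  have x: "xz k ?R2 = xz k R" by (rule goodD(5)[OF g R _ k(2) s R2]) simp
  have "lin ?b * (1 - (\<Sum>i\<in>ix k. fps_const (pw ?R2 k i) * geo (rt R k i))) =
      lin (?b / (q * q)) * (1 - (\<Sum>i\<in>ix k. fps_const (pw R k i) * geo (rt R k i)))"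
  proof (rule rational_ratio)
    show "rt R k i \<noteq> 0" for i by (simp add: rt_def)
    show "\<exists>\<pi>. pw R k i = \<pi> * (1 - ?b / rt R k i) \<and> pw ?R2 k i = \<pi> * (1 - ?b / (q * q) / rt R k i)" if "i \<in> ix k" for i
      using pw_upd[OF R R2, of "fst i" "snd i"] that s k by (cases i) (auto simp: ix_def)
    show "(\<Sum>i\<in>ix k. pw R k i) = wgt R k * wgt R k - 1" by (rule sum_pw[OF k(1) kn R])
    show "(\<Sum>i\<in>ix k. pw ?R2 k i) = wgt R k * wgt R k / (q * q) - 1"
      unfolding sum_pw[OF k(1) kn R2] wgt_upd(1)[OF k(1) s] by simp
    show "q * q \<noteq> 0" "q * q \<noteq> 1" using q0 q_squares by auto
  qed
  then show "lin ?b * xz (Suc k) ?R2 = lin (?b / (q * q)) * xz (Suc k) R"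
    unfolding xz_Suc[OF g k(1) kn R] xz_Suc[OF g k(1) kn R2] x rt_upd[OF order.refl]
    by (simp only: mult.left_commute)
next
  have kn: "k < n" using k by simp
  fix R l s assume R: "R \<in> B" and l: "Suc k < l" "l < n" and s: "s \<in> {1..l}" and R2: "upd R (l, s) 1 \<in> B"
  have x: "xz k (upd R (l, s) 1) = xz k R" by (rule goodD(5)[OF g R _ l(2) s R2]) (use l in simp)
  have "pw (upd R (l, s) 1) k i = pw R k i" if "i \<in> ix k" for i
    using pw_far[OF R R2, of "fst i" k "snd i"] that s l by (cases i) (auto simp: ix_def)
  then show "xz (Suc k) (upd R (l, s) 1) = xz (Suc k) R"
    unfolding xz_Suc[OF g k(1) kn R] xz_Suc[OF g k(1) kn R2] x using l by (simp add: rt_upd)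
qed

lemma good_all: "1 \<le> m \<Longrightarrow> m < n \<Longrightarrow> good m"
  by (induction m rule: dec_induct) (auto intro: good_one[unfolded One_nat_def] good_Suc)

section \<open>Eigenvalues of the central generating functions\<close>

definition az where "az m R = M (r.Az m) R R"

lemma az_diag:
  "m < n \<Longrightarrow> R \<in> B \<Longrightarrow> M (r.Az m) R' R = (if R = R' then az m R else 0)"
  "Suc m < n \<Longrightarrow> R \<in> B \<Longrightarrow> az (Suc m) R = xz (Suc m) R * fps_scale (q * q) (az m R)"
proof -
  have step: "M (r.Az (Suc m)) R' R = (if R = R' then xz (Suc m) R * fps_scale (q * q) (az m R) else 0)"
    if m: "Suc m < n" and R: "R \<in> B" and IH: "\<And>R R'. R \<in> B \<Longrightarrow> M (r.Az m) R' R = (if R = R' then az m R else 0)" for m R R'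
  proof -
    have g: "good (Suc m)" using m by (intro good_all) auto
    have sc: "M (r.rescale (r.Az m)) R' R = (if R = R' then fps_scale (q * q) (az m R) else 0)"
      unfolding usc_simps(2)[symmetric] M_simps(7)[OF R] IH[OF R] by (simp add: fps_scale_simps)
    have "M (r.Az (Suc m)) R' R = xz (Suc m) R' * M (r.rescale (r.Az m)) R' R"
      unfolding r.Az.simps by (rule M_diag_left[OF _ R]) (rule goodD(1)[OF g])
    then show ?thesis unfolding sc by auto
  qed
  have 1: "M (r.Az m) R' R = (if R = R' then az m R else 0)" if "m < n" "R \<in> B" for m R R'
    using that
  proof (induction m arbitrary: R R')
    case 0
    then show ?case by (cases "R = R'") (simp_all add: az_def M_simps)
  next
    case (Suc m)
    have m: "Suc m < n" and R: "R \<in> B" using Suc.prems by auto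
    have IH: "M (r.Az m) R' R = (if R = R' then az m R else 0)" if "R \<in> B" for R R'
      using Suc.IH[OF _ that] m by simp
    have "az (Suc m) R = xz (Suc m) R * fps_scale (q * q) (az m R)"
      unfolding az_def[of "Suc m"] using step[OF m R IH, of R] by simp
    then show ?case using step[OF m R IH, of R'] by (simp only:)
  qed
  show "m < n \<Longrightarrow> R \<in> B \<Longrightarrow> M (r.Az m) R' R = (if R = R' then az m R else 0)" by (rule 1)
  show "az (Suc m) R = xz (Suc m) R * fps_scale (q * q) (az m R)" if "Suc m < n" "R \<in> B"
    using step[OF that 1, of R] that(1) by (simp add: az_def)
qed

lemma az_nth_0: "m < n \<Longrightarrow> R \<in> B \<Longrightarrow> fps_nth (az m R) 0 = 1"
proof (induction m)
  case 0
  then show ?case by (simp add: az_def me_simps)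
next
  case (Suc m)
  then show ?case using goodD(2)[OF good_all[of "Suc m"]] by (simp add: az_diag(2))
qed

text \<open>Series with constant term 1 can be cancelled, so \<open>xz (Suc m)\<close> is recovered
  from two consecutive \<open>az\<close>. Rows are then compared from the bottom upwards, because
  \<open>good_separates\<close> presupposes agreement in the rows below.\<close>

lemma az_separates:
  assumes R: "R \<in> B" "R' \<in> B" and eq: "\<And>m. m < n \<Longrightarrow> az m R = az m R'"
  shows "R = R'"
proof -
  have x: "xz (Suc m) R = xz (Suc m) R'" if m: "Suc m < n" for m
  proof -
    have "fps_nth (fps_scale (q * q) (az m R)) 0 = 1" using az_nth_0[of m R] m R by simp
    then have "fps_scale (q * q) (az m R) \<noteq> 0" by force
    then show ?thesis using eq[of m] eq[of "Suc m"] m unfolding az_diag(2)[OF m R(1)] az_diag(2)[OF m R(2)] by simp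
  qed
  have "R (l, i) = R' (l, i)" for l i
  proof (induction l arbitrary: i rule: less_induct)
    case (less l)
    show ?case
    proof (cases "1 \<le> l \<and> l < n \<and> i \<in> {1..l}")
      case True
      then obtain m where m: "l = Suc m" by (cases l) auto
      show ?thesis
        by (rule good_separates[OF _ _ good_all R less.IH]) (use True x[of m] m in auto)
    next
      case False
      then have "(l, i) \<notin> positions (n - 1)" by (auto simp: positions_def)
      then show ?thesis by (rule basis_outside[OF R])
    qed
  qed
  then show ?thesis by (simp add: fun_eq_iff)
qed

end

section \<open>Characters of the Gelfand-Tsetlin subalgebra\<close>

lemma ucomp_surj: "x \<in> carrier (Uq n q) \<Longrightarrow> \<exists>u. ucomp n q u = x"
proof -
  assume "x \<in> carrier (Uq n q)"
  then obtain p where "p \<in> carrier (uq_free n)" "x = uq_class n q p" using uq_carrier_class by blast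
  then have "ucomp n q (ulift n q p 0) = x" by (simp add: ucomp_ulift)
  then show ?thesis ..
qed

lemma uq_scalar_ucomp: "uq_scalar n q c = ucomp n q (usc c)"
  by (simp add: ucomp_usc uq_scalar_def)

lemma uq_subalgebra_subset: "S \<subseteq> carrier (Uq n q) \<Longrightarrow> uq_subalgebra n q S \<subseteq> carrier (Uq n q)"
  unfolding uq_subalgebra_def by (rule ring.generate_ring_incl[OF Uq_ring]) auto

lemma uq_subalgebra_mono: "S \<subseteq> S' \<Longrightarrow> uq_subalgebra n q S \<subseteq> uq_subalgebra n q S'"
proof
  fix x assume S: "S \<subseteq> S'" and x: "x \<in> uq_subalgebra n q S"
  show "x \<in> uq_subalgebra n q S'"
    using x unfolding uq_subalgebra_def by (induction rule: generate_ring.induct) (use S in \<open>auto intro: generate_ring.intros\<close>)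
qed

lemma uq_subalgebra_commute:
  assumes S: "S \<subseteq> carrier (Uq n q)" and y: "y \<in> carrier (Uq n q)"
    and c: "\<And>s. s \<in> S \<Longrightarrow> s \<otimes>\<^bsub>Uq n q\<^esub> y = y \<otimes>\<^bsub>Uq n q\<^esub> s" and x: "x \<in> uq_subalgebra n q S"
  shows "x \<otimes>\<^bsub>Uq n q\<^esub> y = y \<otimes>\<^bsub>Uq n q\<^esub> x"
proof -
  interpret U: ring "Uq n q" by (rule Uq_ring)
  have H: "range (uq_scalar n q) \<union> S \<subseteq> carrier (Uq n q)" using S by auto
  have carr: "h \<in> carrier (Uq n q)" if "h \<in> generate_ring (Uq n q) (range (uq_scalar n q) \<union> S)" for h
    using U.generate_ring_in_carrier[OF H that] .
  from x have "x \<in> generate_ring (Uq n q) (range (uq_scalar n q) \<union> S)" by (simp add: uq_subalgebra_def)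
  then show ?thesis
  proof (induction x rule: generate_ring.induct)
    case (incl h)
    obtain u where u: "ucomp n q u = y" using ucomp_surj[OF y] ..
    from incl(1) show ?case
    proof
      assume "h \<in> range (uq_scalar n q)"
      then obtain b where "h = ucomp n q (usc b)" by (auto simp: uq_scalar_ucomp)
      then show ?thesis using usc_central[of b u] unfolding u[symmetric] by (simp only: flip: ucomp_simps(4))
    qed (rule c)
  next
    case (eng_add h1 h2)
    then show ?case using y carr[OF eng_add(1)] carr[OF eng_add(2)] by (simp add: U.l_distr U.r_distr)
  next
    case (eng_mult h1 h2)
    have h: "h1 \<in> carrier (Uq n q)" "h2 \<in> carrier (Uq n q)" using carr eng_mult by auto
    have "h1 \<otimes>\<^bsub>Uq n q\<^esub> h2 \<otimes>\<^bsub>Uq n q\<^esub> y = h1 \<otimes>\<^bsub>Uq n q\<^esub> (y \<otimes>\<^bsub>Uq n q\<^esub> h2)"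
      using eng_mult h y by (simp add: U.m_assoc)
    also have "\<dots> = y \<otimes>\<^bsub>Uq n q\<^esub> (h1 \<otimes>\<^bsub>Uq n q\<^esub> h2)"
      using eng_mult h y by (simp flip: U.m_assoc)
    finally show ?case .
  next
    case (a_inv h)
    then show ?case using y carr[OF a_inv(1)] by (simp add: U.l_minus U.r_minus)
  qed (simp add: y)
qed

lemma Um_subset: "m \<le> n \<Longrightarrow> Um n q m \<subseteq> carrier (Uq n q)"
  unfolding Um_def by (rule uq_subalgebra_subset) (auto intro!: uq_class_carrier gen_carrier lattice_simps)

lemma Um_mono: "m \<le> j \<Longrightarrow> Um n q m \<subseteq> Um n q j"
  unfolding Um_def by (intro uq_subalgebra_mono image_mono) auto

lemma Gamma_simps:
  "x \<otimes>\<^bsub>Gamma n q\<^esub> y = x \<otimes>\<^bsub>Uq n q\<^esub> y" "x \<oplus>\<^bsub>Gamma n q\<^esub> y = x \<oplus>\<^bsub>Uq n q\<^esub> y"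
  "\<one>\<^bsub>Gamma n q\<^esub> = \<one>\<^bsub>Uq n q\<^esub>" "\<zero>\<^bsub>Gamma n q\<^esub> = \<zero>\<^bsub>Uq n q\<^esub>"
  by (simp_all add: Gamma_def)

lemma Zm_subset: "m \<in> {1..n} \<Longrightarrow> Zm n q m \<subseteq> carrier (Uq n q)"
  using Um_subset[of m n q] by (auto simp: Zm_def)

lemma Gamma_gens_subset: "(\<Union>m\<in>{1..n}. Zm n q m) \<subseteq> carrier (Uq n q)"
  using Zm_subset by blast

lemma Gamma_subset: "carrier (Gamma n q) \<subseteq> carrier (Uq n q)"
  using uq_subalgebra_subset[OF Gamma_gens_subset] by (simp add: Gamma_def)

lemma Gamma_ring: "ring (Gamma n q)"
  unfolding Gamma_def uq_subalgebra_def
  by (rule ring.generate_ring_is_ring[OF Uq_ring]) (use Gamma_gens_subset in auto)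

lemma Gamma_incl: "m \<in> {1..n} \<Longrightarrow> z \<in> Zm n q m \<Longrightarrow> z \<in> carrier (Gamma n q)" "uq_scalar n q c \<in> carrier (Gamma n q)"
  by (auto simp: Gamma_def uq_subalgebra_def intro!: generate_ring.incl)

section \<open>The central elements inside the Gelfand-Tsetlin subalgebra\<close>

context gt_module
begin

lemma Az_in_Um:
  assumes m: "m \<le> j" "j \<le> n"
  shows "ucomp n q (fps_nth (r.Az m) i) \<in> Um n q j"
proof -
  define S where "S = {u. ucomp n q u \<in> Um n q j}"
  have one: "ucomp n q 1 \<in> Um n q j"
    unfolding Um_def uq_subalgebra_def ucomp_simps by (rule generate_ring.one)
  have neg: "\<ominus>\<^bsub>Uq n q\<^esub> x \<in> Um n q j" if "x \<in> Um n q j" for x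
    using that unfolding Um_def uq_subalgebra_def by (rule generate_ring.a_inv)
  have add: "x \<oplus>\<^bsub>Uq n q\<^esub> y \<in> Um n q j" if "x \<in> Um n q j" "y \<in> Um n q j" for x y
    using that unfolding Um_def uq_subalgebra_def by (rule generate_ring.eng_add)
  have mult: "x \<otimes>\<^bsub>Uq n q\<^esub> y \<in> Um n q j" if "x \<in> Um n q j" "y \<in> Um n q j" for x y
    using that unfolding Um_def uq_subalgebra_def by (rule generate_ring.eng_mult)
  have sc: "ucomp n q (usc c) \<in> Um n q j" for c
    unfolding uq_scalar_ucomp[symmetric] Um_def uq_subalgebra_def by (rule generate_ring.incl) simp
  have zero: "ucomp n q 0 \<in> Um n q j"
    unfolding ucomp_simps Um_def uq_subalgebra_def by (rule ring.zero_in_generate[OF Uq_ring])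
  have gens: "g \<in> E ` {1..j - 1} \<union> F ` {1..j - 1} \<union> {Q (eps i) | i. i \<in> {1..j}} \<union> {Q (\<lambda>k. - eps i k) | i. i \<in> {1..j}} \<Longrightarrow>
      uq_class n q (gen g) \<in> Um n q j" for g
    unfolding Um_def uq_subalgebra_def by (rule generate_ring.incl) blast
  have "fps_nth (r.Az m) i \<in> S"
  proof (rule r.closed_Az)
    fix x y assume "x \<in> S" "y \<in> S"
    then show "x + y \<in> S" "x - y \<in> S" "x * y \<in> S"
      unfolding S_def mem_Collect_eq ucomp_simps a_minus_def by (auto intro: add neg mult)
  next
    fix x assume "x \<in> S"
    then show "uq.qs x \<in> S" unfolding S_def mem_Collect_eq uq.qs_def ucomp_simps by (intro mult sc)
  next
    fix i assume i: "1 \<le> i" "i < m"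
    then have "ucomp n q (ue n q i) = uq_class n q (gen (E i))" "ucomp n q (uf n q i) = uq_class n q (gen (F i))"
      using m by (auto intro!: ucomp_gens)
    moreover have "i \<in> {1..j - 1}" using i m by auto
    ultimately show "ue n q i \<in> S" "uf n q i \<in> S" unfolding S_def by (auto intro!: gens)
  next
    fix i assume i: "i \<in> {1..m}"
    then have "ucomp n q (uti n q i) = uq_class n q (gen (Q (\<lambda>k. - eps i k)))"
      using m by (auto intro!: ucomp_gens)
    moreover have "i \<in> {1..j}" using i m by auto
    ultimately show "uti n q i \<in> S" unfolding S_def by (auto intro!: gens)
  qed (use m one zero in \<open>auto simp: S_def\<close>)
  then show ?thesis by (simp add: S_def)
qed

lemma Az_commute_Um:
  assumes m: "m \<le> n" and x: "x \<in> Um n q m"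
  shows "x \<otimes>\<^bsub>Uq n q\<^esub> ucomp n q (fps_nth (r.Az m) i) = ucomp n q (fps_nth (r.Az m) i) \<otimes>\<^bsub>Uq n q\<^esub> x"
proof (rule uq_subalgebra_commute[OF _ _ _ x[unfolded Um_def]])
  show "uq_class n q ` gen ` (E ` {1..m - 1} \<union> F ` {1..m - 1} \<union> {Q (eps i) | i. i \<in> {1..m}} \<union> {Q (\<lambda>k. - eps i k) | i. i \<in> {1..m}})
      \<subseteq> carrier (Uq n q)"
    using m by (auto intro!: uq_class_carrier gen_carrier lattice_simps)
  fix s assume s: "s \<in> uq_class n q ` gen ` (E ` {1..m - 1} \<union> F ` {1..m - 1} \<union> {Q (eps i) | i. i \<in> {1..m}} \<union> {Q (\<lambda>k. - eps i k) | i. i \<in> {1..m}})"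
  have "\<exists>u. s = ucomp n q u \<and> fps_const u * r.Az m = r.Az m * fps_const u"
  proof -
    have "\<exists>u. uq_class n q (gen (E i)) = ucomp n q u \<and> fps_const u * r.Az m = r.Az m * fps_const u" if "1 \<le> i" "i \<le> m - 1" for i
      by (rule exI[of _ "ue n q i"]) (use that m ucomp_gens(1)[of i n q] r.Az_central(1)[of m i] in auto)
    moreover have "\<exists>u. uq_class n q (gen (F i)) = ucomp n q u \<and> fps_const u * r.Az m = r.Az m * fps_const u" if "1 \<le> i" "i \<le> m - 1" for i
      by (rule exI[of _ "uf n q i"]) (use that m ucomp_gens(2)[of i n q] r.Az_central(2)[of m i] in auto)
    moreover have "\<exists>u. uq_class n q (gen (Q (eps i))) = ucomp n q u \<and> fps_const u * r.Az m = r.Az m * fps_const u" if "1 \<le> i" "i \<le> m" for i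
      by (rule exI[of _ "ut n q i"]) (use that m ucomp_gens(3)[of i n q] r.Az_t[of m i] in auto)
    moreover have "\<exists>u. uq_class n q (gen (Q (\<lambda>k. - eps i k))) = ucomp n q u \<and> fps_const u * r.Az m = r.Az m * fps_const u" if "1 \<le> i" "i \<le> m" for i
      by (rule exI[of _ "uti n q i"]) (use that m ucomp_gens(4)[of i n q] r.Az_ti[of m i] in auto)
    ultimately show ?thesis using s by auto
  qed
  then obtain u where "s = ucomp n q u" "u * fps_nth (r.Az m) i = fps_nth (r.Az m) i * u"
    unfolding fps_commute_const_iff by blast
  then show "s \<otimes>\<^bsub>Uq n q\<^esub> ucomp n q (fps_nth (r.Az m) i) = ucomp n q (fps_nth (r.Az m) i) \<otimes>\<^bsub>Uq n q\<^esub> s"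
    by (simp flip: ucomp_simps(4))
qed simp

lemma Az_in_Gamma: "m < n \<Longrightarrow> ucomp n q (fps_nth (r.Az m) i) \<in> carrier (Gamma n q)"
proof (cases "m = 0")
  case True
  \<comment> \<open>There is no centre of rank zero among the generators; \<open>r.Az 0\<close> is
    the constant series 1, whose coefficients are scalars.\<close>
  have "ucomp n q (fps_nth (r.Az m) i) = uq_scalar n q (if i = 0 then 1 else 0)"
    unfolding uq_scalar_ucomp using True by (simp add: usc_simps)
  then show ?thesis using Gamma_incl(2) by simp
next
  case False
  assume "m < n"
  then have "ucomp n q (fps_nth (r.Az m) i) \<in> Zm n q m"
    unfolding Zm_def using Az_in_Um[of m m i] Az_commute_Um[of m] by auto
  then show ?thesis using False \<open>m < n\<close> by (intro Gamma_incl(1)[of m]) auto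
qed

text \<open>Against an element of the centre of rank j: the one of lower rank lies in the algebra in
  which the other is central. Commutation then extends from the generators to the whole
  subalgebra.\<close>

lemma Gamma_commute:
  assumes m: "m < n" and g: "g \<in> carrier (Gamma n q)"
  shows "g \<otimes>\<^bsub>Uq n q\<^esub> ucomp n q (fps_nth (r.Az m) i) = ucomp n q (fps_nth (r.Az m) i) \<otimes>\<^bsub>Uq n q\<^esub> g"
proof (rule uq_subalgebra_commute[OF Gamma_gens_subset])
  show "g \<in> uq_subalgebra n q (\<Union>m\<in>{1..n}. Zm n q m)" using g by (simp add: Gamma_def)
  fix s assume "s \<in> (\<Union>m\<in>{1..n}. Zm n q m)"
  then obtain j where j: "j \<in> {1..n}" "s \<in> Zm n q j" by blast
  show "s \<otimes>\<^bsub>Uq n q\<^esub> ucomp n q (fps_nth (r.Az m) i) = ucomp n q (fps_nth (r.Az m) i) \<otimes>\<^bsub>Uq n q\<^esub> s"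
  proof (cases "m \<le> j")
    case True
    then have "ucomp n q (fps_nth (r.Az m) i) \<in> Um n q j" using j by (intro Az_in_Um) auto
    then show ?thesis using j(2) unfolding Zm_def by blast
  next
    case False
    then have "s \<in> Um n q m" using j(2) Um_mono[of j m n q] unfolding Zm_def by auto
    then show ?thesis using m by (intro Az_commute_Um) auto
  qed
qed simp

section \<open>Characters and their kernels\<close>

definition chi where "chi R g = Poly_Mapping.lookup (act g (bv R)) R"

lemma az_me:
  "m < n \<Longrightarrow> R \<in> B \<Longrightarrow> me (fps_nth (r.Az m) i) R' R = (if R = R' then fps_nth (az m R) i else 0)"
  using az_diag(1)[of m R R'] by (metis M_nth fps_zero_nth)

text \<open>A nonzero coefficient from \<open>R\<close> to \<open>R'\<close> of an operator
  commuting with the diagonal operators \<open>az\<close> forces equal eigenvalues, and these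
  separate the basis.\<close>

lemma Gamma_diag:
  assumes g: "g \<in> carrier (Gamma n q)" and R: "R \<in> B"
  shows "act g (bv R) = scl (chi R g) (bv R)"
proof (rule poly_mapping_eqI)
  fix R'
  obtain u where u: "ucomp n q u = g" using ucomp_surj g Gamma_subset by blast
  have "me u R' R = 0" if "R \<noteq> R'"
  proof (rule ccontr)
    assume nz: "me u R' R \<noteq> 0"
    then have R': "R' \<in> B" by (rule me_outside[OF R])
    have "az m R = az m R'" if m: "m < n" for m
    proof (rule fps_ext)
      fix i
      let ?a = "fps_nth (r.Az m) i"
      have "ucomp n q (u * ?a) = ucomp n q (?a * u)"
        using Gamma_commute[OF m g, of i] by (simp add: ucomp_simps u)
      then have "me (u * ?a) R' R = me (?a * u) R' R" by (simp add: me_def A_def)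
      moreover have "me (u * ?a) R' R = me u R' R * fps_nth (az m R) i"
        by (rule me_diag_right[OF _ R]) (rule az_me[OF m])
      moreover have "me (?a * u) R' R = fps_nth (az m R') i * me u R' R"
        by (rule me_diag_left[OF _ R]) (rule az_me[OF m])
      ultimately show "fps_nth (az m R) i = fps_nth (az m R') i" using nz by simp
    qed
    then have "R = R'" by (rule az_separates[OF R R'])
    with that show False by simp
  qed
  then show "Poly_Mapping.lookup (act g (bv R)) R' = Poly_Mapping.lookup (scl (chi R g) (bv R)) R'"
    by (auto simp: chi_def lookup_bv me_def A_def u)
qed

lemma Gamma_act:
  assumes g: "g \<in> carrier (Gamma n q)" and v: "v \<in> V"
  shows "Poly_Mapping.lookup (act g v) R = chi R g * Poly_Mapping.lookup v R"
proof -
  obtain u where u: "ucomp n q u = g" using ucomp_surj g Gamma_subset by blast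
  have "act g v = (\<Sum>T\<in>Poly_Mapping.keys v. scl (Poly_Mapping.lookup v T) (act g (bv T)))"
    using A_expand[OF v, of "Poly_Mapping.keys v" u] by (simp add: A_def u in_keys_iff)
  also have "\<dots> = (\<Sum>T\<in>Poly_Mapping.keys v. scl (Poly_Mapping.lookup v T) (scl (chi T g) (bv T)))"
  proof (rule sum.cong[OF refl])
    fix T assume "T \<in> Poly_Mapping.keys v"
    then have "T \<in> B" using v by (auto simp: V_space_def)
    then show "scl (Poly_Mapping.lookup v T) (act g (bv T)) = scl (Poly_Mapping.lookup v T) (scl (chi T g) (bv T))"
      by (simp only: Gamma_diag[OF g])
  qed
  finally show ?thesis
    by (auto simp: lookup_sum lookup_bv if_distrib in_keys_iff cong: if_cong)
qed

lemma chi_hom: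
  assumes "R \<in> B"
  shows "g \<in> carrier (Gamma n q) \<Longrightarrow> h \<in> carrier (Gamma n q) \<Longrightarrow> chi R (g \<otimes>\<^bsub>Uq n q\<^esub> h) = chi R g * chi R h"
    "g \<in> carrier (Uq n q) \<Longrightarrow> h \<in> carrier (Uq n q) \<Longrightarrow> chi R (g \<oplus>\<^bsub>Uq n q\<^esub> h) = chi R g + chi R h"
    "chi R (uq_scalar n q c) = c" "chi R \<one>\<^bsub>Uq n q\<^esub> = 1" "chi R \<zero>\<^bsub>Uq n q\<^esub> = 0"
proof -
  show "chi R (g \<oplus>\<^bsub>Uq n q\<^esub> h) = chi R g + chi R h" if "g \<in> carrier (Uq n q)" "h \<in> carrier (Uq n q)" for g h
    using act_module that bv_V[OF assms] unfolding uq_module_def chi_def by (simp add: lookup_add)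
  show s: "chi R (uq_scalar n q c) = c" for c
    using act_module bv_V[OF assms] unfolding uq_module_def chi_def by (simp add: lookup_bv)
  show "chi R \<one>\<^bsub>Uq n q\<^esub> = 1" "chi R \<zero>\<^bsub>Uq n q\<^esub> = 0"
    using s[of 1] s[of 0] unfolding uq_scalar_ucomp usc_simps ucomp_simps by auto
  assume g: "g \<in> carrier (Gamma n q)" and h: "h \<in> carrier (Gamma n q)"
  have c: "g \<in> carrier (Uq n q)" "h \<in> carrier (Uq n q)" using g h Gamma_subset by auto
  then have "act (g \<otimes>\<^bsub>Uq n q\<^esub> h) (bv R) = act g (act h (bv R))" and V: "act h (bv R) \<in> V"
    using act_module bv_V[OF assms] unfolding uq_module_def by auto
  then show "chi R (g \<otimes>\<^bsub>Uq n q\<^esub> h) = chi R g * chi R h"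
    using Gamma_act[OF g V, of R] by (simp add: chi_def)
qed

definition ker_chi where "ker_chi R = {g \<in> carrier (Gamma n q). chi R g = 0}"

lemma ker_chi_ideal: assumes R: "R \<in> B" shows "ideal (ker_chi R) (Gamma n q)"
proof -
  interpret G: ring "Gamma n q" by (rule Gamma_ring)
  note hom = chi_hom[OF R]
  have neg: "chi R (\<ominus>\<^bsub>Gamma n q\<^esub> g) = - chi R g" if g: "g \<in> carrier (Gamma n q)" for g
  proof -
    have "chi R (g \<oplus>\<^bsub>Uq n q\<^esub> (\<ominus>\<^bsub>Gamma n q\<^esub> g)) = 0"
      using G.r_neg[OF g] hom(5) by (simp add: Gamma_simps)
    moreover have "g \<in> carrier (Uq n q)" "\<ominus>\<^bsub>Gamma n q\<^esub> g \<in> carrier (Uq n q)"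
      using g G.a_inv_closed[OF g] Gamma_subset by blast+
    ultimately have "chi R g + chi R (\<ominus>\<^bsub>Gamma n q\<^esub> g) = 0" by (simp only: hom(2))
    then show ?thesis by (metis add.inverse_unique)
  qed
  show ?thesis
  proof (rule idealI)
    show "subgroup (ker_chi R) (add_monoid (Gamma n q))"
    proof (rule G.add.subgroupI)
      show "ker_chi R \<noteq> {}" using G.zero_closed hom(5) unfolding ker_chi_def by (auto simp: Gamma_simps)
      show "a \<oplus>\<^bsub>Gamma n q\<^esub> b \<in> ker_chi R" if "a \<in> ker_chi R" "b \<in> ker_chi R" for a b
      proof -
        have ab: "a \<in> carrier (Gamma n q)" "b \<in> carrier (Gamma n q)" "chi R a = 0" "chi R b = 0"
          using that by (auto simp: ker_chi_def)
        moreover from this have "a \<in> carrier (Uq n q)" "b \<in> carrier (Uq n q)" using Gamma_subset by blast+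
        then have "chi R (a \<oplus>\<^bsub>Uq n q\<^esub> b) = 0" using ab by (simp add: hom(2))
        ultimately show ?thesis using G.a_closed[OF ab(1,2)] by (simp add: ker_chi_def Gamma_simps)
      qed
    qed (auto simp: ker_chi_def neg)
  next
    fix a x assume "a \<in> ker_chi R" "x \<in> carrier (Gamma n q)"
    then show "x \<otimes>\<^bsub>Gamma n q\<^esub> a \<in> ker_chi R" "a \<otimes>\<^bsub>Gamma n q\<^esub> x \<in> ker_chi R"
      using G.m_closed by (auto simp: ker_chi_def Gamma_simps hom(1))
  qed (rule Gamma_ring)
qed

text \<open>A coefficient of \<open>r.Az m\<close> minus its eigenvalue at \<open>R\<close> lies in
  the kernel for \<open>R\<close>; its value at \<open>R'\<close> is the difference of the two
  eigenvalues.\<close>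

lemma ker_chi_inj:
  assumes R: "R \<in> B" "R' \<in> B" and eq: "ker_chi R = ker_chi R'"
  shows "R = R'"
proof (rule az_separates[OF R])
  fix m assume m: "m < n"
  interpret G: ring "Gamma n q" by (rule Gamma_ring)
  show "az m R = az m R'"
  proof (rule fps_ext)
    fix i
    let ?a = "ucomp n q (fps_nth (r.Az m) i)" and ?c = "- fps_nth (az m R) i"
    have a: "?a \<in> carrier (Gamma n q)" by (rule Az_in_Gamma[OF m])
    have chi: "chi T ?a = fps_nth (az m T) i" if "T \<in> B" for T
      using az_me[OF m that, of i T] by (simp add: chi_def me_def A_def)
    have s: "chi T (?a \<oplus>\<^bsub>Uq n q\<^esub> uq_scalar n q ?c) = fps_nth (az m T) i - fps_nth (az m R) i" if "T \<in> B" for T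
      using chi[OF that] chi_hom(2,3)[OF that] by simp
    have "?a \<oplus>\<^bsub>Uq n q\<^esub> uq_scalar n q ?c \<in> ker_chi R"
      using G.a_closed[OF a Gamma_incl(2)[of n q ?c]] s[OF R(1)] by (simp add: ker_chi_def Gamma_simps)
    then have "chi R' (?a \<oplus>\<^bsub>Uq n q\<^esub> uq_scalar n q ?c) = 0" unfolding eq by (simp add: ker_chi_def)
    then show "fps_nth (az m R) i = fps_nth (az m R') i" using s[OF R(2)] by simp
  qed
qed

section \<open>Generalised weight spaces\<close>

lemma ideals_set_pow:
  "I [^]\<^bsub>ideals_set G\<^esub> (0::nat) = carrier G" "I [^]\<^bsub>ideals_set G\<^esub> (Suc k) = ideal_prod G (I [^]\<^bsub>ideals_set G\<^esub> k) I"
  by (simp_all add: nat_pow_def ideals_set_def)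

text \<open>For \<open>u\<close> in the ideal, its k-th power contains an element with character
  value \<open>chi R u ^ k\<close>. It annihilates \<open>v\<close>, and as \<open>R\<close> is in
  the support of \<open>v\<close> the value is zero. So the ideal lies in the proper ideal
  \<open>ker_chi R\<close>, and maximality makes them equal.\<close>

lemma component_support:
  assumes max: "maximalideal \<mm> (Gamma n q)" and v: "v \<in> gt_component n q V act \<mm>"
    and R: "Poly_Mapping.lookup v R \<noteq> 0"
  shows "R \<in> B" "\<mm> = ker_chi R"
proof -
  interpret G: ring "Gamma n q" by (rule Gamma_ring)
  interpret max: maximalideal \<mm> "Gamma n q" by (rule max)
  have vV: "v \<in> V" using v by (simp add: gt_component_def)
  then show RB: "R \<in> B" using R by (auto simp: V_iff)
  obtain k :: nat where k: "\<And>u. u \<in> \<mm> [^]\<^bsub>ideals_set (Gamma n q)\<^esub> k \<Longrightarrow> act u v = 0"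
    using v by (auto simp: gt_component_def)
  have "chi R u = 0" if u: "u \<in> \<mm>" for u
  proof -
    have uG: "u \<in> carrier (Gamma n q)" using u by (rule max.Icarr)
    have "\<exists>w \<in> \<mm> [^]\<^bsub>ideals_set (Gamma n q)\<^esub> k. w \<in> carrier (Gamma n q) \<and> chi R w = chi R u ^ k" for k
    proof (induction k)
      case 0
      show ?case using G.one_closed chi_hom(4)[OF RB] unfolding ideals_set_pow Gamma_simps(3) by auto
    next
      case (Suc k)
      then obtain w where w: "w \<in> \<mm> [^]\<^bsub>ideals_set (Gamma n q)\<^esub> k" "w \<in> carrier (Gamma n q)" "chi R w = chi R u ^ k" by blast
      have "w \<otimes>\<^bsub>Gamma n q\<^esub> u \<in> \<mm> [^]\<^bsub>ideals_set (Gamma n q)\<^esub> Suc k"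
        unfolding ideals_set_pow by (rule ideal_prod.prod[OF w(1) u])
      moreover have "chi R (w \<otimes>\<^bsub>Gamma n q\<^esub> u) = chi R u ^ Suc k"
        unfolding Gamma_simps chi_hom(1)[OF RB w(2) uG] w(3) by simp
      ultimately show ?case using G.m_closed[OF w(2) uG] by blast
    qed
    then obtain w where w: "w \<in> \<mm> [^]\<^bsub>ideals_set (Gamma n q)\<^esub> k" "w \<in> carrier (Gamma n q)" "chi R w = chi R u ^ k" by blast
    have "chi R w * Poly_Mapping.lookup v R = 0"
      using Gamma_act[OF w(2) vV, of R] k[OF w(1)] by simp
    then show ?thesis using R w(3) by simp
  qed
  then have "\<mm> \<subseteq> ker_chi R" using max.Icarr by (auto simp: ker_chi_def)
  moreover have "ker_chi R \<subseteq> carrier (Gamma n q)" by (auto simp: ker_chi_def)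
  ultimately have "ker_chi R = \<mm> \<or> ker_chi R = carrier (Gamma n q)"
    using max.I_maximal[OF ker_chi_ideal[OF RB]] by blast
  moreover have "\<one>\<^bsub>Gamma n q\<^esub> \<notin> ker_chi R" using chi_hom(4)[OF RB] by (simp add: ker_chi_def Gamma_simps)
  ultimately show "\<mm> = ker_chi R" using G.one_closed by blast
qed

lemma component_dim:
  assumes max: "maximalideal \<mm> (Gamma n q)" and ne: "gt_component n q V act \<mm> \<noteq> {0}"
  shows "tab.dim (gt_component n q V act \<mm>) = 1"
proof -
  interpret G: ring "Gamma n q" by (rule Gamma_ring)
  interpret max: maximalideal \<mm> "Gamma n q" by (rule max)
  let ?W = "gt_component n q V act \<mm>"
  have zero: "act g 0 = 0" if "g \<in> carrier (Gamma n q)" for g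
    by (rule poly_mapping_eqI) (simp add: Gamma_act[OF that V_closed(1)])
  have "0 \<in> ?W"
  proof -
    have "\<forall>u\<in>\<mm> [^]\<^bsub>ideals_set (Gamma n q)\<^esub> (0::nat). act u 0 = 0"
      unfolding ideals_set_pow using zero by blast
    then show ?thesis unfolding gt_component_def using V_closed(1) by blast
  qed
  then obtain v where v: "v \<in> ?W" "v \<noteq> 0" using ne by blast
  then obtain R where R: "Poly_Mapping.lookup v R \<noteq> 0" using poly_mapping_eqI[of v 0] by auto
  have RB: "R \<in> B" and mR: "\<mm> = ker_chi R" using component_support[OF max v(1) R] by auto
  have "?W = tab.span {bv R}"
  proof
    show "?W \<subseteq> tab.span {bv R}"
    proof
      fix w assume w: "w \<in> ?W"
      have "R' = R" if "Poly_Mapping.lookup w R' \<noteq> 0" for R'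
        using component_support[OF max w that] ker_chi_inj[OF _ RB] mR by auto
      then have "w = scl (Poly_Mapping.lookup w R) (bv R)"
        by (intro poly_mapping_eqI) (auto simp: lookup_bv)
      then show "w \<in> tab.span {bv R}" by (metis tab.span_base tab.span_scale singletonI)
    qed
    have "scl c (bv R) \<in> ?W" for c
    proof -
      have V: "scl c (bv R) \<in> V" by (intro V_closed bv_V RB)
      \<comment> \<open>The exponent 1 suffices: the first power is the product of the whole ring
        with the ideal, and the ideal acts by zero on this basis vector.\<close>
      have "\<mm> [^]\<^bsub>ideals_set (Gamma n q)\<^esub> (Suc 0) \<subseteq> \<mm>"
        unfolding ideals_set_pow using G.ideal_prod_inter[OF G.oneideal max.is_ideal] by blast
      moreover have "act u (scl c (bv R)) = 0" if u: "u \<in> \<mm>" for u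
      proof (rule poly_mapping_eqI)
        have "u \<in> carrier (Gamma n q)" "chi R u = 0" using u unfolding mR by (auto simp: ker_chi_def)
        then show "Poly_Mapping.lookup (act u (scl c (bv R))) R' = Poly_Mapping.lookup 0 R'" for R'
          by (auto simp: Gamma_act[OF _ V] lookup_bv)
      qed
      ultimately show ?thesis unfolding gt_component_def using V by blast
    qed
    then show "tab.span {bv R} \<subseteq> ?W" by (auto simp: tab.span_singleton)
  qed
  moreover have "bv R \<noteq> 0" using lookup_bv[of R R] by force
  then have "tab.independent {bv R}" by (simp add: tab.dependent_single)
  ultimately show ?thesis using tab.dim_span_eq_card_independent[of "{bv R}"] by simp
qed

end

theorem proposition4p4:
  fixes n :: nat and q lq :: complex
    and C :: "relation set" and L :: tableau
    and act :: "(uq_gen word \<Rightarrow>\<^sub>0 complex) set \<Rightarrow> (tableau \<Rightarrow>\<^sub>0 complex) \<Rightarrow> (tableau \<Rightarrow>\<^sub>0 complex)"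
    and \<mm> :: "(uq_gen word \<Rightarrow>\<^sub>0 complex) set set"
  assumes "n \<ge> 2"
    and "q \<noteq> 0" and "\<forall>k::nat. k \<ge> 1 \<longrightarrow> q ^ k \<noteq> 1" and "exp lq = q"
    and "C \<subseteq> relations n" and "admissible n C"
    and "L \<in> tableaux n" and "satisfies n lq C L"
    and "uq_module n q (V_space n lq C L) act"
    and "gt_formulas n q lq (basis n lq C L) act"
    and "maximalideal \<mm> (Gamma n q)"
    and "gt_component n q (V_space n lq C L) act \<mm> \<noteq> {0}"
  shows "tab.dim (gt_component n q (V_space n lq C L) act \<mm>) = 1"
proof -
  interpret gt_module n q lq C L act
    by unfold_locales (use assms in auto)
  show ?thesis using component_dim assms by blast
qed

end
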